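(* Let $A$ be a tt-ring in a tt-category $\mathscr K$ and let $\varphi_A:\operatorname{Spc}(A\text{-}\mathrm{Mod}_{\mathscr K})\to\operatorname{Spc}(\mathscr K)$ be the continuous map induced by extension-of-scalars $F_A:\mathscr K\to A\text{-}\mathrm{Mod}_{\mathscr K}$. (1) The image of $\varphi_A$ equals the support of $A$: $\operatorname{Im}(\varphi_A)=\operatorname{supp}(A)$ in $\operatorname{Spc}(\mathscr K)$. Consequently, $\varphi_A$ is onto if and only if $A$ is nil-faithful. Suppose furthermore that $A$ has finite degree $d$. Then: (2) (Going-Up) For every $\mathscr Q\in\operatorname{Spc}(A\text{-}\mathrm{Mod}_{\mathscr K})$ and every $\mathscr P'\in\overline{\{\varphi_A(\mathscr Q)\}}$ there exists $\mathscr Q'\in\overline{\{\mathscr Q\}}$ such that $\varphi_A(\mathscr Q')=\mathscr P'$. (3) (Incomparability) If $\mathscr Q,\mathscr Q'\in\operatorname{Spc}(A\text{-}\mathrm{Mod}_{\mathscr K})$ are such that $\mathscr Q'\in\overline{\{\mathscr Q\}}$ and $\varphi_A(\mathscr Q)=\varphi_A(\mathscr Q')$, then $\mathscr Q=\mathscr Q'$. (4) The fibers of $\varphi_A$ are finite and discrete, with at most $d$ points. Consequently (for $A$ of finite degree), $\operatorname{Spc}(A\text{-}\mathrm{Mod}_{\mathscr K})$ and $\operatorname{supp}(A)$ have the same Krull dimension; and if $A$ is moreover nil-faithful then $\operatorname{Spc}(A\text{-}\mathrm{Mod}_{\mathscr K})$ and $\operatorname{Spc}(\mathscr K)$ have the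 same Krull dimension.
   Context: Triangulated categories are understood in the mildly strengthened sense of Künzer and Maltsiniotis: besides Verdier's axioms, there are distinguished octahedra satisfying the analogue of the morphism axiom (every composable pair of morphisms is the base of a distinguished octahedron and every morphism between bases extends to a morphism of distinguished octahedra). A tt-category is an essentially small, idempotent-complete triangulated category $\mathscr K$ with a symmetric monoidal structure $\otimes$, unit $\mathbb 1$, such that $x\otimes-$ is exact for every object $x$. A tt-functor is an exact (symmetric, strong) monoidal functor $F$ such that the two natural isomorphisms $F(x\otimes\Sigma y)\cong\Sigma F(x\otimes y)$ (obtained by using the compatibilities of $F$, $\otimes$, $\Sigma$ in different orders) agree, and similarly on the left. Spectrum: a thick $\otimes$-ideal of $\mathscr K$ is a triangulated subcategory $\mathscr J$ closed under direct summands with $\mathscr K\otimes\mathscr J\subseteq\mathscr J$; a proper one $\mathscr P\subsetneq\mathscr K$ is prime if $x\otimes y\in\mathscr P$ implies $x\in\mathscr P$ or $y\in\mathscr P$. $\operatorname{Spc}(\mathscr K)$ is the set of primes, with open basis the sets $\{\mathscr P: x\in\mathscr P\}$, $x\in\mathscr K$. The support of $x$ is the closed set $\operatorname{supp}(x)=\{\mathscr P: x\notin\mathscr P\}$. The closure of a point is $\overline{\{\mathscr P\}}=\{\mathscr P':\mathscr P'\subseteq\mathscr P\}$. A tt-functor $F:\mathscr K\to\mathscr L$ induces a continuous map $\operatorname{Spc}(F):\operatorname{Spc}(\mathscr L)\to\operatorname{Spc}(\mathscr K)$, $\mathscr P\mapsto F^{-1}(\mathscr P)$; so $\varphi_A=\operatorname{Spc}(F_A)$.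 Krull dimension of a space is in terms of chains of specializations (equivalently of irreducible closed subsets), and $\operatorname{supp}(A)$ has the subspace topology. tt-rings: a ring object $(A,\mu:A\otimes A\to A,\eta:\mathbb 1\to A)$ in $\mathscr K$ is an associative unital monoid; it is separable if there is $\sigma:A\to A\otimes A$ with $\mu\sigma=\mathrm{id}_A$ and $(1\otimes\mu)(\sigma\otimes1)=\sigma\mu=(\mu\otimes1)(1\otimes\sigma)$; a tt-ring is a commutative separable ring object. $A\text{-}\mathrm{Mod}_{\mathscr K}$ is the category of $A$-modules $(x,\rho:A\otimes x\to x)$ in $\mathscr K$, with forgetful functor $U_A$ to $\mathscr K$ and extension-of-scalars $F_A(y)=(A\otimes y,\mu\otimes1)$. By known results, $A\text{-}\mathrm{Mod}_{\mathscr K}$ is a tt-category (a triangle is distinguished iff its image under $U_A$ is), with tensor $\otimes_A$ (the coequalizer of the two actions $x\otimes A\otimes y\rightrightarrows x\otimes y$) and unit $A$; $F_A$ is a tt-functor. $A$ is nil-faithful if for every morphism $f$ in $\mathscr K$ with $A\otimes f=0$ there is $n\ge1$ with $f^{\otimes n}=0$. Degree: for a tt-ring $A$ define a tower of tt-rings $A^{[0]}=\mathbb 1\to A^{[1]}=A\to A^{[2]}\to\cdots$ as follows: for $n\ge1$, $A^{[n+1]}$ is the (unique up to isomorphism) tt-ring for which there is a ring isomorphism $A^{[n]}\otimes_{A^{[n-1]}}A^{[n]}\cong A^{[n]}\times A^{[n+1]}$ whose first component is the multiplication, and $A^{[n]}\to A^{[n+1]}$ is the second component precomposed with $1\otimes\eta$.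 The tt-ring $A$ has finite degree $d$ if $A^{[d]}\neq0$ and $A^{[d+1]}=0$. *)

theory Defs
  imports "HOL-Analysis.Abstract_Topology" "HOL-Library.Extended_Real"
begin

section \<open>The data of a tensor triangulated category\<close>

text \<open>
  Objects form a set in a type and so do arrows, so every category considered is small; up to
  equivalence these are the essentially small categories. Every arrow has one domain and one
  codomain. A (candidate) triangle is a triple of arrows
  \<open>x \<rightarrow> y \<rightarrow> z \<rightarrow> \<Sigma> x\<close>. On arrows, the suspension is written \<open>\<S>\<close> and
  the tensor product \<open>\<odot>\<close>. The associator is \<open>\<alpha> x y z : (x \<otimes> y) \<otimes> z \<rightarrow> x \<otimes> (y \<otimes> z)\<close>, and
  \<open>\<theta> x y : x \<otimes> \<Sigma> y \<rightarrow> \<Sigma> (x \<otimes> y)\<close> is the isomorphism that is part of the structure of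
  the exact functor \<open>x \<otimes> -\<close>.
\<close>

record ('o, 'm) tt_data =
  Ob :: "'o set"
  Ar :: "'m set"
  Dom :: "'m \<Rightarrow> 'o"
  Cod :: "'m \<Rightarrow> 'o"
  ident :: "'o \<Rightarrow> 'm" ("\<I>\<index>")
  comp :: "'m \<Rightarrow> 'm \<Rightarrow> 'm" (infixr "\<cdot>\<index>" 70)
  add :: "'m \<Rightarrow> 'm \<Rightarrow> 'm" (infixl "\<oplus>\<index>" 65)
  Zero :: "'o \<Rightarrow> 'o \<Rightarrow> 'm"
  Susp :: "'o \<Rightarrow> 'o" ("\<Sigma>\<index>")
  SuspA :: "'m \<Rightarrow> 'm" ("\<S>\<index>")
  Tri :: "('m \<times> 'm \<times> 'm) set"
  Ten :: "'o \<Rightarrow> 'o \<Rightarrow> 'o" (infixr "\<otimes>\<index>" 75)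
  TenA :: "'m \<Rightarrow> 'm \<Rightarrow> 'm" (infixr "\<odot>\<index>" 75)
  Unit :: "'o" ("\<one>\<index>")
  assoc :: "'o \<Rightarrow> 'o \<Rightarrow> 'o \<Rightarrow> 'm" ("\<alpha>\<index>")
  lunit :: "'o \<Rightarrow> 'm" ("\<lambda>\<lambda>\<index>")
  runit :: "'o \<Rightarrow> 'm" ("\<rho>\<rho>\<index>")
  braid :: "'o \<Rightarrow> 'o \<Rightarrow> 'm" ("\<gamma>\<index>")
  tsusp :: "'o \<Rightarrow> 'o \<Rightarrow> 'm" ("\<theta>\<index>")

definition Hom :: "('o, 'm) tt_data \<Rightarrow> 'o \<Rightarrow> 'o \<Rightarrow> 'm set" ("Hom\<index>")
  where "Hom\<^bsub>K\<^esub> x y = {f \<in> Ar K. Dom K f = x \<and> Cod K f = y}"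

context
  fixes K :: "('o, 'm) tt_data" (structure)
begin

definition inverse_arrows :: "'m \<Rightarrow> 'm \<Rightarrow> bool" where
  "inverse_arrows f g \<longleftrightarrow> f \<in> Ar K \<and> g \<in> Hom (Cod K f) (Dom K f) \<and>
     g \<cdot> f = \<I> (Dom K f) \<and> f \<cdot> g = \<I> (Cod K f)"

definition iso :: "'m \<Rightarrow> bool" where
  "iso f \<longleftrightarrow> (\<exists>g. inverse_arrows f g)"

definition inv_arrow :: "'m \<Rightarrow> 'm" where
  "inv_arrow f = (THE g. inverse_arrows f g)"

definition zero_object :: "'o \<Rightarrow> bool" where
  "zero_object z \<longleftrightarrow> z \<in> Ob K \<and> (\<forall>x\<in>Ob K. (\<exists>!f. f \<in> Hom x z) \<and> (\<exists>!f. f \<in> Hom z x))"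

definition biproduct :: "'o \<Rightarrow> 'o \<Rightarrow> 'o \<Rightarrow> 'm \<Rightarrow> 'm \<Rightarrow> 'm \<Rightarrow> 'm \<Rightarrow> bool" where
  "biproduct x y s i j p q \<longleftrightarrow>
     s \<in> Ob K \<and> i \<in> Hom x s \<and> j \<in> Hom y s \<and> p \<in> Hom s x \<and> q \<in> Hom s y \<and>
     p \<cdot> i = \<I> x \<and> q \<cdot> j = \<I> y \<and> p \<cdot> j = Zero K y x \<and> q \<cdot> i = Zero K x y \<and>
     (i \<cdot> p) \<oplus> (j \<cdot> q) = \<I> s"

definition coequalizer :: "'m \<Rightarrow> 'm \<Rightarrow> 'm \<Rightarrow> bool" where
  "coequalizer f g q \<longleftrightarrow>
     f \<in> Ar K \<and> g \<in> Hom (Dom K f) (Cod K f) \<and> q \<in> Ar K \<and> Dom K q = Cod K f \<and>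
     q \<cdot> f = q \<cdot> g \<and>
     (\<forall>h\<in>Ar K. Dom K h = Cod K f \<and> h \<cdot> f = h \<cdot> g \<longrightarrow>
        (\<exists>!k. k \<in> Hom (Cod K q) (Cod K h) \<and> k \<cdot> q = h))"

text \<open>The arrow through which \<open>h\<close> factors along an epimorphism \<open>q\<close>.\<close>

definition induced :: "'m \<Rightarrow> 'm \<Rightarrow> 'm" where
  "induced q h = (THE k. k \<in> Hom (Cod K q) (Cod K h) \<and> k \<cdot> q = h)"

text \<open>
  An octahedron on the base \<open>x \<rightarrow> y \<rightarrow> z\<close> given by \<open>f\<close> and \<open>g\<close>: triangles on \<open>f\<close>, \<open>g\<close> and
  \<open>g \<cdot> f\<close>, and a triangle on their cones whose last arrow is determined by the others.
\<close>

definition octahedron :: "'m \<times> 'm \<times> 'm \<times> 'm \<times> 'm \<times> 'm \<times> 'm \<times> 'm \<times> 'm \<times> 'm \<Rightarrow> bool" where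
  "octahedron = (\<lambda>(f, g, f1, f2, g1, g2, k1, k2, u, v).
     f \<in> Ar K \<and> g \<in> Ar K \<and> Cod K f = Dom K g \<and>
     (f, f1, f2) \<in> Tri K \<and> (g, g1, g2) \<in> Tri K \<and> (g \<cdot> f, k1, k2) \<in> Tri K \<and>
     u \<in> Hom (Cod K f1) (Cod K k1) \<and> v \<in> Hom (Cod K k1) (Cod K g1) \<and>
     (u, v, \<S> f1 \<cdot> g2) \<in> Tri K \<and>
     u \<cdot> f1 = k1 \<cdot> g \<and> k2 \<cdot> u = f2 \<and> v \<cdot> k1 = g1 \<and> g2 \<cdot> v = \<S> f \<cdot> k2)"

text \<open>
  The arrows \<open>a, b, c\<close> are the components of the morphism at the base, \<open>p, q, r\<close> those at the
  cones of \<open>f\<close>, \<open>g \<cdot> f\<close> and \<open>g\<close>.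
\<close>

definition base_morphism ::
  "'m \<times> 'm \<times> 'm \<times> 'm \<times> 'm \<times> 'm \<times> 'm \<times> 'm \<times> 'm \<times> 'm \<Rightarrow>
   'm \<times> 'm \<times> 'm \<times> 'm \<times> 'm \<times> 'm \<times> 'm \<times> 'm \<times> 'm \<times> 'm \<Rightarrow> 'm \<Rightarrow> 'm \<Rightarrow> 'm \<Rightarrow> bool" where
  "base_morphism = (\<lambda>(f, g, _) (f', g', _) a b c.
     a \<in> Hom (Dom K f) (Dom K f') \<and> b \<in> Hom (Dom K g) (Dom K g') \<and>
     c \<in> Hom (Cod K g) (Cod K g') \<and> b \<cdot> f = f' \<cdot> a \<and> c \<cdot> g = g' \<cdot> b)"

definition octahedron_morphism ::
  "'m \<times> 'm \<times> 'm \<times> 'm \<times> 'm \<times> 'm \<times> 'm \<times> 'm \<times> 'm \<times> 'm \<Rightarrow>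
   'm \<times> 'm \<times> 'm \<times> 'm \<times> 'm \<times> 'm \<times> 'm \<times> 'm \<times> 'm \<times> 'm \<Rightarrow>
   'm \<Rightarrow> 'm \<Rightarrow> 'm \<Rightarrow> 'm \<Rightarrow> 'm \<Rightarrow> 'm \<Rightarrow> bool" where
  "octahedron_morphism X X' a b c p q r \<longleftrightarrow> base_morphism X X' a b c \<and>
     (case X of (f, g, f1, f2, g1, g2, k1, k2, u, v) \<Rightarrow>
      case X' of (f', g', f1', f2', g1', g2', k1', k2', u', v') \<Rightarrow>
        p \<in> Hom (Cod K f1) (Cod K f1') \<and> q \<in> Hom (Cod K k1) (Cod K k1') \<and>
        r \<in> Hom (Cod K g1) (Cod K g1') \<and>
        p \<cdot> f1 = f1' \<cdot> b \<and> \<S> a \<cdot> f2 = f2' \<cdot> p \<and>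
        q \<cdot> k1 = k1' \<cdot> c \<and> \<S> a \<cdot> k2 = k2' \<cdot> q \<and>
        r \<cdot> g1 = g1' \<cdot> c \<and> \<S> b \<cdot> g2 = g2' \<cdot> r \<and>
        q \<cdot> u = u' \<cdot> p \<and> r \<cdot> v = v' \<cdot> q)"

end


section \<open>Tensor triangulated categories\<close>

locale category =
  fixes K :: "('o, 'm) tt_data" (structure)
  assumes Dom_Ob: "f \<in> Ar K \<Longrightarrow> Dom K f \<in> Ob K"
    and Cod_Ob: "f \<in> Ar K \<Longrightarrow> Cod K f \<in> Ob K"
    and ident_Hom: "x \<in> Ob K \<Longrightarrow> \<I> x \<in> Hom x x"
    and comp_Hom: "f \<in> Hom x y \<Longrightarrow> g \<in> Hom y z \<Longrightarrow> g \<cdot> f \<in> Hom x z"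
    and comp_assoc: "f \<in> Hom w x \<Longrightarrow> g \<in> Hom x y \<Longrightarrow> h \<in> Hom y z \<Longrightarrow>
      (h \<cdot> g) \<cdot> f = h \<cdot> (g \<cdot> f)"
    and comp_ident: "f \<in> Hom x y \<Longrightarrow> f \<cdot> \<I> x = f"
    and ident_comp: "f \<in> Hom x y \<Longrightarrow> \<I> y \<cdot> f = f"

locale additive_category = category +
  assumes Zero_Hom: "x \<in> Ob K \<Longrightarrow> y \<in> Ob K \<Longrightarrow> Zero K x y \<in> Hom x y"
    and add_Hom: "f \<in> Hom x y \<Longrightarrow> g \<in> Hom x y \<Longrightarrow> f \<oplus> g \<in> Hom x y"
    and add_assoc: "f \<in> Hom x y \<Longrightarrow> g \<in> Hom x y \<Longrightarrow> h \<in> Hom x y \<Longrightarrow>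
      (f \<oplus> g) \<oplus> h = f \<oplus> (g \<oplus> h)"
    and add_commute: "f \<in> Hom x y \<Longrightarrow> g \<in> Hom x y \<Longrightarrow> f \<oplus> g = g \<oplus> f"
    and add_Zero: "f \<in> Hom x y \<Longrightarrow> f \<oplus> Zero K x y = f"
    and add_inverse: "f \<in> Hom x y \<Longrightarrow> \<exists>g\<in>Hom x y. f \<oplus> g = Zero K x y"
    and comp_add: "f \<in> Hom x y \<Longrightarrow> g \<in> Hom x y \<Longrightarrow> h \<in> Hom y z \<Longrightarrow>
      h \<cdot> (f \<oplus> g) = (h \<cdot> f) \<oplus> (h \<cdot> g)"
    and add_comp: "f \<in> Hom y z \<Longrightarrow> g \<in> Hom y z \<Longrightarrow> h \<in> Hom x y \<Longrightarrow>
      (f \<oplus> g) \<cdot> h = (f \<cdot> h) \<oplus> (g \<cdot> h)"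
    and zero_object_exists: "\<exists>z. zero_object K z"
    and biproduct_exists: "x \<in> Ob K \<Longrightarrow> y \<in> Ob K \<Longrightarrow> \<exists>s i j p q. biproduct K x y s i j p q"

text \<open>
  In the rotation axiom, \<open>k \<oplus> \<S> f = 0\<close> says \<open>k = - \<S> f\<close>. The last two conditions on the class
  of distinguished octahedra are the Kuenzer--Maltsiniotis strengthening of Verdier's octahedral
  axiom (which the existence of an octahedron on every base already contains).
\<close>

locale triangulated_category = additive_category +
  assumes Susp_Ob: "x \<in> Ob K \<Longrightarrow> \<Sigma> x \<in> Ob K"
    and SuspA_bij: "x \<in> Ob K \<Longrightarrow> y \<in> Ob K \<Longrightarrow> bij_betw \<S> (Hom x y) (Hom (\<Sigma> x) (\<Sigma> y))"
    and SuspA_ident: "x \<in> Ob K \<Longrightarrow> \<S> (\<I> x) = \<I> (\<Sigma> x)"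
    and SuspA_comp: "f \<in> Hom x y \<Longrightarrow> g \<in> Hom y z \<Longrightarrow> \<S> (g \<cdot> f) = \<S> g \<cdot> \<S> f"
    and SuspA_add: "f \<in> Hom x y \<Longrightarrow> g \<in> Hom x y \<Longrightarrow> \<S> (f \<oplus> g) = \<S> f \<oplus> \<S> g"
    and Susp_ess_surj: "y \<in> Ob K \<Longrightarrow> \<exists>x\<in>Ob K. \<exists>f\<in>Hom (\<Sigma> x) y. iso K f"
    and Tri_Hom: "(f, g, h) \<in> Tri K \<Longrightarrow>
      f \<in> Ar K \<and> g \<in> Hom (Cod K f) (Cod K g) \<and> h \<in> Hom (Cod K g) (\<Sigma> (Dom K f))"
    and Tri_iso: "(f, g, h) \<in> Tri K \<Longrightarrow>
      f' \<in> Hom x y \<Longrightarrow> g' \<in> Hom y z \<Longrightarrow> h' \<in> Hom z (\<Sigma> x) \<Longrightarrow>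
      a \<in> Hom (Dom K f) x \<Longrightarrow> b \<in> Hom (Cod K f) y \<Longrightarrow> c \<in> Hom (Cod K g) z \<Longrightarrow>
      iso K a \<Longrightarrow> iso K b \<Longrightarrow> iso K c \<Longrightarrow>
      b \<cdot> f = f' \<cdot> a \<Longrightarrow> c \<cdot> g = g' \<cdot> b \<Longrightarrow> \<S> a \<cdot> h = h' \<cdot> c \<Longrightarrow> (f', g', h') \<in> Tri K"
    and Tri_ident: "x \<in> Ob K \<Longrightarrow> zero_object K z \<Longrightarrow>
      (\<I> x, Zero K x z, Zero K z (\<Sigma> x)) \<in> Tri K"
    and Tri_exists: "f \<in> Ar K \<Longrightarrow> \<exists>g h. (f, g, h) \<in> Tri K"
    and Tri_rotate: "f \<in> Hom x y \<Longrightarrow> g \<in> Hom y z \<Longrightarrow> h \<in> Hom z (\<Sigma> x) \<Longrightarrow>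
      k \<in> Hom (\<Sigma> x) (\<Sigma> y) \<Longrightarrow> k \<oplus> \<S> f = Zero K (\<Sigma> x) (\<Sigma> y) \<Longrightarrow>
      (f, g, h) \<in> Tri K \<longleftrightarrow> (g, h, k) \<in> Tri K"
    and Tri_morphism: "(f, g, h) \<in> Tri K \<Longrightarrow> (f', g', h') \<in> Tri K \<Longrightarrow>
      a \<in> Hom (Dom K f) (Dom K f') \<Longrightarrow> b \<in> Hom (Cod K f) (Cod K f') \<Longrightarrow> b \<cdot> f = f' \<cdot> a \<Longrightarrow>
      \<exists>c\<in>Hom (Cod K g) (Cod K g'). c \<cdot> g = g' \<cdot> b \<and> \<S> a \<cdot> h = h' \<cdot> c"
    and distinguished_octahedra: "\<exists>Oct.
      (\<forall>X\<in>Oct. octahedron K X) \<and>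
      (\<forall>f\<in>Ar K. \<forall>g\<in>Ar K. Cod K f = Dom K g \<longrightarrow>
         (\<exists>f1 f2 g1 g2 k1 k2 u v. (f, g, f1, f2, g1, g2, k1, k2, u, v) \<in> Oct)) \<and>
      (\<forall>X\<in>Oct. \<forall>X'\<in>Oct. \<forall>a b c. base_morphism K X X' a b c \<longrightarrow>
         (\<exists>p q r. octahedron_morphism K X X' a b c p q r))"

locale symmetric_monoidal_category = category +
  assumes Ten_Ob: "x \<in> Ob K \<Longrightarrow> y \<in> Ob K \<Longrightarrow> x \<otimes> y \<in> Ob K"
    and TenA_Hom: "f \<in> Hom x x' \<Longrightarrow> g \<in> Hom y y' \<Longrightarrow> f \<odot> g \<in> Hom (x \<otimes> y) (x' \<otimes> y')"
    and TenA_ident: "x \<in> Ob K \<Longrightarrow> y \<in> Ob K \<Longrightarrow> \<I> x \<odot> \<I> y = \<I> (x \<otimes> y)"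
    and TenA_comp: "f \<in> Hom x x' \<Longrightarrow> f' \<in> Hom x' x'' \<Longrightarrow> g \<in> Hom y y' \<Longrightarrow> g' \<in> Hom y' y'' \<Longrightarrow>
      (f' \<cdot> f) \<odot> (g' \<cdot> g) = (f' \<odot> g') \<cdot> (f \<odot> g)"
    and Unit_Ob: "\<one> \<in> Ob K"
    and assoc_iso: "x \<in> Ob K \<Longrightarrow> y \<in> Ob K \<Longrightarrow> z \<in> Ob K \<Longrightarrow>
      \<alpha> x y z \<in> Hom ((x \<otimes> y) \<otimes> z) (x \<otimes> (y \<otimes> z)) \<and> iso K (\<alpha> x y z)"
    and assoc_natural: "f \<in> Hom x x' \<Longrightarrow> g \<in> Hom y y' \<Longrightarrow> h \<in> Hom z z' \<Longrightarrow>
      \<alpha> x' y' z' \<cdot> ((f \<odot> g) \<odot> h) = (f \<odot> (g \<odot> h)) \<cdot> \<alpha> x y z"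
    and lunit_iso: "x \<in> Ob K \<Longrightarrow> \<lambda>\<lambda> x \<in> Hom (\<one> \<otimes> x) x \<and> iso K (\<lambda>\<lambda> x)"
    and lunit_natural: "f \<in> Hom x y \<Longrightarrow> \<lambda>\<lambda> y \<cdot> (\<I> \<one> \<odot> f) = f \<cdot> \<lambda>\<lambda> x"
    and runit_iso: "x \<in> Ob K \<Longrightarrow> \<rho>\<rho> x \<in> Hom (x \<otimes> \<one>) x \<and> iso K (\<rho>\<rho> x)"
    and runit_natural: "f \<in> Hom x y \<Longrightarrow> \<rho>\<rho> y \<cdot> (f \<odot> \<I> \<one>) = f \<cdot> \<rho>\<rho> x"
    and braid_Hom: "x \<in> Ob K \<Longrightarrow> y \<in> Ob K \<Longrightarrow> \<gamma> x y \<in> Hom (x \<otimes> y) (y \<otimes> x)"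
    and braid_natural: "f \<in> Hom x x' \<Longrightarrow> g \<in> Hom y y' \<Longrightarrow> \<gamma> x' y' \<cdot> (f \<odot> g) = (g \<odot> f) \<cdot> \<gamma> x y"
    and braid_braid: "x \<in> Ob K \<Longrightarrow> y \<in> Ob K \<Longrightarrow> \<gamma> y x \<cdot> \<gamma> x y = \<I> (x \<otimes> y)"
    and pentagon: "w \<in> Ob K \<Longrightarrow> x \<in> Ob K \<Longrightarrow> y \<in> Ob K \<Longrightarrow> z \<in> Ob K \<Longrightarrow>
      \<alpha> w x (y \<otimes> z) \<cdot> \<alpha> (w \<otimes> x) y z =
      (\<I> w \<odot> \<alpha> x y z) \<cdot> \<alpha> w (x \<otimes> y) z \<cdot> (\<alpha> w x y \<odot> \<I> z)"
    and triangle: "x \<in> Ob K \<Longrightarrow> y \<in> Ob K \<Longrightarrow> (\<I> x \<odot> \<lambda>\<lambda> y) \<cdot> \<alpha> x \<one> y = \<rho>\<rho> x \<odot> \<I> y"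
    and hexagon: "x \<in> Ob K \<Longrightarrow> y \<in> Ob K \<Longrightarrow> z \<in> Ob K \<Longrightarrow>
      \<alpha> y z x \<cdot> \<gamma> x (y \<otimes> z) \<cdot> \<alpha> x y z =
      (\<I> y \<odot> \<gamma> x z) \<cdot> \<alpha> y x z \<cdot> (\<gamma> x y \<odot> \<I> z)"

text \<open>
  The isomorphisms \<open>\<theta>\<close> are natural in both variables and compatible with the associator and the
  left unitor. These compatibilities are what makes the suspension of a module a module.
\<close>

locale tt_category = triangulated_category K + symmetric_monoidal_category K
  for K :: "('o, 'm) tt_data" (structure) +
  assumes idempotent_complete: "e \<in> Hom x x \<Longrightarrow> e \<cdot> e = e \<Longrightarrow>
      \<exists>y\<in>Ob K. \<exists>r\<in>Hom x y. \<exists>s\<in>Hom y x. s \<cdot> r = e \<and> r \<cdot> s = \<I> y"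
    and Ten_additive: "x \<in> Ob K \<Longrightarrow> f \<in> Hom y z \<Longrightarrow> g \<in> Hom y z \<Longrightarrow>
      \<I> x \<odot> (f \<oplus> g) = (\<I> x \<odot> f) \<oplus> (\<I> x \<odot> g)"
    and tsusp_iso: "x \<in> Ob K \<Longrightarrow> y \<in> Ob K \<Longrightarrow>
      \<theta> x y \<in> Hom (x \<otimes> \<Sigma> y) (\<Sigma> (x \<otimes> y)) \<and> iso K (\<theta> x y)"
    and tsusp_natural: "f \<in> Hom x x' \<Longrightarrow> g \<in> Hom y y' \<Longrightarrow>
      \<theta> x' y' \<cdot> (f \<odot> \<S> g) = \<S> (f \<odot> g) \<cdot> \<theta> x y"
    and tsusp_assoc: "x \<in> Ob K \<Longrightarrow> y \<in> Ob K \<Longrightarrow> z \<in> Ob K \<Longrightarrow>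
      \<S> (\<alpha> x y z) \<cdot> \<theta> (x \<otimes> y) z = \<theta> x (y \<otimes> z) \<cdot> (\<I> x \<odot> \<theta> y z) \<cdot> \<alpha> x y (\<Sigma> z)"
    and tsusp_lunit: "x \<in> Ob K \<Longrightarrow> \<S> (\<lambda>\<lambda> x) \<cdot> \<theta> \<one> x = \<lambda>\<lambda> (\<Sigma> x)"
    and Ten_exact: "x \<in> Ob K \<Longrightarrow> (f, g, h) \<in> Tri K \<Longrightarrow>
      (\<I> x \<odot> f, \<I> x \<odot> g, \<theta> x (Dom K f) \<cdot> (\<I> x \<odot> h)) \<in> Tri K"


section \<open>The spectrum\<close>

context
  fixes K :: "('o, 'm) tt_data" (structure)
begin

definition thick_ideal :: "'o set \<Rightarrow> bool" where
  "thick_ideal J \<longleftrightarrow> J \<subseteq> Ob K \<and>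
     (\<forall>z. zero_object K z \<longrightarrow> z \<in> J) \<and>
     (\<forall>x\<in>Ob K. \<Sigma> x \<in> J \<longleftrightarrow> x \<in> J) \<and>
     (\<forall>f g h. (f, g, h) \<in> Tri K \<longrightarrow>
        (Dom K f \<in> J \<and> Cod K f \<in> J \<longrightarrow> Cod K g \<in> J) \<and>
        (Cod K f \<in> J \<and> Cod K g \<in> J \<longrightarrow> Dom K f \<in> J) \<and>
        (Dom K f \<in> J \<and> Cod K g \<in> J \<longrightarrow> Cod K f \<in> J)) \<and>
     (\<forall>x\<in>Ob K. \<forall>y\<in>Ob K. \<forall>s\<in>J. \<forall>i j p q. biproduct K x y s i j p q \<longrightarrow> x \<in> J \<and> y \<in> J) \<and>
     (\<forall>x\<in>Ob K. \<forall>y\<in>J. x \<otimes> y \<in> J)"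

definition prime_ideal :: "'o set \<Rightarrow> bool" where
  "prime_ideal P \<longleftrightarrow> thick_ideal P \<and> P \<noteq> Ob K \<and>
     (\<forall>x\<in>Ob K. \<forall>y\<in>Ob K. x \<otimes> y \<in> P \<longrightarrow> x \<in> P \<or> y \<in> P)"

definition Spc :: "'o set topology" where
  "Spc = topology_generated_by {{P. prime_ideal P \<and> x \<in> P} | x. x \<in> Ob K}"

definition supp :: "'o \<Rightarrow> 'o set set" where
  "supp x = {P. prime_ideal P \<and> x \<notin> P}"

text \<open>The map \<open>P \<mapsto> F\<inverse>(P)\<close> on spectra, for a functor out of \<open>K\<close> with object part \<open>F\<close>.\<close>

definition Spc_map :: "('o \<Rightarrow> 'p) \<Rightarrow> 'p set \<Rightarrow> 'o set" where
  "Spc_map F Q = {x \<in> Ob K. F x \<in> Q}"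

end

text \<open>
  The supremum of the lengths of chains of proper specializations; the dimension of the empty
  space is \<open>-\<infinity>\<close>.
\<close>

definition specialization_chain :: "'a topology \<Rightarrow> (nat \<Rightarrow> 'a) \<Rightarrow> nat \<Rightarrow> bool" where
  "specialization_chain X c n \<longleftrightarrow> (\<forall>i\<le>n. c i \<in> topspace X) \<and>
     (\<forall>i<n. c (Suc i) \<in> X closure_of {c i} \<and> c i \<notin> X closure_of {c (Suc i)})"

definition krull_dim :: "'a topology \<Rightarrow> ereal" where
  "krull_dim X = (SUP n\<in>{n. \<exists>c. specialization_chain X c n}. ereal (real n))"


section \<open>Ring objects and their modules\<close>

record ('o, 'm) ring_object =
  robj :: 'o
  mult :: 'm
  unit :: 'm

context
  fixes K :: "('o, 'm) tt_data" (structure)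
begin

definition is_ring :: "('o, 'm) ring_object \<Rightarrow> bool" where
  "is_ring A \<longleftrightarrow> robj A \<in> Ob K \<and>
     mult A \<in> Hom (robj A \<otimes> robj A) (robj A) \<and> unit A \<in> Hom \<one> (robj A) \<and>
     mult A \<cdot> (mult A \<odot> \<I> (robj A)) =
       mult A \<cdot> (\<I> (robj A) \<odot> mult A) \<cdot> \<alpha> (robj A) (robj A) (robj A) \<and>
     mult A \<cdot> (unit A \<odot> \<I> (robj A)) = \<lambda>\<lambda> (robj A) \<and>
     mult A \<cdot> (\<I> (robj A) \<odot> unit A) = \<rho>\<rho> (robj A)"

definition separable :: "('o, 'm) ring_object \<Rightarrow> bool" where
  "separable A \<longleftrightarrow> (\<exists>\<sigma>\<in>Hom (robj A) (robj A \<otimes> robj A).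
     mult A \<cdot> \<sigma> = \<I> (robj A) \<and>
     (\<I> (robj A) \<odot> mult A) \<cdot> \<alpha> (robj A) (robj A) (robj A) \<cdot> (\<sigma> \<odot> \<I> (robj A)) = \<sigma> \<cdot> mult A \<and>
     (mult A \<odot> \<I> (robj A)) \<cdot> inv_arrow K (\<alpha> (robj A) (robj A) (robj A)) \<cdot> (\<I> (robj A) \<odot> \<sigma>)
       = \<sigma> \<cdot> mult A)"

definition tt_ring :: "('o, 'm) ring_object \<Rightarrow> bool" where
  "tt_ring A \<longleftrightarrow> is_ring A \<and> mult A \<cdot> \<gamma> (robj A) (robj A) = mult A \<and> separable A"

definition ring_hom :: "('o, 'm) ring_object \<Rightarrow> ('o, 'm) ring_object \<Rightarrow> 'm \<Rightarrow> bool" where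
  "ring_hom A B f \<longleftrightarrow> f \<in> Hom (robj A) (robj B) \<and>
     f \<cdot> mult A = mult B \<cdot> (f \<odot> f) \<and> f \<cdot> unit A = unit B"

definition unit_ring :: "('o, 'm) ring_object" where
  "unit_ring = \<lparr>robj = \<one>, mult = \<lambda>\<lambda> \<one>, unit = \<I> \<one>\<rparr>"

text \<open>
  A module is a pair \<open>(x, r)\<close> with \<open>r : A \<otimes> x \<rightarrow> x\<close>. A morphism of modules is a triple consisting
  of its domain, the underlying arrow of \<open>K\<close> and its codomain.
\<close>

definition modules :: "('o, 'm) ring_object \<Rightarrow> ('o \<times> 'm) set" where
  "modules A = {(x, r). x \<in> Ob K \<and> r \<in> Hom (robj A \<otimes> x) x \<and>
     r \<cdot> (mult A \<odot> \<I> x) = r \<cdot> (\<I> (robj A) \<odot> r) \<cdot> \<alpha> (robj A) (robj A) x \<and>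
     r \<cdot> (unit A \<odot> \<I> x) = \<lambda>\<lambda> x}"

definition module_arrows :: "('o, 'm) ring_object \<Rightarrow> (('o \<times> 'm) \<times> 'm \<times> ('o \<times> 'm)) set" where
  "module_arrows A = {(M, f, N). M \<in> modules A \<and> N \<in> modules A \<and> f \<in> Hom (fst M) (fst N) \<and>
     f \<cdot> snd M = snd N \<cdot> (\<I> (robj A) \<odot> f)}"

definition arrow_of :: "('o \<times> 'm) \<times> 'm \<times> ('o \<times> 'm) \<Rightarrow> 'm" where
  "arrow_of F = fst (snd F)"

text \<open>
  A chosen coequalizer \<open>x \<otimes> y \<rightarrow> M \<otimes>\<^sub>A N\<close> in \<open>K\<close> of the two actions
  \<open>(x \<otimes> A) \<otimes> y \<rightarrow> x \<otimes> y\<close>, for \<open>M = (x, _)\<close> and \<open>N = (y, _)\<close>. As \<open>A\<close> is commutative, \<open>M\<close> is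
  viewed as a right module through the symmetry.
\<close>

definition right_action :: "('o, 'm) ring_object \<Rightarrow> 'o \<times> 'm \<Rightarrow> 'm" where
  "right_action A M = snd M \<cdot> \<gamma> (fst M) (robj A)"

definition tensor_quot :: "('o, 'm) ring_object \<Rightarrow> 'o \<times> 'm \<Rightarrow> 'o \<times> 'm \<Rightarrow> 'm" where
  "tensor_quot A M N = (SOME q. coequalizer K
     (right_action A M \<odot> \<I> (fst N))
     ((\<I> (fst M) \<odot> snd N) \<cdot> \<alpha> (fst M) (robj A) (fst N)) q)"

text \<open>The action of \<open>A\<close> on \<open>M \<otimes>\<^sub>A N\<close> is induced by the action on the left factor.\<close>

definition tensor_mod :: "('o, 'm) ring_object \<Rightarrow> 'o \<times> 'm \<Rightarrow> 'o \<times> 'm \<Rightarrow> 'o \<times> 'm" where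
  "tensor_mod A M N = (let q = tensor_quot A M N in
     (Cod K q,
      induced K (\<I> (robj A) \<odot> q)
        (q \<cdot> (snd M \<odot> \<I> (fst N)) \<cdot> inv_arrow K (\<alpha> (robj A) (fst M) (fst N)))))"

definition susp_mod :: "('o, 'm) ring_object \<Rightarrow> 'o \<times> 'm \<Rightarrow> 'o \<times> 'm" where
  "susp_mod A M = (\<Sigma> (fst M), \<S> (snd M) \<cdot> \<theta> (robj A) (fst M))"

definition self_mod :: "('o, 'm) ring_object \<Rightarrow> 'o \<times> 'm" where
  "self_mod A = (robj A, mult A)"

definition Mod :: "('o, 'm) ring_object \<Rightarrow> ('o \<times> 'm, ('o \<times> 'm) \<times> 'm \<times> ('o \<times> 'm)) tt_data" where
  "Mod A = \<lparr>
     Ob = modules A,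
     Ar = module_arrows A,
     Dom = fst,
     Cod = (\<lambda>F. snd (snd F)),
     ident = (\<lambda>M. (M, \<I> (fst M), M)),
     comp = (\<lambda>G F. (fst F, arrow_of G \<cdot> arrow_of F, snd (snd G))),
     add = (\<lambda>F G. (fst F, arrow_of F \<oplus> arrow_of G, snd (snd F))),
     Zero = (\<lambda>M N. (M, Zero K (fst M) (fst N), N)),
     Susp = susp_mod A,
     SuspA = (\<lambda>(M, f, N). (susp_mod A M, \<S> f, susp_mod A N)),
     Tri = {(F, G, H). F \<in> module_arrows A \<and> G \<in> module_arrows A \<and> H \<in> module_arrows A \<and>
              snd (snd F) = fst G \<and> snd (snd G) = fst H \<and> snd (snd H) = susp_mod A (fst F) \<and>
              (arrow_of F, arrow_of G, arrow_of H) \<in> Tri K},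
     Ten = tensor_mod A,
     TenA = (\<lambda>(M, f, M') (N, g, N').
       (tensor_mod A M N,
        induced K (tensor_quot A M N) (tensor_quot A M' N' \<cdot> (f \<odot> g)),
        tensor_mod A M' N')),
     Unit = self_mod A,
     assoc = (\<lambda>L M N.
       (tensor_mod A (tensor_mod A L M) N,
        induced K (tensor_quot A (tensor_mod A L M) N \<cdot> (tensor_quot A L M \<odot> \<I> (fst N)))
          (tensor_quot A L (tensor_mod A M N) \<cdot> (\<I> (fst L) \<odot> tensor_quot A M N) \<cdot>
             \<alpha> (fst L) (fst M) (fst N)),
        tensor_mod A L (tensor_mod A M N))),
     lunit = (\<lambda>M.
       (tensor_mod A (self_mod A) M, induced K (tensor_quot A (self_mod A) M) (snd M), M)),
     runit = (\<lambda>M.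
       (tensor_mod A M (self_mod A),
        induced K (tensor_quot A M (self_mod A)) (right_action A M), M)),
     braid = (\<lambda>M N.
       (tensor_mod A M N,
        induced K (tensor_quot A M N) (tensor_quot A N M \<cdot> \<gamma> (fst M) (fst N)),
        tensor_mod A N M)),
     tsusp = (\<lambda>M N.
       (tensor_mod A M (susp_mod A N),
        induced K (tensor_quot A M (susp_mod A N))
          (\<S> (tensor_quot A M N) \<cdot> \<theta> (fst M) (fst N)),
        susp_mod A (tensor_mod A M N)))
   \<rparr>"

text \<open>Extension of scalars on objects.\<close>

definition extension :: "('o, 'm) ring_object \<Rightarrow> 'o \<Rightarrow> 'o \<times> 'm" where
  "extension A y = (robj A \<otimes> y,
     (mult A \<odot> \<I> y) \<cdot> inv_arrow K (\<alpha> (robj A) (robj A) y))"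

definition phi :: "('o, 'm) ring_object \<Rightarrow> ('o \<times> 'm) set \<Rightarrow> 'o set" where
  "phi A = Spc_map K (extension A)"

text \<open>Only the values at \<open>n \<ge> 1\<close> of the tensor powers of an arrow matter below.\<close>

primrec tensor_power :: "'m \<Rightarrow> nat \<Rightarrow> 'm" where
  "tensor_power f 0 = \<I> \<one>"
| "tensor_power f (Suc n) = (if n = 0 then f else tensor_power f n \<odot> f)"

definition zero_arrow :: "'m \<Rightarrow> bool" where
  "zero_arrow f \<longleftrightarrow> f = Zero K (Dom K f) (Cod K f)"

definition nil_faithful :: "('o, 'm) ring_object \<Rightarrow> bool" where
  "nil_faithful A \<longleftrightarrow> (\<forall>f\<in>Ar K. zero_arrow (\<I> (robj A) \<odot> f) \<longrightarrow>
     (\<exists>n\<ge>1. zero_arrow (tensor_power f n)))"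


section \<open>The splitting tower and the degree\<close>

definition interchange :: "'o \<Rightarrow> 'o \<Rightarrow> 'o \<Rightarrow> 'o \<Rightarrow> 'm" where
  "interchange w x y z = inv_arrow K (\<alpha> w y (x \<otimes> z)) \<cdot>
     (\<I> w \<odot> (\<alpha> y x z \<cdot> (\<gamma> x y \<odot> \<I> z) \<cdot> inv_arrow K (\<alpha> x y z))) \<cdot> \<alpha> w x (y \<otimes> z)"

text \<open>A ring \<open>B\<close> as a module over \<open>A\<close>, along \<open>t : A \<rightarrow> B\<close>.\<close>

definition restrict_mod :: "('o, 'm) ring_object \<Rightarrow> 'm \<Rightarrow> 'o \<times> 'm" where
  "restrict_mod B t = (robj B, mult B \<cdot> (t \<odot> \<I> (robj B)))"

definition self_quot :: "('o, 'm) ring_object \<Rightarrow> 'm \<Rightarrow> ('o, 'm) ring_object \<Rightarrow> 'm" where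
  "self_quot A t B = tensor_quot A (restrict_mod B t) (restrict_mod B t)"

text \<open>The ring \<open>B \<otimes>\<^sub>A B\<close>, for \<open>t : A \<rightarrow> B\<close>.\<close>

definition self_tensor_ring ::
  "('o, 'm) ring_object \<Rightarrow> 'm \<Rightarrow> ('o, 'm) ring_object \<Rightarrow> ('o, 'm) ring_object" where
  "self_tensor_ring A t B = (let q = self_quot A t B; b = robj B in
     \<lparr>robj = Cod K q,
      mult = induced K (q \<odot> q) (q \<cdot> (mult B \<odot> mult B) \<cdot> interchange b b b b),
      unit = q \<cdot> (unit B \<odot> unit B) \<cdot> inv_arrow K (\<lambda>\<lambda> \<one>)\<rparr>)"

text \<open>The product ring carried by a biproduct \<open>s\<close>, with injections \<open>i, j\<close> and projections \<open>p, q\<close>.\<close>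

definition product_ring ::
  "('o, 'm) ring_object \<Rightarrow> ('o, 'm) ring_object \<Rightarrow> 'o \<Rightarrow> 'm \<Rightarrow> 'm \<Rightarrow> 'm \<Rightarrow> 'm \<Rightarrow>
   ('o, 'm) ring_object" where
  "product_ring B C s i j p q =
     \<lparr>robj = s,
      mult = (i \<cdot> mult B \<cdot> (p \<odot> p)) \<oplus> (j \<cdot> mult C \<cdot> (q \<odot> q)),
      unit = (i \<cdot> unit B) \<oplus> (j \<cdot> unit C)\<rparr>"

text \<open>
  Given \<open>t : A \<rightarrow> B\<close>, the next stage of the tower is \<open>t' : B \<rightarrow> C\<close>: there is a ring isomorphism
  \<open>h : B \<otimes>\<^sub>A B \<cong> B \<times> C\<close> whose first component is the multiplication, and \<open>t'\<close> is its second
  component precomposed with \<open>1 \<otimes> \<eta> : B \<rightarrow> B \<otimes>\<^sub>A B\<close>.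
\<close>

definition tower_step ::
  "('o, 'm) ring_object \<Rightarrow> 'm \<Rightarrow> ('o, 'm) ring_object \<Rightarrow> 'm \<Rightarrow> ('o, 'm) ring_object \<Rightarrow> bool" where
  "tower_step A t B t' C \<longleftrightarrow> tt_ring C \<and>
     (\<exists>s i j p q h. biproduct K (robj B) (robj C) s i j p q \<and>
        ring_hom (self_tensor_ring A t B) (product_ring B C s i j p q) h \<and> iso K h \<and>
        p \<cdot> h = induced K (self_quot A t B) (mult B) \<and>
        t' = (q \<cdot> h) \<cdot> self_quot A t B \<cdot> (\<I> (robj B) \<odot> unit B) \<cdot> inv_arrow K (\<rho>\<rho> (robj B)))"

definition splitting_tower ::
  "('o, 'm) ring_object \<Rightarrow> (nat \<Rightarrow> ('o, 'm) ring_object) \<Rightarrow> (nat \<Rightarrow> 'm) \<Rightarrow> bool" where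
  "splitting_tower A R t \<longleftrightarrow> R 0 = unit_ring \<and> R 1 = A \<and> t 0 = unit A \<and>
     (\<forall>n\<ge>1. tower_step (R (n - 1)) (t (n - 1)) (R n) (t n) (R (n + 1)))"

text \<open>The tower is unique up to isomorphism, so any tower computes the degree.\<close>

definition has_degree :: "('o, 'm) ring_object \<Rightarrow> nat \<Rightarrow> bool" where
  "has_degree A d \<longleftrightarrow> (\<exists>R t. splitting_tower A R t \<and>
     \<not> zero_object K (robj (R d)) \<and> zero_object K (robj (R (d + 1))))"

end

end

theory Submission
  imports Defs
begin

text \<open>
  Separability splits the coequalizers defining relative tensor products, so for a ring map
  \<open>f : B \<rightarrow> C\<close> the functor \<open>L \<otimes>\<^sub>B -\<close> is exact and primes of \<open>C\<close>-modules pull back to primes of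
  \<open>B\<close>-modules. A \<open>C\<close>-module \<open>L\<close> is a direct summand of \<open>C \<otimes>\<^sub>B L\<close>, and a prime \<open>Q\<close> of
  \<open>B\<close>-modules not containing \<open>C\<close> is the trace of every prime that contains all \<open>L\<close> whose
  restriction lies in \<open>Q\<close> and avoids all \<open>C \<otimes>\<^sub>B N\<close> with \<open>N \<notin> Q\<close>: this gives lying over, and
  going up follows in the same way.

  For finite degree, let \<open>t : A \<rightarrow> B\<close> be a stage of the tower with
  \<open>B \<otimes>\<^sub>A B \<cong> B \<times> C\<close>, and let \<open>f\<^sub>1, f\<^sub>2 : B \<rightarrow> C\<close> come from the two inclusions of \<open>B\<close>. Then
  \<open>B \<otimes>\<^sub>A N\<close> is \<open>N\<close> plus the restriction along \<open>f\<^sub>2\<close> of \<open>C \<otimes>\<^sub>B N\<close> formed along \<open>f\<^sub>1\<close>.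
  Consequently two primes \<open>Q, Q'\<close> with the same trace on \<open>A\<close> satisfy \<open>Q \<subseteq> Q'\<close>, or some prime
  \<open>T\<close> of \<open>C\<close>-modules has trace \<open>Q\<close> along \<open>f\<^sub>2\<close> and trace contained in \<open>Q'\<close> along \<open>f\<^sub>1\<close>. So
  incomparability for \<open>f\<^sub>1\<close> passes to \<open>t\<close>, and a fibre of \<open>t\<close> has at most one point more than
  a fibre of \<open>f\<^sub>1\<close>. The tower ends in \<open>0\<close>, over which there are no primes.

  For nil-faithfulness: if a prime \<open>P\<close> contains \<open>A\<close>, the third arrow of the triangle on the
  unit \<open>\<one> \<rightarrow> A\<close> is killed by \<open>A\<close> although the cones of all its tensor powers lie in \<open>P\<close>;
  conversely the objects on which \<open>f\<close> is tensor-nilpotent form a thick ideal, which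
  contains \<open>A\<close> when \<open>A \<otimes> f = 0\<close>.
\<close>

section \<open>Symmetric monoidal categories\<close>

text \<open>Two obstacles shape the proof. First, \<open>tensor_quot\<close> and
  \<open>induced\<close> are chosen by universal properties, which by themselves say little about
  further tensor products or triangles. Separability supplies explicit sections: the element
  \<open>\<sigma> \<cdot> unit\<close> of \<open>B \<otimes> B\<close> turns two commuting actions
  of \<open>B\<close> into an idempotent, so identities on a quotient can be checked before passing
  to it. Linearity of this idempotent gives the retract of \<open>C \<otimes>\<^sub>B L\<close>, its
  naturality the exactness. Second, associators: tensor words are nested to the right, and both
  actions on \<open>x \<otimes> y\<close> are written as left actions with source
  \<open>b \<otimes> (x \<otimes> y)\<close>, so that balancing, linearity and commutation become
  equations between such arrows. \<open>K\<close> itself is treated as the modules over the unit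
  ring, so that statements about primes along \<open>B \<rightarrow> C\<close> specialize to the map
  of spectra in question. In the induction over the tower a step yields only an inclusion of traces;
  primes minimal in their fiber turn it into an equality.\<close>

context category
begin

text \<open>As a simplification rule this unfolds all typing into equations on \<open>Dom\<close>
  and \<open>Cod\<close>, which discharge the side conditions of the equational laws.\<close>

lemma Hom_iff [simp]: "f \<in> Hom x y \<longleftrightarrow> f \<in> Ar K \<and> Dom K f = x \<and> Cod K f = y"
  by (auto simp: Hom_def)

lemma ident_simps [simp]:
  assumes "x \<in> Ob K"
  shows "\<I> x \<in> Ar K" "Dom K (\<I> x) = x" "Cod K (\<I> x) = x"
  using ident_Hom[OF assms] by auto

lemma comp_simps [simp]:
  assumes "f \<in> Ar K" "g \<in> Ar K" "Cod K f = Dom K g"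
  shows "g \<cdot> f \<in> Ar K" "Dom K (g \<cdot> f) = Dom K f" "Cod K (g \<cdot> f) = Cod K g"
  using comp_Hom[of f "Dom K f" "Dom K g" g "Cod K g"] assms by auto

lemma comp_assoc_simp [simp]:
  "f \<in> Ar K \<Longrightarrow> g \<in> Ar K \<Longrightarrow> h \<in> Ar K \<Longrightarrow> Cod K f = Dom K g \<Longrightarrow> Cod K g = Dom K h \<Longrightarrow>
    (h \<cdot> g) \<cdot> f = h \<cdot> (g \<cdot> f)"
  using comp_assoc[of f "Dom K f" "Dom K g" g "Dom K h" h "Cod K h"] by auto

declare Dom_Ob [simp] Cod_Ob [simp]

lemma comp_ident_simp [simp]: "f \<in> Ar K \<Longrightarrow> Dom K f = x \<Longrightarrow> f \<cdot> \<I> x = f"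
  using comp_ident[of f x "Cod K f"] by auto

lemma ident_comp_simp [simp]: "f \<in> Ar K \<Longrightarrow> Cod K f = y \<Longrightarrow> \<I> y \<cdot> f = f"
  using ident_comp[of f "Dom K f" y] by auto

text \<open>Lets an equation between composites rewrite inside right-nested composites.\<close>

lemma reassoc:
  "g \<cdot> f = e \<Longrightarrow> f \<in> Ar K \<Longrightarrow> g \<in> Ar K \<Longrightarrow> k \<in> Ar K \<Longrightarrow> Cod K f = Dom K g \<Longrightarrow>
    Cod K k = Dom K f \<Longrightarrow> g \<cdot> (f \<cdot> k) = e \<cdot> k"
  by (metis comp_assoc_simp)

lemma inverse_arrows_unique:
  assumes "inverse_arrows K f g" "inverse_arrows K f h"
  shows "g = h"
proof -
  have [simp]: "f \<in> Ar K" "g \<in> Ar K" "h \<in> Ar K" "Dom K g = Cod K f" "Cod K g = Dom K f"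
    "Dom K h = Cod K f" "Cod K h = Dom K f"
    and e: "f \<cdot> h = \<I> (Cod K f)" "g \<cdot> f = \<I> (Dom K f)"
    using assms by (auto simp: inverse_arrows_def)
  have "(g \<cdot> f) \<cdot> h = g \<cdot> (f \<cdot> h)" by simp
  then show ?thesis unfolding e by simp
qed

lemma inv_arrow_inverse: "iso K f \<Longrightarrow> inverse_arrows K f (inv_arrow K f)"
  unfolding iso_def inv_arrow_def by (erule exE, rule theI, assumption, rule inverse_arrows_unique)

lemma inv_arrow_simps [simp]:
  assumes "iso K f"
  shows "inv_arrow K f \<in> Ar K" "Dom K (inv_arrow K f) = Cod K f" "Cod K (inv_arrow K f) = Dom K f"
    "inv_arrow K f \<cdot> f = \<I> (Dom K f)" "f \<cdot> inv_arrow K f = \<I> (Cod K f)"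
  using inv_arrow_inverse[OF assms] by (auto simp: inverse_arrows_def)

lemma iso_Ar [simp]: "iso K f \<Longrightarrow> f \<in> Ar K"
  by (auto simp: iso_def inverse_arrows_def)

lemma inv_arrow_cancel [simp]:
  assumes "iso K f" "k \<in> Ar K"
  shows "Cod K k = Dom K f \<Longrightarrow> inv_arrow K f \<cdot> (f \<cdot> k) = k"
    "Cod K k = Cod K f \<Longrightarrow> f \<cdot> (inv_arrow K f \<cdot> k) = k"
  by (simp_all add: assms reassoc[OF inv_arrow_simps(4)] reassoc[OF inv_arrow_simps(5)])

lemma isoI:
  assumes "f \<in> Hom x y" "g \<in> Hom y x" "g \<cdot> f = \<I> x" "f \<cdot> g = \<I> y"
  shows "iso K f"
  unfolding iso_def inverse_arrows_def by (rule exI[of _ g]) (use assms in simp)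

lemma inv_arrow_eq:
  assumes "f \<in> Hom x y" "g \<in> Hom y x" "g \<cdot> f = \<I> x" "f \<cdot> g = \<I> y"
  shows "inv_arrow K f = g"
proof (rule inverse_arrows_unique)
  show "inverse_arrows K f (inv_arrow K f)"
    using isoI[OF assms] by (rule inv_arrow_inverse)
  show "inverse_arrows K f g" using assms by (simp add: inverse_arrows_def)
qed

lemma iso_ident [simp]: "x \<in> Ob K \<Longrightarrow> iso K (\<I> x)"
  by (rule isoI[of _ x x "\<I> x"]) auto

lemma inv_ident [simp]: "x \<in> Ob K \<Longrightarrow> inv_arrow K (\<I> x) = \<I> x"
  by (rule inv_arrow_eq) auto

lemma iso_comp [simp]:
  assumes "iso K f" "iso K g" "Cod K f = Dom K g"
  shows "iso K (g \<cdot> f)"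
proof -
  have [simp]: "f \<in> Ar K" "g \<in> Ar K" using assms by auto
  show ?thesis
    by (rule isoI[of _ "Dom K f" "Cod K g" "inv_arrow K f \<cdot> inv_arrow K g"]) (use assms in auto)
qed

lemma iso_inv [simp]: "iso K f \<Longrightarrow> iso K (inv_arrow K f)"
  by (rule isoI[of _ "Cod K f" "Dom K f" f]) auto

lemma comp_cancel_right:
  assumes e: "h \<cdot> q = k \<cdot> q" and s: "q \<cdot> s = \<I> (Cod K q)"
    and t: "h \<in> Ar K" "k \<in> Ar K" "q \<in> Ar K" "s \<in> Ar K"
    "Dom K h = Cod K q" "Dom K k = Cod K q" "Cod K s = Dom K q"
  shows "h = k"
proof -
  have "h = h \<cdot> (q \<cdot> s)" unfolding s using t by simp
  also have "\<dots> = (h \<cdot> q) \<cdot> s" using t by simp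
  also have "\<dots> = k \<cdot> (q \<cdot> s)" unfolding e using t by simp
  also have "\<dots> = k" unfolding s using t by simp
  finally show ?thesis .
qed

lemma iso_cancel_right:
  assumes "iso K q" "h \<cdot> q = k \<cdot> q" "h \<in> Ar K" "k \<in> Ar K" "Dom K h = Cod K q" "Dom K k = Cod K q"
  shows "h = k"
  by (rule comp_cancel_right[OF assms(2), of "inv_arrow K q"]) (use assms(1,3-) in simp_all)

lemma eq_inv_comp:
  assumes "iso K q" "q \<cdot> h = k" "h \<in> Ar K" "Cod K h = Dom K q"
  shows "h = inv_arrow K q \<cdot> k"
  unfolding assms(2)[symmetric] using assms(1,3-) by simp

lemma iso_cancel_left:
  assumes "iso K q" "q \<cdot> h = q \<cdot> k" "h \<in> Ar K" "k \<in> Ar K" "Cod K h = Dom K q" "Cod K k = Dom K q"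
  shows "h = k"
proof -
  have "h = inv_arrow K q \<cdot> (q \<cdot> k)" using eq_inv_comp[OF assms(1,2)] assms(3,5) by simp
  then show ?thesis using assms(1,4,6) by simp
qed

end

context symmetric_monoidal_category
begin

declare Ten_Ob [simp] Unit_Ob [simp] TenA_ident [simp]

lemma TenA_simps [simp]:
  assumes "f \<in> Ar K" "g \<in> Ar K"
  shows "f \<odot> g \<in> Ar K" "Dom K (f \<odot> g) = Dom K f \<otimes> Dom K g" "Cod K (f \<odot> g) = Cod K f \<otimes> Cod K g"
  using TenA_Hom[of f "Dom K f" "Cod K f" g "Dom K g" "Cod K g"] assms by auto

lemma TenA_comp_simp:
  "f \<in> Ar K \<Longrightarrow> f' \<in> Ar K \<Longrightarrow> g \<in> Ar K \<Longrightarrow> g' \<in> Ar K \<Longrightarrow> Cod K f = Dom K f' \<Longrightarrow> Cod K g = Dom K g' \<Longrightarrow>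
   (f' \<odot> g') \<cdot> (f \<odot> g) = (f' \<cdot> f) \<odot> (g' \<cdot> g)"
  using TenA_comp[of f "Dom K f" "Dom K f'" f' "Cod K f'" g "Dom K g" "Dom K g'" g' "Cod K g'"] by auto

lemmas merge = TenA_comp_simp TenA_comp_simp[THEN reassoc]

lemma assoc_simps [simp]:
  assumes "x \<in> Ob K" "y \<in> Ob K" "z \<in> Ob K"
  shows "\<alpha> x y z \<in> Ar K" "Dom K (\<alpha> x y z) = (x \<otimes> y) \<otimes> z" "Cod K (\<alpha> x y z) = x \<otimes> (y \<otimes> z)"
    "iso K (\<alpha> x y z)"
  using assoc_iso[OF assms] by auto

lemma lunit_simps [simp]:
  assumes "x \<in> Ob K"
  shows "\<lambda>\<lambda> x \<in> Ar K" "Dom K (\<lambda>\<lambda> x) = \<one> \<otimes> x" "Cod K (\<lambda>\<lambda> x) = x" "iso K (\<lambda>\<lambda> x)"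
  using lunit_iso[OF assms] by auto

lemma runit_simps [simp]:
  assumes "x \<in> Ob K"
  shows "\<rho>\<rho> x \<in> Ar K" "Dom K (\<rho>\<rho> x) = x \<otimes> \<one>" "Cod K (\<rho>\<rho> x) = x" "iso K (\<rho>\<rho> x)"
  using runit_iso[OF assms] by auto

lemma braid_simps [simp]:
  assumes "x \<in> Ob K" "y \<in> Ob K"
  shows "\<gamma> x y \<in> Ar K" "Dom K (\<gamma> x y) = x \<otimes> y" "Cod K (\<gamma> x y) = y \<otimes> x" "\<gamma> y x \<cdot> \<gamma> x y = \<I> (x \<otimes> y)"
  using braid_Hom[OF assms] braid_braid[OF assms] by auto

lemma braid_iso [simp]: "x \<in> Ob K \<Longrightarrow> y \<in> Ob K \<Longrightarrow> iso K (\<gamma> x y)"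
  by (rule isoI[of _ "x \<otimes> y" "y \<otimes> x" "\<gamma> y x"]) auto

lemma inv_braid [simp]: "x \<in> Ob K \<Longrightarrow> y \<in> Ob K \<Longrightarrow> inv_arrow K (\<gamma> x y) = \<gamma> y x"
  by (rule inv_arrow_eq[of _ "x \<otimes> y" "y \<otimes> x"]) auto

lemma braid_cancel [simp]:
  "x \<in> Ob K \<Longrightarrow> y \<in> Ob K \<Longrightarrow> k \<in> Ar K \<Longrightarrow> Cod K k = x \<otimes> y \<Longrightarrow> \<gamma> y x \<cdot> (\<gamma> x y \<cdot> k) = k"
  using reassoc[of "\<gamma> y x" "\<gamma> x y" "\<I> (x \<otimes> y)" k] by simp

lemma TenA_inverse:
  assumes "iso K f" "iso K g"
  shows "inverse_arrows K (f \<odot> g) (inv_arrow K f \<odot> inv_arrow K g)"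
  using assms by (auto simp: inverse_arrows_def merge)

lemma TenA_iso [simp]: "iso K f \<Longrightarrow> iso K g \<Longrightarrow> iso K (f \<odot> g)"
  unfolding iso_def[of K "f \<odot> g"] by (rule exI, rule TenA_inverse)

lemma inv_TenA [simp]: "iso K f \<Longrightarrow> iso K g \<Longrightarrow> inv_arrow K (f \<odot> g) = inv_arrow K f \<odot> inv_arrow K g"
  by (rule inverse_arrows_unique[OF inv_arrow_inverse TenA_inverse]) auto

lemma assoc_nat:
  "f \<in> Ar K \<Longrightarrow> g \<in> Ar K \<Longrightarrow> h \<in> Ar K \<Longrightarrow> Cod K f = x' \<Longrightarrow> Cod K g = y' \<Longrightarrow> Cod K h = z' \<Longrightarrow>
   \<alpha> x' y' z' \<cdot> ((f \<odot> g) \<odot> h) = (f \<odot> (g \<odot> h)) \<cdot> \<alpha> (Dom K f) (Dom K g) (Dom K h)"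
  using assoc_natural[of f "Dom K f" x' g "Dom K g" y' h "Dom K h" z'] by auto

lemma braid_nat:
  "f \<in> Ar K \<Longrightarrow> g \<in> Ar K \<Longrightarrow> Cod K f = x' \<Longrightarrow> Cod K g = y' \<Longrightarrow>
   \<gamma> x' y' \<cdot> (f \<odot> g) = (g \<odot> f) \<cdot> \<gamma> (Dom K f) (Dom K g)"
  using braid_natural[of f "Dom K f" x' g "Dom K g" y'] by auto

lemma lunit_nat: "f \<in> Ar K \<Longrightarrow> Cod K f = y \<Longrightarrow> \<lambda>\<lambda> y \<cdot> (\<I> \<one> \<odot> f) = f \<cdot> \<lambda>\<lambda> (Dom K f)"
  using lunit_natural[of f "Dom K f" y] by auto

lemma runit_nat: "f \<in> Ar K \<Longrightarrow> Cod K f = y \<Longrightarrow> \<rho>\<rho> y \<cdot> (f \<odot> \<I> \<one>) = f \<cdot> \<rho>\<rho> (Dom K f)"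
  using runit_natural[of f "Dom K f" y] by auto

lemma inv_nat:
  assumes "p \<cdot> f = g \<cdot> q" "iso K p" "iso K q" "f \<in> Hom (Dom K q) (Dom K p)" "g \<in> Hom (Cod K q) (Cod K p)"
  shows "inv_arrow K p \<cdot> g = f \<cdot> inv_arrow K q"
proof -
  have t: "p \<in> Ar K" "q \<in> Ar K" "f \<in> Ar K" "g \<in> Ar K" using assms by auto
  have "inv_arrow K p \<cdot> g = inv_arrow K p \<cdot> ((g \<cdot> q) \<cdot> inv_arrow K q)" using assms(2-) t by simp
  also have "\<dots> = f \<cdot> inv_arrow K q" unfolding assms(1)[symmetric] using assms(2-) t by simp
  finally show ?thesis .
qed

lemma inv_assoc_nat:
  assumes "f \<in> Ar K" "g \<in> Ar K" "h \<in> Ar K" "Cod K f = x'" "Cod K g = y'" "Cod K h = z'"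
  shows "inv_arrow K (\<alpha> x' y' z') \<cdot> (f \<odot> (g \<odot> h)) =
    ((f \<odot> g) \<odot> h) \<cdot> inv_arrow K (\<alpha> (Dom K f) (Dom K g) (Dom K h))"
  by (rule inv_nat[OF assoc_nat]) (use assms in auto)

lemma inv_lunit_nat:
  assumes "f \<in> Ar K" "Cod K f = y"
  shows "inv_arrow K (\<lambda>\<lambda> y) \<cdot> f = (\<I> \<one> \<odot> f) \<cdot> inv_arrow K (\<lambda>\<lambda> (Dom K f))"
  by (rule inv_nat[OF lunit_nat]) (use assms in auto)

text \<open>Naturality of the left unitor conjugates \<open>\<I> \<one> \<odot> f\<close> into
  \<open>f\<close>. Unit coherence laws are proved after tensoring with \<open>\<one>\<close>, where
  the pentagon and the triangle apply.\<close>

lemma unit_left_faithful: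
  assumes "\<I> \<one> \<odot> f = \<I> \<one> \<odot> g" "f \<in> Hom x y" "g \<in> Hom x y"
  shows "f = g"
proof -
  have [simp]: "x \<in> Ob K" "f \<in> Ar K" "Dom K f = x" "Cod K f = y" "g \<in> Ar K" "Dom K g = x" "Cod K g = y"
    using assms(2,3) by auto
  have "f \<cdot> \<lambda>\<lambda> x = \<lambda>\<lambda> y \<cdot> (\<I> \<one> \<odot> f)" using lunit_nat[of f y] by simp
  also have "\<dots> = g \<cdot> \<lambda>\<lambda> x" unfolding assms(1) using lunit_nat[of g y] by simp
  finally show ?thesis by (rule iso_cancel_right[rotated]) simp_all
qed

lemma unit_right_faithful:
  assumes "f \<odot> \<I> \<one> = g \<odot> \<I> \<one>" "f \<in> Hom x y" "g \<in> Hom x y"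
  shows "f = g"
proof -
  have [simp]: "x \<in> Ob K" "f \<in> Ar K" "Dom K f = x" "Cod K f = y" "g \<in> Ar K" "Dom K g = x" "Cod K g = y"
    using assms(2,3) by auto
  have "f \<cdot> \<rho>\<rho> x = \<rho>\<rho> y \<cdot> (f \<odot> \<I> \<one>)" using runit_nat[of f y] by simp
  also have "\<dots> = g \<cdot> \<rho>\<rho> x" unfolding assms(1) using runit_nat[of g y] by simp
  finally show ?thesis by (rule iso_cancel_right[rotated]) simp_all
qed

abbreviation ai :: "'a \<Rightarrow> 'a \<Rightarrow> 'a \<Rightarrow> 'b"
  where "ai x y z \<equiv> inv_arrow K (\<alpha> x y z)"

text \<open>The pentagon solved for the composites that arise when an associator is pushed through
  \<open>ext\<close>, \<open>sw\<close> and \<open>lift\<close>.\<close>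

lemma pent:
  assumes [simp]: "w \<in> Ob K" "x \<in> Ob K" "y \<in> Ob K" "z \<in> Ob K"
  shows pent1: "\<alpha> w (x \<otimes> y) z \<cdot> (\<alpha> w x y \<odot> \<I> z) = (\<I> w \<odot> ai x y z) \<cdot> \<alpha> w x (y \<otimes> z) \<cdot> \<alpha> (w \<otimes> x) y z"
    and pent2: "(ai w x y \<odot> \<I> z) \<cdot> ai w (x \<otimes> y) z \<cdot> (\<I> w \<odot> ai x y z) = ai (w \<otimes> x) y z \<cdot> ai w x (y \<otimes> z)"
    and pent3: "\<alpha> (w \<otimes> x) y z \<cdot> (ai w x y \<odot> \<I> z) \<cdot> ai w (x \<otimes> y) z = ai w x (y \<otimes> z) \<cdot> (\<I> w \<odot> \<alpha> x y z)"
proof -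
  show 1: "\<alpha> w (x \<otimes> y) z \<cdot> (\<alpha> w x y \<odot> \<I> z) = (\<I> w \<odot> ai x y z) \<cdot> \<alpha> w x (y \<otimes> z) \<cdot> \<alpha> (w \<otimes> x) y z"
    unfolding pentagon[OF assms] by (simp add: merge)
  have 2: "\<alpha> w x (y \<otimes> z) \<cdot> \<alpha> (w \<otimes> x) y z \<cdot> (ai w x y \<odot> \<I> z) \<cdot> ai w (x \<otimes> y) z = \<I> w \<odot> \<alpha> x y z"
    using arg_cong[OF pentagon[OF assms], of "\<lambda>t. t \<cdot> (ai w x y \<odot> \<I> z) \<cdot> ai w (x \<otimes> y) z"]
    by (simp add: merge)
  show 3: "\<alpha> (w \<otimes> x) y z \<cdot> (ai w x y \<odot> \<I> z) \<cdot> ai w (x \<otimes> y) z = ai w x (y \<otimes> z) \<cdot> (\<I> w \<odot> \<alpha> x y z)"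
    using arg_cong[OF 2, of "\<lambda>t. ai w x (y \<otimes> z) \<cdot> t"] by simp
  show "(ai w x y \<odot> \<I> z) \<cdot> ai w (x \<otimes> y) z \<cdot> (\<I> w \<odot> ai x y z) = ai (w \<otimes> x) y z \<cdot> ai w x (y \<otimes> z)"
    using arg_cong[OF 3, of "\<lambda>t. ai (w \<otimes> x) y z \<cdot> t \<cdot> (\<I> w \<odot> ai x y z)"] by (simp add: merge)
qed

text \<open>Kelly's argument: after tensoring with \<open>\<one>\<close> both sides are compared
  along the isomorphism \<open>?p\<close>, part of the pentagon on \<open>\<one>\<close>,
  \<open>\<one>\<close>, \<open>x\<close>, \<open>y\<close>; the triangle axiom turns the unitors
  into each other.\<close>

lemma lunit_tensor:
  assumes [simp]: "x \<in> Ob K" "y \<in> Ob K"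
  shows "\<lambda>\<lambda> (x \<otimes> y) \<cdot> \<alpha> \<one> x y = \<lambda>\<lambda> x \<odot> \<I> y"
proof (rule unit_left_faithful)
  let ?p = "\<alpha> \<one> (\<one> \<otimes> x) y \<cdot> (\<alpha> \<one> \<one> x \<odot> \<I> y)"
  have "(\<I> \<one> \<odot> (\<lambda>\<lambda> (x \<otimes> y) \<cdot> \<alpha> \<one> x y)) \<cdot> ?p
      = (\<I> \<one> \<odot> \<lambda>\<lambda> (x \<otimes> y)) \<cdot> \<alpha> \<one> \<one> (x \<otimes> y) \<cdot> \<alpha> (\<one> \<otimes> \<one>) x y"
    by (simp add: pentagon TenA_comp_simp[symmetric, of "\<alpha> \<one> x y" "\<lambda>\<lambda> (x \<otimes> y)" "\<I> \<one>" "\<I> \<one>"]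
       merge)
  also have "\<dots> = (\<rho>\<rho> \<one> \<odot> \<I> (x \<otimes> y)) \<cdot> \<alpha> (\<one> \<otimes> \<one>) x y"
    by (simp add: triangle[THEN reassoc])
  also have "\<dots> = \<alpha> \<one> x y \<cdot> ((\<rho>\<rho> \<one> \<odot> \<I> x) \<odot> \<I> y)"
    by (simp add: assoc_nat)
  also have "\<dots> = \<alpha> \<one> x y \<cdot> ((\<I> \<one> \<odot> \<lambda>\<lambda> x) \<odot> \<I> y) \<cdot> (\<alpha> \<one> \<one> x \<odot> \<I> y)"
    by (simp add: merge triangle)
  also have "\<dots> = (\<I> \<one> \<odot> (\<lambda>\<lambda> x \<odot> \<I> y)) \<cdot> ?p"
    by (simp add: assoc_nat[THEN reassoc])
  finally show "\<I> \<one> \<odot> (\<lambda>\<lambda> (x \<otimes> y) \<cdot> \<alpha> \<one> x y) = \<I> \<one> \<odot> (\<lambda>\<lambda> x \<odot> \<I> y)"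
    by (rule iso_cancel_right[rotated]) simp_all
qed auto

lemma lunit_unit_tensor:
  assumes [simp]: "x \<in> Ob K"
  shows "\<lambda>\<lambda> (\<one> \<otimes> x) = \<I> \<one> \<odot> \<lambda>\<lambda> x"
  by (rule iso_cancel_left[of "\<lambda>\<lambda> x"]) (simp_all add: lunit_nat)

lemma lunit_eq_runit: "\<lambda>\<lambda> \<one> = \<rho>\<rho> \<one>"
  by (rule unit_right_faithful[of _ _ "\<one> \<otimes> \<one>" \<one>])
    (simp_all add: lunit_tensor[symmetric] lunit_unit_tensor triangle[symmetric])

text \<open>The hexagon with two entries \<open>\<one>\<close> evaluates
  \<open>?g \<cdot> (\<rho>\<rho> x \<odot> \<I> \<one>)\<close> to
  \<open>?g \<cdot> (?g \<odot> \<I> \<one>)\<close>; cancel the isomorphism \<open>?g\<close>, then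
  the factor \<open>\<one>\<close>.\<close>

lemma lunit_braid:
  assumes [simp]: "x \<in> Ob K"
  shows "\<lambda>\<lambda> x \<cdot> \<gamma> x \<one> = \<rho>\<rho> x"
proof (rule unit_right_faithful)
  let ?g = "\<lambda>\<lambda> x \<cdot> \<gamma> x \<one>"
  have "?g \<cdot> (\<rho>\<rho> x \<odot> \<I> \<one>) = \<lambda>\<lambda> x \<cdot> (\<rho>\<rho> \<one> \<odot> \<I> x) \<cdot> \<gamma> x (\<one> \<otimes> \<one>) \<cdot> \<alpha> x \<one> \<one>"
    unfolding triangle[OF assms Unit_Ob, symmetric] lunit_eq_runit[symmetric]
    by (simp add: braid_nat[THEN reassoc])
  also have "\<dots> = \<lambda>\<lambda> x \<cdot> (\<I> \<one> \<odot> \<lambda>\<lambda> x) \<cdot> \<alpha> \<one> \<one> x \<cdot> \<gamma> x (\<one> \<otimes> \<one>) \<cdot> \<alpha> x \<one> \<one>"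
    by (simp add: triangle[THEN reassoc])
  also have "\<dots> = \<lambda>\<lambda> x \<cdot> (\<I> \<one> \<odot> ?g) \<cdot> \<alpha> \<one> x \<one> \<cdot> (\<gamma> x \<one> \<odot> \<I> \<one>)"
    by (simp add: hexagon merge)
  also have "\<dots> = ?g \<cdot> \<lambda>\<lambda> (x \<otimes> \<one>) \<cdot> \<alpha> \<one> x \<one> \<cdot> (\<gamma> x \<one> \<odot> \<I> \<one>)"
    by (simp add: lunit_nat[THEN reassoc])
  also have "\<dots> = ?g \<cdot> (?g \<odot> \<I> \<one>)"
    by (simp add: lunit_tensor[THEN reassoc] merge)
  finally show "?g \<odot> \<I> \<one> = \<rho>\<rho> x \<odot> \<I> \<one>"
    by (rule iso_cancel_left[rotated, OF sym]) simp_all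
qed auto

section \<open>Right-nested tensor calculus\<close>

definition ext :: "'a \<Rightarrow> 'a \<Rightarrow> 'b \<Rightarrow> 'a \<Rightarrow> 'b"
  where "ext u v m w = (m \<odot> \<I> w) \<cdot> ai u v w"

definition sw :: "'a \<Rightarrow> 'a \<Rightarrow> 'a \<Rightarrow> 'b"
  where "sw u v w = \<alpha> v u w \<cdot> (\<gamma> u v \<odot> \<I> w) \<cdot> ai u v w"

text \<open>An action of \<open>b\<close> on the second factor of \<open>x \<otimes> y\<close>,
  moved past \<open>x\<close>. It has the same source as \<open>ext\<close>, the action on the first
  factor, so the two can be compared.\<close>

definition lift :: "'a \<Rightarrow> 'a \<Rightarrow> 'b \<Rightarrow> 'a \<Rightarrow> 'b"
  where "lift x b a y = (\<I> x \<odot> a) \<cdot> sw b x y"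

definition uext :: "'b \<Rightarrow> 'a \<Rightarrow> 'b"
  where "uext n w = (n \<odot> \<I> w) \<cdot> inv_arrow K (\<lambda>\<lambda> w)"

lemma ext_simps [simp]:
  assumes "u \<in> Ob K" "v \<in> Ob K" "w \<in> Ob K" "m \<in> Ar K" "Dom K m = u \<otimes> v"
  shows "ext u v m w \<in> Ar K" "Dom K (ext u v m w) = u \<otimes> (v \<otimes> w)" "Cod K (ext u v m w) = Cod K m \<otimes> w"
  using assms by (simp_all add: ext_def)

lemma sw_simps [simp]:
  assumes "u \<in> Ob K" "v \<in> Ob K" "w \<in> Ob K"
  shows "sw u v w \<in> Ar K" "Dom K (sw u v w) = u \<otimes> (v \<otimes> w)" "Cod K (sw u v w) = v \<otimes> (u \<otimes> w)"
    "sw v u w \<cdot> sw u v w = \<I> (u \<otimes> (v \<otimes> w))"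
  using assms by (simp_all add: sw_def merge)

lemma sw_cancel [simp]:
  assumes "u \<in> Ob K" "v \<in> Ob K" "w \<in> Ob K" "k \<in> Ar K" "Cod K k = u \<otimes> (v \<otimes> w)"
  shows "sw v u w \<cdot> (sw u v w \<cdot> k) = k"
  using reassoc[OF sw_simps(4), of u v w k] assms by simp

lemma sw_iso [simp]: "u \<in> Ob K \<Longrightarrow> v \<in> Ob K \<Longrightarrow> w \<in> Ob K \<Longrightarrow> iso K (sw u v w)"
  by (rule isoI[of _ "u \<otimes> (v \<otimes> w)" "v \<otimes> (u \<otimes> w)" "sw v u w"]) auto

lemma lift_simps [simp]:
  assumes "b \<in> Ob K" "x \<in> Ob K" "y \<in> Ob K" "a \<in> Ar K" "Dom K a = b \<otimes> y"
  shows "lift x b a y \<in> Ar K" "Dom K (lift x b a y) = b \<otimes> (x \<otimes> y)" "Cod K (lift x b a y) = x \<otimes> Cod K a"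
  using assms by (simp_all add: lift_def)

lemma uext_simps [simp]:
  assumes "w \<in> Ob K" "n \<in> Ar K" "Dom K n = \<one>"
  shows "uext n w \<in> Ar K" "Dom K (uext n w) = w" "Cod K (uext n w) = Cod K n \<otimes> w"
  using assms by (simp_all add: uext_def)

lemma ext_nat:
  assumes [simp]: "f \<in> Ar K" "g \<in> Ar K" "h \<in> Ar K" "m \<in> Ar K" "Dom K m = Cod K f \<otimes> Cod K g"
    and e: "Cod K f = u" "Cod K g = v" "Cod K h = w"
  shows "ext u v m w \<cdot> (f \<odot> (g \<odot> h)) = (\<I> (Cod K m) \<odot> h) \<cdot> ext (Dom K f) (Dom K g) (m \<cdot> (f \<odot> g)) (Dom K h)"
  unfolding e[symmetric] by (simp add: ext_def inv_assoc_nat merge)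

lemma ext_nat_right:
  assumes "u \<in> Ob K" "v \<in> Ob K" "m \<in> Ar K" "Dom K m = u \<otimes> v" "h \<in> Ar K" "Cod K h = w"
  shows "ext u v m w \<cdot> (\<I> u \<odot> (\<I> v \<odot> h)) = (\<I> (Cod K m) \<odot> h) \<cdot> ext u v m (Dom K h)"
  using ext_nat[of "\<I> u" "\<I> v" h m u v w] assms by simp

lemma ext_comp:
  assumes "u \<in> Ob K" "v \<in> Ob K" "w \<in> Ob K" "m \<in> Ar K" "Dom K m = u \<otimes> v" "g \<in> Ar K" "Dom K g = Cod K m"
  shows "ext u v (g \<cdot> m) w = (g \<odot> \<I> w) \<cdot> ext u v m w"
  using assms by (simp add: ext_def merge)

lemma sw_nat:
  assumes [simp]: "f \<in> Ar K" "g \<in> Ar K" "h \<in> Ar K"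
    and e: "Cod K f = u" "Cod K g = v" "Cod K h = w"
  shows "sw u v w \<cdot> (f \<odot> (g \<odot> h)) = (g \<odot> (f \<odot> h)) \<cdot> sw (Dom K f) (Dom K g) (Dom K h)"
proof -
  have h: "((g \<odot> f) \<cdot> \<gamma> (Dom K f) (Dom K g)) \<odot> h = ((g \<odot> f) \<odot> h) \<cdot> (\<gamma> (Dom K f) (Dom K g) \<odot> \<I> (Dom K h))"
    by (simp add: merge)
  have "sw (Cod K f) (Cod K g) (Cod K h) \<cdot> (f \<odot> (g \<odot> h)) = \<alpha> (Cod K g) (Cod K f) (Cod K h) \<cdot>
      (((g \<odot> f) \<cdot> \<gamma> (Dom K f) (Dom K g)) \<odot> h) \<cdot> ai (Dom K f) (Dom K g) (Dom K h)"
    by (simp add: sw_def inv_assoc_nat TenA_comp_simp[THEN reassoc] braid_nat)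
  then show ?thesis
    unfolding e[symmetric] h by (simp add: sw_def assoc_nat[THEN reassoc])
qed

lemma uext_nat:
  assumes [simp]: "n \<in> Ar K" "Dom K n = \<one>" "h \<in> Ar K"
    and e: "Cod K h = w"
  shows "uext n w \<cdot> h = (\<I> (Cod K n) \<odot> h) \<cdot> uext n (Dom K h)"
  unfolding e[symmetric] by (simp add: uext_def inv_lunit_nat merge)

text \<open>This is the hexagon: moving \<open>x\<close> past \<open>u \<otimes> v\<close> amounts
  to moving it past \<open>u\<close> and then past \<open>v\<close>.\<close>

lemma sw_assoc:
  assumes [simp]: "x \<in> Ob K" "u \<in> Ob K" "v \<in> Ob K" "w \<in> Ob K"
  shows "\<alpha> u v (x \<otimes> w) \<cdot> sw x (u \<otimes> v) w = (\<I> u \<odot> sw x v w) \<cdot> sw x u (v \<otimes> w) \<cdot> (\<I> x \<odot> \<alpha> u v w)"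
proof -
  have hx: "\<alpha> u v x \<cdot> \<gamma> x (u \<otimes> v) = (\<I> u \<odot> \<gamma> x v) \<cdot> \<alpha> u x v \<cdot> (\<gamma> x u \<odot> \<I> v) \<cdot> ai x u v"
    using arg_cong[OF hexagon[of x u v], of "\<lambda>t. t \<cdot> ai x u v"] by simp
  have "\<alpha> u v (x \<otimes> w) \<cdot> sw x (u \<otimes> v) w
    = (\<I> u \<odot> \<alpha> v x w) \<cdot> \<alpha> u (v \<otimes> x) w \<cdot> ((\<alpha> u v x \<cdot> \<gamma> x (u \<otimes> v)) \<odot> \<I> w) \<cdot> ai x (u \<otimes> v) w"
    by (simp add: sw_def pentagon[THEN reassoc] merge)
  also have "\<dots> = (\<I> u \<odot> \<alpha> v x w) \<cdot> \<alpha> u (v \<otimes> x) w \<cdot> ((\<I> u \<odot> \<gamma> x v) \<odot> \<I> w) \<cdot> (\<alpha> u x v \<odot> \<I> w) \<cdot>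
      ((\<gamma> x u \<odot> \<I> v) \<odot> \<I> w) \<cdot> (ai x u v \<odot> \<I> w) \<cdot> ai x (u \<otimes> v) w"
    unfolding hx by (simp add: merge)
  also have "\<dots> = (\<I> u \<odot> \<alpha> v x w) \<cdot> (\<I> u \<odot> (\<gamma> x v \<odot> \<I> w)) \<cdot> (\<alpha> u (x \<otimes> v) w \<cdot> (\<alpha> u x v \<odot> \<I> w)) \<cdot>
      ((\<gamma> x u \<odot> \<I> v) \<odot> \<I> w) \<cdot> (ai x u v \<odot> \<I> w) \<cdot> ai x (u \<otimes> v) w"
    by (simp add: assoc_nat[THEN reassoc])
  also have "\<dots> = (\<I> u \<odot> sw x v w) \<cdot> \<alpha> u x (v \<otimes> w) \<cdot> (\<alpha> (u \<otimes> x) v w \<cdot>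
      ((\<gamma> x u \<odot> \<I> v) \<odot> \<I> w)) \<cdot> (ai x u v \<odot> \<I> w) \<cdot> ai x (u \<otimes> v) w"
    unfolding pent1[of u x v w, simplified] by (simp add: sw_def merge)
  also have "\<dots> = (\<I> u \<odot> sw x v w) \<cdot> \<alpha> u x (v \<otimes> w) \<cdot> (\<gamma> x u \<odot> \<I> (v \<otimes> w)) \<cdot> (\<alpha> (x \<otimes> u) v w \<cdot> 
      (ai x u v \<odot> \<I> w) \<cdot> ai x (u \<otimes> v) w)"
    by (simp add: assoc_nat)
  also have "\<dots> = (\<I> u \<odot> sw x v w) \<cdot> sw x u (v \<otimes> w) \<cdot> (\<I> x \<odot> \<alpha> u v w)"
    by (simp add: pent3) (simp add: sw_def)
  finally show ?thesis .
qed

text \<open>Laws of a strict calculus on right-nested tensor products: an operation \<open>ext u v m\<close> on the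
  first two factors, an element \<open>uext n\<close> in front, and the exchange \<open>sw\<close> of the first two factors.\<close>

lemma sw_ext:
  assumes [simp]: "x \<in> Ob K" "u \<in> Ob K" "v \<in> Ob K" "w \<in> Ob K" "m \<in> Ar K" "Dom K m = u \<otimes> v"
    and t: "Cod K m = t"
  shows "sw x t w \<cdot> (\<I> x \<odot> ext u v m w) = ext u v m (x \<otimes> w) \<cdot> (\<I> u \<odot> sw x v w) \<cdot> sw x u (v \<otimes> w)"
proof -
  have [simp]: "t \<in> Ob K" using t by auto
  have 1: "\<I> x \<odot> ext u v m w = (\<I> x \<odot> (m \<odot> \<I> w)) \<cdot> (\<I> x \<odot> ai u v w)"
    by (simp add: ext_def merge)
  have 2: "sw x (u \<otimes> v) w \<cdot> (\<I> x \<odot> ai u v w) = ai u v (x \<otimes> w) \<cdot> (\<I> u \<odot> sw x v w) \<cdot> sw x u (v \<otimes> w)"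
    using arg_cong[OF sw_assoc[of x u v w], of "\<lambda>t. ai u v (x \<otimes> w) \<cdot> t \<cdot> (\<I> x \<odot> ai u v w)"]
    by (simp add: merge)
  show ?thesis
    unfolding 1 t[symmetric] by (simp add: sw_nat[THEN reassoc] 2) (simp add: ext_def)
qed

lemma ext_sw:
  assumes [simp]: "x \<in> Ob K" "u \<in> Ob K" "v \<in> Ob K" "w \<in> Ob K" "m \<in> Ar K" "Dom K m = u \<otimes> v"
    and t: "Cod K m = t"
  shows "sw t x w \<cdot> ext u v m (x \<otimes> w) = (\<I> x \<odot> ext u v m w) \<cdot> sw u x (v \<otimes> w) \<cdot> (\<I> u \<odot> sw v x w)"
proof -
  have [simp]: "t \<in> Ob K" using t by auto
  have "sw t x w \<cdot> (sw x t w \<cdot> (\<I> x \<odot> ext u v m w)) \<cdot> sw u x (v \<otimes> w) \<cdot> (\<I> u \<odot> sw v x w)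
      = sw t x w \<cdot> ext u v m (x \<otimes> w)"
    unfolding sw_ext[OF assms] by (simp add: t merge)
  then show ?thesis by (simp add: t)
qed

lemma sw_uext:
  assumes [simp]: "x \<in> Ob K" "w \<in> Ob K" "n \<in> Ar K" "Dom K n = \<one>" and t: "Cod K n = t"
  shows "sw x t w \<cdot> (\<I> x \<odot> uext n w) = uext n (x \<otimes> w)"
proof -
  have 1: "\<I> x \<odot> uext n w = (\<I> x \<odot> (n \<odot> \<I> w)) \<cdot> (\<I> x \<odot> inv_arrow K (\<lambda>\<lambda> w))"
    by (simp add: uext_def merge)
  have tr: "ai x \<one> w \<cdot> (\<I> x \<odot> inv_arrow K (\<lambda>\<lambda> w)) = inv_arrow K (\<rho>\<rho> x) \<odot> \<I> w"
    by (rule sym, rule iso_cancel_left[of "(\<I> x \<odot> \<lambda>\<lambda> w) \<cdot> \<alpha> x \<one> w"]) (simp_all add: merge triangle[THEN reassoc])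
  have lb: "\<gamma> x \<one> \<cdot> inv_arrow K (\<rho>\<rho> x) = inv_arrow K (\<lambda>\<lambda> x)"
    by (rule iso_cancel_left[of "\<lambda>\<lambda> x"]) (simp_all add: lunit_braid[THEN reassoc])
  have lt: "\<alpha> \<one> x w \<cdot> (inv_arrow K (\<lambda>\<lambda> x) \<odot> \<I> w) = inv_arrow K (\<lambda>\<lambda> (x \<otimes> w))"
    by (rule iso_cancel_left[of "\<lambda>\<lambda> (x \<otimes> w)"]) (simp_all add: lunit_tensor[THEN reassoc] merge)
  have 2: "sw x \<one> w \<cdot> (\<I> x \<odot> inv_arrow K (\<lambda>\<lambda> w)) = inv_arrow K (\<lambda>\<lambda> (x \<otimes> w))"
    by (simp add: sw_def tr merge lb lt)
  show ?thesis
    unfolding 1 t[symmetric] by (simp add: sw_nat[THEN reassoc] 2) (simp add: uext_def)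
qed

lemma uext_sw:
  assumes [simp]: "x \<in> Ob K" "w \<in> Ob K" "n \<in> Ar K" "Dom K n = \<one>" and t: "Cod K n = t"
  shows "sw t x w \<cdot> uext n (x \<otimes> w) = \<I> x \<odot> uext n w"
proof -
  have [simp]: "t \<in> Ob K" using t by auto
  show ?thesis
    unfolding sw_uext[OF assms, symmetric] by (simp add: t)
qed

lemma ext_uext:
  assumes [simp]: "x \<in> Ob K" "w \<in> Ob K" "n \<in> Ar K" "Dom K n = \<one>" and t: "Cod K n = t"
    and [simp]: "m \<in> Ar K" "Dom K m = t \<otimes> x"
  shows "ext t x m w \<cdot> uext n (x \<otimes> w) = (m \<cdot> uext n x) \<odot> \<I> w"
proof -
  have [simp]: "t \<in> Ob K" using t by auto
  have "inv_arrow K (\<lambda>\<lambda> (x \<otimes> w)) = \<alpha> \<one> x w \<cdot> (inv_arrow K (\<lambda>\<lambda> x) \<odot> \<I> w)"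
    by (rule iso_cancel_left[of "\<lambda>\<lambda> (x \<otimes> w)"]) (simp_all add: lunit_tensor[THEN reassoc] merge)
  moreover have h: "ai t x w \<cdot> (n \<odot> \<I> (x \<otimes> w)) = ((n \<odot> \<I> x) \<odot> \<I> w) \<cdot> ai \<one> x w"
    using inv_assoc_nat[of n "\<I> x" "\<I> w" t x w] t by simp
  note h[THEN reassoc, simp]
  ultimately show ?thesis
    by (simp add: ext_def uext_def t merge)
qed

text \<open>This lemma and the next two make the associator linear for an action on the first, the
  middle and the last factor of a triple product. They carry the associativity of relative tensor
  products.\<close>

lemma assoc_ext:
  assumes [simp]: "b \<in> Ob K" "x \<in> Ob K" "y \<in> Ob K" "z \<in> Ob K" "m \<in> Ar K" "Dom K m = b \<otimes> x" and t: "Cod K m = t"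
  shows "\<alpha> t y z \<cdot> ext b (x \<otimes> y) (ext b x m y) z = ext b x m (y \<otimes> z) \<cdot> (\<I> b \<odot> \<alpha> x y z)"
proof -
  have [simp]: "t \<in> Ob K" using t by auto
  have "ext b x m y \<odot> \<I> z = ((m \<odot> \<I> y) \<odot> \<I> z) \<cdot> (ai b x y \<odot> \<I> z)"
    by (simp add: ext_def merge)
  then have "\<alpha> t y z \<cdot> ext b (x \<otimes> y) (ext b x m y) z =
    (m \<odot> \<I> (y \<otimes> z)) \<cdot> (\<alpha> (b \<otimes> x) y z \<cdot> (ai b x y \<odot> \<I> z) \<cdot> ai b (x \<otimes> y) z)"
    unfolding ext_def[of b "x \<otimes> y"] by (simp add: assoc_nat[THEN reassoc] t)
  then show ?thesis by (simp add: pent3) (simp add: ext_def)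
qed

lemma assoc_ext_lift:
  assumes [simp]: "b \<in> Ob K" "x \<in> Ob K" "y \<in> Ob K" "z \<in> Ob K" "m \<in> Ar K" "Dom K m = b \<otimes> y" and t: "Cod K m = t"
  shows "\<alpha> x t z \<cdot> ext b (x \<otimes> y) (lift x b m y) z = lift x b (ext b y m z) (y \<otimes> z) \<cdot> (\<I> b \<odot> \<alpha> x y z)"
proof -
  have [simp]: "t \<in> Ob K" using t by auto
  have xm: "\<I> x \<odot> ext b y m z = (\<I> x \<odot> (m \<odot> \<I> z)) \<cdot> (\<I> x \<odot> ai b y z)"
    by (simp add: ext_def merge)
  have "lift x b m y \<odot> \<I> z = ((\<I> x \<odot> m) \<odot> \<I> z) \<cdot> (\<alpha> x b y \<odot> \<I> z) \<cdot> ((\<gamma> b x \<odot> \<I> y) \<odot> \<I> z) \<cdot> (ai b x y \<odot> \<I> z)"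
    by (simp add: lift_def sw_def merge)
  then have "\<alpha> x t z \<cdot> ext b (x \<otimes> y) (lift x b m y) z = 
     (\<I> x \<odot> (m \<odot> \<I> z)) \<cdot> (\<alpha> x (b \<otimes> y) z \<cdot> (\<alpha> x b y \<odot> \<I> z)) \<cdot> ((\<gamma> b x \<odot> \<I> y) \<odot> \<I> z) \<cdot> (ai b x y \<odot> \<I> z) \<cdot> ai b (x \<otimes> y) z"
    unfolding ext_def[of b "x \<otimes> y"] by (simp add: assoc_nat[THEN reassoc] t)
  also have "\<dots> = (\<I> x \<odot> ext b y m z) \<cdot> \<alpha> x b (y \<otimes> z) \<cdot> (\<gamma> b x \<odot> \<I> (y \<otimes> z)) \<cdot>
      (\<alpha> (b \<otimes> x) y z \<cdot> (ai b x y \<odot> \<I> z) \<cdot> ai b (x \<otimes> y) z)"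
    unfolding pent1[of x b y z, simplified] xm by (simp add: assoc_nat[THEN reassoc])
  also have "\<dots> = lift x b (ext b y m z) (y \<otimes> z) \<cdot> (\<I> b \<odot> \<alpha> x y z)"
    by (simp add: pent3) (simp add: lift_def sw_def)
  finally show ?thesis .
qed

lemma assoc_lift:
  assumes [simp]: "b \<in> Ob K" "x \<in> Ob K" "y \<in> Ob K" "z \<in> Ob K" "m \<in> Ar K" "Dom K m = b \<otimes> z" and t: "Cod K m = t"
  shows "\<alpha> x y t \<cdot> lift (x \<otimes> y) b m z = lift x b (lift y b m z) (y \<otimes> z) \<cdot> (\<I> b \<odot> \<alpha> x y z)"
proof -
  have [simp]: "t \<in> Ob K" using t by auto
  have h: "\<alpha> x y t \<cdot> (\<I> (x \<otimes> y) \<odot> m) = (\<I> x \<odot> (\<I> y \<odot> m)) \<cdot> \<alpha> x y (b \<otimes> z)"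
    using assoc_nat[of "\<I> x" "\<I> y" m x y t] t by simp
  show ?thesis
    by (simp add: lift_def t h[THEN reassoc] sw_assoc merge)
qed

text \<open>The symmetry exchanges an action on the first factor with one on the second, hence the
  roles of \<open>ext\<close> and \<open>lift\<close>.\<close>

lemma braid_ext:
  assumes [simp]: "b \<in> Ob K" "x \<in> Ob K" "y \<in> Ob K" "m \<in> Ar K" "Dom K m = b \<otimes> x" and t: "Cod K m = t"
  shows "\<gamma> t y \<cdot> ext b x m y = lift y b m x \<cdot> (\<I> b \<odot> \<gamma> x y)"
proof -
  have [simp]: "t \<in> Ob K" using t by auto
  have h: "\<gamma> y (b \<otimes> x) \<cdot> \<alpha> y b x = ai b x y \<cdot> (\<I> b \<odot> \<gamma> y x) \<cdot> \<alpha> b y x \<cdot> (\<gamma> y b \<odot> \<I> x)"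
    by (rule eq_inv_comp) (simp_all add: hexagon)
  have "\<gamma> (b \<otimes> x) y \<cdot> ai b x y = \<gamma> (b \<otimes> x) y \<cdot>
     (ai b x y \<cdot> (\<I> b \<odot> \<gamma> y x) \<cdot> \<alpha> b y x \<cdot> (\<gamma> y b \<odot> \<I> x)) \<cdot> (\<gamma> b y \<odot> \<I> x) \<cdot> ai b y x \<cdot> (\<I> b \<odot> \<gamma> x y)"
    by (simp add: merge)
  also have "\<dots> = \<alpha> y b x \<cdot> (\<gamma> b y \<odot> \<I> x) \<cdot> ai b y x \<cdot> (\<I> b \<odot> \<gamma> x y)"
    unfolding h[symmetric] by simp
  finally have "\<gamma> (b \<otimes> x) y \<cdot> ai b x y = \<alpha> y b x \<cdot> (\<gamma> b y \<odot> \<I> x) \<cdot> ai b y x \<cdot> (\<I> b \<odot> \<gamma> x y)" .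
  then show ?thesis
    by (simp add: ext_def lift_def sw_def braid_nat[THEN reassoc] t)
qed

lemma braid_lift:
  assumes [simp]: "b \<in> Ob K" "x \<in> Ob K" "y \<in> Ob K" "m \<in> Ar K" "Dom K m = b \<otimes> y" and t: "Cod K m = t"
  shows "\<gamma> x t \<cdot> lift x b m y = ext b y m x \<cdot> (\<I> b \<odot> \<gamma> x y)"
proof -
  have [simp]: "t \<in> Ob K" using t by auto
  have "\<gamma> x t \<cdot> lift x b m y = (\<gamma> x t \<cdot> lift x b m y \<cdot> (\<I> b \<odot> \<gamma> y x)) \<cdot> (\<I> b \<odot> \<gamma> x y)"
    using t by (auto simp add: merge)
  also have "lift x b m y \<cdot> (\<I> b \<odot> \<gamma> y x) = \<gamma> t x \<cdot> ext b y m x"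
    by (rule braid_ext[symmetric]) (use t in auto)
  finally show ?thesis using t by auto
qed

text \<open>The arrows coequalized by \<open>tensor_quot\<close> start at
  \<open>(x \<otimes> b) \<otimes> y\<close>. Bringing \<open>b\<close> to the front by an
  isomorphism turns them into \<open>ext\<close> and, in the next lemma,
  \<open>lift\<close>.\<close>

lemma ext_assoc_braid:
  assumes [simp]: "b \<in> Ob K" "x \<in> Ob K" "y \<in> Ob K" "m \<in> Ar K" "Dom K m = b \<otimes> x"
  shows "ext b x m y \<cdot> \<alpha> b x y \<cdot> (\<gamma> x b \<odot> \<I> y) = (m \<cdot> \<gamma> x b) \<odot> \<I> y"
  by (simp add: ext_def merge)

lemma lift_assoc_braid:
  assumes [simp]: "b \<in> Ob K" "x \<in> Ob K" "y \<in> Ob K" "m \<in> Ar K" "Dom K m = b \<otimes> y"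
  shows "lift x b m y \<cdot> \<alpha> b x y \<cdot> (\<gamma> x b \<odot> \<I> y) = (\<I> x \<odot> m) \<cdot> \<alpha> x b y"
  by (simp add: lift_def sw_def merge)

lemma lift_nat:
  assumes [simp]: "b \<in> Ob K" "f \<in> Ar K" "g \<in> Ar K" "m \<in> Ar K" "Dom K m = b \<otimes> Cod K g"
    and e: "Cod K f = x" "Cod K g = y"
  shows "lift x b m y \<cdot> (\<I> b \<odot> (f \<odot> g)) = (f \<odot> (m \<cdot> (\<I> b \<odot> g))) \<cdot> sw b (Dom K f) (Dom K g)"
  unfolding e[symmetric] by (simp add: lift_def sw_nat merge)

lemma ext_ext:
  assumes [simp]: "u \<in> Ob K" "v \<in> Ob K" "x \<in> Ob K" "y \<in> Ob K" "m \<in> Ar K" "Dom K m = u \<otimes> v"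
    "r \<in> Ar K" "Dom K r = t \<otimes> x" and t: "Cod K m = t"
  shows "ext t x r y \<cdot> ext u v m (x \<otimes> y) = ext u (v \<otimes> x) (r \<cdot> ext u v m x) y \<cdot> (\<I> u \<odot> ai v x y)"
proof -
  have [simp]: "t \<in> Ob K" using t by auto
  have h: "ai t x y \<cdot> (m \<odot> \<I> (x \<otimes> y)) = ((m \<odot> \<I> x) \<odot> \<I> y) \<cdot> ai (u \<otimes> v) x y"
    using inv_assoc_nat[of m "\<I> x" "\<I> y" t x y] t by simp
  have "ext t x r y \<cdot> ext u v m (x \<otimes> y) = (r \<odot> \<I> y) \<cdot> ((m \<odot> \<I> x) \<odot> \<I> y) \<cdot> ai (u \<otimes> v) x y \<cdot> ai u v (x \<otimes> y)"
    by (simp add: ext_def t h[THEN reassoc])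
  also have "\<dots> = ext u (v \<otimes> x) (r \<cdot> ext u v m x) y \<cdot> (\<I> u \<odot> ai v x y)"
    unfolding pent2[OF assms(1-4), symmetric] by (simp add: ext_def t merge)
  finally show ?thesis .
qed

lemma ext_TenA_ext:
  assumes [simp]: "u \<in> Ob K" "v \<in> Ob K" "x \<in> Ob K" "y \<in> Ob K" "m \<in> Ar K" "Dom K m = v \<otimes> x"
    "r \<in> Ar K" "Dom K r = u \<otimes> t" and t: "Cod K m = t"
  shows "ext u t r y \<cdot> (\<I> u \<odot> ext v x m y) = ext u (v \<otimes> x) (r \<cdot> (\<I> u \<odot> m)) y \<cdot> (\<I> u \<odot> ai v x y)"
proof -
  have [simp]: "t \<in> Ob K" using t by auto
  have h: "ai u t y \<cdot> (\<I> u \<odot> (m \<odot> \<I> y)) = ((\<I> u \<odot> m) \<odot> \<I> y) \<cdot> ai u (v \<otimes> x) y"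
    using inv_assoc_nat[of "\<I> u" m "\<I> y" u t y] t by simp
  have e: "\<I> u \<odot> ext v x m y = (\<I> u \<odot> (m \<odot> \<I> y)) \<cdot> (\<I> u \<odot> ai v x y)"
    by (simp add: ext_def merge t)
  show ?thesis
    unfolding e by (simp add: ext_def t h[THEN reassoc] TenA_comp_simp[THEN reassoc])
qed

lemma ext_TenA:
  assumes [simp]: "b \<in> Ob K" "x \<in> Ob K" "y \<in> Ob K" "f \<in> Ar K" "Dom K f = b" "r \<in> Ar K" "Dom K r = c \<otimes> x"
    and c: "Cod K f = c"
  shows "ext b x (r \<cdot> (f \<odot> \<I> x)) y = ext c x r y \<cdot> (f \<odot> \<I> (x \<otimes> y))"
proof -
  have [simp]: "c \<in> Ob K" using c by auto
  show ?thesis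
    using ext_nat[of f "\<I> x" "\<I> y" r c x y] c by simp
qed

lemma lift_TenA:
  assumes [simp]: "b \<in> Ob K" "x \<in> Ob K" "y \<in> Ob K" "f \<in> Ar K" "Dom K f = b" "r \<in> Ar K" "Dom K r = c \<otimes> y"
    and c: "Cod K f = c"
  shows "lift x b (r \<cdot> (f \<odot> \<I> y)) y = lift x c r y \<cdot> (f \<odot> \<I> (x \<otimes> y))"
proof -
  have [simp]: "c \<in> Ob K" using c by auto
  show ?thesis
    using sw_nat[of f "\<I> x" "\<I> y" c x y] c by (simp add: lift_def merge)
qed

lemma ext_braid:
  assumes [simp]: "b \<in> Ob K" "c \<in> Ob K" "z \<in> Ob K" "m \<in> Ar K" "Dom K m = c \<otimes> b"
  shows "ext b c (m \<cdot> \<gamma> b c) z = ext c b m z \<cdot> sw b c z"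
  by (simp add: ext_def sw_def merge)

definition action :: "('a, 'b) ring_object \<Rightarrow> 'a \<Rightarrow> 'b \<Rightarrow> bool" where
  "action B x r \<longleftrightarrow> x \<in> Ob K \<and> r \<in> Hom (robj B \<otimes> x) x \<and>
     r \<cdot> ext (robj B) (robj B) (mult B) x = r \<cdot> (\<I> (robj B) \<odot> r) \<and> r \<cdot> uext (unit B) x = \<I> x"

lemma actionD:
  assumes "action B x r"
  shows "x \<in> Ob K" "r \<in> Ar K" "Dom K r = robj B \<otimes> x" "Cod K r = x"
    "r \<cdot> ext (robj B) (robj B) (mult B) x = r \<cdot> (\<I> (robj B) \<odot> r)" "r \<cdot> uext (unit B) x = \<I> x"
  using assms by (simp_all add: action_def)

section \<open>Commutative separable rings and their modules\<close>

lemma tt_ringD: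
  assumes "tt_ring K B"
  shows "robj B \<in> Ob K" "mult B \<in> Ar K" "Dom K (mult B) = robj B \<otimes> robj B" "Cod K (mult B) = robj B"
    "unit B \<in> Ar K" "Dom K (unit B) = \<one>" "Cod K (unit B) = robj B"
  using assms by (simp_all add: tt_ring_def is_ring_def)

lemma tt_ring_eqs:
  assumes "tt_ring K B"
  shows "mult B \<cdot> \<gamma> (robj B) (robj B) = mult B"
    "mult B \<cdot> uext (unit B) (robj B) = \<I> (robj B)"
    "mult B \<cdot> ext (robj B) (robj B) (mult B) (robj B) = mult B \<cdot> (\<I> (robj B) \<odot> mult B)"
proof -
  note [simp] = tt_ringD[OF assms]
  show "mult B \<cdot> \<gamma> (robj B) (robj B) = mult B" using assms by (simp add: tt_ring_def)
  have 1: "mult B \<cdot> (unit B \<odot> \<I> (robj B)) = \<lambda>\<lambda> (robj B)" 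
   and 2: "mult B \<cdot> (mult B \<odot> \<I> (robj B)) = mult B \<cdot> (\<I> (robj B) \<odot> mult B) \<cdot> \<alpha> (robj B) (robj B) (robj B)"
    using assms by (simp_all add: tt_ring_def is_ring_def)
  show "mult B \<cdot> uext (unit B) (robj B) = \<I> (robj B)"
    by (simp add: uext_def 1[THEN reassoc])
  show "mult B \<cdot> ext (robj B) (robj B) (mult B) (robj B) = mult B \<cdot> (\<I> (robj B) \<odot> mult B)"
    by (simp add: ext_def 2[THEN reassoc])
qed

lemma modules_iff:
  assumes "tt_ring K B"
  shows "M \<in> modules K B \<longleftrightarrow> action B (fst M) (snd M)"
proof -
  note [simp] = tt_ringD[OF assms]
  let ?b = "robj B" let ?x = "fst M" let ?r = "snd M"
  have "?r \<cdot> (mult B \<odot> \<I> ?x) = ?r \<cdot> (\<I> ?b \<odot> ?r) \<cdot> \<alpha> ?b ?b ?x \<longleftrightarrow>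
      ?r \<cdot> ext ?b ?b (mult B) ?x = ?r \<cdot> (\<I> ?b \<odot> ?r)" (is "?l = ?r'")
    if [simp]: "?x \<in> Ob K" "?r \<in> Ar K" "Dom K ?r = ?b \<otimes> ?x" "Cod K ?r = ?x"
  proof
    assume h: ?l
    show ?r' by (simp add: ext_def h[THEN reassoc])
  next
    assume h: ?r'
    have "?r \<cdot> (mult B \<odot> \<I> ?x) = (?r \<cdot> ext ?b ?b (mult B) ?x) \<cdot> \<alpha> ?b ?b ?x"
      by (simp add: ext_def)
    then show ?l unfolding h by simp
  qed
  moreover have "?r \<cdot> (unit B \<odot> \<I> ?x) = \<lambda>\<lambda> ?x \<longleftrightarrow> ?r \<cdot> uext (unit B) ?x = \<I> ?x" (is "?l = ?r'")
    if [simp]: "?x \<in> Ob K" "?r \<in> Ar K" "Dom K ?r = ?b \<otimes> ?x" "Cod K ?r = ?x"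
  proof
    assume h: ?l
    show ?r' by (simp add: uext_def h[THEN reassoc])
  next
    assume h: ?r'
    have "?r \<cdot> (unit B \<odot> \<I> ?x) = (?r \<cdot> uext (unit B) ?x) \<cdot> \<lambda>\<lambda> ?x"
      by (simp add: uext_def)
    then show ?l unfolding h by simp
  qed
  ultimately show ?thesis
    by (cases M) (auto simp: modules_def action_def)
qed

lemma modulesD:
  assumes "tt_ring K B" "M \<in> modules K B"
  shows "fst M \<in> Ob K" "snd M \<in> Ar K" "Dom K (snd M) = robj B \<otimes> fst M" "Cod K (snd M) = fst M"
    "snd M \<cdot> ext (robj B) (robj B) (mult B) (fst M) = snd M \<cdot> (\<I> (robj B) \<odot> snd M)"
    "snd M \<cdot> uext (unit B) (fst M) = \<I> (fst M)"
  using assms(2) unfolding modules_iff[OF assms(1)] by (fact actionD)+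

lemma action_self: "tt_ring K B \<Longrightarrow> action B (robj B) (mult B)"
  by (simp add: action_def tt_ringD tt_ring_eqs)

lemma action_ext:
  assumes B: "tt_ring K B" and a: "action B x r" and [simp]: "y \<in> Ob K"
  shows "action B (x \<otimes> y) (ext (robj B) x r y)"
proof -
  note [simp] = tt_ringD[OF B] actionD[OF a]
  show ?thesis by (simp add: action_def ext_ext ext_TenA_ext ext_uext)
qed

lemma action_lift:
  assumes B: "tt_ring K B" and a: "action B y r" and [simp]: "x \<in> Ob K"
  shows "action B (x \<otimes> y) (lift x (robj B) r y)"
proof -
  note [simp] = tt_ringD[OF B] actionD(1-4)[OF a]
  let ?b = "robj B"
  have "lift x ?b r y \<cdot> ext ?b ?b (mult B) (x \<otimes> y) = (\<I> x \<odot> (r \<cdot> ext ?b ?b (mult B) y)) \<cdot> sw ?b x (?b \<otimes> y) \<cdot> (\<I> ?b \<odot> sw ?b x y)"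
    by (simp add: lift_def ext_sw merge)
  also have "\<dots> = (\<I> x \<odot> r) \<cdot> (\<I> x \<odot> (\<I> ?b \<odot> r)) \<cdot> sw ?b x (?b \<otimes> y) \<cdot> (\<I> ?b \<odot> sw ?b x y)"
    unfolding actionD(5)[OF a] by (simp add: merge)
  also have "\<dots> = lift x ?b r y \<cdot> (\<I> ?b \<odot> (\<I> x \<odot> r)) \<cdot> (\<I> ?b \<odot> sw ?b x y)"
    by (simp add: lift_def sw_nat[THEN reassoc])
  also have "\<dots> = lift x ?b r y \<cdot> (\<I> ?b \<odot> lift x ?b r y)"
    by (simp add: lift_def merge)
  finally have 1: "lift x ?b r y \<cdot> ext ?b ?b (mult B) (x \<otimes> y) = lift x ?b r y \<cdot> (\<I> ?b \<odot> lift x ?b r y)" .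
  have 2: "lift x ?b r y \<cdot> uext (unit B) (x \<otimes> y) = \<I> (x \<otimes> y)"
    by (simp add: lift_def uext_sw merge actionD(6)[OF a])
  show ?thesis by (simp add: action_def 1 2)
qed

definition commute :: "'a \<Rightarrow> 'a \<Rightarrow> 'a \<Rightarrow> 'b \<Rightarrow> 'b \<Rightarrow> bool" where
  "commute b c z a a' \<longleftrightarrow> a \<cdot> (\<I> b \<odot> a') = a' \<cdot> (\<I> c \<odot> a) \<cdot> sw b c z"

lemma commute_sym:
  assumes h: "commute b c z a a'" and [simp]: "b \<in> Ob K" "c \<in> Ob K" "z \<in> Ob K" "a \<in> Ar K" "Dom K a = b \<otimes> z"
    "Cod K a = z" "a' \<in> Ar K" "Dom K a' = c \<otimes> z" "Cod K a' = z"
  shows "commute c b z a' a"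
proof -
  have "a \<cdot> (\<I> b \<odot> a') \<cdot> sw c b z = (a \<cdot> (\<I> b \<odot> a')) \<cdot> sw c b z" by simp
  also have "\<dots> = a' \<cdot> (\<I> c \<odot> a)"
    unfolding h[unfolded commute_def] by simp
  finally show ?thesis by (simp add: commute_def)
qed

lemma commute_ext_lift:
  assumes [simp]: "b \<in> Ob K" "c \<in> Ob K" "x \<in> Ob K" "y \<in> Ob K" "r \<in> Ar K" "Dom K r = b \<otimes> x" "Cod K r = x"
    "k \<in> Ar K" "Dom K k = c \<otimes> y" "Cod K k = y"
  shows "commute b c (x \<otimes> y) (ext b x r y) (lift x c k y)"
proof -
  have 1: "\<I> b \<odot> lift x c k y = (\<I> b \<odot> (\<I> x \<odot> k)) \<cdot> (\<I> b \<odot> sw c x y)"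
    by (simp add: lift_def merge)
  show ?thesis
    unfolding commute_def 1 by (simp add: lift_def sw_ext[THEN reassoc] ext_nat_right[THEN reassoc])
qed

text \<open>Commutativity of \<open>B\<close> enters here: the multiplication absorbs the exchange
  of its two factors, and associativity of the action transfers this to \<open>a\<close>.\<close>

lemma commute_self:
  assumes B: "tt_ring K B" and a: "action B z a"
  shows "commute (robj B) (robj B) z a a"
proof -
  note [simp] = tt_ringD[OF B] actionD(1-4)[OF a]
  let ?b = "robj B"
  have "a \<cdot> ext ?b ?b (mult B) z = (a \<cdot> ext ?b ?b (mult B) z) \<cdot> sw ?b ?b z"
    using ext_braid[of ?b ?b z "mult B"] tt_ring_eqs(1)[OF B] by simp
  then show ?thesis unfolding actionD(5)[OF a] by (simp add: commute_def)
qed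

lemma commute_restrict:
  assumes h: "commute b c z a a'" and [simp]: "b' \<in> Ob K" "b \<in> Ob K" "c \<in> Ob K" "z \<in> Ob K"
    "a \<in> Ar K" "Dom K a = b \<otimes> z" "Cod K a = z" "a' \<in> Ar K" "Dom K a' = c \<otimes> z" "Cod K a' = z"
    "f \<in> Ar K" "Dom K f = b'" "Cod K f = b"
  shows "commute b' c z (a \<cdot> (f \<odot> \<I> z)) a'"
proof -
  have "a \<cdot> (f \<odot> \<I> z) \<cdot> (\<I> b' \<odot> a') = (a \<cdot> (\<I> b \<odot> a')) \<cdot> (f \<odot> \<I> (c \<otimes> z))"
    by (simp add: merge)
  also have "\<dots> = a' \<cdot> (\<I> c \<odot> a) \<cdot> (\<I> c \<odot> (f \<odot> \<I> z)) \<cdot> sw b' c z"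
    unfolding h[unfolded commute_def] using sw_nat[of f "\<I> c" "\<I> z" b c z] by simp
  finally show ?thesis by (simp add: commute_def merge)
qed

lemma commute_ext:
  assumes h: "commute b c x a a'" and [simp]: "b \<in> Ob K" "c \<in> Ob K" "x \<in> Ob K" "y \<in> Ob K"
    "a \<in> Ar K" "Dom K a = b \<otimes> x" "Cod K a = x" "a' \<in> Ar K" "Dom K a' = c \<otimes> x" "Cod K a' = x"
  shows "commute b c (x \<otimes> y) (ext b x a y) (ext c x a' y)"
proof -
  \<comment> \<open>The structural identity behind the claim is \<open>assoc_ext_lift\<close> for
    the identity operation \<open>\<I> (b \<otimes> x)\<close>, solved for the inverse
    associators.\<close>
  have h': "ai c (b \<otimes> x) y \<cdot> (\<I> c \<odot> ai b x y) \<cdot> sw b c (x \<otimes> y) =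
      (sw b c x \<odot> \<I> y) \<cdot> ai b (c \<otimes> x) y \<cdot> (\<I> b \<odot> ai c x y)"
  proof (rule iso_cancel_left[of "(\<I> c \<odot> \<alpha> b x y) \<cdot> \<alpha> c (b \<otimes> x) y"])
    have "\<alpha> c (b \<otimes> x) y \<cdot> ext b (c \<otimes> x) (lift c b (\<I> (b \<otimes> x)) x) y = lift c b (ext b x (\<I> (b \<otimes> x)) y) (x \<otimes> y) \<cdot> (\<I> b \<odot> \<alpha> c x y)"
      by (rule assoc_ext_lift) simp_all
    then have "\<alpha> c (b \<otimes> x) y \<cdot> (sw b c x \<odot> \<I> y) \<cdot> ai b (c \<otimes> x) y = (\<I> c \<odot> ai b x y) \<cdot> sw b c (x \<otimes> y) \<cdot> (\<I> b \<odot> \<alpha> c x y)"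
      by (simp add: ext_def lift_def)
    from arg_cong[OF this, of "\<lambda>t. (\<I> c \<odot> \<alpha> b x y) \<cdot> t \<cdot> (\<I> b \<odot> ai c x y)"]
    show "((\<I> c \<odot> \<alpha> b x y) \<cdot> \<alpha> c (b \<otimes> x) y) \<cdot> ai c (b \<otimes> x) y \<cdot> (\<I> c \<odot> ai b x y) \<cdot> sw b c (x \<otimes> y) =
      ((\<I> c \<odot> \<alpha> b x y) \<cdot> \<alpha> c (b \<otimes> x) y) \<cdot> (sw b c x \<odot> \<I> y) \<cdot> ai b (c \<otimes> x) y \<cdot> (\<I> b \<odot> ai c x y)"
      by (simp add: merge)
  qed simp_all
  have "ext b x a y \<cdot> (\<I> b \<odot> ext c x a' y) = ((a \<cdot> (\<I> b \<odot> a')) \<odot> \<I> y) \<cdot> ai b (c \<otimes> x) y \<cdot> (\<I> b \<odot> ai c x y)"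
    by (simp add: ext_TenA_ext) (simp add: ext_def)
  also have "\<dots> = ((a' \<cdot> (\<I> c \<odot> a)) \<odot> \<I> y) \<cdot> (sw b c x \<odot> \<I> y) \<cdot> ai b (c \<otimes> x) y \<cdot> (\<I> b \<odot> ai c x y)"
    unfolding h[unfolded commute_def] by (simp add: merge)
  also have "\<dots> = ext c x a' y \<cdot> (\<I> c \<odot> ext b x a y) \<cdot> sw b c (x \<otimes> y)"
    unfolding h'[symmetric] by (simp add: ext_TenA_ext[THEN reassoc]) (simp add: ext_def)
  finally show ?thesis by (simp add: commute_def)
qed

lemma action_restrict:
  assumes B: "tt_ring K B" and C: "tt_ring K C" and f: "ring_hom K B C f" and a: "action C z a"
  shows "action B z (a \<cdot> (f \<odot> \<I> z))"
proof -
  note [simp] = tt_ringD[OF B] tt_ringD[OF C] actionD(1-4)[OF a]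
  have [simp]: "f \<in> Ar K" "Dom K f = robj B" "Cod K f = robj C"
    and fm: "f \<cdot> mult B = mult C \<cdot> (f \<odot> f)" and fu: "f \<cdot> unit B = unit C"
    using f by (simp_all add: ring_hom_def)
  let ?b = "robj B" let ?c = "robj C"
  have "a \<cdot> (f \<odot> \<I> z) \<cdot> ext ?b ?b (mult B) z = a \<cdot> ext ?b ?b (mult C \<cdot> (f \<odot> f)) z"
    unfolding fm[symmetric] by (simp add: ext_comp)
  also have "\<dots> = (a \<cdot> ext ?c ?c (mult C) z) \<cdot> (f \<odot> (f \<odot> \<I> z))"
    using ext_nat[of f f "\<I> z" "mult C" ?c ?c z] by simp
  also have "\<dots> = a \<cdot> (f \<odot> \<I> z) \<cdot> (\<I> ?b \<odot> (a \<cdot> (f \<odot> \<I> z)))"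
    unfolding actionD(5)[OF a] by (simp add: merge)
  finally have 1: "a \<cdot> (f \<odot> \<I> z) \<cdot> ext ?b ?b (mult B) z = a \<cdot> (f \<odot> \<I> z) \<cdot> (\<I> ?b \<odot> (a \<cdot> (f \<odot> \<I> z)))" .
  have "(f \<odot> \<I> z) \<cdot> uext (unit B) z = uext (unit C) z"
    unfolding fu[symmetric] by (simp add: uext_def merge)
  then have 2: "a \<cdot> (f \<odot> \<I> z) \<cdot> uext (unit B) z = \<I> z"
    using actionD(6)[OF a] by simp
  show ?thesis by (simp add: action_def 1 2)
qed

section \<open>The separability idempotent\<close>

definition sep :: "('a, 'b) ring_object \<Rightarrow> 'b" where
  "sep B = (SOME s. s \<in> Hom \<one> (robj B \<otimes> robj B) \<and> mult B \<cdot> s = unit B \<and>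
     (\<I> (robj B) \<odot> mult B) \<cdot> \<alpha> (robj B) (robj B) (robj B) \<cdot> uext s (robj B) =
     (mult B \<odot> \<I> (robj B)) \<cdot> ai (robj B) (robj B) (robj B) \<cdot> (\<I> (robj B) \<odot> s) \<cdot> inv_arrow K (\<rho>\<rho> (robj B)))"

text \<open>Obtained as \<open>s \<cdot> unit B\<close> from a section \<open>s\<close> of the
  multiplication. In elements \<open>sep B\<close> is a sum of terms \<open>u \<otimes> v\<close>
  such that the \<open>u v\<close> add up to \<open>1\<close>, and \<open>u \<otimes> v b\<close>
  adds up to the same as \<open>b u \<otimes> v\<close>. Being an arrow out of
  \<open>\<one>\<close>, it can be inserted in front of any object.\<close>

lemma sep:
  assumes B: "tt_ring K B"
  shows "sep B \<in> Hom \<one> (robj B \<otimes> robj B) \<and> mult B \<cdot> sep B = unit B \<and>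
     (\<I> (robj B) \<odot> mult B) \<cdot> \<alpha> (robj B) (robj B) (robj B) \<cdot> uext (sep B) (robj B) =
     (mult B \<odot> \<I> (robj B)) \<cdot> ai (robj B) (robj B) (robj B) \<cdot> (\<I> (robj B) \<odot> sep B) \<cdot> inv_arrow K (\<rho>\<rho> (robj B))"
  unfolding sep_def
proof (rule someI_ex)
  note [simp] = tt_ringD[OF B]
  let ?b = "robj B"
  obtain s where [simp]: "s \<in> Ar K" "Dom K s = ?b" "Cod K s = ?b \<otimes> ?b" and 1: "mult B \<cdot> s = \<I> ?b"
    and 2: "(\<I> ?b \<odot> mult B) \<cdot> \<alpha> ?b ?b ?b \<cdot> (s \<odot> \<I> ?b) = s \<cdot> mult B"
    and 3: "(mult B \<odot> \<I> ?b) \<cdot> ai ?b ?b ?b \<cdot> (\<I> ?b \<odot> s) = s \<cdot> mult B"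
    using B by (auto simp: tt_ring_def separable_def)
  have ru: "mult B \<cdot> (\<I> ?b \<odot> unit B) = \<rho>\<rho> ?b"
    using B by (simp add: tt_ring_def is_ring_def)
  have a: "mult B \<cdot> s \<cdot> unit B = unit B"
    using reassoc[OF 1, of "unit B"] by simp
  have "(\<I> ?b \<odot> mult B) \<cdot> \<alpha> ?b ?b ?b \<cdot> uext (s \<cdot> unit B) ?b = ((\<I> ?b \<odot> mult B) \<cdot> \<alpha> ?b ?b ?b \<cdot> (s \<odot> \<I> ?b)) \<cdot> uext (unit B) ?b"
    by (simp add: uext_def merge)
  also have "\<dots> = s" unfolding 2 by (simp add: tt_ring_eqs(2)[OF B])
  also have "s = ((mult B \<odot> \<I> ?b) \<cdot> ai ?b ?b ?b \<cdot> (\<I> ?b \<odot> s)) \<cdot> (\<I> ?b \<odot> unit B) \<cdot> inv_arrow K (\<rho>\<rho> ?b)"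
    unfolding 3 by (simp add: ru[THEN reassoc])
  also have "\<dots> = (mult B \<odot> \<I> ?b) \<cdot> ai ?b ?b ?b \<cdot> (\<I> ?b \<odot> (s \<cdot> unit B)) \<cdot> inv_arrow K (\<rho>\<rho> ?b)"
    by (simp add: merge)
  finally show "\<exists>s. s \<in> Hom \<one> (?b \<otimes> ?b) \<and> mult B \<cdot> s = unit B \<and>
     (\<I> ?b \<odot> mult B) \<cdot> \<alpha> ?b ?b ?b \<cdot> uext s ?b =
     (mult B \<odot> \<I> ?b) \<cdot> ai ?b ?b ?b \<cdot> (\<I> ?b \<odot> s) \<cdot> inv_arrow K (\<rho>\<rho> ?b)"
    by (intro exI[of _ "s \<cdot> unit B"]) (simp add: a)
qed

lemma sep_simps:
  assumes "tt_ring K B"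
  shows "sep B \<in> Ar K" "Dom K (sep B) = \<one>" "Cod K (sep B) = robj B \<otimes> robj B"
  using sep[OF assms] by simp_all

definition sig :: "('a, 'b) ring_object \<Rightarrow> 'a \<Rightarrow> 'b" where
  "sig B z = \<alpha> (robj B) (robj B) z \<cdot> uext (sep B) z"

lemma sig_simps:
  assumes "tt_ring K B" "z \<in> Ob K"
  shows "sig B z \<in> Ar K" "Dom K (sig B z) = z" "Cod K (sig B z) = robj B \<otimes> (robj B \<otimes> z)"
  using assms by (simp_all add: sig_def tt_ringD sep_simps)

lemma mult_sig:
  assumes B: "tt_ring K B" and [simp]: "z \<in> Ob K"
  shows "ext (robj B) (robj B) (mult B) z \<cdot> sig B z = uext (unit B) z"
proof -
  note [simp] = tt_ringD[OF B] sep_simps[OF B]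
  show ?thesis using sep[OF B] by (simp add: sig_def ext_def uext_def merge)
qed

lemma sig_nat:
  assumes B: "tt_ring K B" and [simp]: "g \<in> Ar K" and z: "Cod K g = z"
  shows "sig B z \<cdot> g = (\<I> (robj B) \<odot> (\<I> (robj B) \<odot> g)) \<cdot> sig B (Dom K g)"
proof -
  note [simp] = tt_ringD[OF B] sep_simps[OF B]
  have h: "\<alpha> (robj B) (robj B) z \<cdot> (\<I> (robj B \<otimes> robj B) \<odot> g) = (\<I> (robj B) \<odot> (\<I> (robj B) \<odot> g)) \<cdot> \<alpha> (robj B) (robj B) (Dom K g)"
    using assoc_nat[of "\<I> (robj B)" "\<I> (robj B)" g "robj B" "robj B" z] z by simp
  show ?thesis using z Cod_Ob[of g] by (simp add: sig_def uext_nat h[THEN reassoc])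
qed

text \<open>The relation between \<open>u \<otimes> v b\<close> and \<open>b u \<otimes> v\<close>
  with a spectator \<open>z\<close> behind; the proof moves associators until the defining equation
  of \<open>sep\<close> can be applied to the factors in front of \<open>z\<close>.\<close>

lemma mult_sig_swap:
  assumes B: "tt_ring K B" and [simp]: "z \<in> Ob K"
  shows "(\<I> (robj B) \<odot> ext (robj B) (robj B) (mult B) z) \<cdot> sig B (robj B \<otimes> z) =
    ext (robj B) (robj B) (mult B) (robj B \<otimes> z) \<cdot> (\<I> (robj B) \<odot> sig B z)"
proof -
  note [simp] = tt_ringD[OF B] sep_simps[OF B]
  let ?b = "robj B" let ?m = "mult B" let ?s = "sep B"
  have lt: "inv_arrow K (\<lambda>\<lambda> (?b \<otimes> z)) = \<alpha> \<one> ?b z \<cdot> (inv_arrow K (\<lambda>\<lambda> ?b) \<odot> \<I> z)"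
    by (rule iso_cancel_left[of "\<lambda>\<lambda> (?b \<otimes> z)"]) (simp_all add: lunit_tensor[THEN reassoc] merge)
  have tr: "ai ?b \<one> z \<cdot> (\<I> ?b \<odot> inv_arrow K (\<lambda>\<lambda> z)) = inv_arrow K (\<rho>\<rho> ?b) \<odot> \<I> z"
    by (rule sym, rule iso_cancel_left[of "(\<I> ?b \<odot> \<lambda>\<lambda> z) \<cdot> \<alpha> ?b \<one> z"]) (simp_all add: merge triangle[THEN reassoc])
  have h: "(?s \<odot> \<I> (?b \<otimes> z)) \<cdot> \<alpha> \<one> ?b z = \<alpha> (?b \<otimes> ?b) ?b z \<cdot> ((?s \<odot> \<I> ?b) \<odot> \<I> z)"
    by (simp add: assoc_nat)
  have x1: "\<I> ?b \<odot> ext ?b ?b ?m z = (\<I> ?b \<odot> (?m \<odot> \<I> z)) \<cdot> (\<I> ?b \<odot> ai ?b ?b z)"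
    by (simp add: ext_def merge)
  have "(\<I> ?b \<odot> ext ?b ?b ?m z) \<cdot> sig B (?b \<otimes> z) = (\<I> ?b \<odot> (?m \<odot> \<I> z)) \<cdot>
     ((\<I> ?b \<odot> ai ?b ?b z) \<cdot> \<alpha> ?b ?b (?b \<otimes> z) \<cdot> \<alpha> (?b \<otimes> ?b) ?b z) \<cdot> ((?s \<odot> \<I> ?b) \<odot> \<I> z) \<cdot> (inv_arrow K (\<lambda>\<lambda> ?b) \<odot> \<I> z)"
    unfolding x1 sig_def uext_def lt by (simp add: h[THEN reassoc])
  also have "\<dots> = \<alpha> ?b ?b z \<cdot> ((\<I> ?b \<odot> ?m) \<odot> \<I> z) \<cdot> (\<alpha> ?b ?b ?b \<odot> \<I> z) \<cdot> ((?s \<odot> \<I> ?b) \<odot> \<I> z) \<cdot> (inv_arrow K (\<lambda>\<lambda> ?b) \<odot> \<I> z)"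
    unfolding pent1[symmetric, of ?b ?b ?b z, simplified] by (simp add: assoc_nat[THEN reassoc])
  also have "\<dots> = \<alpha> ?b ?b z \<cdot> (((\<I> ?b \<odot> ?m) \<cdot> \<alpha> ?b ?b ?b \<cdot> uext ?s ?b) \<odot> \<I> z)"
    by (simp add: uext_def merge)
  also have "\<dots> = \<alpha> ?b ?b z \<cdot> (((?m \<odot> \<I> ?b) \<cdot> ai ?b ?b ?b \<cdot> (\<I> ?b \<odot> ?s) \<cdot> inv_arrow K (\<rho>\<rho> ?b)) \<odot> \<I> z)"
    using sep[OF B] by simp
  also have "\<dots> = \<alpha> ?b ?b z \<cdot> ((?m \<odot> \<I> ?b) \<odot> \<I> z) \<cdot> (ai ?b ?b ?b \<odot> \<I> z) \<cdot> ((\<I> ?b \<odot> ?s) \<odot> \<I> z) \<cdot> ai ?b \<one> z \<cdot> (\<I> ?b \<odot> inv_arrow K (\<lambda>\<lambda> z))"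
    unfolding tr by (simp add: merge)
  also have "\<dots> = (?m \<odot> \<I> (?b \<otimes> z)) \<cdot> (\<alpha> (?b \<otimes> ?b) ?b z \<cdot> (ai ?b ?b ?b \<odot> \<I> z) \<cdot> ai ?b (?b \<otimes> ?b) z) \<cdot> (\<I> ?b \<odot> (?s \<odot> \<I> z)) \<cdot> (\<I> ?b \<odot> inv_arrow K (\<lambda>\<lambda> z))"
    by (simp add: assoc_nat[THEN reassoc] inv_assoc_nat[THEN reassoc])
  also have "\<dots> = ext ?b ?b ?m (?b \<otimes> z) \<cdot> (\<I> ?b \<odot> sig B z)"
    unfolding pent3[of ?b ?b ?b z, simplified] by (simp add: ext_def sig_def uext_def merge)
  finally show ?thesis .
qed

text \<open>\<open>sep B\<close> is an arrow out of the unit, so it may be inserted behind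
  \<open>c\<close> and then moved to the front.\<close>

lemma sw_sig:
  assumes B: "tt_ring K B" and [simp]: "z \<in> Ob K" "c \<in> Ob K"
  shows "(\<I> (robj B) \<odot> sw c (robj B) z) \<cdot> sw c (robj B) (robj B \<otimes> z) \<cdot> (\<I> c \<odot> sig B z) = sig B (c \<otimes> z)"
proof -
  note [simp] = tt_ringD[OF B] sep_simps[OF B]
  let ?b = "robj B"
  have 1: "\<I> c \<odot> sig B z = (\<I> c \<odot> \<alpha> ?b ?b z) \<cdot> (\<I> c \<odot> uext (sep B) z)"
    by (simp add: sig_def merge)
  have "(\<I> ?b \<odot> sw c ?b z) \<cdot> sw c ?b (?b \<otimes> z) \<cdot> (\<I> c \<odot> sig B z) =
    ((\<I> ?b \<odot> sw c ?b z) \<cdot> sw c ?b (?b \<otimes> z) \<cdot> (\<I> c \<odot> \<alpha> ?b ?b z)) \<cdot> (\<I> c \<odot> uext (sep B) z)"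
    unfolding 1 by simp
  also have "\<dots> = \<alpha> ?b ?b (c \<otimes> z) \<cdot> sw c (?b \<otimes> ?b) z \<cdot> (\<I> c \<odot> uext (sep B) z)"
    by (simp add: sw_assoc[THEN reassoc])
  also have "\<dots> = sig B (c \<otimes> z)" by (simp add: sw_uext sig_def)
  finally show ?thesis .
qed

text \<open>In elements \<open>a1 \<cdot> w\<close> sends \<open>z\<close> to the sum of
  \<open>u \<cdot>\<^sub>1 (v \<cdot>\<^sub>2 z)\<close> over the terms of \<open>sep B\<close>. It
  identifies the two actions, and it fixes whatever already identifies them: any \<open>h\<close>
  with \<open>h \<cdot> a1 = h \<cdot> a2\<close> satisfies
  \<open>h \<cdot> a1 \<cdot> w = h\<close>, because \<open>a2 \<cdot> w\<close> is the identity.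
  Hence it will be the idempotent splitting the coequalizer of \<open>a1\<close> and
  \<open>a2\<close>; the third claim says that it carries \<open>a2\<close> to
  \<open>a1\<close>.\<close>

lemma separating_idempotent:
  assumes B: "tt_ring K B" and a1: "action B z a1" and a2: "action B z a2" and c: "commute (robj B) (robj B) z a1 a2"
  defines "w \<equiv> (\<I> (robj B) \<odot> a2) \<cdot> sig B z"
  shows "w \<in> Hom z (robj B \<otimes> z)" "a2 \<cdot> w = \<I> z" "a1 \<cdot> w \<cdot> a2 = a1 \<cdot> (\<I> (robj B) \<odot> (a1 \<cdot> w))"
    "a1 \<cdot> w \<cdot> a1 = a1 \<cdot> w \<cdot> a2"
proof -
  note [simp] = tt_ringD[OF B] sep_simps[OF B] actionD(1-4)[OF a1] actionD(1-4)[OF a2] sig_simps[OF B]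
  let ?b = "robj B" let ?m = "mult B"
  show "w \<in> Hom z (?b \<otimes> z)" by (simp add: w_def)
  have "a2 \<cdot> w = (a2 \<cdot> (\<I> ?b \<odot> a2)) \<cdot> sig B z" by (simp add: w_def)
  also have "\<dots> = \<I> z"
    unfolding actionD(5)[OF a2, symmetric] by (simp add: mult_sig[OF B] actionD(6)[OF a2])
  finally show "a2 \<cdot> w = \<I> z" .
  have n: "ext ?b ?b ?m z \<cdot> (\<I> ?b \<odot> (\<I> ?b \<odot> a2)) = (\<I> ?b \<odot> a2) \<cdot> ext ?b ?b ?m (?b \<otimes> z)"
    by (simp add: ext_nat_right)
  have A: "a1 \<cdot> (\<I> ?b \<odot> a1) \<cdot> (\<I> ?b \<odot> w) = a1 \<cdot> (\<I> ?b \<odot> a2) \<cdot> ext ?b ?b ?m (?b \<otimes> z) \<cdot> (\<I> ?b \<odot> sig B z)"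
  proof -
    have "a1 \<cdot> (\<I> ?b \<odot> a1) \<cdot> (\<I> ?b \<odot> w) = (a1 \<cdot> (\<I> ?b \<odot> a1)) \<cdot> (\<I> ?b \<odot> w)" by (simp add: w_def)
    also have "\<dots> = a1 \<cdot> ext ?b ?b ?m z \<cdot> (\<I> ?b \<odot> (\<I> ?b \<odot> a2)) \<cdot> (\<I> ?b \<odot> sig B z)"
      unfolding actionD(5)[OF a1, symmetric] by (simp add: w_def merge)
    finally show ?thesis by (simp add: n[THEN reassoc])
  qed
  have "a1 \<cdot> w \<cdot> a2 = a1 \<cdot> (\<I> ?b \<odot> a2) \<cdot> (\<I> ?b \<odot> (\<I> ?b \<odot> a2)) \<cdot> sig B (?b \<otimes> z)"
    by (simp add: w_def sig_nat[OF B])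
  also have "\<dots> = a1 \<cdot> (\<I> ?b \<odot> (a2 \<cdot> (\<I> ?b \<odot> a2))) \<cdot> sig B (?b \<otimes> z)"
    by (simp add: merge)
  also have "\<dots> = a1 \<cdot> (\<I> ?b \<odot> a2) \<cdot> (\<I> ?b \<odot> ext ?b ?b ?m z) \<cdot> sig B (?b \<otimes> z)"
    unfolding actionD(5)[OF a2, symmetric] by (simp add: merge)
  also have "\<dots> = a1 \<cdot> (\<I> ?b \<odot> a2) \<cdot> ext ?b ?b ?m (?b \<otimes> z) \<cdot> (\<I> ?b \<odot> sig B z)"
    by (simp add: mult_sig_swap[OF B])
  finally have E2: "a1 \<cdot> w \<cdot> a2 = a1 \<cdot> (\<I> ?b \<odot> a2) \<cdot> ext ?b ?b ?m (?b \<otimes> z) \<cdot> (\<I> ?b \<odot> sig B z)" .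
  show "a1 \<cdot> w \<cdot> a2 = a1 \<cdot> (\<I> ?b \<odot> (a1 \<cdot> w))"
    unfolding E2 A[symmetric] by (simp add: w_def merge)
  have c': "a2 \<cdot> (\<I> ?b \<odot> a1) = a1 \<cdot> (\<I> ?b \<odot> a2) \<cdot> sw ?b ?b z"
    using commute_sym[OF c] by (simp add: commute_def)
  have mb: "ext ?b ?b ?m (?b \<otimes> z) \<cdot> sw ?b ?b (?b \<otimes> z) = ext ?b ?b ?m (?b \<otimes> z)"
    using ext_braid[of ?b ?b "?b \<otimes> z" ?m] tt_ring_eqs(1)[OF B] by simp
  have ss: "(\<I> ?b \<odot> sw ?b ?b z) \<cdot> sig B (?b \<otimes> z) = sw ?b ?b (?b \<otimes> z) \<cdot> (\<I> ?b \<odot> sig B z)"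
    unfolding sw_sig[OF B, of z ?b, simplified, symmetric] by (simp add: merge)
  \<comment> \<open>\<open>v \<cdot>\<^sub>2 (b \<cdot>\<^sub>1 z) = b \<cdot>\<^sub>1 (v
    \<cdot>\<^sub>2 z)\<close> lets \<open>b\<close> reach \<open>u\<close>, and commutativity of
    \<open>B\<close> makes \<open>u b\<close> into \<open>b u\<close>, the form that
    \<open>E2\<close> found for \<open>a2\<close>.\<close>
  have "a1 \<cdot> w \<cdot> a1 = a1 \<cdot> (\<I> ?b \<odot> a2) \<cdot> (\<I> ?b \<odot> (\<I> ?b \<odot> a1)) \<cdot> sig B (?b \<otimes> z)"
    by (simp add: w_def sig_nat[OF B])
  also have "\<dots> = a1 \<cdot> (\<I> ?b \<odot> (a2 \<cdot> (\<I> ?b \<odot> a1))) \<cdot> sig B (?b \<otimes> z)"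
    by (simp add: merge)
  also have "\<dots> = (a1 \<cdot> (\<I> ?b \<odot> a1)) \<cdot> (\<I> ?b \<odot> (\<I> ?b \<odot> a2)) \<cdot> (\<I> ?b \<odot> sw ?b ?b z) \<cdot> sig B (?b \<otimes> z)"
    unfolding c' by (simp add: merge)
  also have "\<dots> = a1 \<cdot> (\<I> ?b \<odot> a2) \<cdot> (ext ?b ?b ?m (?b \<otimes> z) \<cdot> sw ?b ?b (?b \<otimes> z)) \<cdot> (\<I> ?b \<odot> sig B z)"
    unfolding actionD(5)[OF a1, symmetric] by (simp add: n[THEN reassoc] ss)
  finally show "a1 \<cdot> w \<cdot> a1 = a1 \<cdot> w \<cdot> a2"
    unfolding mb E2 .
qed

end

context category
begin

lemma split_epi_factor:
  assumes e: "k \<cdot> q = h" and s: "q \<cdot> s = \<I> (Cod K q)"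
    and t: "q \<in> Ar K" "s \<in> Hom (Cod K q) (Dom K q)" "k \<in> Ar K" "Dom K k = Cod K q"
  shows "k = h \<cdot> s"
  unfolding e[symmetric] using t s by simp

text \<open>\<open>induced\<close> is a definite description; a section of \<open>q\<close> settles
  uniqueness, and the second premise existence. The action on a relative tensor product and the
  multiplication of \<open>B \<otimes>\<^sub>A B\<close> are evaluated this way.\<close>

lemma induced_eq:
  assumes "q \<cdot> s = \<I> (Cod K q)" "h \<cdot> s \<cdot> q = h"
    "q \<in> Ar K" "s \<in> Hom (Cod K q) (Dom K q)" "h \<in> Ar K" "Dom K h = Dom K q"
  shows "induced K q h = h \<cdot> s"
  unfolding induced_def
proof (rule the_equality)
  show "h \<cdot> s \<in> Hom (Cod K q) (Cod K h) \<and> (h \<cdot> s) \<cdot> q = h" using assms by auto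
  fix k assume k: "k \<in> Hom (Cod K q) (Cod K h) \<and> k \<cdot> q = h"
  show "k = h \<cdot> s" by (rule split_epi_factor[OF _ assms(1)]) (use k assms in simp_all)
qed

end

context symmetric_monoidal_category
begin

lemma ring_homD:
  assumes "ring_hom K B C f"
  shows "f \<in> Ar K" "Dom K f = robj B" "Cod K f = robj C"
  using assms by (simp_all add: ring_hom_def)

lemma ring_hom_ident:
  assumes B: "tt_ring K B"
  shows "ring_hom K B B (\<I> (robj B))"
  using tt_ringD[OF B] by (simp add: ring_hom_def)

lemma ring_hom_comp:
  assumes B: "tt_ring K B" and C: "tt_ring K C" and D: "tt_ring K D"
    and f: "ring_hom K B C f" and g: "ring_hom K C D g"
  shows "ring_hom K B D (g \<cdot> f)"
proof -
  note [simp] = tt_ringD[OF B] tt_ringD[OF C] tt_ringD[OF D] ring_homD[OF f] ring_homD[OF g]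
  have f1: "f \<cdot> mult B = mult C \<cdot> (f \<odot> f)" and f2: "f \<cdot> unit B = unit C"
    and g1: "g \<cdot> mult C = mult D \<cdot> (g \<odot> g)" and g2: "g \<cdot> unit C = unit D"
    using f g by (simp_all add: ring_hom_def)
  show ?thesis
    by (simp add: ring_hom_def f1 f2 g2 g1[THEN reassoc] merge)
qed

definition res_mod :: "'b \<Rightarrow> 'a \<times> 'b \<Rightarrow> 'a \<times> 'b" where
  "res_mod f M = (fst M, snd M \<cdot> (f \<odot> \<I> (fst M)))"

lemma fst_res_mod [simp]: "fst (res_mod f M) = fst M"
  by (simp add: res_mod_def)

lemma res_mod_modules:
  assumes B: "tt_ring K B" and C: "tt_ring K C" and f: "ring_hom K B C f" and M: "M \<in> modules K C"
  shows "res_mod f M \<in> modules K B"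
  using action_restrict[OF B C f] M unfolding modules_iff[OF B] modules_iff[OF C]
  by (simp add: res_mod_def)

lemma res_mod_ident:
  assumes "tt_ring K C" "M \<in> modules K C"
  shows "res_mod (\<I> (robj C)) M = M"
  using modulesD[OF assms] tt_ringD[OF assms(1)] by (simp add: res_mod_def)

section \<open>Relative tensor products\<close>

abbreviation lact :: "('a, 'b) ring_object \<Rightarrow> 'a \<times> 'b \<Rightarrow> 'a \<Rightarrow> 'b" where
  "lact B M y \<equiv> ext (robj B) (fst M) (snd M) y"

abbreviation ract :: "('a, 'b) ring_object \<Rightarrow> 'a \<Rightarrow> 'a \<times> 'b \<Rightarrow> 'b" where
  "ract B x N \<equiv> lift x (robj B) (snd N) (fst N)"

text \<open>The arrow \<open>w\<close> of \<open>separating_idempotent\<close> for the two actions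
  on \<open>x \<otimes> y\<close>; \<open>lact\<close> after it is the idempotent with image
  \<open>M \<otimes>\<^sub>B N\<close>.\<close>

definition tw :: "('a, 'b) ring_object \<Rightarrow> 'a \<times> 'b \<Rightarrow> 'a \<times> 'b \<Rightarrow> 'b" where
  "tw B M N = (\<I> (robj B) \<odot> ract B (fst M) N) \<cdot> sig B (fst M \<otimes> fst N)"

lemma tw:
  assumes B: "tt_ring K B" and M: "M \<in> modules K B" and N: "N \<in> modules K B"
  shows "tw B M N \<in> Ar K" "Dom K (tw B M N) = fst M \<otimes> fst N" "Cod K (tw B M N) = robj B \<otimes> (fst M \<otimes> fst N)"
    "ract B (fst M) N \<cdot> tw B M N = \<I> (fst M \<otimes> fst N)"
    "lact B M (fst N) \<cdot> tw B M N \<cdot> ract B (fst M) N =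
     lact B M (fst N) \<cdot> (\<I> (robj B) \<odot> (lact B M (fst N) \<cdot> tw B M N))"
    "lact B M (fst N) \<cdot> tw B M N \<cdot> lact B M (fst N) = lact B M (fst N) \<cdot> tw B M N \<cdot> ract B (fst M) N"
proof -
  note [simp] = modulesD(1-4)[OF B M] modulesD(1-4)[OF B N] tt_ringD[OF B]
  have a1: "action B (fst M \<otimes> fst N) (lact B M (fst N))"
    using M unfolding modules_iff[OF B] by (rule action_ext[OF B]) simp
  have a2: "action B (fst M \<otimes> fst N) (ract B (fst M) N)"
    using N unfolding modules_iff[OF B] by (rule action_lift[OF B]) simp
  have c: "commute (robj B) (robj B) (fst M \<otimes> fst N) (lact B M (fst N)) (ract B (fst M) N)"
    by (rule commute_ext_lift) simp_all
  note e = separating_idempotent[OF B a1 a2 c, folded tw_def]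
  show "tw B M N \<in> Ar K" "Dom K (tw B M N) = fst M \<otimes> fst N" "Cod K (tw B M N) = robj B \<otimes> (fst M \<otimes> fst N)"
    using e(1) by simp_all
  show "ract B (fst M) N \<cdot> tw B M N = \<I> (fst M \<otimes> fst N)"
    "lact B M (fst N) \<cdot> tw B M N \<cdot> ract B (fst M) N =
     lact B M (fst N) \<cdot> (\<I> (robj B) \<odot> (lact B M (fst N) \<cdot> tw B M N))"
    "lact B M (fst N) \<cdot> tw B M N \<cdot> lact B M (fst N) = lact B M (fst N) \<cdot> tw B M N \<cdot> ract B (fst M) N"
    by (fact e(2-4))+
qed

end

context tt_category
begin

definition tsec :: "('o, 'm) ring_object \<Rightarrow> 'o \<times> 'm \<Rightarrow> 'o \<times> 'm \<Rightarrow> 'm" where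
  "tsec B M N = (SOME s. s \<in> Hom (Cod K (tensor_quot K B M N)) (fst M \<otimes> fst N) \<and>
     tensor_quot K B M N \<cdot> s = \<I> (Cod K (tensor_quot K B M N)) \<and>
     s \<cdot> tensor_quot K B M N = lact B M (fst N) \<cdot> tw B M N)"

text \<open>The idempotent \<open>e\<close> splits by idempotent completeness, and its splitting
  \<open>r\<close> is a coequalizer of the two actions. So coequalizers exist and the arrow chosen
  by \<open>tensor_quot\<close> is one. It may differ from \<open>r\<close>, but its universal
  property applied to \<open>e\<close> yields a section with the same composite
  \<open>e\<close>.\<close>

lemma tensor_quot_aux:
  assumes B: "tt_ring K B" and M: "M \<in> modules K B" and N: "N \<in> modules K B"
  shows "tensor_quot K B M N \<in> Ar K \<and> Dom K (tensor_quot K B M N) = fst M \<otimes> fst N \<and>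
    tensor_quot K B M N \<cdot> lact B M (fst N) = tensor_quot K B M N \<cdot> ract B (fst M) N \<and>
    (\<exists>s. s \<in> Hom (Cod K (tensor_quot K B M N)) (fst M \<otimes> fst N) \<and>
     tensor_quot K B M N \<cdot> s = \<I> (Cod K (tensor_quot K B M N)) \<and>
     s \<cdot> tensor_quot K B M N = lact B M (fst N) \<cdot> tw B M N)"
proof -
  define x y b a1 a2 w where d: "x = fst M" "y = fst N" "b = robj B" "a1 = lact B M (fst N)"
    "a2 = ract B (fst M) N" "w = tw B M N"
  note [simp] = modulesD(1-4)[OF B M, folded d] modulesD(1-4)[OF B N, folded d] tt_ringD[OF B, folded d]
  note [simp] = tw(1-3)[OF B M N, folded d]
  note ee = tw(4-6)[OF B M N, folded d]
  have [simp]: "a1 \<in> Ar K" "Dom K a1 = b \<otimes> (x \<otimes> y)" "Cod K a1 = x \<otimes> y"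
    "a2 \<in> Ar K" "Dom K a2 = b \<otimes> (x \<otimes> y)" "Cod K a2 = x \<otimes> y"
    unfolding d(4,5) d(1-3)[symmetric] by simp_all
  define j where "j = \<alpha> b x y \<cdot> (\<gamma> x b \<odot> \<I> y)"
  have [simp]: "iso K j" "j \<in> Ar K" "Dom K j = (x \<otimes> b) \<otimes> y" "Cod K j = b \<otimes> (x \<otimes> y)"
    by (simp_all add: j_def)
  define u v where uv: "u = a1 \<cdot> j" "v = a2 \<cdot> j"
  have u: "right_action K B M \<odot> \<I> (fst N) = u"
    using ext_assoc_braid[of b x y "snd M"] by (simp add: right_action_def uv j_def d(4) flip: d(1-3))
  have v: "(\<I> (fst M) \<odot> snd N) \<cdot> \<alpha> (fst M) (robj B) (fst N) = v"
    using lift_assoc_braid[of b x y "snd N"] by (simp add: uv j_def d(5) flip: d(1-3))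
  have uvs [simp]: "u \<in> Ar K" "Dom K u = (x \<otimes> b) \<otimes> y" "Cod K u = x \<otimes> y"
    "v \<in> Ar K" "Dom K v = (x \<otimes> b) \<otimes> y" "Cod K v = x \<otimes> y"
    by (simp_all add: uv)
  have ueq: "h \<cdot> u = h \<cdot> v \<longleftrightarrow> h \<cdot> a1 = h \<cdot> a2" if [simp]: "h \<in> Ar K" "Dom K h = x \<otimes> y" for h
  proof
    assume "h \<cdot> u = h \<cdot> v"
    then have "(h \<cdot> a1) \<cdot> j = (h \<cdot> a2) \<cdot> j" by (simp add: uv)
    then show "h \<cdot> a1 = h \<cdot> a2" by (rule iso_cancel_right[rotated]) simp_all
  next
    assume e: "h \<cdot> a1 = h \<cdot> a2"
    have "h \<cdot> u = (h \<cdot> a1) \<cdot> j" by (simp add: uv)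
    then show "h \<cdot> u = h \<cdot> v" unfolding e by (simp add: uv)
  qed
  define e where "e = a1 \<cdot> w"
  have [simp]: "e \<in> Ar K" "Dom K e = x \<otimes> y" "Cod K e = x \<otimes> y" by (simp_all add: e_def)
  have he: "h \<cdot> e = h" if "h \<cdot> a1 = h \<cdot> a2" and [simp]: "h \<in> Ar K" "Dom K h = x \<otimes> y" for h
  proof -
    have "h \<cdot> e = (h \<cdot> a1) \<cdot> w" by (simp add: e_def)
    also have "\<dots> = h \<cdot> (a2 \<cdot> w)" unfolding that(1) by simp
    finally show ?thesis by (simp add: ee(1))
  qed
  have ea: "e \<cdot> a1 = e \<cdot> a2" using ee(3) by (simp add: e_def)
  have "e \<cdot> e = e" by (rule he[OF ea]) simp_all
  then obtain z r s where z: "z \<in> Ob K" "r \<in> Hom (x \<otimes> y) z" "s \<in> Hom z (x \<otimes> y)" and sr: "s \<cdot> r = e" and rs: "r \<cdot> s = \<I> z"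
    using idempotent_complete[of e "x \<otimes> y"] by fastforce
  have [simp]: "z \<in> Ob K" "r \<in> Ar K" "Dom K r = x \<otimes> y" "Cod K r = z" "s \<in> Ar K" "Dom K s = z" "Cod K s = x \<otimes> y"
    using z by simp_all
  have ra: "r \<cdot> a1 = r \<cdot> a2"
  proof -
    have re: "r \<cdot> e = r" using rs[THEN reassoc, of r] by (simp add: sr[symmetric])
    have "r \<cdot> a1 = r \<cdot> (e \<cdot> a1)" using re[THEN reassoc, of a1] by simp
    then show ?thesis unfolding ea using re[THEN reassoc, of a2] by simp
  qed
  have "coequalizer K u v r"
    unfolding coequalizer_def
  proof (intro conjI ballI impI)
    show "r \<cdot> u = r \<cdot> v" using ra by (simp add: ueq)
    fix h assume hA: "h \<in> Ar K" and h: "Dom K h = Cod K u \<and> h \<cdot> u = h \<cdot> v"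
    then have [simp]: "h \<in> Ar K" "Dom K h = x \<otimes> y" by simp_all
    have "h \<cdot> a1 = h \<cdot> a2" using h by (simp add: ueq)
    from he[OF this] have hs: "(h \<cdot> s) \<cdot> r = h" by (simp add: sr)
    show "\<exists>!k. k \<in> Hom (Cod K r) (Cod K h) \<and> k \<cdot> r = h"
    proof (rule ex1I[of _ "h \<cdot> s"])
      show "h \<cdot> s \<in> Hom (Cod K r) (Cod K h) \<and> (h \<cdot> s) \<cdot> r = h" using hs by simp
      fix k assume k: "k \<in> Hom (Cod K r) (Cod K h) \<and> k \<cdot> r = h"
      show "k = h \<cdot> s" by (rule split_epi_factor[of k r]) (use k rs in simp_all)
    qed
  qed simp_all
  then have "coequalizer K u v (tensor_quot K B M N)"
    unfolding tensor_quot_def u v by (rule someI)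
  moreover define q where "q = tensor_quot K B M N"
  ultimately have cq: "coequalizer K u v q" by simp
  then have [simp]: "q \<in> Ar K" "Dom K q = x \<otimes> y" and "q \<cdot> u = q \<cdot> v"
    by (simp_all add: coequalizer_def)
  then have qa: "q \<cdot> a1 = q \<cdot> a2" using ueq by simp
  have uni: "\<exists>!k. k \<in> Hom (Cod K q) (Cod K h) \<and> k \<cdot> q = h" if "h \<cdot> a1 = h \<cdot> a2" "h \<in> Ar K" "Dom K h = x \<otimes> y" for h
    using cq that ueq[of h] by (simp add: coequalizer_def)
  obtain s' where [simp]: "s' \<in> Ar K" "Dom K s' = Cod K q" "Cod K s' = x \<otimes> y" and sq: "s' \<cdot> q = e"
    using uni[OF ea] by auto
  have qs: "q \<cdot> s' = \<I> (Cod K q)"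
  proof -
    have "(q \<cdot> s') \<cdot> q = q" using he[OF qa] by (simp add: sq)
    have "\<exists>!k. k \<in> Hom (Cod K q) (Cod K q) \<and> k \<cdot> q = q"
      using uni[OF qa] by simp
    then show ?thesis
    proof (rule ex1E)
      fix k assume "\<forall>y. y \<in> Hom (Cod K q) (Cod K q) \<and> y \<cdot> q = q \<longrightarrow> y = k"
      then have "q \<cdot> s' = k" "\<I> (Cod K q) = k" using \<open>(q \<cdot> s') \<cdot> q = q\<close> by simp_all
      then show ?thesis by simp
    qed
  qed
  have "q \<in> Ar K \<and> Dom K q = x \<otimes> y \<and> q \<cdot> a1 = q \<cdot> a2 \<and>
     (\<exists>s. s \<in> Hom (Cod K q) (x \<otimes> y) \<and> q \<cdot> s = \<I> (Cod K q) \<and> s \<cdot> q = a1 \<cdot> w)"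
    using qa qs sq[unfolded e_def] by (intro conjI exI[of _ s']) simp_all
  then show ?thesis unfolding q_def d .
qed

lemma tensor_quot:
  assumes B: "tt_ring K B" and M: "M \<in> modules K B" and N: "N \<in> modules K B"
  shows "tensor_quot K B M N \<in> Ar K" "Dom K (tensor_quot K B M N) = fst M \<otimes> fst N"
    "tensor_quot K B M N \<cdot> lact B M (fst N) = tensor_quot K B M N \<cdot> ract B (fst M) N"
    "tsec B M N \<in> Ar K" "Dom K (tsec B M N) = Cod K (tensor_quot K B M N)"
    "Cod K (tsec B M N) = fst M \<otimes> fst N"
    "tensor_quot K B M N \<cdot> tsec B M N = \<I> (Cod K (tensor_quot K B M N))"
    "tsec B M N \<cdot> tensor_quot K B M N = lact B M (fst N) \<cdot> tw B M N"
proof -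
  note t = tensor_quot_aux[OF assms]
  show "tensor_quot K B M N \<in> Ar K" "Dom K (tensor_quot K B M N) = fst M \<otimes> fst N"
    "tensor_quot K B M N \<cdot> lact B M (fst N) = tensor_quot K B M N \<cdot> ract B (fst M) N"
    using t by blast+
  have "tsec B M N \<in> Hom (Cod K (tensor_quot K B M N)) (fst M \<otimes> fst N) \<and>
     tensor_quot K B M N \<cdot> tsec B M N = \<I> (Cod K (tensor_quot K B M N)) \<and>
     tsec B M N \<cdot> tensor_quot K B M N = lact B M (fst N) \<cdot> tw B M N"
    unfolding tsec_def by (rule someI_ex) (use t in blast)
  then show "tsec B M N \<in> Ar K" "Dom K (tsec B M N) = Cod K (tensor_quot K B M N)"
    "Cod K (tsec B M N) = fst M \<otimes> fst N"
    "tensor_quot K B M N \<cdot> tsec B M N = \<I> (Cod K (tensor_quot K B M N))"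
    "tsec B M N \<cdot> tensor_quot K B M N = lact B M (fst N) \<cdot> tw B M N"
    by simp_all
qed

text \<open>The coequalizer is split, hence preserved by every functor; these are the functors needed.\<close>

lemma tensor_quot_descend:
  assumes B: "tt_ring K B" and M: "M \<in> modules K B" and N: "N \<in> modules K B"
    and h: "h \<in> Ar K" "Dom K h = fst M \<otimes> fst N" "h \<cdot> lact B M (fst N) = h \<cdot> ract B (fst M) N"
  shows "h \<cdot> tsec B M N \<cdot> tensor_quot K B M N = h"
proof -
  note [simp] = modulesD(1-4)[OF B M] modulesD(1-4)[OF B N] tt_ringD[OF B] tw(1-4)[OF B M N] h(1,2)
    tensor_quot(1,2,4-8)[OF B M N]
  show ?thesis
    by (simp add: h(3)[THEN reassoc])
qed

lemma tensor_quot_descend_left: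
  assumes B: "tt_ring K B" and M: "M \<in> modules K B" and N: "N \<in> modules K B" and c: "c \<in> Ob K"
    and h: "h \<in> Ar K" "Dom K h = c \<otimes> (fst M \<otimes> fst N)"
    "h \<cdot> (\<I> c \<odot> lact B M (fst N)) = h \<cdot> (\<I> c \<odot> ract B (fst M) N)"
  shows "h \<cdot> (\<I> c \<odot> tsec B M N) \<cdot> (\<I> c \<odot> tensor_quot K B M N) = h"
proof -
  note [simp] = modulesD(1-4)[OF B M] modulesD(1-4)[OF B N] tt_ringD[OF B] tw(1-4)[OF B M N] h(1,2) c
    tensor_quot(1,2,4-8)[OF B M N]
  have "h \<cdot> (\<I> c \<odot> tsec B M N) \<cdot> (\<I> c \<odot> tensor_quot K B M N) = (h \<cdot> (\<I> c \<odot> lact B M (fst N))) \<cdot> (\<I> c \<odot> tw B M N)"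
    by (simp add: merge)
  also have "\<dots> = h" unfolding h(3) by (simp add: merge)
  finally show ?thesis .
qed

lemma tensor_quot_descend_right:
  assumes B: "tt_ring K B" and M: "M \<in> modules K B" and N: "N \<in> modules K B" and c: "c \<in> Ob K"
    and h: "h \<in> Ar K" "Dom K h = (fst M \<otimes> fst N) \<otimes> c"
    "h \<cdot> (lact B M (fst N) \<odot> \<I> c) = h \<cdot> (ract B (fst M) N \<odot> \<I> c)"
  shows "h \<cdot> (tsec B M N \<odot> \<I> c) \<cdot> (tensor_quot K B M N \<odot> \<I> c) = h"
proof -
  note [simp] = modulesD(1-4)[OF B M] modulesD(1-4)[OF B N] tt_ringD[OF B] tw(1-4)[OF B M N] h(1,2) c
    tensor_quot(1,2,4-8)[OF B M N]
  have "h \<cdot> (tsec B M N \<odot> \<I> c) \<cdot> (tensor_quot K B M N \<odot> \<I> c) = (h \<cdot> (lact B M (fst N) \<odot> \<I> c)) \<cdot> (tw B M N \<odot> \<I> c)"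
    by (simp add: merge)
  also have "\<dots> = h" unfolding h(3) by (simp add: merge)
  finally show ?thesis .
qed

text \<open>For \<open>f : B \<rightarrow> C\<close>, a \<open>C\<close>-module \<open>L\<close> and a \<open>B\<close>-module \<open>N\<close>, this is \<open>L \<otimes>\<^sub>B N\<close> with the
  action of \<open>C\<close> on \<open>L\<close>. It contains extension of scalars (\<open>L = C\<close>) and the tensor product of
  \<open>C\<close>-modules (\<open>f = 1\<close>).\<close>

definition rten where
  "rten C B f L N = (let q = tensor_quot K B (res_mod f L) N in
    (Cod K q, induced K (\<I> (robj C) \<odot> q) (q \<cdot> lact C L (fst N))))"

lemma tensor_mod_rten:
  assumes C: "tt_ring K C" and L: "L \<in> modules K C" and N: "N \<in> modules K C"
  shows "tensor_mod K C L N = rten C C (\<I> (robj C)) L N"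
proof -
  show ?thesis
    by (simp add: tensor_mod_def rten_def res_mod_ident[OF C L] ext_def Let_def)
qed

context
  fixes B C f L N
  assumes B: "tt_ring K B" and C: "tt_ring K C" and f: "ring_hom K B C f"
    and L: "L \<in> modules K C" and N: "N \<in> modules K B"
begin

abbreviation "rq \<equiv> tensor_quot K B (res_mod f L) N"
abbreviation "rs \<equiv> tsec B (res_mod f L) N"

lemmas rten_base = tt_ringD[OF B] tt_ringD[OF C] ring_homD[OF f] modulesD(1-4)[OF C L] modulesD(1-4)[OF B N]
  modulesD(1-4)[OF B res_mod_modules[OF B C f L], simplified]

lemmas rq = tensor_quot[OF B res_mod_modules[OF B C f L] N, simplified]
lemmas rq_desc = tensor_quot_descend[OF B res_mod_modules[OF B C f L] N, simplified]
lemmas rq_desc_left = tensor_quot_descend_left[OF B res_mod_modules[OF B C f L] N, simplified]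
lemmas rq_desc_right = tensor_quot_descend_right[OF B res_mod_modules[OF B C f L] N, simplified]

lemma rten_fst: "fst (rten C B f L N) = Cod K rq"
  by (simp add: rten_def Let_def)

lemma restricted_commute:
  "commute (robj C) (robj B) (fst L \<otimes> fst N) (lact C L (fst N)) (lact B (res_mod f L) (fst N))"
proof -
  note [simp] = rten_base
  have "commute (robj C) (robj C) (fst L) (snd L) (snd L)"
    using L unfolding modules_iff[OF C] by (rule commute_self[OF C])
  then have "commute (robj B) (robj C) (fst L) (snd (res_mod f L)) (snd L)"
    unfolding res_mod_def snd_conv by (rule commute_restrict) simp_all
  from commute_ext[OF commute_sym[OF this], of "fst N"] show ?thesis
    by simp
qed

text \<open>The action of \<open>C\<close> descends to \<open>L \<otimes>\<^sub>B N\<close>: it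
  commutes with the restricted action of \<open>B\<close> on \<open>L\<close> because
  \<open>C\<close> is commutative, and with the action on \<open>N\<close> because that sits on the
  other factor.\<close>

lemma rten_act_aux:
  "rq \<cdot> lact C L (fst N) \<cdot> (\<I> (robj C) \<odot> lact B (res_mod f L) (fst N)) =
   rq \<cdot> lact C L (fst N) \<cdot> (\<I> (robj C) \<odot> ract B (fst L) N)"
proof -
  note [simp] = rten_base rq(1,2)
  let ?c = "robj C" let ?b = "robj B"
  have c2: "commute ?c ?b (fst L \<otimes> fst N) (lact C L (fst N)) (ract B (fst L) N)"
    by (rule commute_ext_lift) simp_all
  have "rq \<cdot> lact C L (fst N) \<cdot> (\<I> ?c \<odot> lact B (res_mod f L) (fst N)) =
    rq \<cdot> lact B (res_mod f L) (fst N) \<cdot> (\<I> ?b \<odot> lact C L (fst N)) \<cdot> sw ?c ?b (fst L \<otimes> fst N)"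
    using restricted_commute by (simp add: commute_def)
  also have "\<dots> = rq \<cdot> ract B (fst L) N \<cdot> (\<I> ?b \<odot> lact C L (fst N)) \<cdot> sw ?c ?b (fst L \<otimes> fst N)"
    by (simp add: rq(3)[THEN reassoc])
  also have "\<dots> = rq \<cdot> lact C L (fst N) \<cdot> (\<I> ?c \<odot> ract B (fst L) N)"
    using c2 by (simp add: commute_def)
  finally show ?thesis .
qed

lemma rten_snd:
  shows "snd (rten C B f L N) = rq \<cdot> lact C L (fst N) \<cdot> (\<I> (robj C) \<odot> rs)"
    "snd (rten C B f L N) \<cdot> (\<I> (robj C) \<odot> rq) = rq \<cdot> lact C L (fst N)"
proof -
  note [simp] = rten_base rq(1,2,4-8)
  let ?h = "rq \<cdot> lact C L (fst N)"
  have d: "?h \<cdot> (\<I> (robj C) \<odot> rs) \<cdot> (\<I> (robj C) \<odot> rq) = ?h"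
    using rten_act_aux by (intro rq_desc_left) simp_all
  have "induced K (\<I> (robj C) \<odot> rq) ?h = ?h \<cdot> (\<I> (robj C) \<odot> rs)"
    by (rule induced_eq) (use d in \<open>simp_all add: merge\<close>)
  then show 1: "snd (rten C B f L N) = rq \<cdot> lact C L (fst N) \<cdot> (\<I> (robj C) \<odot> rs)"
    by (simp add: rten_def Let_def)
  show "snd (rten C B f L N) \<cdot> (\<I> (robj C) \<odot> rq) = rq \<cdot> lact C L (fst N)"
    unfolding 1 using d by simp
qed

text \<open>The section survives tensoring, so \<open>rq\<close> stays an epimorphism with
  spectators around it. This and the following variants reduce identities on
  \<open>L \<otimes>\<^sub>B N\<close> to identities on \<open>L \<otimes> N\<close>.\<close>

lemma rq_epi:
  assumes "h \<cdot> rq = k \<cdot> rq" "h \<in> Ar K" "k \<in> Ar K" "Dom K h = Cod K rq" "Dom K k = Cod K rq"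
  shows "h = k"
  by (rule comp_cancel_right[OF assms(1) rq(7)]) (use assms(2-) rq(1,2,4-6) in simp_all)

lemma rq_epi_left:
  assumes "h \<cdot> (\<I> c \<odot> rq) = k \<cdot> (\<I> c \<odot> rq)" "h \<in> Ar K" "k \<in> Ar K" "Dom K h = c \<otimes> Cod K rq" "Dom K k = c \<otimes> Cod K rq"
    "c \<in> Ob K"
  shows "h = k"
  by (rule comp_cancel_right[OF assms(1), of "\<I> c \<odot> rs"]) (use assms(2-) rq in \<open>simp_all add: merge\<close>)

lemma rq_epi_left2:
  assumes "h \<cdot> (\<I> c \<odot> (\<I> d \<odot> rq)) = k \<cdot> (\<I> c \<odot> (\<I> d \<odot> rq))" "h \<in> Ar K" "k \<in> Ar K"
    "Dom K h = c \<otimes> (d \<otimes> Cod K rq)" "Dom K k = c \<otimes> (d \<otimes> Cod K rq)"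
    "c \<in> Ob K" "d \<in> Ob K"
  shows "h = k"
  by (rule comp_cancel_right[OF assms(1), of "\<I> c \<odot> (\<I> d \<odot> rs)"]) (use assms(2-) rq in \<open>simp_all add: merge\<close>)

lemma rq_epi_left_right:
  assumes "h \<cdot> (\<I> c \<odot> (rq \<odot> \<I> d)) = k \<cdot> (\<I> c \<odot> (rq \<odot> \<I> d))" "h \<in> Ar K" "k \<in> Ar K"
    "Dom K h = c \<otimes> (Cod K rq \<otimes> d)" "Dom K k = c \<otimes> (Cod K rq \<otimes> d)"
    "c \<in> Ob K" "d \<in> Ob K"
  shows "h = k"
  by (rule comp_cancel_right[OF assms(1), of "\<I> c \<odot> (rs \<odot> \<I> d)"]) (use assms(2-) rq in \<open>simp_all add: merge\<close>)

lemma rq_epi_right: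
  assumes "h \<cdot> (rq \<odot> \<I> d) = k \<cdot> (rq \<odot> \<I> d)" "h \<in> Ar K" "k \<in> Ar K"
    "Dom K h = Cod K rq \<otimes> d" "Dom K k = Cod K rq \<otimes> d" "d \<in> Ob K"
  shows "h = k"
  by (rule comp_cancel_right[OF assms(1), of "rs \<odot> \<I> d"]) (use assms(2-) rq in \<open>simp_all add: merge\<close>)

lemma rten_modules: "rten C B f L N \<in> modules K C"
proof -
  note [simp] = rten_base rq(1,2)
  let ?c = "robj C" let ?k = "snd (rten C B f L N)" let ?z = "Cod K rq" let ?a = "lact C L (fst N)"
  have [simp]: "?k \<in> Ar K" "Dom K ?k = ?c \<otimes> ?z" "Cod K ?k = ?z"
    by (simp_all add: rten_snd(1) rq(4-6))
  have a: "action C (fst L \<otimes> fst N) ?a"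
    using L unfolding modules_iff[OF C] by (rule action_ext[OF C]) simp
  have "?k \<cdot> ext ?c ?c (mult C) ?z = ?k \<cdot> (\<I> ?c \<odot> ?k)"
  proof (rule rq_epi_left2)
    have "(?k \<cdot> ext ?c ?c (mult C) ?z) \<cdot> (\<I> ?c \<odot> (\<I> ?c \<odot> rq)) = ?k \<cdot> (\<I> ?c \<odot> rq) \<cdot> ext ?c ?c (mult C) (fst L \<otimes> fst N)"
      by (simp add: ext_nat_right)
    also have "\<dots> = rq \<cdot> (?a \<cdot> ext ?c ?c (mult C) (fst L \<otimes> fst N))"
      by (simp add: rten_snd(2)[THEN reassoc])
    also have "\<dots> = ?k \<cdot> (\<I> ?c \<odot> rq) \<cdot> (\<I> ?c \<odot> ?a)"
      unfolding actionD(5)[OF a] by (simp add: rten_snd(2)[THEN reassoc])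
    also have "\<dots> = ?k \<cdot> (\<I> ?c \<odot> (?k \<cdot> (\<I> ?c \<odot> rq)))"
      unfolding rten_snd(2) by (simp add: merge)
    finally show "(?k \<cdot> ext ?c ?c (mult C) ?z) \<cdot> (\<I> ?c \<odot> (\<I> ?c \<odot> rq)) = (?k \<cdot> (\<I> ?c \<odot> ?k)) \<cdot> (\<I> ?c \<odot> (\<I> ?c \<odot> rq))"
      by (simp add: merge)
  qed simp_all
  moreover have "?k \<cdot> uext (unit C) ?z = \<I> ?z"
  proof (rule rq_epi)
    have "(?k \<cdot> uext (unit C) ?z) \<cdot> rq = (?k \<cdot> (\<I> ?c \<odot> rq)) \<cdot> uext (unit C) (fst L \<otimes> fst N)"
      by (simp add: uext_nat)
    then show "(?k \<cdot> uext (unit C) ?z) \<cdot> rq = \<I> ?z \<cdot> rq"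
      unfolding rten_snd(2) using actionD(6)[OF a] by simp
  qed simp_all
  ultimately show ?thesis
    by (simp add: modules_iff[OF C] action_def rten_fst)
qed

end

text \<open>This is an equality of pairs because both sides use the same chosen
  \<open>tensor_quot\<close>; only the two actions of \<open>B\<close> are left to compare.\<close>

lemma res_mod_rten:
  assumes B: "tt_ring K B" and C: "tt_ring K C" and f: "ring_hom K B C f"
    and L: "L \<in> modules K C" and N: "N \<in> modules K B"
  shows "res_mod f (rten C B f L N) = rten B B (\<I> (robj B)) (res_mod f L) N"
proof -
  let ?q = "tensor_quot K B (res_mod f L) N"
  let ?P = "rten C B f L N" and ?P' = "rten B B (\<I> (robj B)) (res_mod f L) N"
  note RL = res_mod_modules[OF B C f L]
  have r: "res_mod (\<I> (robj B)) (res_mod f L) = res_mod f L"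
    by (rule res_mod_ident[OF B RL])
  note 1 = rten_snd(2)[OF B C f L N] rten_modules[OF B C f L N] rten_fst[OF B C f L N]
  note 2 = rten_snd(2)[OF B B ring_hom_ident[OF B] RL N, unfolded r]
    rten_modules[OF B B ring_hom_ident[OF B] RL N] rten_fst[OF B B ring_hom_ident[OF B] RL N, unfolded r]
  note [simp] = rten_base[OF B C f L N] rq(1,2)[OF B C f L N] modulesD(1-4)[OF C 1(2), unfolded 1(3)]
    modulesD(1-4)[OF B 2(2), unfolded 2(3)] 1(3) 2(3)
  have "snd ?P \<cdot> (f \<odot> \<I> (Cod K ?q)) = snd ?P'"
  proof (rule rq_epi_left[OF B C f L N])
    have "(snd ?P \<cdot> (f \<odot> \<I> (Cod K ?q))) \<cdot> (\<I> (robj B) \<odot> ?q) = (snd ?P \<cdot> (\<I> (robj C) \<odot> ?q)) \<cdot> (f \<odot> \<I> (fst L \<otimes> fst N))"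
      by (simp add: merge)
    also have "\<dots> = ?q \<cdot> lact B (res_mod f L) (fst N)"
    proof -
      have "lact B (res_mod f L) (fst N) = lact C L (fst N) \<cdot> (f \<odot> \<I> (fst L \<otimes> fst N))"
        by (simp add: res_mod_def ext_TenA)
      then show ?thesis unfolding 1(1) by simp
    qed
    finally show "(snd ?P \<cdot> (f \<odot> \<I> (Cod K ?q))) \<cdot> (\<I> (robj B) \<odot> ?q) = snd ?P' \<cdot> (\<I> (robj B) \<odot> ?q)"
      unfolding 2(1) by simp
  qed simp_all
  then show ?thesis
    by (intro prod_eqI) (simp_all add: res_mod_def[of f ?P])
qed

end

context symmetric_monoidal_category
begin

lemma ext_map:
  assumes [simp]: "b \<in> Ob K" "x \<in> Ob K" "u \<in> Ar K" "v \<in> Ar K" "r \<in> Ar K" "Dom K r = b \<otimes> x" "Cod K r = Dom K u"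
    "r' \<in> Ar K" "Dom K r' = b \<otimes> x'" "Dom K v = y" "Cod K v = y'" "Dom K u = t"
    and e: "u \<cdot> r = r' \<cdot> (\<I> b \<odot> w)" and w: "w \<in> Ar K" "Dom K w = x" "Cod K w = x'"
  shows "(u \<odot> v) \<cdot> ext b x r y = ext b x' r' y' \<cdot> (\<I> b \<odot> (w \<odot> v))"
proof -
  note [simp] = w
  have [simp]: "x' \<in> Ob K" "y \<in> Ob K" "y' \<in> Ob K" 
    using w Cod_Ob[of w] Cod_Ob[of v] Dom_Ob[of v] by simp_all
  have c: "Cod K u = Cod K r'" using arg_cong[OF e, of "Cod K"] by simp
  have "ext b x' r' y' \<cdot> (\<I> b \<odot> (w \<odot> v)) = (\<I> (Cod K r') \<odot> v) \<cdot> ext b x (r' \<cdot> (\<I> b \<odot> w)) y"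
    using ext_nat[of "\<I> b" w v r' b x' y'] by simp
  also have "\<dots> = (u \<odot> v) \<cdot> ext b x r y"
    unfolding e[symmetric] by (simp add: ext_comp merge flip: c)
  finally show ?thesis by simp
qed

lemma lift_map:
  assumes [simp]: "b \<in> Ob K" "u \<in> Ar K" "v \<in> Ar K" "r \<in> Ar K" "Dom K r = b \<otimes> y" "Cod K r = Dom K v"
    "r' \<in> Ar K" "Dom K r' = b \<otimes> y'" "Dom K u = x" "Cod K u = x'" "Dom K v = t"
    and e: "v \<cdot> r = r' \<cdot> (\<I> b \<odot> w)" and w: "w \<in> Ar K" "Dom K w = y" "Cod K w = y'"
  shows "(u \<odot> v) \<cdot> lift x b r y = lift x' b r' y' \<cdot> (\<I> b \<odot> (u \<odot> w))"
proof -
  note [simp] = w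
  have [simp]: "x \<in> Ob K" "x' \<in> Ob K" "y \<in> Ob K" "y' \<in> Ob K" 
    using w Cod_Ob[of w] Dom_Ob[of w] Cod_Ob[of u] Dom_Ob[of u] by simp_all
  have "lift x' b r' y' \<cdot> (\<I> b \<odot> (u \<odot> w)) = (u \<odot> (r' \<cdot> (\<I> b \<odot> w))) \<cdot> sw b x y"
    using lift_nat[of b u w r' x' y'] by simp
  also have "\<dots> = (u \<odot> v) \<cdot> lift x b r y"
    unfolding e[symmetric] by (simp add: lift_def merge)
  finally show ?thesis by simp
qed

section \<open>Morphisms and retracts of modules\<close>

definition mhom :: "('a, 'b) ring_object \<Rightarrow> 'a \<times> 'b \<Rightarrow> 'a \<times> 'b \<Rightarrow> 'b \<Rightarrow> bool" where
  "mhom C M N f \<longleftrightarrow> M \<in> modules K C \<and> N \<in> modules K C \<and> f \<in> Hom (fst M) (fst N) \<and>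
     f \<cdot> snd M = snd N \<cdot> (\<I> (robj C) \<odot> f)"

text \<open>Direct summands without a named complement: this form composes and is preserved by
  functors. \<open>mret_biproduct\<close> produces the complement where \<open>thick_ideal\<close>
  asks for a biproduct.\<close>

definition mret :: "('a, 'b) ring_object \<Rightarrow> 'a \<times> 'b \<Rightarrow> 'a \<times> 'b \<Rightarrow> bool" where
  "mret C M N \<longleftrightarrow> (\<exists>i p. mhom C M N i \<and> mhom C N M p \<and> p \<cdot> i = \<I> (fst M))"

definition miso :: "('a, 'b) ring_object \<Rightarrow> 'a \<times> 'b \<Rightarrow> 'a \<times> 'b \<Rightarrow> bool" where
  "miso C M N \<longleftrightarrow> (\<exists>i p. mhom C M N i \<and> mhom C N M p \<and> p \<cdot> i = \<I> (fst M) \<and> i \<cdot> p = \<I> (fst N))"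

lemma mhomD:
  assumes "mhom C M N f"
  shows "M \<in> modules K C" "N \<in> modules K C" "f \<in> Ar K" "Dom K f = fst M" "Cod K f = fst N"
    "f \<cdot> snd M = snd N \<cdot> (\<I> (robj C) \<odot> f)"
  using assms by (simp_all add: mhom_def)

lemma module_arrows_iff: "F \<in> module_arrows K C \<longleftrightarrow> mhom C (fst F) (snd (snd F)) (arrow_of F)"
  by (cases F) (simp add: module_arrows_def mhom_def arrow_of_def)

lemma mhom_ident:
  assumes "tt_ring K C" "M \<in> modules K C"
  shows "mhom C M M (\<I> (fst M))"
  using assms modulesD[OF assms] tt_ringD[OF assms(1)] by (simp add: mhom_def)

lemma mhom_comp:
  assumes C: "tt_ring K C" and f: "mhom C L M f" and g: "mhom C M N g"
  shows "mhom C L N (g \<cdot> f)"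
proof -
  note [simp] = mhomD(1-5)[OF f] mhomD(1-5)[OF g] tt_ringD[OF C] modulesD(1-4)[OF C mhomD(1)[OF f]]
    modulesD(1-4)[OF C mhomD(2)[OF f]]  modulesD(1-4)[OF C mhomD(2)[OF g]]
  show ?thesis
    by (simp add: mhom_def mhomD(6)[OF f] mhomD(6)[OF g, THEN reassoc] merge)
qed

lemma mhom_res:
  assumes B: "tt_ring K B" and C: "tt_ring K C" and f: "ring_hom K B C f" and u: "mhom C M N u"
  shows "mhom B (res_mod f M) (res_mod f N) u"
proof -
  note [simp] = mhomD(1-5)[OF u] tt_ringD[OF C] tt_ringD[OF B] modulesD(1-4)[OF C mhomD(1)[OF u]]
    modulesD(1-4)[OF C mhomD(2)[OF u]] ring_homD[OF f]
  show ?thesis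
    using res_mod_modules[OF B C f mhomD(1)[OF u]] res_mod_modules[OF B C f mhomD(2)[OF u]]
    by (simp add: mhom_def) (simp add: res_mod_def mhomD(6)[OF u, THEN reassoc] merge)
qed

lemma mhom_inverse:
  assumes C: "tt_ring K C" and f: "mhom C M N f" and g: "g \<in> Hom (fst N) (fst M)" "g \<cdot> f = \<I> (fst M)" "f \<cdot> g = \<I> (fst N)"
  shows "mhom C N M g"
proof -
  note [simp] = mhomD(1-5)[OF f] tt_ringD[OF C] modulesD(1-4)[OF C mhomD(1)[OF f]]
    modulesD(1-4)[OF C mhomD(2)[OF f]]
  have [simp]: "g \<in> Ar K" "Dom K g = fst N" "Cod K g = fst M" using g(1) by simp_all
  have "g \<cdot> snd N = g \<cdot> (snd N \<cdot> (\<I> (robj C) \<odot> f)) \<cdot> (\<I> (robj C) \<odot> g)"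
    by (simp add: merge g(3))
  also have "\<dots> = snd M \<cdot> (\<I> (robj C) \<odot> g)"
    unfolding mhomD(6)[OF f, symmetric] by (simp add: g(2)[THEN reassoc])
  finally show ?thesis by (simp add: mhom_def)
qed

lemma misoI:
  assumes "tt_ring K C" "mhom C M N f" "g \<in> Hom (fst N) (fst M)" "g \<cdot> f = \<I> (fst M)" "f \<cdot> g = \<I> (fst N)"
  shows "miso C M N"
  unfolding miso_def by (intro exI conjI, rule assms(2), rule mhom_inverse[OF assms], (rule assms)+)

lemma mretI: "mhom C M N i \<Longrightarrow> mhom C N M p \<Longrightarrow> p \<cdot> i = \<I> (fst M) \<Longrightarrow> mret C M N"
  by (auto simp: mret_def)

lemma miso_sym: "miso C M N \<Longrightarrow> miso C N M"
  unfolding miso_def by (elim exE conjE, intro exI conjI)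

lemma miso_mret: "miso C M N \<Longrightarrow> mret C M N"
  unfolding miso_def mret_def by (elim exE conjE, intro exI conjI)

lemma mret_trans:
  assumes C: "tt_ring K C" and "mret C L M" "mret C M N"
  shows "mret C L N"
proof -
  obtain i p where i: "mhom C L M i" and p: "mhom C M L p" and pi: "p \<cdot> i = \<I> (fst L)"
    using assms(2) by (auto simp: mret_def)
  obtain j q where j: "mhom C M N j" and q: "mhom C N M q" and qj: "q \<cdot> j = \<I> (fst M)"
    using assms(3) by (auto simp: mret_def)
  note [simp] = mhomD(3-5)[OF i] mhomD(3-5)[OF p] mhomD(3-5)[OF j] mhomD(3-5)[OF q]
  show ?thesis
    by (rule mretI[OF mhom_comp[OF C i j] mhom_comp[OF C q p]]) (simp add: qj[THEN reassoc] pi)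
qed

lemma mret_refl: "tt_ring K C \<Longrightarrow> M \<in> modules K C \<Longrightarrow> mret C M M"
  by (rule mretI[OF mhom_ident mhom_ident]) (auto dest: modulesD(1))

lemma mret_res:
  assumes B: "tt_ring K B" and C: "tt_ring K C" and f: "ring_hom K B C f" and u: "mret C M N"
  shows "mret B (res_mod f M) (res_mod f N)"
proof -
  obtain i p where i: "mhom C M N i" and p: "mhom C N M p" and pi: "p \<cdot> i = \<I> (fst M)"
    using u by (auto simp: mret_def)
  show ?thesis by (rule mretI[OF mhom_res[OF B C f i] mhom_res[OF B C f p]]) (simp add: pi)
qed

lemma self_mod_modules: "tt_ring K C \<Longrightarrow> self_mod C \<in> modules K C"
  by (simp add: modules_iff self_mod_def action_self)

lemma self_mod_simps [simp]: "fst (self_mod C) = robj C" "snd (self_mod C) = mult C"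
  by (simp_all add: self_mod_def)

end

section \<open>Functoriality, symmetry, units and associativity of relative tensor products\<close>

context tt_category
begin

lemma rten_univ:
  assumes B: "tt_ring K B" and C: "tt_ring K C" and f: "ring_hom K B C f"
    and L: "L \<in> modules K C" and N: "N \<in> modules K B" and M: "M \<in> modules K C"
    and g: "g \<in> Hom (fst L \<otimes> fst N) (fst M)" "g \<cdot> lact B (res_mod f L) (fst N) = g \<cdot> ract B (fst L) N"
      "g \<cdot> lact C L (fst N) = snd M \<cdot> (\<I> (robj C) \<odot> g)"
  shows "mhom C (rten C B f L N) M (g \<cdot> tsec B (res_mod f L) N)"
    "g \<cdot> tsec B (res_mod f L) N \<cdot> tensor_quot K B (res_mod f L) N = g"
proof -
  let ?q = "tensor_quot K B (res_mod f L) N" and ?s = "tsec B (res_mod f L) N" and ?P = "rten C B f L N"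
  note P = rten_modules[OF B C f L N] and F = rten_fst[OF B C f L N]
  note [simp] = rten_base[OF B C f L N] modulesD(1-4)[OF C P, unfolded F] modulesD(1-4)[OF C M] F rq(1,2,4-6)[OF B C f L N]
  have [simp]: "g \<in> Ar K" "Dom K g = fst L \<otimes> fst N" "Cod K g = fst M" using g(1) by simp_all
  show gs: "g \<cdot> ?s \<cdot> ?q = g"
    by (rule rq_desc[OF B C f L N]) (use g(2) in simp_all)
  have "(g \<cdot> ?s) \<cdot> snd ?P = snd M \<cdot> (\<I> (robj C) \<odot> (g \<cdot> ?s))"
  proof (rule rq_epi_left[OF B C f L N])
    have "((g \<cdot> ?s) \<cdot> snd ?P) \<cdot> (\<I> (robj C) \<odot> ?q) = (g \<cdot> ?s \<cdot> ?q) \<cdot> lact C L (fst N)"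
      by (simp add: rten_snd(2)[OF B C f L N])
    also have "\<dots> = snd M \<cdot> (\<I> (robj C) \<odot> (g \<cdot> ?s \<cdot> ?q))"
      unfolding gs by (rule g)
    finally show "((g \<cdot> ?s) \<cdot> snd ?P) \<cdot> (\<I> (robj C) \<odot> ?q) = (snd M \<cdot> (\<I> (robj C) \<odot> (g \<cdot> ?s))) \<cdot> (\<I> (robj C) \<odot> ?q)"
      by (simp add: merge)
  qed simp_all
  then show "mhom C ?P M (g \<cdot> ?s)" using P M by (simp add: mhom_def)
qed

lemma rten_map:
  assumes B: "tt_ring K B" and C: "tt_ring K C" and f: "ring_hom K B C f"
    and u: "mhom C L L' u" and v: "mhom B N N' v"
  shows "\<exists>m. mhom C (rten C B f L N) (rten C B f L' N') m \<and>
    m \<cdot> tensor_quot K B (res_mod f L) N = tensor_quot K B (res_mod f L') N' \<cdot> (u \<odot> v)"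
proof -
  note LN = mhomD(1,2)[OF u] mhomD(1,2)[OF v]
  note P = rten_modules[OF B C f LN(2,4)] and F = rten_fst[OF B C f LN(2,4)]
  let ?q = "tensor_quot K B (res_mod f L') N'"
  note [simp] = rten_base[OF B C f LN(1,3)] rten_base[OF B C f LN(2,4)] mhomD(3-5)[OF u] mhomD(3-5)[OF v] F
    rq(1,2)[OF B C f LN(2,4)] modulesD(1-4)[OF C P, unfolded F]
  have 1: "(u \<odot> v) \<cdot> lact B (res_mod f L) (fst N) = lact B (res_mod f L') (fst N') \<cdot> (\<I> (robj B) \<odot> (u \<odot> v))"
    by (rule ext_map) (use mhomD(6)[OF mhom_res[OF B C f u]] in simp_all)
  have 2: "(u \<odot> v) \<cdot> lact C L (fst N) = lact C L' (fst N') \<cdot> (\<I> (robj C) \<odot> (u \<odot> v))"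
    by (rule ext_map) (use mhomD(6)[OF u] in simp_all)
  have 3: "(u \<odot> v) \<cdot> ract B (fst L) N = ract B (fst L') N' \<cdot> (\<I> (robj B) \<odot> (u \<odot> v))"
    by (rule lift_map) (use mhomD(6)[OF v] in simp_all)
  have a: "?q \<cdot> (u \<odot> v) \<in> Hom (fst L \<otimes> fst N) (fst (rten C B f L' N'))" by simp
  have b: "(?q \<cdot> (u \<odot> v)) \<cdot> lact B (res_mod f L) (fst N) = (?q \<cdot> (u \<odot> v)) \<cdot> ract B (fst L) N"
    by (simp add: 1[unfolded fst_res_mod] 3 rq(3)[OF B C f LN(2,4), THEN reassoc])
  have c: "(?q \<cdot> (u \<odot> v)) \<cdot> lact C L (fst N) = snd (rten C B f L' N') \<cdot> (\<I> (robj C) \<odot> (?q \<cdot> (u \<odot> v)))"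
  proof -
    have "(?q \<cdot> (u \<odot> v)) \<cdot> lact C L (fst N) = (snd (rten C B f L' N') \<cdot> (\<I> (robj C) \<odot> ?q)) \<cdot> (\<I> (robj C) \<odot> (u \<odot> v))"
      unfolding rten_snd(2)[OF B C f LN(2,4)] by (simp add: 2)
    then show ?thesis by (simp add: merge)
  qed
  note U = rten_univ[OF B C f LN(1,3) P a b c]
  show ?thesis
    by (rule exI, rule conjI, rule U(1)) (use U(2) rq(1,2,4-6)[OF B C f LN(1,3)] in simp)
qed

lemma mret_rten:
  assumes B: "tt_ring K B" and C: "tt_ring K C" and f: "ring_hom K B C f"
    and u: "mret C L L'" and v: "mret B N N'"
  shows "mret C (rten C B f L N) (rten C B f L' N')"
proof -
  obtain i p where i: "mhom C L L' i" and p: "mhom C L' L p" and pi: "p \<cdot> i = \<I> (fst L)"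
    using u by (auto simp: mret_def)
  obtain j r where j: "mhom B N N' j" and r: "mhom B N' N r" and rj: "r \<cdot> j = \<I> (fst N)"
    using v by (auto simp: mret_def)
  let ?q = "tensor_quot K B (res_mod f L) N" let ?q' = "tensor_quot K B (res_mod f L') N'"
  note LN = mhomD(1,2)[OF i] mhomD(1,2)[OF j]
  obtain m where m: "mhom C (rten C B f L N) (rten C B f L' N') m" and mq: "m \<cdot> ?q = ?q' \<cdot> (i \<odot> j)"
    using rten_map[OF B C f i j] by blast
  obtain n where n: "mhom C (rten C B f L' N') (rten C B f L N) n" and nq: "n \<cdot> ?q' = ?q \<cdot> (p \<odot> r)"
    using rten_map[OF B C f p r] by blast
  note F = rten_fst[OF B C f LN(1,3)] rten_fst[OF B C f LN(2,4)]
  note [simp] = rten_base[OF B C f LN(1,3)] rten_base[OF B C f LN(2,4)] mhomD(3-5)[OF i] mhomD(3-5)[OF j]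
    mhomD(3-5)[OF p] mhomD(3-5)[OF r] mhomD(3-5)[OF m, unfolded F] mhomD(3-5)[OF n, unfolded F]
    rq(1,2)[OF B C f LN(1,3)] rq(1,2)[OF B C f LN(2,4)]
  show ?thesis
  proof (rule mretI[OF m n], rule rq_epi[OF B C f LN(1,3)])
    show "(n \<cdot> m) \<cdot> ?q = \<I> (fst (rten C B f L N)) \<cdot> ?q"
      by (simp add: mq nq[THEN reassoc] merge pi rj F)
  qed (simp_all add: F)
qed

lemma rten_comm:
  assumes C: "tt_ring K C" and M: "M \<in> modules K C" and N: "N \<in> modules K C"
  shows "miso C (rten C C (\<I> (robj C)) M N) (rten C C (\<I> (robj C)) N M)"
proof -
  let ?i = "\<I> (robj C)"
  note I = ring_hom_ident[OF C]
  have *: "\<exists>m. mhom C (rten C C ?i M N) (rten C C ?i N M) m \<and>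
     m \<cdot> tensor_quot K C M N = tensor_quot K C N M \<cdot> \<gamma> (fst M) (fst N)"
    if M: "M \<in> modules K C" and N: "N \<in> modules K C" for M N
  proof -
    note r = res_mod_ident[OF C M] res_mod_ident[OF C N]
    note P = rten_modules[OF C C I N M, unfolded r] and F = rten_fst[OF C C I N M, unfolded r]
    note [simp] = rten_base[OF C C I M N] rten_base[OF C C I N M] F rq(1,2)[OF C C I N M, unfolded r]
      modulesD(1-4)[OF C P, unfolded F]
    let ?q = "tensor_quot K C N M" let ?x = "fst M" let ?y = "fst N" let ?c = "robj C"
    have 1: "\<gamma> ?x ?y \<cdot> lact C M ?y = ract C ?y M \<cdot> (\<I> ?c \<odot> \<gamma> ?x ?y)"
      by (rule braid_ext) simp_all
    have 2: "\<gamma> ?x ?y \<cdot> ract C ?x N = lact C N ?x \<cdot> (\<I> ?c \<odot> \<gamma> ?x ?y)"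
      by (rule braid_lift) simp_all
    have 3: "(?q \<cdot> \<gamma> ?x ?y) \<cdot> lact C M ?y = (?q \<cdot> lact C N ?x) \<cdot> (\<I> ?c \<odot> \<gamma> ?x ?y)"
      unfolding rq(3)[OF C C I N M, unfolded r] by (simp add: 1)
    have a: "?q \<cdot> \<gamma> ?x ?y \<in> Hom (?x \<otimes> ?y) (fst (rten C C ?i N M))" by simp
    have b: "(?q \<cdot> \<gamma> ?x ?y) \<cdot> lact C (res_mod ?i M) ?y = (?q \<cdot> \<gamma> ?x ?y) \<cdot> ract C ?x N"
      unfolding r 3 by (simp add: 2)
    have c: "(?q \<cdot> \<gamma> ?x ?y) \<cdot> lact C M ?y = snd (rten C C ?i N M) \<cdot> (\<I> ?c \<odot> (?q \<cdot> \<gamma> ?x ?y))"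
      unfolding 3 rten_snd(2)[OF C C I N M, unfolded r, symmetric] by (simp add: merge)
    note U = rten_univ[OF C C I M N P a b c, unfolded r]
    show ?thesis
      by (rule exI, rule conjI, rule U(1)) (use U(2) rq(1,2,4-6)[OF C C I M N, unfolded r] in simp)
  qed
  note r = res_mod_ident[OF C M] res_mod_ident[OF C N]
  obtain m where m: "mhom C (rten C C ?i M N) (rten C C ?i N M) m"
    and mq: "m \<cdot> tensor_quot K C M N = tensor_quot K C N M \<cdot> \<gamma> (fst M) (fst N)"
    using *[OF M N] by blast
  obtain n where n: "mhom C (rten C C ?i N M) (rten C C ?i M N) n"
    and nq: "n \<cdot> tensor_quot K C N M = tensor_quot K C M N \<cdot> \<gamma> (fst N) (fst M)"
    using *[OF N M] by blast
  note F = rten_fst[OF C C I M N, unfolded r] rten_fst[OF C C I N M, unfolded r]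
  note [simp] = rten_base[OF C C I M N] rten_base[OF C C I N M] rq(1,2)[OF C C I N M, unfolded r]
    rq(1,2)[OF C C I M N, unfolded r] mhomD(3-5)[OF m, unfolded F] mhomD(3-5)[OF n, unfolded F] F
  show ?thesis
  proof (rule misoI[OF C m])
    show "n \<in> Hom (fst (rten C C ?i N M)) (fst (rten C C ?i M N))" by simp
    show "n \<cdot> m = \<I> (fst (rten C C ?i M N))"
      by (rule rq_epi[OF C C I M N, unfolded r]) (simp_all add: mq nq[THEN reassoc])
    show "m \<cdot> n = \<I> (fst (rten C C ?i N M))"
      by (rule rq_epi[OF C C I N M, unfolded r]) (simp_all add: nq mq[THEN reassoc])
  qed
qed

lemma rten_left_unit:
  assumes C: "tt_ring K C" and N: "N \<in> modules K C"
  shows "miso C (rten C C (\<I> (robj C)) (self_mod C) N) N"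
proof -
  let ?i = "\<I> (robj C)" let ?c = "robj C" let ?y = "fst N" let ?r = "snd N"
  note I = ring_hom_ident[OF C] and S = self_mod_modules[OF C]
  note r = res_mod_ident[OF C S]
  let ?q = "tensor_quot K C (self_mod C) N" let ?s = "tsec C (self_mod C) N"
  note F = rten_fst[OF C C I S N, unfolded r]
  note [simp] = rten_base[OF C C I S N, simplified] F rq(1,2,4-6)[OF C C I S N, unfolded r, simplified]
  note Nu = modulesD(5,6)[OF C N]
  have cs: "commute ?c ?c ?y ?r ?r" using N unfolding modules_iff[OF C] by (rule commute_self[OF C])
  have b: "?r \<cdot> lact C (res_mod ?i (self_mod C)) ?y = ?r \<cdot> ract C (fst (self_mod C)) N"
    using cs by (simp add: r Nu(1) lift_def commute_def)
  have c: "?r \<cdot> lact C (self_mod C) ?y = snd N \<cdot> (\<I> (robj C) \<odot> ?r)"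
    by (simp add: Nu(1))
  note U = rten_univ[OF C C I S N N _ b c, unfolded r]
  let ?m = "?r \<cdot> ?s"
  have mq: "?m \<cdot> ?q = ?r" using U(2) by simp
  \<comment> \<open>The inverse is \<open>n \<mapsto> 1 \<otimes> n\<close>; the next equation says
    that \<open>1 \<otimes> c n\<close> and \<open>c \<otimes> n\<close> agree in the
    quotient.\<close>
  let ?n = "?q \<cdot> uext (unit C) ?y"
  have e: "?q \<cdot> (\<I> ?c \<odot> ?r) \<cdot> uext (unit C) (?c \<otimes> ?y) = ?q"
  proof -
    have "?q \<cdot> (\<I> ?c \<odot> ?r) = (?q \<cdot> ract C ?c N) \<cdot> sw ?c ?c ?y"
      by (simp add: lift_def)
    also have "\<dots> = ?q \<cdot> ext ?c ?c (mult C) ?y \<cdot> sw ?c ?c ?y"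
      using rq(3)[OF C C I S N, unfolded r, symmetric] by simp
    also have "ext ?c ?c (mult C) ?y \<cdot> sw ?c ?c ?y = ext ?c ?c (mult C) ?y"
      using ext_braid[of ?c ?c ?y "mult C"] tt_ring_eqs(1)[OF C] by simp
    finally have h: "?q \<cdot> (\<I> ?c \<odot> ?r) = ?q \<cdot> ext ?c ?c (mult C) ?y" .
    show ?thesis
      by (simp add: h[THEN reassoc] ext_uext tt_ring_eqs(2)[OF C])
  qed
  show ?thesis
  proof (rule misoI[OF C U(1)])
    show "?n \<in> Hom (fst N) (fst (rten C C ?i (self_mod C) N))" by simp
    show "?m \<cdot> ?n = \<I> (fst N)"
      using reassoc[OF mq, of "uext (unit C) ?y"] Nu(2) by simp
    show "?n \<cdot> ?m = \<I> (fst (rten C C ?i (self_mod C) N))"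
    proof (rule rq_epi[OF C C I S N, unfolded r])
      have "(?n \<cdot> ?m) \<cdot> ?q = ?n \<cdot> (?m \<cdot> ?q)" by simp
      also have "\<dots> = ?q \<cdot> uext (unit C) ?y \<cdot> ?r" unfolding mq by simp
      also have "\<dots> = ?q" using e by (simp add: uext_nat)
      finally show "(?n \<cdot> ?m) \<cdot> ?q = \<I> (fst (rten C C ?i (self_mod C) N)) \<cdot> ?q" by simp
    qed simp_all
  qed simp
qed

lemma rten_right_unit:
  assumes B: "tt_ring K B" and C: "tt_ring K C" and f: "ring_hom K B C f" and L: "L \<in> modules K C"
  shows "miso C (rten C B f L (self_mod B)) L"
proof -
  let ?c = "robj C" let ?b = "robj B" let ?x = "fst L" let ?r = "snd L" let ?rf = "snd (res_mod f L)"
  note S = self_mod_modules[OF B] and R = res_mod_modules[OF B C f L]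
  let ?q = "tensor_quot K B (res_mod f L) (self_mod B)" let ?s = "tsec B (res_mod f L) (self_mod B)"
  note F = rten_fst[OF B C f L S]
  note [simp] = rten_base[OF B C f L S, simplified] F rq(1,2,4-6)[OF B C f L S, simplified]
  note Ru = modulesD(5,6)[OF B R, simplified]
  have cs: "commute ?b ?b ?x ?rf ?rf" using R unfolding modules_iff[OF B] by (simp add: commute_self[OF B])
  have cc: "commute ?b ?c ?x ?rf ?r"
  proof -
    have "commute ?c ?c ?x ?r ?r" using L unfolding modules_iff[OF C] by (simp add: commute_self[OF C])
    from commute_restrict[OF this, of ?b f] show ?thesis by (simp add: res_mod_def)
  qed
  \<comment> \<open>This is \<open>l \<otimes> b \<mapsto> f b \<cdot> l\<close>; the inverse
    \<open>?n\<close> below comes from \<open>l \<mapsto> l \<otimes> 1\<close>.\<close>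
  let ?g = "?rf \<cdot> \<gamma> ?x ?b"
  have b1: "?g \<cdot> lact B (res_mod f L) ?b = ?rf \<cdot> (\<I> ?b \<odot> ?rf) \<cdot> (\<I> ?b \<odot> \<gamma> ?x ?b)"
  proof -
    have "?g \<cdot> lact B (res_mod f L) ?b = (?rf \<cdot> (\<I> ?b \<odot> ?rf) \<cdot> sw ?b ?b ?x) \<cdot> (\<I> ?b \<odot> \<gamma> ?x ?b)"
      by (simp add: braid_ext) (simp add: lift_def)
    then show ?thesis unfolding cs[unfolded commute_def, symmetric] by simp
  qed
  have b2: "?g \<cdot> ract B ?x (self_mod B) = ?rf \<cdot> (\<I> ?b \<odot> ?rf) \<cdot> (\<I> ?b \<odot> \<gamma> ?x ?b)"
    by (simp add: braid_lift Ru(1)[THEN reassoc])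
  have c: "?g \<cdot> lact C L (fst (self_mod B)) = snd L \<cdot> (\<I> (robj C) \<odot> ?g)"
  proof -
    have cc': "?rf \<cdot> (\<I> ?b \<odot> ?r) \<cdot> sw ?c ?b ?x = ?r \<cdot> (\<I> ?c \<odot> ?rf)"
      using commute_sym[OF cc] by (simp add: commute_def)
    have "?g \<cdot> lact C L ?b = (?rf \<cdot> (\<I> ?b \<odot> ?r) \<cdot> sw ?c ?b ?x) \<cdot> (\<I> ?c \<odot> \<gamma> ?x ?b)"
      by (simp add: braid_ext) (simp add: lift_def)
    then show ?thesis unfolding cc' by (simp add: merge)
  qed
  have b: "?g \<cdot> lact B (res_mod f L) (fst (self_mod B)) = ?g \<cdot> ract B ?x (self_mod B)"
    unfolding b2 using b1 by simp
  note U = rten_univ[OF B C f L S L _ b c]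
  let ?m = "?g \<cdot> ?s"
  have mq: "?m \<cdot> ?q = ?g" using U(2) by simp
  let ?n = "?q \<cdot> \<gamma> ?b ?x \<cdot> uext (unit B) ?x"
  have h: "?q \<cdot> \<gamma> ?b ?x \<cdot> (\<I> ?b \<odot> ?rf) = ?q \<cdot> \<gamma> ?b ?x \<cdot> ext ?b ?b (mult B) ?x"
  proof -
    have l: "\<gamma> ?b ?x \<cdot> lift ?b ?b ?rf ?x = lact B (res_mod f L) ?b \<cdot> (\<I> ?b \<odot> \<gamma> ?b ?x)"
      by (simp add: braid_lift)
    have m: "\<gamma> ?b ?x \<cdot> ext ?b ?b (mult B) ?x = ract B ?x (self_mod B) \<cdot> (\<I> ?b \<odot> \<gamma> ?b ?x)"
      by (simp add: braid_ext)
    have "?q \<cdot> \<gamma> ?b ?x \<cdot> (\<I> ?b \<odot> ?rf) = ?q \<cdot> (\<gamma> ?b ?x \<cdot> lift ?b ?b ?rf ?x) \<cdot> sw ?b ?b ?x"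
      by (simp add: lift_def)
    also have "\<dots> = (?q \<cdot> lact B (res_mod f L) ?b) \<cdot> (\<I> ?b \<odot> \<gamma> ?b ?x) \<cdot> sw ?b ?b ?x"
      unfolding l by simp
    also have "\<dots> = ?q \<cdot> (\<gamma> ?b ?x \<cdot> ext ?b ?b (mult B) ?x) \<cdot> sw ?b ?b ?x"
      unfolding m using rq(3)[OF B C f L S] by simp
    also have "\<dots> = ?q \<cdot> \<gamma> ?b ?x \<cdot> (ext ?b ?b (mult B) ?x \<cdot> sw ?b ?b ?x)" by simp
    also have "ext ?b ?b (mult B) ?x \<cdot> sw ?b ?b ?x = ext ?b ?b (mult B) ?x"
      using ext_braid[of ?b ?b ?x "mult B"] tt_ring_eqs(1)[OF B] by simp
    finally show ?thesis .
  qed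
  show ?thesis
  proof (rule misoI[OF C U(1)])
    show "?n \<in> Hom (fst L) (fst (rten C B f L (self_mod B)))" by simp
    show "?m \<cdot> ?n = \<I> (fst L)"
      using reassoc[OF mq, of "\<gamma> ?b ?x \<cdot> uext (unit B) ?x"] Ru(2) by simp
    show "?n \<cdot> ?m = \<I> (fst (rten C B f L (self_mod B)))"
    proof (rule rq_epi[OF B C f L S])
      have "(?n \<cdot> ?m) \<cdot> ?q = ?n \<cdot> (?m \<cdot> ?q)" by simp
      also have "\<dots> = (?q \<cdot> \<gamma> ?b ?x \<cdot> (\<I> ?b \<odot> ?rf)) \<cdot> uext (unit B) (?b \<otimes> ?x) \<cdot> \<gamma> ?x ?b"
        unfolding mq by (simp add: uext_nat[THEN reassoc])
      also have "\<dots> = ?q" unfolding h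
        by (simp add: ext_uext[THEN reassoc] tt_ring_eqs(2)[OF B])
      finally show "(?n \<cdot> ?m) \<cdot> ?q = \<I> (fst (rten C B f L (self_mod B))) \<cdot> ?q" by simp
    qed simp_all
  qed simp
qed

text \<open>The idempotent that splits \<open>L' \<otimes>\<^sub>C L\<close> off \<open>L' \<otimes> L\<close> is \<open>C\<close>-linear.\<close>

lemma rten_retract:
  assumes B: "tt_ring K B" and C: "tt_ring K C" and f: "ring_hom K B C f"
    and L': "L' \<in> modules K C" and L: "L \<in> modules K C"
  shows "mret C (rten C C (\<I> (robj C)) L' L) (rten C B f L' (res_mod f L))"
proof -
  let ?i = "\<I> (robj C)" let ?c = "robj C" let ?x = "fst L'" let ?y = "fst L"
  note I = ring_hom_ident[OF C] and R = res_mod_modules[OF B C f L] and R' = res_mod_modules[OF B C f L']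
  note r = res_mod_ident[OF C L']
  let ?q = "tensor_quot K B (res_mod f L') (res_mod f L)" let ?qC = "tensor_quot K C L' L"
  let ?sC = "tsec C L' L" let ?P = "rten C B f L' (res_mod f L)" let ?PC = "rten C C ?i L' L"
  let ?la = "lact C L' ?y" let ?ra = "ract C ?x L" let ?w = "tw C L' L"
  note F = rten_fst[OF B C f L' R] rten_fst[OF C C I L' L, unfolded r]
  note P = rten_modules[OF B C f L' R] rten_modules[OF C C I L' L]
  note [simp] = rten_base[OF B C f L' R, simplified] rten_base[OF C C I L' L, unfolded r] F rq(1,2,4-6)[OF B C f L' R, simplified]
     rq(1,2,4-6)[OF C C I L' L, unfolded r] modulesD(1-4)[OF C P(1), unfolded F] modulesD(1-4)[OF C P(2), unfolded F]
     tw(1-4)[OF C L' L]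
  have 1: "lact B (res_mod f L') ?y = ?la \<cdot> (f \<odot> \<I> (?x \<otimes> ?y))"
    by (simp add: res_mod_def ext_TenA)
  have 2: "ract B ?x (res_mod f L) = ?ra \<cdot> (f \<odot> \<I> (?x \<otimes> ?y))"
    by (simp add: res_mod_def lift_TenA)
  have b: "?qC \<cdot> lact B (res_mod f L') (fst (res_mod f L)) = ?qC \<cdot> ract B ?x (res_mod f L)"
    using 2 by (simp add: 1[unfolded fst_res_mod] rq(3)[OF C C I L' L, unfolded r, THEN reassoc])
  have c: "?qC \<cdot> lact C L' (fst (res_mod f L)) = snd ?PC \<cdot> (\<I> (robj C) \<odot> ?qC)"
    using rten_snd(2)[OF C C I L' L, unfolded r] by simp
  note U = rten_univ[OF B C f L' R P(2) _ b c]
  let ?p = "?qC \<cdot> tsec B (res_mod f L') (res_mod f L)"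
  have pq: "?p \<cdot> ?q = ?qC" using U(2) by simp
  let ?j = "?q \<cdot> ?sC"
  have "?j \<cdot> snd ?PC = snd ?P \<cdot> (\<I> ?c \<odot> ?j)"
  proof (rule rq_epi_left[OF C C I L' L, unfolded r])
    have "(?j \<cdot> snd ?PC) \<cdot> (\<I> ?c \<odot> ?qC) = ?q \<cdot> (?sC \<cdot> ?qC) \<cdot> ?la"
      by (simp add: rten_snd(2)[OF C C I L' L, unfolded r])
    also have "\<dots> = ?q \<cdot> (?la \<cdot> ?w \<cdot> ?la)"
      unfolding rq(8)[OF C C I L' L, unfolded r] by simp
    also have "\<dots> = (?q \<cdot> ?la) \<cdot> (\<I> ?c \<odot> (?la \<cdot> ?w))"
      unfolding tw(5,6)[OF C L' L] by simp
    also have "\<dots> = snd ?P \<cdot> (\<I> ?c \<odot> ?q) \<cdot> (\<I> ?c \<odot> (?sC \<cdot> ?qC))"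
      unfolding rq(8)[OF C C I L' L, unfolded r] using rten_snd(2)[OF B C f L' R, symmetric] by simp
    finally show "(?j \<cdot> snd ?PC) \<cdot> (\<I> ?c \<odot> ?qC) = (snd ?P \<cdot> (\<I> ?c \<odot> ?j)) \<cdot> (\<I> ?c \<odot> ?qC)"
      by (simp add: merge)
  qed simp_all
  then have j: "mhom C ?PC ?P ?j" using P by (simp add: mhom_def)
  show ?thesis
  proof (rule mretI[OF j U(1)])
    show "?p \<cdot> ?j = \<I> (fst ?PC)"
      using reassoc[OF pq, of ?sC] rq(7)[OF C C I L' L, unfolded r] by simp
  qed simp
qed

text \<open>Both sides are quotients of \<open>(x \<otimes> y) \<otimes> z\<close>, by the
  epimorphisms \<open>p\<close> and \<open>p'\<close>. Each of the two satisfies the relations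
  defining the other, hence factors through it, and the factorizations are inverse to each other by
  cancellation. The cases where \<open>f\<close> or \<open>g\<close> is an identity give
  \<open>rten_rten\<close> and \<open>rten_extension\<close>.\<close>

lemma rten_assoc:
  assumes B: "tt_ring K B" and C: "tt_ring K C" and D: "tt_ring K D"
    and f: "ring_hom K B C f" and g: "ring_hom K C D g"
    and L: "L \<in> modules K D" and M: "M \<in> modules K C" and N: "N \<in> modules K B"
  shows "miso D (rten D B (g \<cdot> f) (rten D C g L M) N) (rten D C g L (rten C B f M N))"
proof -
  note gf = ring_hom_comp[OF B C D f g]
  define P1 P2 where P12: "P1 = rten D C g L M" "P2 = rten C B f M N"
  note P1 = rten_modules[OF C D g L M, folded P12] and P2 = rten_modules[OF B C f M N, folded P12]
  define P P' where PP': "P = rten D B (g \<cdot> f) P1 N" "P' = rten D C g L P2"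
  note P = rten_modules[OF B D gf P1 N, folded PP'] and P' = rten_modules[OF C D g L P2, folded PP']
  define b c d x y z where obs: "b = robj B" "c = robj C" "d = robj D" "x = fst L" "y = fst M" "z = fst N"
  define rL rho kap where acts: "rL = snd L" "rho = snd M" "kap = snd N"
  define q1 q2 q3 q4 where qs: "q1 = tensor_quot K C (res_mod g L) M"
    "q2 = tensor_quot K B (res_mod (g \<cdot> f) P1) N"
    "q3 = tensor_quot K B (res_mod f M) N" "q4 = tensor_quot K C (res_mod g L) P2"
  define s1 where "s1 = tsec C (res_mod g L) M"
  define s3 where "s3 = tsec B (res_mod f M) N"
  define X1 Y1 where X1: "X1 = Cod K q1" and Y1: "Y1 = Cod K q3"
  have F: "fst P1 = X1" "fst P2 = Y1" "fst P = Cod K q2" "fst P' = Cod K q4"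
    using rten_fst[OF C D g L M, folded P12 qs] rten_fst[OF B C f M N, folded P12 qs]
      rten_fst[OF B D gf P1 N, folded PP' qs] rten_fst[OF C D g L P2, folded PP' qs] by (simp_all add: X1 Y1)
  define k1 k2 k k' where ks: "k1 = snd P1" "k2 = snd P2" "k = snd P" "k' = snd P'"
  note [simp] = tt_ringD(1)[OF B, folded obs] tt_ringD(1)[OF C, folded obs] tt_ringD(1)[OF D, folded obs]
    ring_homD[OF f, folded obs] ring_homD[OF g, folded obs]
    modulesD(1-4)[OF D L, folded obs acts] modulesD(1-4)[OF C M, folded obs acts] modulesD(1-4)[OF B N, folded obs acts]
    modulesD(1-4)[OF D P1, folded obs ks, unfolded F] modulesD(1-4)[OF C P2, folded obs ks, unfolded F]
    modulesD(1-4)[OF D P, folded obs ks, unfolded F] modulesD(1-4)[OF D P', folded obs ks, unfolded F]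
  have Q1 [simp]: "q1 \<in> Ar K" "Dom K q1 = x \<otimes> y" "Cod K q1 = X1"
    "s1 \<in> Ar K" "Dom K s1 = X1" "Cod K s1 = x \<otimes> y"
    using rq(1,2,4-6)[OF C D g L M, folded obs qs s1_def] X1 by simp_all
  have Q3 [simp]: "q3 \<in> Ar K" "Dom K q3 = y \<otimes> z" "Cod K q3 = Y1"
    "s3 \<in> Ar K" "Dom K s3 = Y1" "Cod K s3 = y \<otimes> z"
    using rq(1,2,4-6)[OF B C f M N, folded obs qs s3_def] Y1 by simp_all
  have Q2 [simp]: "q2 \<in> Ar K" "Dom K q2 = X1 \<otimes> z"
    using rq(1,2)[OF B D gf P1 N, folded obs qs] F by simp_all
  have Q4 [simp]: "q4 \<in> Ar K" "Dom K q4 = x \<otimes> Y1"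
    using rq(1,2)[OF C D g L P2, folded obs qs] F by simp_all
  define rLg where "rLg = rL \<cdot> (g \<odot> \<I> x)"
  define rLgf where "rLgf = rL \<cdot> ((g \<cdot> f) \<odot> \<I> x)"
  define rhof where "rhof = rho \<cdot> (f \<odot> \<I> y)"
  define k1gf where "k1gf = k1 \<cdot> ((g \<cdot> f) \<odot> \<I> X1)"
  have [simp]: "rLg \<in> Ar K" "Dom K rLg = c \<otimes> x" "Cod K rLg = x"
    "rLgf \<in> Ar K" "Dom K rLgf = b \<otimes> x" "Cod K rLgf = x"
    "rhof \<in> Ar K" "Dom K rhof = b \<otimes> y" "Cod K rhof = y"
    "k1gf \<in> Ar K" "Dom K k1gf = b \<otimes> X1" "Cod K k1gf = X1"
    by (simp_all add: rLg_def rLgf_def rhof_def k1gf_def)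
  have S: "snd (res_mod g L) = rLg" "snd (res_mod (g \<cdot> f) P1) = k1gf" "snd (res_mod f M) = rhof"
    by (simp_all add: res_mod_def rLg_def rLgf_def rhof_def k1gf_def flip: acts obs ks F)
  have rLgf: "rLgf = rLg \<cdot> (f \<odot> \<I> x)"
    by (simp add: rLg_def rLgf_def merge)
  have bal1: "q1 \<cdot> ext c x rLg y = q1 \<cdot> lift x c rho y"
    using rq(3)[OF C D g L M, folded obs qs] by (simp add: S flip: obs acts)
  have bal2: "q2 \<cdot> ext b X1 k1gf z = q2 \<cdot> lift X1 b kap z"
    using rq(3)[OF B D gf P1 N, folded obs qs] by (simp add: S F flip: obs acts)
  have bal3: "q3 \<cdot> ext b y rhof z = q3 \<cdot> lift y b kap z"
    using rq(3)[OF B C f M N, folded obs qs] by (simp add: S flip: obs acts)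
  have bal4: "q4 \<cdot> ext c x rLg Y1 = q4 \<cdot> lift x c k2 Y1"
    using rq(3)[OF C D g L P2, folded obs qs] by (simp add: S F flip: obs acts ks)
  have lin1: "q1 \<cdot> ext d x rL y = k1 \<cdot> (\<I> d \<odot> q1)"
    using rten_snd(2)[OF C D g L M, folded obs qs P12] by (simp flip: obs acts ks)
  have lin2: "q2 \<cdot> ext d X1 k1 z = k \<cdot> (\<I> d \<odot> q2)"
    using rten_snd(2)[OF B D gf P1 N, folded obs qs PP'] by (simp add: F flip: obs acts ks)
  have lin3: "q3 \<cdot> ext c y rho z = k2 \<cdot> (\<I> c \<odot> q3)"
    using rten_snd(2)[OF B C f M N, folded obs qs P12] by (simp flip: obs acts ks)
  have lin4: "q4 \<cdot> ext d x rL Y1 = k' \<cdot> (\<I> d \<odot> q4)"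
    using rten_snd(2)[OF C D g L P2, folded obs qs PP'] by (simp add: F flip: obs acts ks)
  have lin1': "q1 \<cdot> ext b x rLgf y = k1gf \<cdot> (\<I> b \<odot> q1)"
  proof -
    have "q1 \<cdot> ext b x rLgf y = (q1 \<cdot> ext d x rL y) \<cdot> ((g \<cdot> f) \<odot> \<I> (x \<otimes> y))"
      by (simp add: rLgf_def ext_TenA)
    then show ?thesis unfolding lin1 by (simp add: k1gf_def merge)
  qed
  define p p' where p: "p = q2 \<cdot> (q1 \<odot> \<I> z)" and p': "p' = q4 \<cdot> (\<I> x \<odot> q3) \<cdot> \<alpha> x y z"
  have [simp]: "p \<in> Ar K" "Dom K p = (x \<otimes> y) \<otimes> z" "Cod K p = Cod K q2"
    "p' \<in> Ar K" "Dom K p' = (x \<otimes> y) \<otimes> z" "Cod K p' = Cod K q4"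
    by (simp_all add: p p')
  \<comment> \<open>\<open>E1\<close> and \<open>E2\<close> move a scalar of \<open>C\<close> from
    \<open>x\<close> to \<open>y\<close>, respectively a scalar of \<open>B\<close> from
    \<open>x\<close> to \<open>z\<close>, inside the second quotient; the latter passes through
    \<open>y\<close>, as a scalar of \<open>C\<close> along \<open>f\<close>.\<close>
  let ?h = "q4 \<cdot> (\<I> x \<odot> q3)"
  have E1: "?h \<cdot> ext c x rLg (y \<otimes> z) = ?h \<cdot> lift x c (ext c y rho z) (y \<otimes> z)"
  proof -
    have "(\<I> x \<odot> q3) \<cdot> lift x c (ext c y rho z) (y \<otimes> z) = lift x c k2 Y1 \<cdot> (\<I> c \<odot> (\<I> x \<odot> q3))"
      by (rule lift_map) (simp_all add: lin3)
    moreover have "(\<I> x \<odot> q3) \<cdot> ext c x rLg (y \<otimes> z) = ext c x rLg Y1 \<cdot> (\<I> c \<odot> (\<I> x \<odot> q3))"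
      by (simp add: ext_nat_right)
    ultimately show ?thesis by (simp add: bal4[THEN reassoc])
  qed
  have E2: "?h \<cdot> ext b x rLgf (y \<otimes> z) = ?h \<cdot> lift x b (lift y b kap z) (y \<otimes> z)"
  proof -
    have "?h \<cdot> ext b x rLgf (y \<otimes> z) = (?h \<cdot> ext c x rLg (y \<otimes> z)) \<cdot> (f \<odot> \<I> (x \<otimes> (y \<otimes> z)))"
      by (simp add: rLgf ext_TenA)
    also have "\<dots> = ?h \<cdot> lift x b (ext b y rhof z) (y \<otimes> z)"
      unfolding E1 by (simp add: rhof_def ext_TenA lift_TenA)
    also have "\<dots> = q4 \<cdot> (\<I> x \<odot> (q3 \<cdot> ext b y rhof z)) \<cdot> sw b x (y \<otimes> z)"
      by (simp add: lift_def merge)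
    also have "\<dots> = ?h \<cdot> lift x b (lift y b kap z) (y \<otimes> z)"
      unfolding bal3 unfolding lift_def[of x b] by (simp add: merge)
    finally show ?thesis .
  qed
  have A1: "p' \<cdot> ext c (x \<otimes> y) (ext c x rLg y) z = p' \<cdot> ext c (x \<otimes> y) (lift x c rho y) z"
  proof -
    have "p' \<cdot> ext c (x \<otimes> y) (ext c x rLg y) z = (?h \<cdot> ext c x rLg (y \<otimes> z)) \<cdot> (\<I> c \<odot> \<alpha> x y z)"
      by (simp add: p' assoc_ext)
    also have "\<dots> = p' \<cdot> ext c (x \<otimes> y) (lift x c rho y) z"
      unfolding E1 by (simp add: p' assoc_ext_lift)
    finally show ?thesis .
  qed
  have A2: "p' \<cdot> ext b (x \<otimes> y) (ext b x rLgf y) z = p' \<cdot> lift (x \<otimes> y) b kap z"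
  proof -
    have "p' \<cdot> ext b (x \<otimes> y) (ext b x rLgf y) z = (?h \<cdot> ext b x rLgf (y \<otimes> z)) \<cdot> (\<I> b \<odot> \<alpha> x y z)"
      by (simp add: p' assoc_ext)
    also have "\<dots> = p' \<cdot> lift (x \<otimes> y) b kap z"
      unfolding E2 by (simp add: p' assoc_lift)
    finally show ?thesis .
  qed
  have A3: "p' \<cdot> ext d (x \<otimes> y) (ext d x rL y) z = k' \<cdot> (\<I> d \<odot> p')"
  proof -
    have "p' \<cdot> ext d (x \<otimes> y) (ext d x rL y) z = q4 \<cdot> (\<I> x \<odot> q3) \<cdot> ext d x rL (y \<otimes> z) \<cdot> (\<I> d \<odot> \<alpha> x y z)"
      by (simp add: p' assoc_ext)
    also have "\<dots> = (q4 \<cdot> ext d x rL Y1) \<cdot> (\<I> d \<odot> (\<I> x \<odot> q3)) \<cdot> (\<I> d \<odot> \<alpha> x y z)"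
      by (simp add: ext_nat_right[THEN reassoc])
    finally show ?thesis unfolding lin4 by (simp add: p' merge)
  qed
  \<comment> \<open>\<open>p'\<close> descends along \<open>q1 \<odot> \<I> z\<close> by
    \<open>A1\<close>; then \<open>A2\<close> and \<open>A3\<close> make \<open>g0\<close> balanced
    and linear, so that it descends along \<open>q2\<close>.\<close>
  define g0 where "g0 = p' \<cdot> (s1 \<odot> \<I> z)"
  have [simp]: "g0 \<in> Ar K" "Dom K g0 = X1 \<otimes> z" "Cod K g0 = Cod K q4" by (simp_all add: g0_def)
  have g0: "g0 \<cdot> (q1 \<odot> \<I> z) = p'"
  proof -
    have e: "a \<odot> \<I> z = ext c (x \<otimes> y) a z \<cdot> \<alpha> c (x \<otimes> y) z"
      if "a \<in> Ar K" "Dom K a = c \<otimes> (x \<otimes> y)" for a using that by (simp add: ext_def)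
    have "p' \<cdot> (ext c x rLg y \<odot> \<I> z) = p' \<cdot> (lift x c rho y \<odot> \<I> z)"
      by (simp add: e A1[THEN reassoc])
    then have "p' \<cdot> (s1 \<odot> \<I> z) \<cdot> (q1 \<odot> \<I> z) = p'"
      unfolding s1_def qs
      by (intro rq_desc_right[OF C D g L M, folded obs]) (simp_all add: S flip: obs acts)
    then show ?thesis by (simp add: g0_def)
  qed
  have extq1: "(q1 \<odot> \<I> z) \<cdot> ext e (x \<otimes> y) a z = ext e X1 a' z \<cdot> (\<I> e \<odot> (q1 \<odot> \<I> z))"
    if "q1 \<cdot> a = a' \<cdot> (\<I> e \<odot> q1)" "e \<in> Ob K" "a \<in> Ar K" "Dom K a = e \<otimes> (x \<otimes> y)" "Cod K a = x \<otimes> y"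
      "a' \<in> Ar K" "Dom K a' = e \<otimes> X1" for e a a'
    by (rule ext_map) (use that in simp_all)
  have lq1: "(q1 \<odot> \<I> z) \<cdot> lift (x \<otimes> y) b kap z = lift X1 b kap z \<cdot> (\<I> b \<odot> (q1 \<odot> \<I> z))"
    by (rule lift_map) simp_all
  have bal: "g0 \<cdot> ext b X1 k1gf z = g0 \<cdot> lift X1 b kap z"
  proof (rule rq_epi_left_right[OF C D g L M, folded obs qs])
    have "(g0 \<cdot> ext b X1 k1gf z) \<cdot> (\<I> b \<odot> (q1 \<odot> \<I> z)) = (g0 \<cdot> (q1 \<odot> \<I> z)) \<cdot> ext b (x \<otimes> y) (ext b x rLgf y) z"
      by (simp add: extq1[OF lin1'])
    also have "\<dots> = (g0 \<cdot> (q1 \<odot> \<I> z)) \<cdot> lift (x \<otimes> y) b kap z"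
      unfolding g0 A2 ..
    finally show "(g0 \<cdot> ext b X1 k1gf z) \<cdot> (\<I> b \<odot> (q1 \<odot> \<I> z)) = (g0 \<cdot> lift X1 b kap z) \<cdot> (\<I> b \<odot> (q1 \<odot> \<I> z))"
      by (simp add: lq1)
  qed simp_all
  have lin: "g0 \<cdot> ext d X1 k1 z = k' \<cdot> (\<I> d \<odot> g0)"
  proof (rule rq_epi_left_right[OF C D g L M, folded obs qs])
    have "(g0 \<cdot> ext d X1 k1 z) \<cdot> (\<I> d \<odot> (q1 \<odot> \<I> z)) = (g0 \<cdot> (q1 \<odot> \<I> z)) \<cdot> ext d (x \<otimes> y) (ext d x rL y) z"
      by (simp add: extq1[OF lin1])
    also have "\<dots> = k' \<cdot> (\<I> d \<odot> (g0 \<cdot> (q1 \<odot> \<I> z)))"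
      unfolding g0 A3 ..
    finally show "(g0 \<cdot> ext d X1 k1 z) \<cdot> (\<I> d \<odot> (q1 \<odot> \<I> z)) = (k' \<cdot> (\<I> d \<odot> g0)) \<cdot> (\<I> d \<odot> (q1 \<odot> \<I> z))"
      by (simp add: merge)
  qed simp_all
  have "\<exists>t. mhom D P P' t \<and> t \<cdot> q2 = g0"
  proof -
    have a1: "g0 \<in> Hom (fst P1 \<otimes> fst N) (fst P')" by (simp add: F flip: obs)
    have a2: "g0 \<cdot> lact B (res_mod (g \<cdot> f) P1) (fst N) = g0 \<cdot> ract B (fst P1) N"
      using bal by (simp add: S F flip: obs acts)
    have a3: "g0 \<cdot> lact D P1 (fst N) = snd P' \<cdot> (\<I> (robj D) \<odot> g0)"
      using lin by (simp add: F flip: obs acts ks)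
    note U = rten_univ[OF B D gf P1 N P' a1 a2 a3, folded PP' qs]
    show ?thesis by (rule exI, rule conjI, rule U(1)) (use U(2) in \<open>simp add: F rq(4-6)[OF B D gf P1 N, folded obs qs]\<close>)
  qed
  then obtain t where t: "mhom D P P' t" and tq: "t \<cdot> q2 = g0" by blast
  define i where "i = p \<cdot> ai x y z"
  have [simp]: "i \<in> Ar K" "Dom K i = x \<otimes> (y \<otimes> z)" "Cod K i = Cod K q2" by (simp_all add: i_def)
  have B1: "p \<cdot> ext c (x \<otimes> y) (lift x c rho y) z = p \<cdot> ext c (x \<otimes> y) (ext c x rLg y) z"
  proof -
    have e: "(q1 \<odot> \<I> z) \<cdot> ext c (x \<otimes> y) a z = ext c (x \<otimes> y) (q1 \<cdot> a) z"
      if "a \<in> Ar K" "Dom K a = c \<otimes> (x \<otimes> y)" "Cod K a = x \<otimes> y" for a using that by (simp add: ext_comp)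
    show ?thesis by (simp add: p e bal1)
  qed
  have B2: "p \<cdot> ext b (x \<otimes> y) (ext b x rLgf y) z = p \<cdot> lift (x \<otimes> y) b kap z"
  proof -
    have "p \<cdot> ext b (x \<otimes> y) (ext b x rLgf y) z = (q2 \<cdot> ext b X1 k1gf z) \<cdot> (\<I> b \<odot> (q1 \<odot> \<I> z))"
      by (simp add: p extq1[OF lin1'])
    then show ?thesis unfolding bal2 by (simp add: p lq1)
  qed
  have C1: "i \<cdot> lift x c (ext c y rho z) (y \<otimes> z) = i \<cdot> ext c x rLg (y \<otimes> z)"
  proof -
    have 1: "lift x c (ext c y rho z) (y \<otimes> z) = \<alpha> x y z \<cdot> ext c (x \<otimes> y) (lift x c rho y) z \<cdot> (\<I> c \<odot> ai x y z)"
      by (simp add: assoc_ext_lift[THEN reassoc] merge)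
    have 2: "ext c x rLg (y \<otimes> z) = \<alpha> x y z \<cdot> ext c (x \<otimes> y) (ext c x rLg y) z \<cdot> (\<I> c \<odot> ai x y z)"
      by (simp add: assoc_ext[THEN reassoc] merge)
    show ?thesis unfolding 1 2 by (simp add: i_def B1[THEN reassoc])
  qed
  have C2: "i \<cdot> lift x b (ext b y rhof z) (y \<otimes> z) = i \<cdot> lift x b (lift y b kap z) (y \<otimes> z)"
  proof -
    have 1: "lift x b (lift y b kap z) (y \<otimes> z) = \<alpha> x y z \<cdot> lift (x \<otimes> y) b kap z \<cdot> (\<I> b \<odot> ai x y z)"
      by (simp add: assoc_lift[THEN reassoc] merge)
    have 2: "ext b x rLgf (y \<otimes> z) = \<alpha> x y z \<cdot> ext b (x \<otimes> y) (ext b x rLgf y) z \<cdot> (\<I> b \<odot> ai x y z)"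
      by (simp add: assoc_ext[THEN reassoc] merge)
    have "i \<cdot> lift x b (ext b y rhof z) (y \<otimes> z) = (i \<cdot> lift x c (ext c y rho z) (y \<otimes> z)) \<cdot> (f \<odot> \<I> (x \<otimes> (y \<otimes> z)))"
      by (simp add: rhof_def ext_TenA lift_TenA)
    also have "\<dots> = i \<cdot> ext b x rLgf (y \<otimes> z)"
      unfolding C1 by (simp add: rLgf ext_TenA)
    also have "\<dots> = i \<cdot> lift x b (lift y b kap z) (y \<otimes> z)"
      unfolding 1 2 by (simp add: i_def B2[THEN reassoc])
    finally show ?thesis .
  qed
  \<comment> \<open>The other direction: \<open>i\<close> is \<open>p\<close> read on
    \<open>x \<otimes> (y \<otimes> z)\<close>, and it descends along
    \<open>\<I> x \<odot> q3\<close> by \<open>C2\<close> and along \<open>q4\<close> by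
    \<open>C1\<close>.\<close>
  define g1 where "g1 = i \<cdot> (\<I> x \<odot> s3)"
  have [simp]: "g1 \<in> Ar K" "Dom K g1 = x \<otimes> Y1" "Cod K g1 = Cod K q2" by (simp_all add: g1_def)
  have g1: "g1 \<cdot> (\<I> x \<odot> q3) = i"
  proof -
    have e: "\<I> x \<odot> a = lift x b a (y \<otimes> z) \<cdot> sw x b (y \<otimes> z)"
      if "a \<in> Ar K" "Dom K a = b \<otimes> (y \<otimes> z)" for a using that by (simp add: lift_def)
    have "i \<cdot> (\<I> x \<odot> ext b y rhof z) = i \<cdot> (\<I> x \<odot> lift y b kap z)"
      by (simp add: e C2[THEN reassoc])
    then have "i \<cdot> (\<I> x \<odot> s3) \<cdot> (\<I> x \<odot> q3) = i"
      unfolding s3_def qs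
      by (intro rq_desc_left[OF B C f M N, folded obs]) (simp_all add: S flip: obs acts)
    then show ?thesis by (simp add: g1_def)
  qed
  have bal': "g1 \<cdot> ext c x rLg Y1 = g1 \<cdot> lift x c k2 Y1"
  proof (rule rq_epi_left2[OF B C f M N, folded obs qs])
    have 1: "(\<I> x \<odot> q3) \<cdot> lift x c (ext c y rho z) (y \<otimes> z) = lift x c k2 Y1 \<cdot> (\<I> c \<odot> (\<I> x \<odot> q3))"
      by (rule lift_map) (simp_all add: lin3)
    have "(g1 \<cdot> ext c x rLg Y1) \<cdot> (\<I> c \<odot> (\<I> x \<odot> q3)) = (g1 \<cdot> (\<I> x \<odot> q3)) \<cdot> ext c x rLg (y \<otimes> z)"
      by (simp add: ext_nat_right)
    also have "\<dots> = (g1 \<cdot> (\<I> x \<odot> q3)) \<cdot> lift x c (ext c y rho z) (y \<otimes> z)"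
      unfolding g1 C1 ..
    finally show "(g1 \<cdot> ext c x rLg Y1) \<cdot> (\<I> c \<odot> (\<I> x \<odot> q3)) = (g1 \<cdot> lift x c k2 Y1) \<cdot> (\<I> c \<odot> (\<I> x \<odot> q3))"
      by (simp add: 1)
  qed simp_all
  have "g1 \<cdot> tsec C (res_mod g L) P2 \<cdot> q4 = g1"
    unfolding qs
    by (rule rq_desc[OF C D g L P2, folded obs]) (use bal' in \<open>simp_all add: S F flip: obs acts ks\<close>)
  then obtain t' where [simp]: "t' \<in> Ar K" "Dom K t' = Cod K q4" "Cod K t' = Cod K q2" and tq': "t' \<cdot> q4 = g1"
    using rq(4-6)[OF C D g L P2, folded obs qs] by (intro that[of "g1 \<cdot> tsec C (res_mod g L) P2"]) (simp_all add: F)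
  have [simp]: "t \<in> Ar K" "Dom K t = Cod K q2" "Cod K t = Cod K q4"
    using mhomD(3-5)[OF t] F by simp_all
  have tp: "t \<cdot> p = p'" by (simp add: p tq[THEN reassoc] g0)
  have tp': "t' \<cdot> p' = p" by (simp add: p' tq'[THEN reassoc] g1[THEN reassoc]) (simp add: i_def)
  have epi2: "h = j" if "h \<cdot> p = j \<cdot> p" "h \<in> Ar K" "Dom K h = Cod K q2" "j \<in> Ar K" "Dom K j = Cod K q2" for h j
  proof (rule rq_epi[OF B D gf P1 N, folded qs])
    show "h \<cdot> q2 = j \<cdot> q2"
      by (rule rq_epi_right[OF C D g L M, folded qs, of _ z]) (use that in \<open>simp_all add: p\<close>)
  qed (use that in simp_all)
  have epi4: "h = j" if "h \<cdot> p' = j \<cdot> p'" "h \<in> Ar K" "Dom K h = Cod K q4" "j \<in> Ar K" "Dom K j = Cod K q4" for h j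
  proof (rule rq_epi[OF C D g L P2, folded qs])
    show "h \<cdot> q4 = j \<cdot> q4"
    proof (rule rq_epi_left[OF B C f M N, folded qs, of _ x])
      have "(h \<cdot> q4 \<cdot> (\<I> x \<odot> q3)) \<cdot> \<alpha> x y z = (j \<cdot> q4 \<cdot> (\<I> x \<odot> q3)) \<cdot> \<alpha> x y z"
        using that by (simp add: p')
      then have "h \<cdot> q4 \<cdot> (\<I> x \<odot> q3) = j \<cdot> q4 \<cdot> (\<I> x \<odot> q3)"
        by (rule iso_cancel_right[rotated]) (use that in simp_all)
      then show "(h \<cdot> q4) \<cdot> (\<I> x \<odot> q3) = (j \<cdot> q4) \<cdot> (\<I> x \<odot> q3)"
        using that by simp
    qed (use that in simp_all)
  qed (use that in simp_all)
  have "miso D P P'"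
  proof (rule misoI[OF D t])
    show "t' \<in> Hom (fst P') (fst P)" by (simp add: F)
    show "t' \<cdot> t = \<I> (fst P)"
      by (rule epi2) (simp_all add: F tp tp')
    show "t \<cdot> t' = \<I> (fst P')"
      by (rule epi4) (simp_all add: F tp tp')
  qed
  then show ?thesis by (simp add: PP' P12)
qed

end

lemma ex1_unique: "\<exists>!x. P x \<Longrightarrow> P a \<Longrightarrow> P b \<Longrightarrow> a = b"
  by blast

section \<open>Triangles\<close>

context additive_category
begin

lemma Zero_simps [simp]:
  assumes "x \<in> Ob K" "y \<in> Ob K"
  shows "Zero K x y \<in> Ar K" "Dom K (Zero K x y) = x" "Cod K (Zero K x y) = y"
  using Zero_Hom[OF assms] by simp_all

lemma add_simps [simp]:
  assumes "f \<in> Ar K" "g \<in> Ar K" "Dom K f = Dom K g" "Cod K f = Cod K g"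
  shows "f \<oplus> g \<in> Ar K" "Dom K (f \<oplus> g) = Dom K g" "Cod K (f \<oplus> g) = Cod K g"
  using add_Hom[of f "Dom K g" "Cod K g" g] assms by simp_all

definition neg :: "'b \<Rightarrow> 'b" where
  "neg f = (SOME g. g \<in> Hom (Dom K f) (Cod K f) \<and> f \<oplus> g = Zero K (Dom K f) (Cod K f))"

lemma neg:
  assumes "f \<in> Ar K"
  shows "neg f \<in> Hom (Dom K f) (Cod K f) \<and> f \<oplus> neg f = Zero K (Dom K f) (Cod K f)"
proof -
  have "\<exists>g\<in>Hom (Dom K f) (Cod K f). f \<oplus> g = Zero K (Dom K f) (Cod K f)"
    using assms by (intro add_inverse) simp
  then show ?thesis unfolding neg_def by (rule someI2_bex) simp
qed

lemma neg_simps [simp]: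
  assumes "f \<in> Ar K"
  shows "neg f \<in> Ar K" "Dom K (neg f) = Dom K f" "Cod K (neg f) = Cod K f"
    "f \<oplus> neg f = Zero K (Dom K f) (Cod K f)"
  using neg[OF assms] by simp_all

lemma add_comm: "f \<in> Ar K \<Longrightarrow> g \<in> Ar K \<Longrightarrow> Dom K f = Dom K g \<Longrightarrow> Cod K f = Cod K g \<Longrightarrow> f \<oplus> g = g \<oplus> f"
  using add_commute[of f "Dom K f" "Cod K f" g] by simp

lemma add_assoc': "f \<in> Ar K \<Longrightarrow> g \<in> Ar K \<Longrightarrow> h \<in> Ar K \<Longrightarrow> Dom K f = Dom K g \<Longrightarrow> Cod K f = Cod K g \<Longrightarrow>
    Dom K g = Dom K h \<Longrightarrow> Cod K g = Cod K h \<Longrightarrow> (f \<oplus> g) \<oplus> h = f \<oplus> (g \<oplus> h)"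
  using add_assoc[of f "Dom K f" "Cod K f" g h] by simp

lemma add_Zero_right [simp]: "f \<in> Ar K \<Longrightarrow> Dom K f = x \<Longrightarrow> Cod K f = y \<Longrightarrow> f \<oplus> Zero K x y = f"
  using add_Zero[of f x y] by simp

lemma add_Zero_left [simp]:
  assumes "f \<in> Ar K" "Dom K f = x" "Cod K f = y"
  shows "Zero K x y \<oplus> f = f"
proof -
  have "x \<in> Ob K" "y \<in> Ob K" using assms by auto
  then show ?thesis using add_comm[of "Zero K x y" f] assms by simp
qed

lemma neg_add [simp]: "f \<in> Ar K \<Longrightarrow> neg f \<oplus> f = Zero K (Dom K f) (Cod K f)"
  using add_comm[of "neg f" f] by simp

lemma add_idem_Zero:
  assumes "f \<oplus> f = f" and [simp]: "f \<in> Ar K"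
  shows "f = Zero K (Dom K f) (Cod K f)"
proof -
  have "f = f \<oplus> (f \<oplus> neg f)" by simp
  also have "\<dots> = (f \<oplus> f) \<oplus> neg f" by (simp add: add_assoc' del: neg_simps(4))
  also have "\<dots> = Zero K (Dom K f) (Cod K f)" unfolding assms(1) by simp
  finally show ?thesis .
qed

lemma eq_neg:
  assumes "f \<oplus> g = Zero K (Dom K f) (Cod K f)" and [simp]: "f \<in> Ar K" "g \<in> Ar K" "Dom K g = Dom K f" "Cod K g = Cod K f"
  shows "g = neg f"
proof -
  have "g = (neg f \<oplus> f) \<oplus> g" by simp
  also have "\<dots> = neg f \<oplus> (f \<oplus> g)" by (simp add: add_assoc' del: neg_add)
  finally show ?thesis unfolding assms(1) by simp
qed

lemma comp_add': "f \<in> Ar K \<Longrightarrow> g \<in> Ar K \<Longrightarrow> h \<in> Ar K \<Longrightarrow> Dom K f = Dom K g \<Longrightarrow> Cod K f = Cod K g \<Longrightarrow>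
    Cod K g = Dom K h \<Longrightarrow> h \<cdot> (f \<oplus> g) = (h \<cdot> f) \<oplus> (h \<cdot> g)"
  using comp_add[of f "Dom K f" "Cod K f" g h "Cod K h"] by simp

lemma add_comp': "f \<in> Ar K \<Longrightarrow> g \<in> Ar K \<Longrightarrow> h \<in> Ar K \<Longrightarrow> Dom K f = Dom K g \<Longrightarrow> Cod K f = Cod K g \<Longrightarrow>
    Cod K h = Dom K g \<Longrightarrow> (f \<oplus> g) \<cdot> h = (f \<cdot> h) \<oplus> (g \<cdot> h)"
  using add_comp[of f "Dom K f" "Cod K f" g h "Dom K h"] by simp

lemma comp_Zero [simp]:
  assumes [simp]: "h \<in> Ar K" "x \<in> Ob K" and y: "Dom K h = y"
  shows "h \<cdot> Zero K x y = Zero K x (Cod K h)"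
proof -
  have [simp]: "y \<in> Ob K" using y by auto
  have "h \<cdot> Zero K x y = h \<cdot> (Zero K x y \<oplus> Zero K x y)" by simp
  also have "\<dots> = (h \<cdot> Zero K x y) \<oplus> (h \<cdot> Zero K x y)" using y by (simp add: comp_add' del: add_Zero_right add_Zero_left)
  finally have "(h \<cdot> Zero K x y) \<oplus> (h \<cdot> Zero K x y) = h \<cdot> Zero K x y" by (rule sym)
  from add_idem_Zero[OF this] show ?thesis using y by simp
qed

lemma Zero_comp [simp]:
  assumes [simp]: "h \<in> Ar K" "z \<in> Ob K" and y: "Cod K h = y"
  shows "Zero K y z \<cdot> h = Zero K (Dom K h) z"
proof -
  have [simp]: "y \<in> Ob K" using y by auto
  have "Zero K y z \<cdot> h = (Zero K y z \<oplus> Zero K y z) \<cdot> h" by simp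
  also have "\<dots> = (Zero K y z \<cdot> h) \<oplus> (Zero K y z \<cdot> h)" using y by (simp add: add_comp' del: add_Zero_right add_Zero_left)
  finally have "(Zero K y z \<cdot> h) \<oplus> (Zero K y z \<cdot> h) = Zero K y z \<cdot> h" by (rule sym)
  from add_idem_Zero[OF this] show ?thesis using y by simp
qed

lemma zero_object_ident:
  assumes z: "zero_object K z"
  shows "z \<in> Ob K" "\<I> z = Zero K z z"
proof -
  show zo: "z \<in> Ob K" using z unfolding zero_object_def by (rule conjunct1)
  have "\<exists>!f. f \<in> Hom z z"
    using bspec[OF conjunct2[OF z[unfolded zero_object_def]] zo] by (rule conjunct1)
  then show "\<I> z = Zero K z z"
    by (rule ex1_unique) (simp_all add: zo)
qed

lemma zero_object_unique:
  assumes z: "z \<in> Ob K" and i: "\<I> z = Zero K z z" and f: "f \<in> Ar K"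
  shows "Cod K f = z \<Longrightarrow> f = Zero K (Dom K f) z" "Dom K f = z \<Longrightarrow> f = Zero K z (Cod K f)"
proof -
  have 1: "\<I> z \<cdot> f = Zero K (Dom K f) z" if "Cod K f = z" unfolding i using f that z by simp
  have 2: "f \<cdot> \<I> z = Zero K z (Cod K f)" if "Dom K f = z" unfolding i using f that z by simp
  show "f = Zero K (Dom K f) z" if "Cod K f = z" using 1[OF that] f that by (simp only: ident_comp_simp)
  show "f = Zero K z (Cod K f)" if "Dom K f = z" using 2[OF that] f that by (simp only: comp_ident_simp)
qed

lemma zero_object_iff: "zero_object K z \<longleftrightarrow> z \<in> Ob K \<and> \<I> z = Zero K z z"
proof (intro iffI conjI)
  assume "z \<in> Ob K \<and> \<I> z = Zero K z z"
  then have z: "z \<in> Ob K" and i: "\<I> z = Zero K z z" by (rule conjunct1, rule conjunct2)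
  have "(\<exists>!f. f \<in> Hom x z) \<and> (\<exists>!f. f \<in> Hom z x)" if x: "x \<in> Ob K" for x
  proof (intro conjI ex1I)
    show "Zero K x z \<in> Hom x z" "Zero K z x \<in> Hom z x" using x z by simp_all
    show "f = Zero K x z" if "f \<in> Hom x z" for f using zero_object_unique(1)[OF z i, of f] that by auto
    show "f = Zero K z x" if "f \<in> Hom z x" for f using zero_object_unique(2)[OF z i, of f] that by auto
  qed
  then show "zero_object K z" unfolding zero_object_def using z by blast
qed (fact zero_object_ident)+

text \<open>The inverse is \<open>\<I> z \<oplus> neg f\<close>. Composites of comparison maps
  between cones turn out to differ from the identity by such an \<open>f\<close>.\<close>

lemma iso_ident_add:
  assumes e: "e = \<I> z \<oplus> f" and ff: "f \<cdot> f = Zero K z z" and [simp]: "f \<in> Ar K" "Dom K f = z" "Cod K f = z"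
  shows "iso K e"
proof -
  have [simp]: "z \<in> Ob K" using Dom_Ob[of f] by simp
  have fn: "f \<cdot> neg f = Zero K z z"
  proof -
    have "f \<cdot> (f \<oplus> neg f) = (f \<cdot> f) \<oplus> (f \<cdot> neg f)" by (rule comp_add') simp_all
    then show ?thesis by (simp add: ff)
  qed
  have nf: "neg f \<cdot> f = Zero K z z"
  proof -
    have "(f \<oplus> neg f) \<cdot> f = (f \<cdot> f) \<oplus> (neg f \<cdot> f)" by (rule add_comp') simp_all
    then show ?thesis by (simp add: ff)
  qed
  have "(\<I> z \<oplus> neg f) \<cdot> e = \<I> z \<oplus> (neg f \<oplus> (f \<oplus> Zero K z z))"
    by (simp add: e comp_add' add_comp' nf fn add_assoc' del: add_Zero_right)
  also have "\<dots> = \<I> z \<oplus> (neg f \<oplus> f)" by simp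
  finally have 1: "(\<I> z \<oplus> neg f) \<cdot> e = \<I> z" by simp
  have "e \<cdot> (\<I> z \<oplus> neg f) = \<I> z \<oplus> (f \<oplus> (neg f \<oplus> Zero K z z))"
    by (simp add: e comp_add' add_comp' nf fn add_assoc' del: add_Zero_right)
  also have "\<dots> = \<I> z \<oplus> (f \<oplus> neg f)" by simp
  finally have 2: "e \<cdot> (\<I> z \<oplus> neg f) = \<I> z" by simp
  show ?thesis
    by (rule isoI[of _ z z "\<I> z \<oplus> neg f"]) (simp_all add: 1 2, simp_all add: e)
qed

end

context triangulated_category
begin

lemma Susp_simps [simp]:
  assumes "f \<in> Ar K"
  shows "\<S> f \<in> Ar K" "Dom K (\<S> f) = \<Sigma> (Dom K f)" "Cod K (\<S> f) = \<Sigma> (Cod K f)"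
proof -
  have "\<S> f \<in> Hom (\<Sigma> (Dom K f)) (\<Sigma> (Cod K f))"
    by (rule bij_betw_apply[OF SuspA_bij]) (use assms in simp_all)
  then show "\<S> f \<in> Ar K" "Dom K (\<S> f) = \<Sigma> (Dom K f)" "Cod K (\<S> f) = \<Sigma> (Cod K f)" by simp_all
qed

declare Susp_Ob [simp] SuspA_ident [simp]

lemma SuspA_comp': "f \<in> Ar K \<Longrightarrow> g \<in> Ar K \<Longrightarrow> Cod K f = Dom K g \<Longrightarrow> \<S> g \<cdot> \<S> f = \<S> (g \<cdot> f)"
  using SuspA_comp[of f "Dom K f" "Cod K f" g "Cod K g"] by simp

lemmas merge_S = SuspA_comp' SuspA_comp'[THEN reassoc]

lemma SuspA_cancel:
  assumes "\<S> f = \<S> g" "f \<in> Ar K" "g \<in> Ar K" "Dom K f = Dom K g" "Cod K f = Cod K g"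
  shows "f = g"
  by (rule inj_onD[OF bij_betw_imp_inj_on[OF SuspA_bij] assms(1), of "Dom K f" "Cod K f"]) (use assms(2-) in simp_all)

lemma SuspA_surj:
  assumes "g \<in> Hom (\<Sigma> x) (\<Sigma> y)" "x \<in> Ob K" "y \<in> Ob K"
  obtains f where "f \<in> Hom x y" "g = \<S> f"
  using SuspA_bij[OF assms(2,3)] assms(1) unfolding bij_betw_def by blast

lemma SuspA_iso [simp]: "iso K f \<Longrightarrow> iso K (\<S> f)"
  by (rule isoI[of _ "\<Sigma> (Dom K f)" "\<Sigma> (Cod K f)" "\<S> (inv_arrow K f)"]) (simp_all add: merge_S)

lemma inv_SuspA: "iso K f \<Longrightarrow> inv_arrow K (\<S> f) = \<S> (inv_arrow K f)"
  by (rule inv_arrow_eq[of _ "\<Sigma> (Dom K f)" "\<Sigma> (Cod K f)"]) (simp_all add: merge_S)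

lemma SuspA_Zero [simp]:
  assumes [simp]: "x \<in> Ob K" "y \<in> Ob K"
  shows "\<S> (Zero K x y) = Zero K (\<Sigma> x) (\<Sigma> y)"
proof -
  have "\<S> (Zero K x y) \<oplus> \<S> (Zero K x y) = \<S> (Zero K x y)"
    using SuspA_add[of "Zero K x y" x y "Zero K x y"] by simp
  from add_idem_Zero[OF this] show ?thesis by simp
qed

lemma zero_object_Susp: "zero_object K z \<Longrightarrow> zero_object K (\<Sigma> z)"
  by (simp add: zero_object_iff flip: SuspA_ident SuspA_Zero)

lemma Tri_simps:
  assumes "(f, g, h) \<in> Tri K"
  shows "f \<in> Ar K" "g \<in> Ar K" "Dom K g = Cod K f" "h \<in> Ar K" "Dom K h = Cod K g" "Cod K h = \<Sigma> (Dom K f)"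
  using Tri_Hom[OF assms] by simp_all

lemma Tri_rotated:
  assumes t: "(f, g, h) \<in> Tri K"
  shows "(g, h, neg (\<S> f)) \<in> Tri K"
proof -
  note [simp] = Tri_simps[OF t]
  show ?thesis
    using Tri_rotate[of f "Dom K f" "Cod K f" g "Cod K g" h "neg (\<S> f)"] t by simp
qed

text \<open>A morphism from the triangle \<open>x = x \<rightarrow> 0\<close> to the given one
  factors \<open>g \<cdot> f\<close> through the zero object.\<close>

lemma Tri_comp_Zero:
  assumes t: "(f, g, h) \<in> Tri K"
  shows "g \<cdot> f = Zero K (Dom K f) (Cod K g)"
proof -
  note [simp] = Tri_simps[OF t]
  obtain o' where o: "zero_object K o'" using zero_object_exists by blast
  then have [simp]: "o' \<in> Ob K" by (simp add: zero_object_def)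
  have "(\<I> (Dom K f), Zero K (Dom K f) o', Zero K o' (\<Sigma> (Dom K f))) \<in> Tri K"
    by (rule Tri_ident[OF _ o]) simp
  then have "\<exists>c\<in>Hom (Cod K (Zero K (Dom K f) o')) (Cod K g). c \<cdot> Zero K (Dom K f) o' = g \<cdot> f \<and>
      \<S> (\<I> (Dom K f)) \<cdot> Zero K o' (\<Sigma> (Dom K f)) = h \<cdot> c"
    by (rule Tri_morphism[OF _ t]) simp_all
  then obtain c where c: "c \<in> Hom (Cod K (Zero K (Dom K f) o')) (Cod K g)" and e: "c \<cdot> Zero K (Dom K f) o' = g \<cdot> f" by blast
  show ?thesis unfolding e[symmetric] using c by simp
qed

lemma Tri_comp_Zero2:
  assumes t: "(f, g, h) \<in> Tri K"
  shows "h \<cdot> g = Zero K (Cod K f) (\<Sigma> (Dom K f))"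
  using Tri_comp_Zero[OF Tri_rotated[OF t]] Tri_simps[OF t] by simp

text \<open>\<open>h\<close> is a weak cokernel of \<open>g\<close>. The required arrow is the third
  component of a morphism from the rotated triangle to \<open>0 \<rightarrow> w = w\<close>.\<close>

lemma Tri_colift:
  assumes t: "(f, g, h) \<in> Tri K" and p: "p \<in> Ar K" "Dom K p = Cod K g" "p \<cdot> g = Zero K (Dom K g) (Cod K p)"
  shows "\<exists>r\<in>Hom (\<Sigma> (Dom K f)) (Cod K p). p = r \<cdot> h"
proof -
  note [simp] = Tri_simps[OF t] p(1,2)
  obtain o' where o: "zero_object K o'" using zero_object_exists by blast
  then have [simp]: "o' \<in> Ob K" by (simp add: zero_object_def)
  let ?w = "Cod K p"
  \<comment> \<open>The third object is taken as \<open>\<Sigma> o'\<close> rather than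
    \<open>o'\<close>, the shape needed to rotate the triangle backwards.\<close>
  have "(\<I> ?w, Zero K ?w (\<Sigma> o'), Zero K (\<Sigma> o') (\<Sigma> ?w)) \<in> Tri K"
    by (rule Tri_ident[OF _ zero_object_Susp[OF o]]) simp
  then have u: "(Zero K o' ?w, \<I> ?w, Zero K ?w (\<Sigma> o')) \<in> Tri K"
    using Tri_rotate[of "Zero K o' ?w" o' ?w "\<I> ?w" ?w "Zero K ?w (\<Sigma> o')" "Zero K (\<Sigma> o') (\<Sigma> ?w)"] by simp
  have "\<exists>c\<in>Hom (Cod K h) (Cod K (\<I> ?w)). c \<cdot> h = \<I> ?w \<cdot> p \<and> \<S> (Zero K (Dom K g) o') \<cdot> neg (\<S> f) = Zero K ?w (\<Sigma> o') \<cdot> c"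
    by (rule Tri_morphism[OF Tri_rotated[OF t] u]) (simp_all add: p(3))
  then obtain c where c: "c \<in> Hom (Cod K h) (Cod K (\<I> ?w))" "c \<cdot> h = \<I> ?w \<cdot> p" by blast
  show ?thesis by (rule bexI[of _ c]) (use c in simp_all)
qed

text \<open>\<open>f\<close> is a weak kernel of \<open>g\<close>. The morphism axiom produces an
  arrow between suspensions, and full faithfulness of \<open>\<S>\<close> brings it down; the signs
  introduced by rotation cancel.\<close>

lemma Tri_lift:
  assumes t: "(f, g, h) \<in> Tri K" and p: "p \<in> Ar K" "Cod K p = Cod K f" "g \<cdot> p = Zero K (Dom K p) (Cod K g)"
  shows "\<exists>r\<in>Hom (Dom K p) (Dom K f). p = f \<cdot> r"
proof -
  note [simp] = Tri_simps[OF t] p(1,2)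
  obtain o' where o: "zero_object K o'" using zero_object_exists by blast
  then have [simp]: "o' \<in> Ob K" by (simp add: zero_object_def)
  let ?w = "Dom K p"
  have u0: "(\<I> ?w, Zero K ?w o', Zero K o' (\<Sigma> ?w)) \<in> Tri K"
    by (rule Tri_ident[OF _ o]) simp
  have "\<exists>c\<in>Hom (Cod K (Zero K o' (\<Sigma> ?w))) (Cod K h). c \<cdot> Zero K o' (\<Sigma> ?w) = h \<cdot> Zero K o' (Cod K g) \<and>
      \<S> p \<cdot> neg (\<S> (\<I> ?w)) = neg (\<S> f) \<cdot> c"
    by (rule Tri_morphism[OF Tri_rotated[OF u0] Tri_rotated[OF t]]) (simp_all add: p(3))
  then obtain c where c': "c \<in> Hom (Cod K (Zero K o' (\<Sigma> ?w))) (Cod K h)" and e': "\<S> p \<cdot> neg (\<S> (\<I> ?w)) = neg (\<S> f) \<cdot> c"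
    by blast
  have c: "c \<in> Hom (\<Sigma> ?w) (\<Sigma> (Dom K f))" using c' by simp
  have e: "\<S> p \<cdot> neg (\<I> (\<Sigma> ?w)) = neg (\<S> f) \<cdot> c" using e' by simp
  from SuspA_surj[OF c] obtain r where r: "r \<in> Hom ?w (Dom K f)" and cr: "c = \<S> r" by auto
  then have [simp]: "r \<in> Ar K" "Dom K r = ?w" "Cod K r = Dom K f" by simp_all
  have n: "neg a \<cdot> b = neg (a \<cdot> b)" if "a \<in> Ar K" "b \<in> Ar K" "Cod K b = Dom K a" for a b
    by (rule eq_neg) (use that in \<open>simp_all flip: add_comp'\<close>)
  have n': "a \<cdot> neg b = neg (a \<cdot> b)" if "a \<in> Ar K" "b \<in> Ar K" "Cod K b = Dom K a" for a b
    by (rule eq_neg) (use that in \<open>simp_all flip: comp_add'\<close>)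
  have nn: "neg (neg a) = a" if "a \<in> Ar K" for a
    by (rule eq_neg[symmetric]) (use that in simp_all)
  have "neg (\<S> p) = neg (\<S> f \<cdot> \<S> r)" using e by (simp add: n n' cr)
  from arg_cong[OF this, of neg] have "\<S> p = \<S> (f \<cdot> r)" by (simp add: nn merge_S)
  then have "p = f \<cdot> r" by (rule SuspA_cancel) simp_all
  then show ?thesis using r by blast
qed

lemma iso_comp_cancel:
  assumes "iso K (g \<cdot> f)" "iso K (f \<cdot> g)" "f \<in> Hom x y" "g \<in> Hom y x"
  shows "iso K f"
proof -
  have [simp]: "f \<in> Ar K" "Dom K f = x" "Cod K f = y" "g \<in> Ar K" "Dom K g = y" "Cod K g = x" using assms(3,4) by simp_all
  define l where "l = inv_arrow K (g \<cdot> f) \<cdot> g"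
  define r where "r = g \<cdot> inv_arrow K (f \<cdot> g)"
  have [simp]: "l \<in> Ar K" "Dom K l = y" "Cod K l = x" "r \<in> Ar K" "Dom K r = y" "Cod K r = x"
    using assms(1,2) by (simp_all add: l_def r_def)
  have l: "l \<cdot> f = \<I> x" using inv_arrow_simps(4)[OF assms(1)] assms(1) by (simp add: l_def)
  have "f \<cdot> r = (f \<cdot> g) \<cdot> inv_arrow K (f \<cdot> g)"
    unfolding r_def by (rule comp_assoc_simp[symmetric]) (use assms(2) in simp_all)
  also have "\<dots> = \<I> y" unfolding inv_arrow_simps(5)[OF assms(2)] by simp
  finally have r: "f \<cdot> r = \<I> y" .
  have "l = l \<cdot> (f \<cdot> r)" unfolding r by simp
  also have "\<dots> = r" by (simp add: l[THEN reassoc])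
  finally have "f \<cdot> l = \<I> y" using r by simp
  then show ?thesis using l by (intro isoI[of f x y l]) simp_all
qed

text \<open>The difference \<open>v\<close> of \<open>u\<close> and the identity kills
  \<open>g\<close>, so it factors through \<open>h\<close>; as \<open>h \<cdot> v\<close> vanishes
  too, \<open>v\<close> squares to zero.\<close>

lemma Tri_endomorphism_iso:
  assumes t: "(f, g, h) \<in> Tri K" and u: "u \<in> Hom (Cod K g) (Cod K g)" "u \<cdot> g = g" "h \<cdot> u = h"
  shows "iso K u"
proof -
  let ?z = "Cod K g"
  note [simp] = Tri_simps[OF t] u(1)[unfolded Hom_iff]
  define v where "v = u \<oplus> neg (\<I> ?z)"
  have [simp]: "v \<in> Ar K" "Dom K v = ?z" "Cod K v = ?z" by (simp_all add: v_def)
  have nl: "neg (\<I> w) \<cdot> a = neg a" if "a \<in> Ar K" "Cod K a = w" for a w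
    by (rule eq_neg) (use that add_comp'[of "\<I> w" "neg (\<I> w)" a] in auto)
  have nr: "a \<cdot> neg (\<I> w) = neg a" if "a \<in> Ar K" "Dom K a = w" for a w
    by (rule eq_neg) (use that comp_add'[of "\<I> w" "neg (\<I> w)" a] in auto)
  show ?thesis
  proof (rule iso_ident_add)
    show "u = \<I> ?z \<oplus> v" using add_comm[of u "neg (\<I> ?z)"] by (simp add: v_def flip: add_assoc')
    have vg: "v \<cdot> g = Zero K (Dom K g) ?z" by (simp add: v_def add_comp' nl u(2))
    have hv: "h \<cdot> v = Zero K ?z (\<Sigma> (Dom K f))" by (simp add: v_def comp_add' nr u(3))
    have "\<exists>r\<in>Hom (\<Sigma> (Dom K f)) (Cod K v). v = r \<cdot> h"
      by (rule Tri_colift[OF t, of v]) (simp_all add: vg)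
    then obtain r where r: "r \<in> Hom (\<Sigma> (Dom K f)) (Cod K v)" and v: "v = r \<cdot> h" by blast
    have "r \<cdot> (h \<cdot> v) = Zero K ?z ?z" using r by (simp add: hv)
    moreover have "v \<cdot> v = r \<cdot> (h \<cdot> v)" by (subst (1) v) (use r in simp)
    ultimately show "v \<cdot> v = Zero K ?z ?z" by simp
  qed simp_all
qed

text \<open>A retract of a triangle is compared with a triangle on its first arrow; both composites of the
  comparison maps differ from the identity by an arrow of square zero.\<close>

lemma Tri_retract:
  assumes t: "(f, g, h) \<in> Tri K" and f': "f' \<in> Hom x' y'" and g': "g' \<in> Hom y' z'" and h': "h' \<in> Hom z' (\<Sigma> x')"
    and i: "i1 \<in> Hom x' (Dom K f)" "i2 \<in> Hom y' (Cod K f)" "i3 \<in> Hom z' (Cod K g)"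
    and p: "p1 \<in> Hom (Dom K f) x'" "p2 \<in> Hom (Cod K f) y'" "p3 \<in> Hom (Cod K g) z'"
    and pi: "p1 \<cdot> i1 = \<I> x'" "p2 \<cdot> i2 = \<I> y'" "p3 \<cdot> i3 = \<I> z'"
    and ci: "i2 \<cdot> f' = f \<cdot> i1" "i3 \<cdot> g' = g \<cdot> i2" "\<S> i1 \<cdot> h' = h \<cdot> i3"
    and cp: "p2 \<cdot> f = f' \<cdot> p1" "p3 \<cdot> g = g' \<cdot> p2" "\<S> p1 \<cdot> h = h' \<cdot> p3"
  shows "(f', g', h') \<in> Tri K"
proof -
  note [simp] = Tri_simps[OF t] f'[unfolded Hom_iff] g'[unfolded Hom_iff] h'[unfolded Hom_iff]
    i[unfolded Hom_iff] p[unfolded Hom_iff]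
  have ob [simp]: "x' \<in> Ob K" "y' \<in> Ob K" "z' \<in> Ob K" using Dom_Ob[of i1] Dom_Ob[of i2] Dom_Ob[of i3] by simp_all
  obtain g2 h2 where t2: "(f', g2, h2) \<in> Tri K" using Tri_exists[of f'] by auto
  note T2 [simp] = Tri_simps[OF t2]
  define z2 where "z2 = Cod K g2"
  have [simp]: "Cod K g2 = z2" "z2 \<in> Ob K" by (simp_all add: z2_def)
  have "\<exists>c\<in>Hom (Cod K g2) (Cod K g). c \<cdot> g2 = g \<cdot> i2 \<and> \<S> i1 \<cdot> h2 = h \<cdot> c"
    by (rule Tri_morphism[OF t2 t]) (simp_all add: ci(1))
  then obtain c where c: "c \<in> Hom z2 (Cod K g)" and c1: "c \<cdot> g2 = g \<cdot> i2" and c2: "\<S> i1 \<cdot> h2 = h \<cdot> c"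
    unfolding z2_def by blast
  have "\<exists>c\<in>Hom (Cod K g) (Cod K g2). c \<cdot> g = g2 \<cdot> p2 \<and> \<S> p1 \<cdot> h = h2 \<cdot> c"
    by (rule Tri_morphism[OF t t2]) (simp_all add: cp(1))
  then obtain c' where c': "c' \<in> Hom (Cod K g) z2" and c1': "c' \<cdot> g = g2 \<cdot> p2" and c2': "\<S> p1 \<cdot> h = h2 \<cdot> c'"
    unfolding z2_def by blast
  note [simp] = c[unfolded Hom_iff] c'[unfolded Hom_iff]
  define d where "d = p3 \<cdot> c"
  define d' where "d' = c' \<cdot> i3"
  have [simp]: "d \<in> Ar K" "Dom K d = z2" "Cod K d = z'" "d' \<in> Ar K" "Dom K d' = z'" "Cod K d' = z2"
    by (simp_all add: d_def d'_def)
  have S1: "\<S> p1 \<cdot> \<S> i1 = \<I> (\<Sigma> x')" by (simp add: merge_S pi)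
  have d1: "d \<cdot> g2 = g'" by (simp add: d_def c1 cp(2)[THEN reassoc] pi)
  have d2: "h' \<cdot> d = h2" 
  proof -
    have "h' \<cdot> d = \<S> p1 \<cdot> (h \<cdot> c)" by (simp add: d_def cp(3)[THEN reassoc])
    also have "\<dots> = h2" unfolding c2[symmetric] by (simp add: S1[THEN reassoc])
    finally show ?thesis .
  qed
  have d1': "d' \<cdot> g' = g2" by (simp add: d'_def ci(2) c1'[THEN reassoc] pi)
  have d2': "h2 \<cdot> d' = h'"
  proof -
    have "h2 \<cdot> d' = \<S> p1 \<cdot> (h \<cdot> i3)" by (simp add: d'_def c2'[THEN reassoc])
    also have "\<dots> = h'" unfolding ci(3)[symmetric] by (simp add: S1[THEN reassoc])
    finally show ?thesis .
  qed
  have nl: "neg (\<I> w) \<cdot> a = neg a" if "a \<in> Ar K" "Cod K a = w" for a w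
    by (rule eq_neg) (use that add_comp'[of "\<I> w" "neg (\<I> w)" a] in auto)
  have nr: "a \<cdot> neg (\<I> w) = neg a" if "a \<in> Ar K" "Dom K a = w" for a w
    by (rule eq_neg) (use that comp_add'[of "\<I> w" "neg (\<I> w)" a] in auto)
  have "iso K (d' \<cdot> d)"
    by (rule Tri_endomorphism_iso[OF t2]) (simp_all add: d1 d1' d2 d2'[THEN reassoc])
  moreover
  define u' where "u' = d \<cdot> d'"
  have [simp]: "u' \<in> Ar K" "Dom K u' = z'" "Cod K u' = z'" by (simp_all add: u'_def)
  define v' where "v' = u' \<oplus> neg (\<I> z')"
  have [simp]: "v' \<in> Ar K" "Dom K v' = z'" "Cod K v' = z'" by (simp_all add: v'_def)
  \<comment> \<open>\<open>Tri_endomorphism_iso\<close> cannot be quoted for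
    \<open>d \<cdot> d'\<close>, since its triangle is the one to be shown distinguished. Instead
    \<open>v' \<cdot> p3\<close> is factored through \<open>h\<close>, and \<open>i3\<close> brings
    the result back to \<open>v'\<close>.\<close>
  have "iso K u'"
  proof (rule iso_ident_add)
    show "u' = \<I> z' \<oplus> v'" using add_comm[of u' "neg (\<I> z')"] by (simp add: v'_def flip: add_assoc')
    have vg: "v' \<cdot> g' = Zero K y' z'" by (simp add: v'_def add_comp' nl u'_def d1 d1')
    have hv: "h' \<cdot> v' = Zero K z' (\<Sigma> x')" by (simp add: v'_def comp_add' nr u'_def d2' d2[THEN reassoc])
    have "\<exists>r\<in>Hom (\<Sigma> (Dom K f)) (Cod K (v' \<cdot> p3)). v' \<cdot> p3 = r \<cdot> h"
      by (rule Tri_colift[OF t]) (simp_all add: cp(2) vg[THEN reassoc])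
    then obtain r where r0: "r \<in> Hom (\<Sigma> (Dom K f)) (Cod K (v' \<cdot> p3))" and vp: "v' \<cdot> p3 = r \<cdot> h"
      by blast
    from r0 have r: "r \<in> Hom (\<Sigma> (Dom K f)) z'" by simp
    have "v' \<cdot> v' = (v' \<cdot> p3) \<cdot> (i3 \<cdot> v')" by (simp add: pi(3)[THEN reassoc])
    also have "\<dots> = r \<cdot> (h \<cdot> i3) \<cdot> v'" unfolding vp using r by simp
    also have "\<dots> = Zero K z' z'" unfolding ci(3)[symmetric] using r by (simp add: hv)
    finally show "v' \<cdot> v' = Zero K z' z'" .
  qed simp_all
  ultimately have "iso K d"
    unfolding u'_def by (rule iso_comp_cancel[of d' d z2 z']) simp_all
  show ?thesis
    by (rule Tri_iso[OF t2 f' g' h', of "\<I> x'" "\<I> y'" d]) (simp_all add: \<open>iso K d\<close> d1 d2)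
qed

end

section \<open>Suspension and exactness of relative tensor products\<close>

context tt_category
begin

lemma theta_simps [simp]:
  assumes "x \<in> Ob K" "y \<in> Ob K"
  shows "\<theta> x y \<in> Ar K" "Dom K (\<theta> x y) = x \<otimes> \<Sigma> y" "Cod K (\<theta> x y) = \<Sigma> (x \<otimes> y)" "iso K (\<theta> x y)"
  using tsusp_iso[OF assms] by simp_all

lemma theta_nat:
  "f \<in> Ar K \<Longrightarrow> g \<in> Ar K \<Longrightarrow> Cod K f = x' \<Longrightarrow> Cod K g = y' \<Longrightarrow>
    \<theta> x' y' \<cdot> (f \<odot> \<S> g) = \<S> (f \<odot> g) \<cdot> \<theta> (Dom K f) (Dom K g)"
  using tsusp_natural[of f "Dom K f" x' g "Dom K g" y'] by simp

lemma theta_nat_left: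
  "f \<in> Ar K \<Longrightarrow> y \<in> Ob K \<Longrightarrow> Cod K f = x' \<Longrightarrow>
    \<theta> x' y \<cdot> (f \<odot> \<I> (\<Sigma> y)) = \<S> (f \<odot> \<I> y) \<cdot> \<theta> (Dom K f) y"
  using theta_nat[of f "\<I> y" x' y] by simp

lemma theta_assoc:
  assumes [simp]: "x \<in> Ob K" "y \<in> Ob K" "z \<in> Ob K"
  shows "\<theta> (x \<otimes> y) z = \<S> (ai x y z) \<cdot> \<theta> x (y \<otimes> z) \<cdot> (\<I> x \<odot> \<theta> y z) \<cdot> \<alpha> x y (\<Sigma> z)"
    "\<theta> (x \<otimes> y) z \<cdot> ai x y (\<Sigma> z) = \<S> (ai x y z) \<cdot> \<theta> x (y \<otimes> z) \<cdot> (\<I> x \<odot> \<theta> y z)"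
proof -
  have "\<theta> (x \<otimes> y) z = inv_arrow K (\<S> (\<alpha> x y z)) \<cdot> (\<theta> x (y \<otimes> z) \<cdot> (\<I> x \<odot> \<theta> y z) \<cdot> \<alpha> x y (\<Sigma> z))"
    by (rule eq_inv_comp) (simp_all add: tsusp_assoc)
  then show 1: "\<theta> (x \<otimes> y) z = \<S> (ai x y z) \<cdot> \<theta> x (y \<otimes> z) \<cdot> (\<I> x \<odot> \<theta> y z) \<cdot> \<alpha> x y (\<Sigma> z)"
    by (simp add: inv_SuspA)
  show "\<theta> (x \<otimes> y) z \<cdot> ai x y (\<Sigma> z) = \<S> (ai x y z) \<cdot> \<theta> x (y \<otimes> z) \<cdot> (\<I> x \<odot> \<theta> y z)"
    unfolding 1 by simp
qed

text \<open>\<open>\<theta>\<close> is natural and compatible with the associator, so it passes the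
  operations of the right-nested calculus. This series leads to \<open>tid_theta\<close>: the
  idempotent splitting off \<open>M \<otimes>\<^sub>B N\<close> commutes with suspension.\<close>

lemma theta_ext:
  assumes [simp]: "u \<in> Ob K" "v \<in> Ob K" "w \<in> Ob K" "m \<in> Ar K" "Dom K m = u \<otimes> v" and t: "Cod K m = t"
  shows "\<theta> t w \<cdot> ext u v m (\<Sigma> w) = \<S> (ext u v m w) \<cdot> \<theta> u (v \<otimes> w) \<cdot> (\<I> u \<odot> \<theta> v w)"
proof -
  have [simp]: "t \<in> Ob K" using t by auto
  have "\<theta> t w \<cdot> ext u v m (\<Sigma> w) = \<S> (m \<odot> \<I> w) \<cdot> (\<theta> (u \<otimes> v) w \<cdot> ai u v (\<Sigma> w))"
    by (simp add: ext_def t theta_nat_left[THEN reassoc])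
  also have "\<dots> = \<S> (ext u v m w) \<cdot> \<theta> u (v \<otimes> w) \<cdot> (\<I> u \<odot> \<theta> v w)"
    unfolding theta_assoc(2)[OF assms(1-3)] by (simp add: ext_def merge_S t)
  finally show ?thesis .
qed

lemma theta_sw:
  assumes [simp]: "u \<in> Ob K" "v \<in> Ob K" "w \<in> Ob K"
  shows "\<theta> v (u \<otimes> w) \<cdot> (\<I> v \<odot> \<theta> u w) \<cdot> sw u v (\<Sigma> w) = \<S> (sw u v w) \<cdot> \<theta> u (v \<otimes> w) \<cdot> (\<I> u \<odot> \<theta> v w)"
proof -
  have "\<theta> v (u \<otimes> w) \<cdot> (\<I> v \<odot> \<theta> u w) \<cdot> sw u v (\<Sigma> w) =
      (\<theta> v (u \<otimes> w) \<cdot> (\<I> v \<odot> \<theta> u w) \<cdot> \<alpha> v u (\<Sigma> w)) \<cdot> (\<gamma> u v \<odot> \<I> (\<Sigma> w)) \<cdot> ai u v (\<Sigma> w)"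
    by (simp add: sw_def)
  also have "\<dots> = \<S> (\<alpha> v u w) \<cdot> \<S> (\<gamma> u v \<odot> \<I> w) \<cdot> (\<theta> (u \<otimes> v) w \<cdot> ai u v (\<Sigma> w))"
    unfolding tsusp_assoc[OF assms(2,1,3), symmetric] by (simp add: theta_nat_left[THEN reassoc])
  also have "\<dots> = \<S> (sw u v w) \<cdot> \<theta> u (v \<otimes> w) \<cdot> (\<I> u \<odot> \<theta> v w)"
    unfolding theta_assoc(2)[OF assms(1-3)] by (simp add: sw_def merge_S)
  finally show ?thesis .
qed

lemma theta_lift:
  assumes [simp]: "b \<in> Ob K" "x \<in> Ob K" "y \<in> Ob K" "m \<in> Ar K" "Dom K m = b \<otimes> y" and t: "Cod K m = t"
  shows "\<theta> x t \<cdot> lift x b (\<S> m \<cdot> \<theta> b y) (\<Sigma> y) = \<S> (lift x b m y) \<cdot> \<theta> b (x \<otimes> y) \<cdot> (\<I> b \<odot> \<theta> x y)"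
proof -
  have [simp]: "t \<in> Ob K" using t by auto
  have 1: "\<I> x \<odot> (\<S> m \<cdot> \<theta> b y) = (\<I> x \<odot> \<S> m) \<cdot> (\<I> x \<odot> \<theta> b y)" by (simp add: merge)
  have "\<theta> x t \<cdot> lift x b (\<S> m \<cdot> \<theta> b y) (\<Sigma> y) = \<S> (\<I> x \<odot> m) \<cdot> (\<theta> x (b \<otimes> y) \<cdot> (\<I> x \<odot> \<theta> b y) \<cdot> sw b x (\<Sigma> y))"
    unfolding lift_def 1 by (simp add: theta_nat[THEN reassoc] t)
  also have "\<dots> = \<S> (lift x b m y) \<cdot> \<theta> b (x \<otimes> y) \<cdot> (\<I> b \<odot> \<theta> x y)"
    unfolding theta_sw[OF assms(1-3)] by (simp add: lift_def merge_S t)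
  finally show ?thesis .
qed

lemma theta_uext:
  assumes [simp]: "z \<in> Ob K" "n \<in> Ar K" "Dom K n = \<one>" and t: "Cod K n = t"
  shows "\<theta> t z \<cdot> uext n (\<Sigma> z) = \<S> (uext n z)"
proof -
  have [simp]: "t \<in> Ob K" using t by auto
  have "\<theta> \<one> z = inv_arrow K (\<S> (\<lambda>\<lambda> z)) \<cdot> \<lambda>\<lambda> (\<Sigma> z)"
    by (rule eq_inv_comp) (simp_all add: tsusp_lunit)
  then have 1: "\<theta> \<one> z \<cdot> inv_arrow K (\<lambda>\<lambda> (\<Sigma> z)) = \<S> (inv_arrow K (\<lambda>\<lambda> z))"
    by (simp add: inv_SuspA)
  show ?thesis
    by (simp add: uext_def theta_nat_left[THEN reassoc] t 1 merge_S)
qed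

lemma theta_sig:
  assumes B: "tt_ring K B" and [simp]: "z \<in> Ob K"
  shows "\<theta> (robj B) (robj B \<otimes> z) \<cdot> (\<I> (robj B) \<odot> \<theta> (robj B) z) \<cdot> sig B (\<Sigma> z) = \<S> (sig B z)"
proof -
  note [simp] = tt_ringD[OF B] sep_simps[OF B]
  let ?b = "robj B"
  have "\<theta> ?b (?b \<otimes> z) \<cdot> (\<I> ?b \<odot> \<theta> ?b z) \<cdot> sig B (\<Sigma> z) =
    (\<theta> ?b (?b \<otimes> z) \<cdot> (\<I> ?b \<odot> \<theta> ?b z) \<cdot> \<alpha> ?b ?b (\<Sigma> z)) \<cdot> uext (sep B) (\<Sigma> z)"
    by (simp add: sig_def)
  also have "\<dots> = \<S> (sig B z)"
    unfolding tsusp_assoc[OF tt_ringD(1)[OF B] tt_ringD(1)[OF B] assms(2), symmetric]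
    by (simp add: theta_uext sig_def merge_S)
  finally show ?thesis .
qed

lemma action_susp:
  assumes B: "tt_ring K B" and a: "action B y r"
  shows "action B (\<Sigma> y) (\<S> r \<cdot> \<theta> (robj B) y)"
proof -
  note [simp] = tt_ringD[OF B] actionD(1-4)[OF a]
  let ?b = "robj B"
  have "\<S> r \<cdot> \<theta> ?b y \<cdot> ext ?b ?b (mult B) (\<Sigma> y) = \<S> (r \<cdot> ext ?b ?b (mult B) y) \<cdot> \<theta> ?b (?b \<otimes> y) \<cdot> (\<I> ?b \<odot> \<theta> ?b y)"
    by (simp add: theta_ext merge_S)
  also have "\<dots> = \<S> r \<cdot> \<theta> ?b y \<cdot> (\<I> ?b \<odot> \<S> r) \<cdot> (\<I> ?b \<odot> \<theta> ?b y)"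
    unfolding actionD(5)[OF a] by (simp add: theta_nat[THEN reassoc] merge_S)
  finally have 1: "\<S> r \<cdot> \<theta> ?b y \<cdot> ext ?b ?b (mult B) (\<Sigma> y) = \<S> r \<cdot> \<theta> ?b y \<cdot> (\<I> ?b \<odot> (\<S> r \<cdot> \<theta> ?b y))"
    by (simp add: merge)
  have 2: "\<S> r \<cdot> \<theta> ?b y \<cdot> uext (unit B) (\<Sigma> y) = \<I> (\<Sigma> y)"
    by (simp add: theta_uext merge_S actionD(6)[OF a])
  show ?thesis by (simp add: action_def 1 2)
qed

lemma susp_mod_simps [simp]: "fst (susp_mod K B M) = \<Sigma> (fst M)" "snd (susp_mod K B M) = \<S> (snd M) \<cdot> \<theta> (robj B) (fst M)"
  by (simp_all add: susp_mod_def)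

lemma susp_mod_modules: "tt_ring K B \<Longrightarrow> M \<in> modules K B \<Longrightarrow> susp_mod K B M \<in> modules K B"
  by (simp add: modules_iff action_susp)

lemma res_mod_susp_mod:
  assumes B: "tt_ring K B" and C: "tt_ring K C" and f: "ring_hom K B C f" and L: "L \<in> modules K C"
  shows "res_mod f (susp_mod K C L) = susp_mod K B (res_mod f L)"
proof -
  note [simp] = tt_ringD[OF B] tt_ringD[OF C] ring_homD[OF f] modulesD(1-4)[OF C L]
  have "snd (res_mod f (susp_mod K C L)) = snd (susp_mod K B (res_mod f L))"
    by (simp add: res_mod_def theta_nat_left merge_S)
  then show ?thesis by (intro prod_eqI) simp_all
qed

definition tid where
  "tid B M N = lact B M (fst N) \<cdot> tw B M N"

lemma tid_simps:
  assumes B: "tt_ring K B" and M: "M \<in> modules K B" and N: "N \<in> modules K B"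
  shows "tid B M N \<in> Ar K" "Dom K (tid B M N) = fst M \<otimes> fst N" "Cod K (tid B M N) = fst M \<otimes> fst N"
  using tw(1-3)[OF assms] modulesD(1-4)[OF B M] modulesD(1-4)[OF B N] tt_ringD[OF B] by (simp_all add: tid_def)

text \<open>\<open>M \<otimes>\<^sub>B N\<close> is cut out of \<open>M \<otimes> N\<close> by an
  idempotent that is natural in \<open>N\<close>; together with \<open>tid_theta\<close> this makes
  \<open>M \<otimes>\<^sub>B -\<close> a summand of the exact functor
  \<open>M \<otimes> -\<close>.\<close>

lemma tid_nat:
  assumes B: "tt_ring K B" and M: "M \<in> modules K B" and v: "mhom B N N' v"
  shows "(\<I> (fst M) \<odot> v) \<cdot> tid B M N = tid B M N' \<cdot> (\<I> (fst M) \<odot> v)"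
proof -
  note N = mhomD(1,2)[OF v]
  note [simp] = tt_ringD[OF B] modulesD(1-4)[OF B M] modulesD(1-4)[OF B N(1)] modulesD(1-4)[OF B N(2)] mhomD(3-5)[OF v]
    sig_simps[OF B]
  let ?x = "fst M" let ?b = "robj B" let ?xv = "\<I> ?x \<odot> v"
  have 1: "?xv \<cdot> lact B M (fst N) = lact B M (fst N') \<cdot> (\<I> ?b \<odot> ?xv)"
    by (simp add: ext_nat_right)
  have 2: "?xv \<cdot> ract B ?x N = ract B ?x N' \<cdot> (\<I> ?b \<odot> ?xv)"
    by (rule lift_map) (simp_all add: mhomD(6)[OF v])
  have 3: "(\<I> ?b \<odot> ?xv) \<cdot> (\<I> ?b \<odot> ract B ?x N) = (\<I> ?b \<odot> ract B ?x N') \<cdot> (\<I> ?b \<odot> (\<I> ?b \<odot> ?xv))"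
    by (simp add: merge 2)
  show ?thesis
    by (simp add: tid_def tw_def 1[THEN reassoc] 3[THEN reassoc] sig_nat[OF B])
qed

lemma tid_theta:
  assumes B: "tt_ring K B" and M: "M \<in> modules K B" and N: "N \<in> modules K B"
  shows "\<theta> (fst M) (fst N) \<cdot> tid B M (susp_mod K B N) = \<S> (tid B M N) \<cdot> \<theta> (fst M) (fst N)"
proof -
  note [simp] = tt_ringD[OF B] modulesD(1-4)[OF B M] modulesD(1-4)[OF B N] sig_simps[OF B]
  let ?x = "fst M" let ?y = "fst N" let ?b = "robj B" let ?t = "\<theta> ?x ?y"
  let ?la = "lact B M ?y" let ?ra = "ract B ?x N"
  have 1: "?t \<cdot> lact B M (\<Sigma> ?y) = \<S> ?la \<cdot> \<theta> ?b (?x \<otimes> ?y) \<cdot> (\<I> ?b \<odot> ?t)"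
    by (simp add: theta_ext)
  have 2: "?t \<cdot> ract B ?x (susp_mod K B N) = \<S> ?ra \<cdot> \<theta> ?b (?x \<otimes> ?y) \<cdot> (\<I> ?b \<odot> ?t)"
    by (simp add: theta_lift)
  have [simp]: "ract B ?x (susp_mod K B N) \<in> Ar K" "Dom K (ract B ?x (susp_mod K B N)) = ?b \<otimes> (?x \<otimes> \<Sigma> ?y)"
    "Cod K (ract B ?x (susp_mod K B N)) = ?x \<otimes> \<Sigma> ?y" by simp_all
  have 3: "(\<I> ?b \<odot> ?t) \<cdot> (\<I> ?b \<odot> ract B ?x (susp_mod K B N)) = (\<I> ?b \<odot> \<S> ?ra) \<cdot> (\<I> ?b \<odot> \<theta> ?b (?x \<otimes> ?y)) \<cdot> (\<I> ?b \<odot> (\<I> ?b \<odot> ?t))"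
    using 2 by (simp add: merge)
  have "?t \<cdot> tid B M (susp_mod K B N) = \<S> ?la \<cdot> \<theta> ?b (?x \<otimes> ?y) \<cdot> ((\<I> ?b \<odot> ?t) \<cdot> (\<I> ?b \<odot> ract B ?x (susp_mod K B N))) \<cdot> sig B (?x \<otimes> \<Sigma> ?y)"
    by (simp add: tid_def tw_def 1[THEN reassoc])
  also have "\<dots> = \<S> ?la \<cdot> \<theta> ?b (?x \<otimes> ?y) \<cdot> (\<I> ?b \<odot> \<S> ?ra) \<cdot> (\<I> ?b \<odot> \<theta> ?b (?x \<otimes> ?y)) \<cdot> (\<I> ?b \<odot> (\<I> ?b \<odot> ?t)) \<cdot> sig B (?x \<otimes> \<Sigma> ?y)"
    unfolding 3 by simp
  also have "\<dots> = \<S> ?la \<cdot> \<S> (\<I> ?b \<odot> ?ra) \<cdot> (\<theta> ?b (?b \<otimes> (?x \<otimes> ?y)) \<cdot> (\<I> ?b \<odot> \<theta> ?b (?x \<otimes> ?y)) \<cdot> sig B (\<Sigma> (?x \<otimes> ?y))) \<cdot> ?t"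
    by (simp add: sig_nat[OF B] theta_nat[THEN reassoc])
  also have "\<dots> = \<S> (tid B M N) \<cdot> ?t"
    by (simp add: theta_sig[OF B]) (simp add: tid_def tw_def merge_S)
  finally show ?thesis .
qed

lemma rten_susp_map:
  assumes B: "tt_ring K B" and C: "tt_ring K C" and f: "ring_hom K B C f" and L: "L \<in> modules K C"
    and N: "N \<in> modules K B" and w: "mhom B N' (susp_mod K B N) w"
  shows "\<exists>m. mhom C (rten C B f L N') (susp_mod K C (rten C B f L N)) m \<and>
    m \<cdot> tensor_quot K B (res_mod f L) N' = \<S> (tensor_quot K B (res_mod f L) N) \<cdot> \<theta> (fst L) (fst N) \<cdot> (\<I> (fst L) \<odot> w)"
proof -
  note N' = mhomD(1)[OF w]
  note R = rten_modules[OF B C f L N] and F = rten_fst[OF B C f L N]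
  note P = susp_mod_modules[OF C R]
  let ?q = "tensor_quot K B (res_mod f L) N" let ?x = "fst L" let ?y = "fst N" let ?b = "robj B" let ?c = "robj C"
  note [simp] = rten_base[OF B C f L N] rten_base[OF B C f L N'] F rq(1,2)[OF B C f L N]
    modulesD(1-4)[OF C R, unfolded F] mhomD(3-5)[OF w, simplified] 
  let ?g = "\<S> ?q \<cdot> \<theta> ?x ?y \<cdot> (\<I> ?x \<odot> w)"
  have xw: "(\<I> ?x \<odot> w) \<cdot> ext e ?x r (fst N') = ext e ?x r (\<Sigma> ?y) \<cdot> (\<I> e \<odot> (\<I> ?x \<odot> w))"
    if "e \<in> Ob K" "r \<in> Ar K" "Dom K r = e \<otimes> ?x" "Cod K r = ?x" for e r
    using that by (simp add: ext_nat_right)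
  have 1: "?g \<cdot> ext e ?x r (fst N') = \<S> (?q \<cdot> ext e ?x r ?y) \<cdot> \<theta> e (?x \<otimes> ?y) \<cdot> (\<I> e \<odot> \<theta> ?x ?y) \<cdot> (\<I> e \<odot> (\<I> ?x \<odot> w))"
    if "e \<in> Ob K" "r \<in> Ar K" "Dom K r = e \<otimes> ?x" "Cod K r = ?x" for e r
    using that by (simp add: xw theta_ext[THEN reassoc] merge_S)
  have xr: "(\<I> ?x \<odot> w) \<cdot> ract B ?x N' = lift ?x ?b (\<S> (snd N) \<cdot> \<theta> ?b ?y) (\<Sigma> ?y) \<cdot> (\<I> ?b \<odot> (\<I> ?x \<odot> w))"
    by (rule lift_map) (use mhomD(6)[OF w] in simp_all)
  have 2: "?g \<cdot> ract B ?x N' = \<S> (?q \<cdot> ract B ?x N) \<cdot> \<theta> ?b (?x \<otimes> ?y) \<cdot> (\<I> ?b \<odot> \<theta> ?x ?y) \<cdot> (\<I> ?b \<odot> (\<I> ?x \<odot> w))"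
    by (simp add: xr theta_lift[THEN reassoc] merge_S)
  have a: "?g \<in> Hom (fst L \<otimes> fst N') (fst (susp_mod K C (rten C B f L N)))" by simp
  have b: "?g \<cdot> lact B (res_mod f L) (fst N') = ?g \<cdot> ract B (fst L) N'"
    unfolding 2 rq(3)[OF B C f L N, symmetric] using 1[of ?b "snd (res_mod f L)"] by simp
  have c: "?g \<cdot> lact C L (fst N') = snd (susp_mod K C (rten C B f L N)) \<cdot> (\<I> ?c \<odot> ?g)"
  proof -
    have "?g \<cdot> lact C L (fst N') = \<S> (?q \<cdot> lact C L ?y) \<cdot> \<theta> ?c (?x \<otimes> ?y) \<cdot> (\<I> ?c \<odot> \<theta> ?x ?y) \<cdot> (\<I> ?c \<odot> (\<I> ?x \<odot> w))"
      by (rule 1) simp_all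
    also have "\<dots> = snd (susp_mod K C (rten C B f L N)) \<cdot> (\<I> ?c \<odot> \<S> ?q) \<cdot> (\<I> ?c \<odot> \<theta> ?x ?y) \<cdot> (\<I> ?c \<odot> (\<I> ?x \<odot> w))"
      unfolding rten_snd(2)[OF B C f L N, symmetric] by (simp add: theta_nat[THEN reassoc] merge_S)
    finally show ?thesis by (simp add: merge)
  qed
  note U = rten_univ[OF B C f L N' P a b c]
  show ?thesis
    by (rule exI, rule conjI, rule U(1)) (use U(2) rq(1,2,4-6)[OF B C f L N'] in simp)
qed

lemma rten_susp:
  assumes B: "tt_ring K B" and C: "tt_ring K C" and f: "ring_hom K B C f" and L: "L \<in> modules K C"
    and N: "N \<in> modules K B"
  shows "miso C (rten C B f L (susp_mod K B N)) (susp_mod K C (rten C B f L N))"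
proof -
  note S = susp_mod_modules[OF B N] and RL = res_mod_modules[OF B C f L]
  let ?q = "tensor_quot K B (res_mod f L) N" let ?q' = "tensor_quot K B (res_mod f L) (susp_mod K B N)"
  let ?s = "tsec B (res_mod f L) N" let ?t = "\<theta> (fst L) (fst N)"
  note F = rten_fst[OF B C f L N] rten_fst[OF B C f L S]
  note [simp] = rten_base[OF B C f L N] rq(1,2,4-7)[OF B C f L N] rq(1,2)[OF B C f L S, simplified] F
    tid_simps[OF B RL N, simplified] tid_simps[OF B RL S, simplified]
  obtain m where m: "mhom C (rten C B f L (susp_mod K B N)) (susp_mod K C (rten C B f L N)) m"
    and mq: "m \<cdot> ?q' = \<S> ?q \<cdot> ?t"
    using rten_susp_map[OF B C f L N mhom_ident[OF B S]] by auto
  have [simp]: "m \<in> Ar K" "Dom K m = Cod K ?q'" "Cod K m = \<Sigma> (Cod K ?q)" using mhomD(3-5)[OF m] by simp_all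
  define n where "n = ?q' \<cdot> inv_arrow K ?t \<cdot> \<S> ?s"
  have [simp]: "n \<in> Ar K" "Dom K n = \<Sigma> (Cod K ?q)" "Cod K n = Cod K ?q'" by (simp_all add: n_def)
  have sq: "?s \<cdot> ?q = tid B (res_mod f L) N"
    using rq(8)[OF B C f L N] by (simp add: tid_def)
  show ?thesis
  proof (rule misoI[OF C m])
    show "n \<in> Hom (fst (susp_mod K C (rten C B f L N))) (fst (rten C B f L (susp_mod K B N)))" by simp
    show "m \<cdot> n = \<I> (fst (susp_mod K C (rten C B f L N)))"
      by (simp add: n_def mq[THEN reassoc] merge_S)
    have e: "?q' \<cdot> tid B (res_mod f L) (susp_mod K B N) = ?q'"
    proof -
      have "?q' \<cdot> tid B (res_mod f L) (susp_mod K B N) = ?q' \<cdot> (tsec B (res_mod f L) (susp_mod K B N) \<cdot> ?q')"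
        using rq(8)[OF B C f L S] by (simp add: tid_def)
      also have "\<dots> = ?q'" using rq(7)[OF B C f L S, THEN reassoc, of ?q'] rq(4-6)[OF B C f L S] by simp
      finally show ?thesis .
    qed
    have t: "inv_arrow K ?t \<cdot> \<S> (tid B (res_mod f L) N) \<cdot> ?t = tid B (res_mod f L) (susp_mod K B N)"
      by (rule eq_inv_comp[symmetric]) (use tid_theta[OF B RL N] in simp_all)
    show "n \<cdot> m = \<I> (fst (rten C B f L (susp_mod K B N)))"
    proof (rule rq_epi[OF B C f L S])
      have "(n \<cdot> m) \<cdot> ?q' = ?q' \<cdot> (inv_arrow K ?t \<cdot> \<S> (?s \<cdot> ?q) \<cdot> ?t)"
        by (simp add: mq n_def merge_S)
      also have "\<dots> = \<I> (fst (rten C B f L (susp_mod K B N))) \<cdot> ?q'"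
        unfolding sq t e by simp
      finally show "(n \<cdot> m) \<cdot> ?q' = \<I> (fst (rten C B f L (susp_mod K B N))) \<cdot> ?q'" .
    qed simp_all
  qed
qed

text \<open>\<open>L \<otimes> -\<close> sends the triangle to a triangle of \<open>K\<close>, and
  the quotient maps with their sections present \<open>mu\<close>, \<open>mv\<close>,
  \<open>mw\<close> as a retract of it; \<open>Tri_retract\<close> applies.\<close>

lemma rten_Tri:
  assumes B: "tt_ring K B" and C: "tt_ring K C" and f: "ring_hom K B C f" and L: "L \<in> modules K C"
    and u: "mhom B N1 N2 u" and v: "mhom B N2 N3 v" and w: "mhom B N3 (susp_mod K B N1) w" and t: "(u, v, w) \<in> Tri K"
  shows "\<exists>mu mv mw. mhom C (rten C B f L N1) (rten C B f L N2) mu \<and> mhom C (rten C B f L N2) (rten C B f L N3) mv \<and>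
     mhom C (rten C B f L N3) (susp_mod K C (rten C B f L N1)) mw \<and> (mu, mv, mw) \<in> Tri K"
proof -
  note N = mhomD(1,2)[OF u] mhomD(2)[OF v] and RL = res_mod_modules[OF B C f L]
  let ?q1 = "tensor_quot K B (res_mod f L) N1" let ?q2 = "tensor_quot K B (res_mod f L) N2" let ?q3 = "tensor_quot K B (res_mod f L) N3"
  let ?s1 = "tsec B (res_mod f L) N1" let ?s2 = "tsec B (res_mod f L) N2" let ?s3 = "tsec B (res_mod f L) N3"
  let ?x = "fst L" let ?t = "\<theta> ?x (fst N1)"
  let ?e = "\<lambda>N. tid B (res_mod f L) N"
  note F = rten_fst[OF B C f L N(1)] rten_fst[OF B C f L N(2)] rten_fst[OF B C f L N(3)]
  obtain mu where mu: "mhom C (rten C B f L N1) (rten C B f L N2) mu" and muq: "mu \<cdot> ?q1 = ?q2 \<cdot> (\<I> ?x \<odot> u)"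
    using rten_map[OF B C f mhom_ident[OF C L] u] by blast
  obtain mv where mv: "mhom C (rten C B f L N2) (rten C B f L N3) mv" and mvq: "mv \<cdot> ?q2 = ?q3 \<cdot> (\<I> ?x \<odot> v)"
    using rten_map[OF B C f mhom_ident[OF C L] v] by blast
  obtain mw where mw: "mhom C (rten C B f L N3) (susp_mod K C (rten C B f L N1)) mw" and mwq: "mw \<cdot> ?q3 = \<S> ?q1 \<cdot> ?t \<cdot> (\<I> ?x \<odot> w)"
    using rten_susp_map[OF B C f L N(1) w] by blast
  note [simp] = rten_base[OF B C f L N(1)] rten_base[OF B C f L N(2)] rten_base[OF B C f L N(3)]
    rq(1,2,4-7)[OF B C f L N(1)] rq(1,2,4-7)[OF B C f L N(2)] rq(1,2,4-7)[OF B C f L N(3)] F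
    tid_simps[OF B RL N(1), simplified] tid_simps[OF B RL N(2), simplified] tid_simps[OF B RL N(3), simplified]
    mhomD(3-5)[OF u] mhomD(3-5)[OF v] mhomD(3-5)[OF w, simplified] mhomD(3-5)[OF mu, unfolded F] mhomD(3-5)[OF mv, unfolded F] 
    mhomD(3-5)[OF mw, simplified susp_mod_simps F]
  have sq: "?s1 \<cdot> ?q1 = ?e N1" "?s2 \<cdot> ?q2 = ?e N2" "?s3 \<cdot> ?q3 = ?e N3"
    using rq(8)[OF B C f L N(1)] rq(8)[OF B C f L N(2)] rq(8)[OF B C f L N(3)] by (simp_all add: tid_def)
  note nat = tid_nat[OF B RL u, simplified fst_res_mod] tid_nat[OF B RL v, simplified fst_res_mod] tid_nat[OF B RL w, simplified fst_res_mod]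
  have su: "?s2 \<cdot> mu = (\<I> ?x \<odot> u) \<cdot> ?s1"
    by (rule rq_epi[OF B C f L N(1)]) (simp_all add: muq sq sq(2)[THEN reassoc] nat(1))
  have sv: "?s3 \<cdot> mv = (\<I> ?x \<odot> v) \<cdot> ?s2"
    by (rule rq_epi[OF B C f L N(2)]) (simp_all add: mvq sq sq(3)[THEN reassoc] nat(2))
  have sw: "\<S> ?s1 \<cdot> mw = (?t \<cdot> (\<I> ?x \<odot> w)) \<cdot> ?s3"
  proof (rule rq_epi[OF B C f L N(3)])
    have "(\<S> ?s1 \<cdot> mw) \<cdot> ?q3 = (\<S> (?e N1) \<cdot> ?t) \<cdot> (\<I> ?x \<odot> w)"
      by (simp add: mwq merge_S sq)
    also have "\<dots> = ?t \<cdot> ?e (susp_mod K B N1) \<cdot> (\<I> ?x \<odot> w)"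
      using tid_theta[OF B RL N(1)] tid_simps[OF B RL susp_mod_modules[OF B N(1)]] by (simp flip: tid_theta[OF B RL N(1), simplified fst_res_mod])
    also have "\<dots> = ((?t \<cdot> (\<I> ?x \<odot> w)) \<cdot> ?s3) \<cdot> ?q3"
      by (simp add: sq flip: nat(3))
    finally show "(\<S> ?s1 \<cdot> mw) \<cdot> ?q3 = ((?t \<cdot> (\<I> ?x \<odot> w)) \<cdot> ?s3) \<cdot> ?q3" .
  qed simp_all
  have tx: "(\<I> ?x \<odot> u, \<I> ?x \<odot> v, ?t \<cdot> (\<I> ?x \<odot> w)) \<in> Tri K"
    using Ten_exact[OF _ t, of ?x] by simp
  have "(mu, mv, mw) \<in> Tri K"
    by (rule Tri_retract[OF tx, of mu "Cod K ?q1" "Cod K ?q2" mv "Cod K ?q3" mw ?s1 ?s2 ?s3 ?q1 ?q2 ?q3])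
      (simp_all add: su sv sw[simplified] muq mvq mwq)
  then show ?thesis using mu mv mw by blast
qed

section \<open>Additive and triangulated structure on modules\<close>

lemma TenA_Zero [simp]:
  assumes [simp]: "x \<in> Ob K" "y \<in> Ob K" "z \<in> Ob K"
  shows "\<I> x \<odot> Zero K y z = Zero K (x \<otimes> y) (x \<otimes> z)"
proof -
  have "(\<I> x \<odot> Zero K y z) \<oplus> (\<I> x \<odot> Zero K y z) = \<I> x \<odot> Zero K y z"
    using Ten_additive[of x "Zero K y z" y z "Zero K y z"] by simp
  from add_idem_Zero[OF this] show ?thesis by simp
qed

lemma mhom_Zero:
  assumes C: "tt_ring K C" and M: "M \<in> modules K C" and N: "N \<in> modules K C"
  shows "mhom C M N (Zero K (fst M) (fst N))"
  using M N modulesD(1-4)[OF C M] modulesD(1-4)[OF C N] tt_ringD(1)[OF C] by (simp add: mhom_def)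

lemma mhom_add:
  assumes C: "tt_ring K C" and f: "mhom C M N f" and g: "mhom C M N g"
  shows "mhom C M N (f \<oplus> g)"
proof -
  note [simp] = mhomD(1-5)[OF f] mhomD(3-5)[OF g] modulesD(1-4)[OF C mhomD(1)[OF f]] modulesD(1-4)[OF C mhomD(2)[OF f]] tt_ringD(1)[OF C]
  have "\<I> (robj C) \<odot> (f \<oplus> g) = (\<I> (robj C) \<odot> f) \<oplus> (\<I> (robj C) \<odot> g)"
    by (rule Ten_additive[of _ _ "fst M" "fst N"]) simp_all
  then show ?thesis
    by (simp add: mhom_def comp_add' add_comp' mhomD(6)[OF f] mhomD(6)[OF g])
qed

lemma TenA_neg:
  assumes "x \<in> Ob K" "f \<in> Ar K"
  shows "\<I> x \<odot> neg f = neg (\<I> x \<odot> f)"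
proof (rule eq_neg)
  have "\<I> x \<odot> (f \<oplus> neg f) = (\<I> x \<odot> f) \<oplus> (\<I> x \<odot> neg f)"
    by (rule Ten_additive[of _ _ "Dom K f" "Cod K f"]) (use assms in simp_all)
  then show "(\<I> x \<odot> f) \<oplus> (\<I> x \<odot> neg f) = Zero K (Dom K (\<I> x \<odot> f)) (Cod K (\<I> x \<odot> f))"
    using assms by simp
qed (use assms in simp_all)

lemma comp_neg: "a \<in> Ar K \<Longrightarrow> b \<in> Ar K \<Longrightarrow> Cod K b = Dom K a \<Longrightarrow> a \<cdot> neg b = neg (a \<cdot> b)"
  by (rule eq_neg) (simp_all flip: comp_add')

lemma neg_comp: "a \<in> Ar K \<Longrightarrow> b \<in> Ar K \<Longrightarrow> Cod K b = Dom K a \<Longrightarrow> neg a \<cdot> b = neg (a \<cdot> b)"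
  by (rule eq_neg) (simp_all flip: add_comp')

lemma mhom_neg:
  assumes C: "tt_ring K C" and f: "mhom C M N f"
  shows "mhom C M N (neg f)"
proof -
  note [simp] = mhomD(1-5)[OF f] modulesD(1-4)[OF C mhomD(1)[OF f]] modulesD(1-4)[OF C mhomD(2)[OF f]] tt_ringD(1)[OF C]
  show ?thesis
    by (simp add: mhom_def comp_neg neg_comp TenA_neg mhomD(6)[OF f])
qed

lemma Mod_simps [simp]:
  "Ob (Mod K C) = modules K C" "Ar (Mod K C) = module_arrows K C" "Dom (Mod K C) F = fst F" "Cod (Mod K C) F = snd (snd F)"
  "Susp (Mod K C) M = susp_mod K C M" "ident (Mod K C) M = (M, \<I> (fst M), M)"
  "comp (Mod K C) G F = (fst F, arrow_of G \<cdot> arrow_of F, snd (snd G))"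
  "add (Mod K C) F G = (fst F, arrow_of F \<oplus> arrow_of G, snd (snd F))"
  "Zero (Mod K C) M N = (M, Zero K (fst M) (fst N), N)"
  "Ten (Mod K C) = tensor_mod K C"
  by (simp_all add: Mod_def)

lemma arrow_of_simp [simp]: "arrow_of (M, f, N) = f"
  by (simp add: arrow_of_def)

lemma Hom_Mod: "F \<in> Hom\<^bsub>Mod K C\<^esub> M N \<longleftrightarrow> F = (M, arrow_of F, N) \<and> mhom C M N (arrow_of F)"
  by (cases F) (auto simp: Hom_def module_arrows_iff)

lemma Tri_Mod: "(F, G, H) \<in> Tri (Mod K C) \<longleftrightarrow>
    (\<exists>L M N f g h. F = (L, f, M) \<and> G = (M, g, N) \<and> H = (N, h, susp_mod K C L) \<and>
      mhom C L M f \<and> mhom C M N g \<and> mhom C N (susp_mod K C L) h \<and> (f, g, h) \<in> Tri K)"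
  by (cases F; cases G; cases H) (auto simp: Mod_def module_arrows_iff)

lemma zero_object_Mod:
  assumes C: "tt_ring K C"
  shows "zero_object (Mod K C) M \<longleftrightarrow> M \<in> modules K C \<and> zero_object K (fst M)"
proof
  assume z: "zero_object (Mod K C) M"
  then have M: "M \<in> modules K C" by (simp add: zero_object_def)
  then have "\<exists>!f. f \<in> Hom\<^bsub>Mod K C\<^esub> M M" using z by (simp add: zero_object_def)
  then have "(M, \<I> (fst M), M) = (M, Zero K (fst M) (fst M), M)"
    by (rule ex1_unique) (simp_all add: Hom_Mod mhom_Zero[OF C M M] mhom_ident[OF C M])
  then show "M \<in> modules K C \<and> zero_object K (fst M)"
    using M modulesD(1)[OF C M] by (simp add: zero_object_iff)
next
  assume "M \<in> modules K C \<and> zero_object K (fst M)"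
  then have M: "M \<in> modules K C" and z: "zero_object K (fst M)" by simp_all
  note zi = zero_object_ident[OF z] and un = zero_object_unique[OF zero_object_ident[OF z]]
  have "(\<exists>!f. f \<in> Hom\<^bsub>Mod K C\<^esub> N M) \<and> (\<exists>!f. f \<in> Hom\<^bsub>Mod K C\<^esub> M N)" if N: "N \<in> modules K C" for N
  proof (intro conjI ex1I)
    show "(N, Zero K (fst N) (fst M), M) \<in> Hom\<^bsub>Mod K C\<^esub> N M" "(M, Zero K (fst M) (fst N), N) \<in> Hom\<^bsub>Mod K C\<^esub> M N"
      by (simp_all add: Hom_Mod mhom_Zero[OF C] M N)
    show "F = (N, Zero K (fst N) (fst M), M)" if "F \<in> Hom\<^bsub>Mod K C\<^esub> N M" for F
    proof -
      have F: "F = (N, arrow_of F, M)" and m: "mhom C N M (arrow_of F)" using that by (simp_all add: Hom_Mod)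
      have "arrow_of F = Zero K (fst N) (fst M)" using un(1)[of "arrow_of F"] mhomD(3-5)[OF m] by simp
      then show ?thesis using F by simp
    qed
    show "F = (M, Zero K (fst M) (fst N), N)" if "F \<in> Hom\<^bsub>Mod K C\<^esub> M N" for F
    proof -
      have F: "F = (M, arrow_of F, N)" and m: "mhom C M N (arrow_of F)" using that by (simp_all add: Hom_Mod)
      have "arrow_of F = Zero K (fst M) (fst N)" using un(2)[of "arrow_of F"] mhomD(3-5)[OF m] by simp
      then show ?thesis using F by simp
    qed
  qed
  then show "zero_object (Mod K C) M" using M by (simp add: zero_object_def)
qed

lemma biproduct_Mod:
  "biproduct (Mod K C) M N S I J P Q \<longleftrightarrow> S \<in> modules K C \<and>
     (\<exists>i j p q. I = (M, i, S) \<and> J = (N, j, S) \<and> P = (S, p, M) \<and> Q = (S, q, N) \<and>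
       mhom C M S i \<and> mhom C N S j \<and> mhom C S M p \<and> mhom C S N q \<and>
       p \<cdot> i = \<I> (fst M) \<and> q \<cdot> j = \<I> (fst N) \<and> p \<cdot> j = Zero K (fst N) (fst M) \<and> q \<cdot> i = Zero K (fst M) (fst N) \<and>
       (i \<cdot> p) \<oplus> (j \<cdot> q) = \<I> (fst S))"
  by (cases I; cases J; cases P; cases Q) (auto simp: biproduct_def Hom_Mod)

text \<open>The complement is the image of the linear idempotent \<open>e\<close>, the identity
  minus \<open>i \<cdot> p\<close>. It splits because \<open>K\<close> is idempotent complete, and
  the action of \<open>N\<close> restricts to the image since \<open>e\<close> is linear.\<close>

lemma mret_biproduct:
  assumes C: "tt_ring K C" and r: "mret C M N"
  shows "\<exists>M' I J P Q. M' \<in> modules K C \<and> biproduct (Mod K C) M M' N I J P Q"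
proof -
  obtain i p where i: "mhom C M N i" and p: "mhom C N M p" and pi: "p \<cdot> i = \<I> (fst M)"
    using r by (auto simp: mret_def)
  note M = mhomD(1)[OF i] and N = mhomD(2)[OF i]
  let ?x = "fst M" let ?y = "fst N" let ?c = "robj C"
  note [simp] = modulesD(1-4)[OF C M] modulesD(1-4)[OF C N] mhomD(3-5)[OF i] mhomD(3-5)[OF p] tt_ringD[OF C]
  define e where "e = \<I> ?y \<oplus> neg (i \<cdot> p)"
  have e: "mhom C N N e"
    unfolding e_def by (intro mhom_add[OF C] mhom_ident[OF C N] mhom_neg[OF C] mhom_comp[OF C p i])
  note [simp] = mhomD(3-5)[OF e]
  have pe: "p \<cdot> e = Zero K ?y ?x"
    by (simp add: e_def comp_add' comp_neg pi[THEN reassoc])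
  have ei: "e \<cdot> i = Zero K ?x ?y"
    by (simp add: e_def add_comp' neg_comp pi)
  have ee: "e \<cdot> e = e"
  proof -
    have "e \<cdot> e = (\<I> ?y \<oplus> neg (i \<cdot> p)) \<cdot> e" by (simp add: e_def)
    also have "\<dots> = e \<oplus> neg (i \<cdot> (p \<cdot> e))" by (simp add: add_comp' neg_comp)
    also have "neg (i \<cdot> (p \<cdot> e)) = Zero K ?y ?y"
      unfolding pe by (rule eq_neg[symmetric]) simp_all
    finally show ?thesis by simp
  qed
  have "\<exists>y\<in>Ob K. \<exists>r\<in>Hom ?y y. \<exists>s\<in>Hom y ?y. s \<cdot> r = e \<and> r \<cdot> s = \<I> y"
    by (rule idempotent_complete) (simp_all add: ee)
  then obtain z where z0: "z \<in> Ob K" and "\<exists>r\<in>Hom ?y z. \<exists>s\<in>Hom z ?y. s \<cdot> r = e \<and> r \<cdot> s = \<I> z" by blast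
  then obtain r s where rs0: "r \<in> Hom ?y z" "s \<in> Hom z ?y" and sr: "s \<cdot> r = e" and rs: "r \<cdot> s = \<I> z" by blast
  note [simp] = z0 rs0[unfolded Hom_iff]
  define k where "k = r \<cdot> snd N \<cdot> (\<I> ?c \<odot> s)"
  have [simp]: "k \<in> Ar K" "Dom K k = ?c \<otimes> z" "Cod K k = z" by (simp_all add: k_def)
  have re: "r \<cdot> e = r" unfolding sr[symmetric] by (simp add: rs[THEN reassoc])
  have es: "e \<cdot> s = s" unfolding sr[symmetric] by (simp add: rs)
  have kr: "k \<cdot> (\<I> ?c \<odot> r) = r \<cdot> snd N"
  proof -
    have "k \<cdot> (\<I> ?c \<odot> r) = r \<cdot> (snd N \<cdot> (\<I> ?c \<odot> e))" by (simp add: k_def merge sr)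
    then show ?thesis unfolding mhomD(6)[OF e, symmetric] by (simp add: re[THEN reassoc])
  qed
  have sk: "s \<cdot> k = snd N \<cdot> (\<I> ?c \<odot> s)"
    by (simp add: k_def sr[THEN reassoc] mhomD(6)[OF e, THEN reassoc] merge es)
  have "action C z k"
  proof -
    have "k \<cdot> ext ?c ?c (mult C) z = r \<cdot> (snd N \<cdot> ext ?c ?c (mult C) ?y) \<cdot> (\<I> ?c \<odot> (\<I> ?c \<odot> s))"
      by (simp add: k_def ext_nat_right)
    also have "\<dots> = r \<cdot> snd N \<cdot> (\<I> ?c \<odot> (snd N \<cdot> (\<I> ?c \<odot> s)))"
      unfolding modulesD(5)[OF C N] by (simp add: merge)
    also have "\<dots> = k \<cdot> (\<I> ?c \<odot> k)"
      unfolding sk[symmetric] by (simp add: k_def merge)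
    finally have 1: "k \<cdot> ext ?c ?c (mult C) z = k \<cdot> (\<I> ?c \<odot> k)" .
    have "k \<cdot> uext (unit C) z = r \<cdot> (snd N \<cdot> uext (unit C) ?y) \<cdot> s"
      by (simp add: k_def uext_nat)
    then have 2: "k \<cdot> uext (unit C) z = \<I> z" unfolding modulesD(6)[OF C N] by (simp add: rs)
    show ?thesis by (simp add: action_def 1 2)
  qed
  then have Z: "(z, k) \<in> modules K C" by (simp add: modules_iff[OF C])
  have r: "mhom C N (z, k) r" and s: "mhom C (z, k) N s"
    using Z N kr sk by (simp_all add: mhom_def)
  have ps: "p \<cdot> s = Zero K z ?x"
  proof -
    have "p \<cdot> s = (p \<cdot> e) \<cdot> s" by (simp add: es)
    then show ?thesis unfolding pe by simp
  qed
  have ri: "r \<cdot> i = Zero K ?x z"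
  proof -
    have "r \<cdot> i = (r \<cdot> e) \<cdot> i" by (simp add: re)
    also have "\<dots> = r \<cdot> (e \<cdot> i)" by simp
    finally show ?thesis unfolding ei by simp
  qed
  have sum: "(i \<cdot> p) \<oplus> (s \<cdot> r) = \<I> ?y"
  proof -
    have "(i \<cdot> p) \<oplus> e = (i \<cdot> p) \<oplus> (neg (i \<cdot> p) \<oplus> \<I> ?y)"
      using add_comm[of "\<I> ?y" "neg (i \<cdot> p)"] by (simp add: e_def)
    also have "\<dots> = ((i \<cdot> p) \<oplus> neg (i \<cdot> p)) \<oplus> \<I> ?y" by (rule add_assoc'[symmetric]) simp_all
    finally show ?thesis by (simp add: sr)
  qed
  have "biproduct (Mod K C) M (z, k) N (M, i, N) ((z, k), s, N) (N, p, M) (N, r, (z, k))"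
    unfolding biproduct_Mod using N i p r s pi rs ps ri sum by simp
  then show ?thesis using Z by blast
qed

section \<open>Thick ideals and primes of modules\<close>

text \<open>\<open>thick_ideal (Mod K C)\<close> restated through underlying arrows of
  \<open>K\<close>, retracts and \<open>rten\<close>, so that functors between module categories can
  be applied directly.\<close>

definition mthick :: "('o, 'm) ring_object \<Rightarrow> ('o \<times> 'm) set \<Rightarrow> bool" where
  "mthick C J \<longleftrightarrow> J \<subseteq> modules K C \<and>
    (\<forall>M\<in>modules K C. zero_object K (fst M) \<longrightarrow> M \<in> J) \<and>
    (\<forall>M\<in>modules K C. susp_mod K C M \<in> J \<longleftrightarrow> M \<in> J) \<and>
    (\<forall>L M N f g h. mhom C L M f \<and> mhom C M N g \<and> mhom C N (susp_mod K C L) h \<and> (f, g, h) \<in> Tri K \<longrightarrow>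
       (L \<in> J \<and> M \<in> J \<longrightarrow> N \<in> J) \<and> (M \<in> J \<and> N \<in> J \<longrightarrow> L \<in> J) \<and> (L \<in> J \<and> N \<in> J \<longrightarrow> M \<in> J)) \<and>
    (\<forall>M N. mret C M N \<and> N \<in> J \<longrightarrow> M \<in> J) \<and>
    (\<forall>M\<in>modules K C. \<forall>N\<in>J. rten C C (\<I> (robj C)) M N \<in> J)"

lemma mthickI:
  assumes "J \<subseteq> modules K C" "\<And>M. M \<in> modules K C \<Longrightarrow> zero_object K (fst M) \<Longrightarrow> M \<in> J"
    "\<And>M. M \<in> modules K C \<Longrightarrow> susp_mod K C M \<in> J \<longleftrightarrow> M \<in> J"
    "\<And>L M N f g h. mhom C L M f \<Longrightarrow> mhom C M N g \<Longrightarrow> mhom C N (susp_mod K C L) h \<Longrightarrow> (f, g, h) \<in> Tri K \<Longrightarrow>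
       (L \<in> J \<and> M \<in> J \<longrightarrow> N \<in> J) \<and> (M \<in> J \<and> N \<in> J \<longrightarrow> L \<in> J) \<and> (L \<in> J \<and> N \<in> J \<longrightarrow> M \<in> J)"
    "\<And>M N. mret C M N \<Longrightarrow> N \<in> J \<Longrightarrow> M \<in> J"
    "\<And>M N. M \<in> modules K C \<Longrightarrow> N \<in> J \<Longrightarrow> rten C C (\<I> (robj C)) M N \<in> J"
  shows "mthick C J"
  unfolding mthick_def
  apply (intro conjI allI ballI impI)
  subgoal by (rule assms(1))
  subgoal by (rule assms(2))
  subgoal by (rule assms(3))
  subgoal using assms(4) by blast
  subgoal using assms(4) by blast
  subgoal using assms(4) by blast
  subgoal using assms(5) by blast
  subgoal by (rule assms(6))
  done

lemma mthickD:
  assumes "mthick C J"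
  shows "J \<subseteq> modules K C" "\<And>M. M \<in> modules K C \<Longrightarrow> zero_object K (fst M) \<Longrightarrow> M \<in> J"
    "\<And>M. M \<in> modules K C \<Longrightarrow> susp_mod K C M \<in> J \<longleftrightarrow> M \<in> J"
    "\<And>L M N f g h. mhom C L M f \<Longrightarrow> mhom C M N g \<Longrightarrow> mhom C N (susp_mod K C L) h \<Longrightarrow> (f, g, h) \<in> Tri K \<Longrightarrow>
       (L \<in> J \<and> M \<in> J \<longrightarrow> N \<in> J) \<and> (M \<in> J \<and> N \<in> J \<longrightarrow> L \<in> J) \<and> (L \<in> J \<and> N \<in> J \<longrightarrow> M \<in> J)"
    "\<And>M N. mret C M N \<Longrightarrow> N \<in> J \<Longrightarrow> M \<in> J"
    "\<And>M N. M \<in> modules K C \<Longrightarrow> N \<in> J \<Longrightarrow> rten C C (\<I> (robj C)) M N \<in> J"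
  using assms unfolding mthick_def by (blast, blast, blast, blast, blast, blast)

lemma thick_ideal_Mod:
  assumes C: "tt_ring K C"
  shows "thick_ideal (Mod K C) J \<longleftrightarrow> mthick C J"
proof
  assume t: "thick_ideal (Mod K C) J"
  then have sub: "J \<subseteq> modules K C" by (simp add: thick_ideal_def)
  show "mthick C J"
  proof (rule mthickI)
    show "M \<in> J" if "M \<in> modules K C" "zero_object K (fst M)" for M
      using t that zero_object_Mod[OF C] unfolding thick_ideal_def by blast
    show "susp_mod K C M \<in> J \<longleftrightarrow> M \<in> J" if "M \<in> modules K C" for M
      using t that unfolding thick_ideal_def Mod_simps by blast
    show "(L \<in> J \<and> M \<in> J \<longrightarrow> N \<in> J) \<and> (M \<in> J \<and> N \<in> J \<longrightarrow> L \<in> J) \<and> (L \<in> J \<and> N \<in> J \<longrightarrow> M \<in> J)"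
      if "mhom C L M f" "mhom C M N g" "mhom C N (susp_mod K C L) h" "(f, g, h) \<in> Tri K" for L M N f g h
    proof -
      have "((L, f, M), (M, g, N), (N, h, susp_mod K C L)) \<in> Tri (Mod K C)"
        unfolding Tri_Mod using that by blast
      moreover have "\<forall>f g h. (f, g, h) \<in> Tri (Mod K C) \<longrightarrow>
        (fst f \<in> J \<and> snd (snd f) \<in> J \<longrightarrow> snd (snd g) \<in> J) \<and>
        (snd (snd f) \<in> J \<and> snd (snd g) \<in> J \<longrightarrow> fst f \<in> J) \<and>
        (fst f \<in> J \<and> snd (snd g) \<in> J \<longrightarrow> snd (snd f) \<in> J)"
        using t unfolding thick_ideal_def Mod_simps by blast
      ultimately show ?thesis by fastforce
    qed
    show "M \<in> J" if r: "mret C M N" and N: "N \<in> J" for M N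
    proof -
      have "M \<in> modules K C" using r by (auto simp: mret_def mhom_def)
      with mret_biproduct[OF C r] N t show ?thesis
        unfolding thick_ideal_def Mod_simps by blast
    qed
    show "rten C C (\<I> (robj C)) M N \<in> J" if M: "M \<in> modules K C" and N: "N \<in> J" for M N
    proof -
      have "tensor_mod K C M N \<in> J" using t M N unfolding thick_ideal_def Mod_simps by blast
      moreover have "N \<in> modules K C" using N sub by blast
      ultimately show ?thesis using tensor_mod_rten[OF C M] by simp
    qed
  qed (rule sub)
next
  assume t: "mthick C J"
  note D = mthickD[OF t]
  show "thick_ideal (Mod K C) J"
    unfolding thick_ideal_def Mod_simps
  proof (intro conjI)
    show "\<forall>z. zero_object (Mod K C) z \<longrightarrow> z \<in> J" using D(2) zero_object_Mod[OF C] by blast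
    show "\<forall>x\<in>modules K C. susp_mod K C x \<in> J \<longleftrightarrow> x \<in> J" using D(3) by blast
    show "\<forall>f g h. (f, g, h) \<in> Tri (Mod K C) \<longrightarrow>
        (fst f \<in> J \<and> snd (snd f) \<in> J \<longrightarrow> snd (snd g) \<in> J) \<and>
        (snd (snd f) \<in> J \<and> snd (snd g) \<in> J \<longrightarrow> fst f \<in> J) \<and>
        (fst f \<in> J \<and> snd (snd g) \<in> J \<longrightarrow> snd (snd f) \<in> J)"
    proof (intro allI impI)
      fix F G H assume "(F, G, H) \<in> Tri (Mod K C)"
      then obtain L M N f g h where FGH: "F = (L, f, M)" "G = (M, g, N)" "H = (N, h, susp_mod K C L)"
        and "mhom C L M f" "mhom C M N g" "mhom C N (susp_mod K C L) h" "(f, g, h) \<in> Tri K"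
        unfolding Tri_Mod by blast
      from D(4)[OF this(4-7)] show "(fst F \<in> J \<and> snd (snd F) \<in> J \<longrightarrow> snd (snd G) \<in> J) \<and>
        (snd (snd F) \<in> J \<and> snd (snd G) \<in> J \<longrightarrow> fst F \<in> J) \<and>
        (fst F \<in> J \<and> snd (snd G) \<in> J \<longrightarrow> snd (snd F) \<in> J)"
        unfolding FGH fst_conv snd_conv .
    qed
    show "\<forall>x\<in>modules K C. \<forall>y\<in>modules K C. \<forall>s\<in>J. \<forall>i j p q. biproduct (Mod K C) x y s i j p q \<longrightarrow> x \<in> J \<and> y \<in> J"
    proof (intro ballI allI impI)
      fix M N S I J' P Q assume S: "S \<in> J" and b: "biproduct (Mod K C) M N S I J' P Q"
      then have "mret C M S" "mret C N S" unfolding biproduct_Mod mret_def by blast+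
      then show "M \<in> J \<and> N \<in> J" using D(5) S by blast
    qed
    show "\<forall>x\<in>modules K C. \<forall>y\<in>J. tensor_mod K C x y \<in> J"
    proof (intro ballI)
      fix M N assume M: "M \<in> modules K C" and N: "N \<in> J"
      then have "N \<in> modules K C" using D(1) by blast
      then show "tensor_mod K C M N \<in> J" using D(6)[OF M N] tensor_mod_rten[OF C M] by simp
    qed
  qed (rule D(1))
qed

lemma mret_modules: "mret C M N \<Longrightarrow> M \<in> modules K C \<and> N \<in> modules K C"
  by (auto simp: mret_def mhom_def)

lemma miso_mthick:
  assumes "mthick C J" "miso C M N"
  shows "M \<in> J \<longleftrightarrow> N \<in> J"
  using mthickD(5)[OF assms(1)] miso_mret[OF assms(2)] miso_mret[OF miso_sym[OF assms(2)]] by blast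

lemma mret_rten_right_unit:
  assumes C: "tt_ring K C" and L: "L \<in> modules K C"
  shows "mret C L (rten C C (\<I> (robj C)) L (self_mod C))" "mret C (rten C C (\<I> (robj C)) L (self_mod C)) L"
  using rten_right_unit[OF C C ring_hom_ident[OF C] L] miso_mret miso_sym by blast+

text \<open>\<open>L \<otimes>\<^sub>B N\<close> is the tensor product over \<open>C\<close> of
  \<open>L\<close> with the extension of \<open>N\<close>, so ideals and primes of
  \<open>C\<close>-modules see \<open>N\<close> only through that extension.\<close>

lemma rten_extension:
  assumes B: "tt_ring K B" and C: "tt_ring K C" and f: "ring_hom K B C f" and L: "L \<in> modules K C" and N: "N \<in> modules K B"
  shows "mret C (rten C B f L N) (rten C C (\<I> (robj C)) L (rten C B f (self_mod C) N))"
    "mret C (rten C C (\<I> (robj C)) L (rten C B f (self_mod C) N)) (rten C B f L N)"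
proof -
  have e: "\<I> (robj C) \<cdot> f = f" using ring_homD[OF f] by simp
  note I = ring_hom_ident[OF C] and S = self_mod_modules[OF C]
  note a = rten_assoc[OF B C C f I L S N, unfolded e]
  note u = mret_rten_right_unit[OF C L] and n = mret_refl[OF B N]
  show "mret C (rten C B f L N) (rten C C (\<I> (robj C)) L (rten C B f (self_mod C) N))"
    by (rule mret_trans[OF C mret_rten[OF B C f u(1) n] miso_mret[OF a]])
  show "mret C (rten C C (\<I> (robj C)) L (rten C B f (self_mod C) N)) (rten C B f L N)"
    by (rule mret_trans[OF C miso_mret[OF miso_sym[OF a]] mret_rten[OF B C f u(2) n]])
qed

lemma rten_rten:
  assumes B: "tt_ring K B" and C: "tt_ring K C" and f: "ring_hom K B C f" and L: "L \<in> modules K C"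
    and M: "M \<in> modules K B" and N: "N \<in> modules K B"
  shows "miso C (rten C B f (rten C B f L M) N) (rten C B f L (rten B B (\<I> (robj B)) M N))"
proof -
  have e: "f \<cdot> \<I> (robj B) = f" using ring_homD[OF f] by simp
  show ?thesis using rten_assoc[OF B B C ring_hom_ident[OF B] f L M N] unfolding e .
qed

lemma rten_mthick:
  assumes B: "tt_ring K B" and C: "tt_ring K C" and f: "ring_hom K B C f" and J: "mthick C J" and L: "L \<in> J" and N: "N \<in> modules K B"
  shows "rten C B f L N \<in> J"
proof -
  have L': "L \<in> modules K C" using mthickD(1)[OF J] L by blast
  let ?X = "rten C B f (self_mod C) N"
  have X: "?X \<in> modules K C" by (rule rten_modules[OF B C f self_mod_modules[OF C] N])
  have "rten C C (\<I> (robj C)) ?X L \<in> J" by (rule mthickD(6)[OF J X L])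
  then have "rten C C (\<I> (robj C)) L ?X \<in> J" using miso_mthick[OF J rten_comm[OF C X L']] by blast
  then show ?thesis using mthickD(5)[OF J rten_extension(1)[OF B C f L' N]] by blast
qed

text \<open>Besides pulling ideals back along extension of scalars, this is applied with
  \<open>f\<close> an identity: the modules whose product with a fixed one lies in an ideal form an
  ideal. Closure under products comes from regrouping \<open>L \<otimes> (N \<otimes> M)\<close> as
  \<open>(L \<otimes> N) \<otimes> M\<close>.\<close>

lemma mthick_vimage_rten:
  assumes B: "tt_ring K B" and C: "tt_ring K C" and f: "ring_hom K B C f" and J: "mthick C J" and L: "L \<in> modules K C"
  shows "mthick B {N \<in> modules K B. rten C B f L N \<in> J}"
proof (rule mthickI)
  note D = mthickD[OF J]
  show "M \<in> {N \<in> modules K B. rten C B f L N \<in> J}" if M: "M \<in> modules K B" and z: "zero_object K (fst M)" for M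
  proof -
    let ?q = "tensor_quot K B (res_mod f L) M" let ?s = "tsec B (res_mod f L) M"
    note [simp] = rten_base[OF B C f L M] rq(1,2,4-7)[OF B C f L M]
    have z: "fst M \<in> Ob K" "\<I> (fst M) = Zero K (fst M) (fst M)" using zero_object_ident[OF z] by blast+
    have "\<I> (fst L \<otimes> fst M) = \<I> (fst L) \<odot> \<I> (fst M)" by simp
    also have "\<dots> = Zero K (fst L \<otimes> fst M) (fst L \<otimes> fst M)" unfolding z(2) by simp
    finally have i: "\<I> (fst L \<otimes> fst M) = Zero K (fst L \<otimes> fst M) (fst L \<otimes> fst M)" .
    have "\<I> (Cod K ?q) = ?q \<cdot> \<I> (fst L \<otimes> fst M) \<cdot> ?s" by simp
    also have "\<dots> = Zero K (Cod K ?q) (Cod K ?q)" unfolding i by simp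
    finally have "zero_object K (Cod K ?q)" by (simp add: zero_object_iff)
    then have "rten C B f L M \<in> J" by (intro D(2) rten_modules[OF B C f L M]) (simp add: rten_fst[OF B C f L M])
    then show ?thesis using M by simp
  qed
  show "susp_mod K B M \<in> {N \<in> modules K B. rten C B f L N \<in> J} \<longleftrightarrow> M \<in> {N \<in> modules K B. rten C B f L N \<in> J}"
    if M: "M \<in> modules K B" for M
    using miso_mthick[OF J rten_susp[OF B C f L M]] D(3)[OF rten_modules[OF B C f L M]] M susp_mod_modules[OF B M] by simp
  show "(N1 \<in> {N \<in> modules K B. rten C B f L N \<in> J} \<and> N2 \<in> {N \<in> modules K B. rten C B f L N \<in> J} \<longrightarrow> N3 \<in> {N \<in> modules K B. rten C B f L N \<in> J}) \<and>
     (N2 \<in> {N \<in> modules K B. rten C B f L N \<in> J} \<and> N3 \<in> {N \<in> modules K B. rten C B f L N \<in> J} \<longrightarrow> N1 \<in> {N \<in> modules K B. rten C B f L N \<in> J}) \<and>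
     (N1 \<in> {N \<in> modules K B. rten C B f L N \<in> J} \<and> N3 \<in> {N \<in> modules K B. rten C B f L N \<in> J} \<longrightarrow> N2 \<in> {N \<in> modules K B. rten C B f L N \<in> J})"
    if h: "mhom B N1 N2 u" "mhom B N2 N3 v" "mhom B N3 (susp_mod K B N1) w" "(u, v, w) \<in> Tri K" for N1 N2 N3 u v w
  proof -
    have N: "N1 \<in> modules K B" "N2 \<in> modules K B" "N3 \<in> modules K B" using mhomD(1,2)[OF h(1)] mhomD(2)[OF h(2)] by simp_all
    obtain mu mv mw where "mhom C (rten C B f L N1) (rten C B f L N2) mu" "mhom C (rten C B f L N2) (rten C B f L N3) mv"
     "mhom C (rten C B f L N3) (susp_mod K C (rten C B f L N1)) mw" "(mu, mv, mw) \<in> Tri K"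
      using rten_Tri[OF B C f L h] by blast
    from D(4)[OF this] show ?thesis using N by blast
  qed
  show "M \<in> {N \<in> modules K B. rten C B f L N \<in> J}" if "mret B M N" "N \<in> {N \<in> modules K B. rten C B f L N \<in> J}" for M N
    using D(5)[OF mret_rten[OF B C f mret_refl[OF C L] that(1)]] that mret_modules by blast
  show "rten B B (\<I> (robj B)) M N \<in> {N \<in> modules K B. rten C B f L N \<in> J}"
    if M: "M \<in> modules K B" and N: "N \<in> {N \<in> modules K B. rten C B f L N \<in> J}" for M N
  proof -
    have N: "N \<in> modules K B" "rten C B f L N \<in> J" using N by simp_all
    have "rten C B f (rten C B f L N) M \<in> J" by (rule rten_mthick[OF B C f J N(2) M])
    then have "rten C B f L (rten B B (\<I> (robj B)) N M) \<in> J"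
      using miso_mthick[OF J rten_rten[OF B C f L N(1) M]] by blast
    moreover have "mret B (rten B B (\<I> (robj B)) M N) (rten B B (\<I> (robj B)) N M)"
      by (rule miso_mret[OF rten_comm[OF B M N(1)]])
    ultimately have "rten C B f L (rten B B (\<I> (robj B)) M N) \<in> J"
      using D(5)[OF mret_rten[OF B C f mret_refl[OF C L]]] by blast
    then show ?thesis using rten_modules[OF B B ring_hom_ident[OF B] M N(1)] by simp
  qed
qed simp

text \<open>Restriction is exact but not monoidal. Closure under products rests on separability: by
  \<open>rten_retract\<close> the module \<open>M \<otimes>\<^sub>C N\<close> is a summand of
  \<open>M \<otimes>\<^sub>B N\<close>, whose restriction is a product over \<open>B\<close> with a
  factor in \<open>J\<close>.\<close>

lemma mthick_vimage_res:
  assumes B: "tt_ring K B" and C: "tt_ring K C" and f: "ring_hom K B C f" and J: "mthick B J"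
  shows "mthick C {L \<in> modules K C. res_mod f L \<in> J}"
proof (rule mthickI)
  note D = mthickD[OF J] and R = res_mod_modules[OF B C f]
  show "M \<in> {L \<in> modules K C. res_mod f L \<in> J}" if "M \<in> modules K C" "zero_object K (fst M)" for M
    using D(2)[OF R[OF that(1)]] that by simp
  show "susp_mod K C M \<in> {L \<in> modules K C. res_mod f L \<in> J} \<longleftrightarrow> M \<in> {L \<in> modules K C. res_mod f L \<in> J}" if "M \<in> modules K C" for M
    using D(3)[OF R[OF that]] that susp_mod_modules[OF C that] by (simp add: res_mod_susp_mod[OF B C f that])
  show "(N1 \<in> {L \<in> modules K C. res_mod f L \<in> J} \<and> N2 \<in> {L \<in> modules K C. res_mod f L \<in> J} \<longrightarrow> N3 \<in> {L \<in> modules K C. res_mod f L \<in> J}) \<and>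
     (N2 \<in> {L \<in> modules K C. res_mod f L \<in> J} \<and> N3 \<in> {L \<in> modules K C. res_mod f L \<in> J} \<longrightarrow> N1 \<in> {L \<in> modules K C. res_mod f L \<in> J}) \<and>
     (N1 \<in> {L \<in> modules K C. res_mod f L \<in> J} \<and> N3 \<in> {L \<in> modules K C. res_mod f L \<in> J} \<longrightarrow> N2 \<in> {L \<in> modules K C. res_mod f L \<in> J})"
    if h: "mhom C N1 N2 u" "mhom C N2 N3 v" "mhom C N3 (susp_mod K C N1) w" "(u, v, w) \<in> Tri K" for N1 N2 N3 u v w
  proof -
    have N: "N1 \<in> modules K C" "N2 \<in> modules K C" "N3 \<in> modules K C" using mhomD(1,2)[OF h(1)] mhomD(2)[OF h(2)] by simp_all
    from D(4)[OF mhom_res[OF B C f h(1)] mhom_res[OF B C f h(2)] mhom_res[OF B C f h(3), unfolded res_mod_susp_mod[OF B C f N(1)]] h(4)]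
    show ?thesis using N by blast
  qed
  show "M \<in> {L \<in> modules K C. res_mod f L \<in> J}" if "mret C M N" "N \<in> {L \<in> modules K C. res_mod f L \<in> J}" for M N
    using D(5)[OF mret_res[OF B C f that(1)]] that mret_modules by blast
  show "rten C C (\<I> (robj C)) M N \<in> {L \<in> modules K C. res_mod f L \<in> J}"
    if M: "M \<in> modules K C" and N: "N \<in> {L \<in> modules K C. res_mod f L \<in> J}" for M N
  proof -
    have N: "N \<in> modules K C" "res_mod f N \<in> J" using N by simp_all
    have "rten B B (\<I> (robj B)) (res_mod f M) (res_mod f N) \<in> J" by (rule D(6)[OF R[OF M] N(2)])
    then have "res_mod f (rten C B f M (res_mod f N)) \<in> J" by (simp add: res_mod_rten[OF B C f M R[OF N(1)]])
    then have "res_mod f (rten C C (\<I> (robj C)) M N) \<in> J"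
      using D(5)[OF mret_res[OF B C f rten_retract[OF B C f M N(1)]]] by blast
    then show ?thesis using rten_modules[OF C C ring_hom_ident[OF C] M N(1)] by simp
  qed
qed simp

lemma mthick_Inter:
  assumes "A \<noteq> {}" "\<And>J. J \<in> A \<Longrightarrow> mthick C J"
  shows "mthick C (\<Inter>A)"
proof (rule mthickI)
  show "\<Inter>A \<subseteq> modules K C" using assms mthickD(1) by blast
  show "M \<in> \<Inter>A" if "M \<in> modules K C" "zero_object K (fst M)" for M
    using assms(2) mthickD(2) that by blast
  show "susp_mod K C M \<in> \<Inter>A \<longleftrightarrow> M \<in> \<Inter>A" if "M \<in> modules K C" for M
    using assms(2) mthickD(3) that by blast
  show "(L \<in> \<Inter>A \<and> M \<in> \<Inter>A \<longrightarrow> N \<in> \<Inter>A) \<and> (M \<in> \<Inter>A \<and> N \<in> \<Inter>A \<longrightarrow> L \<in> \<Inter>A) \<and> (L \<in> \<Inter>A \<and> N \<in> \<Inter>A \<longrightarrow> M \<in> \<Inter>A)"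
    if h: "mhom C L M f" "mhom C M N g" "mhom C N (susp_mod K C L) h" "(f, g, h) \<in> Tri K" for L M N f g h
  proof -
    have "(L \<in> J \<and> M \<in> J \<longrightarrow> N \<in> J) \<and> (M \<in> J \<and> N \<in> J \<longrightarrow> L \<in> J) \<and> (L \<in> J \<and> N \<in> J \<longrightarrow> M \<in> J)" if "J \<in> A" for J
      by (rule mthickD(4)[OF assms(2)[OF that] h])
    then show ?thesis by blast
  qed
  show "M \<in> \<Inter>A" if "mret C M N" "N \<in> \<Inter>A" for M N
    using assms(2) mthickD(5) that by blast
  show "rten C C (\<I> (robj C)) M N \<in> \<Inter>A" if "M \<in> modules K C" "N \<in> \<Inter>A" for M N
    using assms(2) mthickD(6) that by blast
qed

lemma mthick_Union:
  assumes A: "A \<noteq> {}" "\<And>J. J \<in> A \<Longrightarrow> mthick C J" and ch: "\<And>I J. I \<in> A \<Longrightarrow> J \<in> A \<Longrightarrow> I \<subseteq> J \<or> J \<subseteq> I"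
  shows "mthick C (\<Union>A)"
proof (rule mthickI)
  have two: "\<exists>J\<in>A. M \<in> J \<and> N \<in> J" if "M \<in> \<Union>A" "N \<in> \<Union>A" for M N
    using that ch by (meson UnionE subsetD)
  show "\<Union>A \<subseteq> modules K C" using A mthickD(1) by blast
  show "M \<in> \<Union>A" if "M \<in> modules K C" "zero_object K (fst M)" for M
    using A mthickD(2) that by blast
  show "susp_mod K C M \<in> \<Union>A \<longleftrightarrow> M \<in> \<Union>A" if "M \<in> modules K C" for M
    using A(2) mthickD(3) that by blast
  show "(L \<in> \<Union>A \<and> M \<in> \<Union>A \<longrightarrow> N \<in> \<Union>A) \<and> (M \<in> \<Union>A \<and> N \<in> \<Union>A \<longrightarrow> L \<in> \<Union>A) \<and> (L \<in> \<Union>A \<and> N \<in> \<Union>A \<longrightarrow> M \<in> \<Union>A)"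
    if h: "mhom C L M f" "mhom C M N g" "mhom C N (susp_mod K C L) h" "(f, g, h) \<in> Tri K" for L M N f g h
  proof -
    have "(L \<in> J \<and> M \<in> J \<longrightarrow> N \<in> J) \<and> (M \<in> J \<and> N \<in> J \<longrightarrow> L \<in> J) \<and> (L \<in> J \<and> N \<in> J \<longrightarrow> M \<in> J)" if "J \<in> A" for J
      by (rule mthickD(4)[OF A(2)[OF that] h])
    then show ?thesis using two[of L M] two[of M N] two[of L N] by blast
  qed
  show "M \<in> \<Union>A" if "mret C M N" "N \<in> \<Union>A" for M N
    using A(2) mthickD(5) that by blast
  show "rten C C (\<I> (robj C)) M N \<in> \<Union>A" if "M \<in> modules K C" "N \<in> \<Union>A" for M N
    using A(2) mthickD(6) that by blast
qed

lemma mthick_comm: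
  assumes "tt_ring K C" "mthick C J" "M \<in> modules K C" "N \<in> modules K C"
  shows "rten C C (\<I> (robj C)) M N \<in> J \<longleftrightarrow> rten C C (\<I> (robj C)) N M \<in> J"
  using miso_mthick[OF assms(2) rten_comm[OF assms(1,3,4)]] .

lemma mthick_self:
  assumes C: "tt_ring K C" and J: "mthick C J" and s: "self_mod C \<in> J"
  shows "J = modules K C"
proof
  show "modules K C \<subseteq> J"
  proof
    fix M assume M: "M \<in> modules K C"
    have "rten C C (\<I> (robj C)) M (self_mod C) \<in> J" by (rule mthickD(6)[OF J M s])
    then show "M \<in> J" using mthickD(5)[OF J mret_rten_right_unit(1)[OF C M]] by blast
  qed
qed (rule mthickD(1)[OF J])

section \<open>Primes of modules and their existence\<close>

definition mprime :: "('o, 'm) ring_object \<Rightarrow> ('o \<times> 'm) set \<Rightarrow> bool" where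
  "mprime C Q \<longleftrightarrow> mthick C Q \<and> self_mod C \<notin> Q \<and>
     (\<forall>M\<in>modules K C. \<forall>N\<in>modules K C. rten C C (\<I> (robj C)) M N \<in> Q \<longrightarrow> M \<in> Q \<or> N \<in> Q)"

lemma mprimeD:
  assumes "mprime C Q"
  shows "mthick C Q" "self_mod C \<notin> Q" "Q \<subseteq> modules K C"
    "\<And>M N. M \<in> modules K C \<Longrightarrow> N \<in> modules K C \<Longrightarrow> rten C C (\<I> (robj C)) M N \<in> Q \<Longrightarrow> M \<in> Q \<or> N \<in> Q"
  using assms mthickD(1) by (auto simp: mprime_def)

lemma prime_ideal_Mod:
  assumes C: "tt_ring K C"
  shows "prime_ideal (Mod K C) Q \<longleftrightarrow> mprime C Q"
proof -
  have "(Q \<noteq> modules K C) = (self_mod C \<notin> Q)" if "mthick C Q"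
    using mthick_self[OF C that] self_mod_modules[OF C] by blast
  then show ?thesis
    unfolding prime_ideal_def mprime_def thick_ideal_Mod[OF C] Mod_simps
    using tensor_mod_rten[OF C] by auto
qed

text \<open>The analogue of Krull's lemma on ideals disjoint from a multiplicative set. A product of
  elements of \<open>S\<close> is represented by some \<open>u\<close> in \<open>S\<close> that lies
  in every ideal containing the product; retracts of the product provide such a
  \<open>u\<close>.\<close>

lemma mprime_exists:
  assumes C: "tt_ring K C" and J0: "mthick C J0" and S: "S \<subseteq> modules K C" "S \<noteq> {}" "S \<inter> J0 = {}"
    and mult: "\<And>s t. s \<in> S \<Longrightarrow> t \<in> S \<Longrightarrow> \<exists>u\<in>S. \<forall>J. mthick C J \<longrightarrow> rten C C (\<I> (robj C)) s t \<in> J \<longrightarrow> u \<in> J"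
  shows "\<exists>Q. mprime C Q \<and> J0 \<subseteq> Q \<and> Q \<inter> S = {}"
proof -
  let ?A = "{J. mthick C J \<and> J0 \<subseteq> J \<and> J \<inter> S = {}}"
  have "\<exists>Q\<in>?A. \<forall>X\<in>?A. Q \<subseteq> X \<longrightarrow> X = Q"
  proof (rule subset_Zorn_nonempty)
    show "?A \<noteq> {}" using J0 S(3) by blast
    fix \<C> assume ne: "\<C> \<noteq> {}" and ch: "subset.chain ?A \<C>"
    then have sub: "\<C> \<subseteq> ?A" and tot: "\<And>I J. I \<in> \<C> \<Longrightarrow> J \<in> \<C> \<Longrightarrow> I \<subseteq> J \<or> J \<subseteq> I"
      unfolding subset_chain_def by blast+
    have "mthick C (\<Union>\<C>)"
      by (rule mthick_Union[OF ne _ tot]) (use sub in blast)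
    moreover have "J0 \<subseteq> \<Union>\<C>" using ne sub by blast
    moreover have "\<Union>\<C> \<inter> S = {}" using sub by blast
    ultimately show "\<Union>\<C> \<in> ?A" by (intro CollectI conjI)
  qed
  then obtain Q where "Q \<in> ?A" and mx: "\<forall>X\<in>?A. Q \<subseteq> X \<longrightarrow> X = Q" by (rule bexE)
  then have Q: "mthick C Q" "J0 \<subseteq> Q" "Q \<inter> S = {}" by simp_all
  have max: "X = Q" if "mthick C X" "J0 \<subseteq> X" "X \<inter> S = {}" "Q \<subseteq> X" for X
    using bspec[OF mx, of X] that by simp
  note QD = mthickD[OF Q(1)] and I = ring_hom_ident[OF C]
  let ?T = "rten C C (\<I> (robj C))"
  have all: "mthick C (modules K C)"
  proof (rule mthickI)
    fix L M N f g h assume "mhom C L M f" "mhom C M N g"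
    then show "(L \<in> modules K C \<and> M \<in> modules K C \<longrightarrow> N \<in> modules K C) \<and>
      (M \<in> modules K C \<and> N \<in> modules K C \<longrightarrow> L \<in> modules K C) \<and> (L \<in> modules K C \<and> N \<in> modules K C \<longrightarrow> M \<in> modules K C)"
      using mhomD(1,2) by blast
  qed (use susp_mod_modules[OF C] mret_modules rten_modules[OF C C I] in blast)+
  \<comment> \<open>By maximality of \<open>Q\<close>, the ideal generated by \<open>Q\<close> and
    \<open>a\<close>, taken as an intersection, meets \<open>S\<close>.\<close>
  have gen: "\<exists>s\<in>S. \<forall>J. mthick C J \<longrightarrow> Q \<subseteq> J \<longrightarrow> a \<in> J \<longrightarrow> s \<in> J" if a: "a \<in> modules K C" "a \<notin> Q" for a
  proof -
    let ?G = "\<Inter>{J. mthick C J \<and> Q \<subseteq> J \<and> a \<in> J}"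
    have "mthick C ?G" using all QD(1) a by (intro mthick_Inter) auto
    moreover have "Q \<subseteq> ?G" "a \<in> ?G" by auto
    ultimately have "?G \<inter> S \<noteq> {}" using max[of ?G] Q(2) a(2) by blast
    then show ?thesis by blast
  qed
  have "mprime C Q"
    unfolding mprime_def
  proof (intro conjI ballI impI)
    show "mthick C Q" by (rule Q)
    show "self_mod C \<notin> Q"
    proof
      assume "self_mod C \<in> Q"
      then have "Q = modules K C" by (rule mthick_self[OF C Q(1)])
      then show False using S Q(3) by blast
    qed
    fix a b assume a: "a \<in> modules K C" and b: "b \<in> modules K C" and ab: "?T a b \<in> Q"
    show "a \<in> Q \<or> b \<in> Q"
    proof (rule ccontr)
      assume "\<not> (a \<in> Q \<or> b \<in> Q)"
      then obtain s t where s: "s \<in> S" "\<And>J. mthick C J \<Longrightarrow> Q \<subseteq> J \<Longrightarrow> a \<in> J \<Longrightarrow> s \<in> J"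
        and t: "t \<in> S" "\<And>J. mthick C J \<Longrightarrow> Q \<subseteq> J \<Longrightarrow> b \<in> J \<Longrightarrow> t \<in> J"
        using gen[OF a] gen[OF b] by blast
      have sm: "s \<in> modules K C" "t \<in> modules K C" using s t S by blast+
      \<comment> \<open>The modules \<open>N\<close> with \<open>b \<otimes> N\<close> in
        \<open>Q\<close> form an ideal containing \<open>Q\<close> and \<open>a\<close>, hence
        \<open>s\<close>. Likewise those with \<open>s \<otimes> N\<close> in \<open>Q\<close>
        contain \<open>Q\<close> and \<open>b\<close>, hence \<open>t\<close>. So
        \<open>s \<otimes> t\<close> lies in \<open>Q\<close>, against \<open>Q\<close> missing
        \<open>S\<close>.\<close>
      have "s \<in> {N \<in> modules K C. ?T b N \<in> Q}"
      proof (rule s(2)[OF mthick_vimage_rten[OF C C I Q(1) b]])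
        show "Q \<subseteq> {N \<in> modules K C. ?T b N \<in> Q}" using QD(1) QD(6)[OF b] by blast
        show "a \<in> {N \<in> modules K C. ?T b N \<in> Q}" using a ab mthick_comm[OF C Q(1) a b] by blast
      qed
      then have "?T s b \<in> Q" using mthick_comm[OF C Q(1) b sm(1)] by blast
      have "t \<in> {N \<in> modules K C. ?T s N \<in> Q}"
      proof (rule t(2)[OF mthick_vimage_rten[OF C C I Q(1) sm(1)]])
        show "Q \<subseteq> {N \<in> modules K C. ?T s N \<in> Q}" using QD(1) QD(6)[OF sm(1)] by blast
        show "b \<in> {N \<in> modules K C. ?T s N \<in> Q}" using b \<open>?T s b \<in> Q\<close> by blast
      qed
      then have "?T s t \<in> Q" by blast
      then show False using mult[OF s(1) t(1)] Q(1,3) by blast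
    qed
  qed
  then show ?thesis using Q by blast
qed

text \<open>A reordering of the factors of
  \<open>(L \<otimes> N) \<otimes> (L' \<otimes> N')\<close>; it supplies the witness
  \<open>u\<close> of \<open>mprime_exists\<close> for sets of extended modules.\<close>

lemma rten_product_mret:
  assumes B: "tt_ring K B" and C: "tt_ring K C" and f: "ring_hom K B C f"
    and L: "L \<in> modules K C" and L': "L' \<in> modules K C" and N: "N \<in> modules K B" and N': "N' \<in> modules K B"
  shows "mret C (rten C B f (rten C C (\<I> (robj C)) L' L) (rten B B (\<I> (robj B)) N N'))
    (rten C C (\<I> (robj C)) (rten C B f L N) (rten C B f L' N'))"
proof -
  have e: "\<I> (robj C) \<cdot> f = f" using ring_homD[OF f] by simp
  note I = ring_hom_ident[OF C]
  let ?T = "rten C C (\<I> (robj C))" let ?X = "rten C B f L N"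
  have X: "?X \<in> modules K C" by (rule rten_modules[OF B C f L N])
  have LL: "?T L' L \<in> modules K C" by (rule rten_modules[OF C C I L' L])
  have "mret C (rten C B f (?T L' L) N) (?T L' ?X)"
    using miso_mret[OF rten_assoc[OF B C C f I L' L N, unfolded e]] .
  then have "mret C (rten C B f (?T L' L) N) (?T ?X L')"
    using mret_trans[OF C _ miso_mret[OF rten_comm[OF C L' X]]] by blast
  then have "mret C (rten C B f (rten C B f (?T L' L) N) N') (rten C B f (?T ?X L') N')"
    by (rule mret_rten[OF B C f _ mret_refl[OF B N']])
  then have "mret C (rten C B f (?T L' L) (rten B B (\<I> (robj B)) N N')) (rten C B f (?T ?X L') N')"
    using mret_trans[OF C miso_mret[OF miso_sym[OF rten_rten[OF B C f LL N N']]]] by blast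
  then show ?thesis
    using mret_trans[OF C _ miso_mret[OF rten_assoc[OF B C C f I X L' N', unfolded e]]] by blast
qed

section \<open>Primes along extension of scalars: lying over and going up\<close>

definition pull :: "('o, 'm) ring_object \<Rightarrow> ('o, 'm) ring_object \<Rightarrow> 'm \<Rightarrow> ('o \<times> 'm) set \<Rightarrow> ('o \<times> 'm) set" where
  "pull C B f T = {N \<in> modules K B. rten C B f (self_mod C) N \<in> T}"

context
  fixes B C f
  assumes B: "tt_ring K B" and C: "tt_ring K C" and f: "ring_hom K B C f"
begin

lemma pull_mthick: "mthick C T \<Longrightarrow> mthick B (pull C B f T)"
  unfolding pull_def by (rule mthick_vimage_rten[OF B C f _ self_mod_modules[OF C]])

lemma prime_rten:
  assumes T: "mprime C T" and L: "L \<in> modules K C" and N: "N \<in> modules K B"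
  shows "rten C B f L N \<in> T \<longleftrightarrow> L \<in> T \<or> N \<in> pull C B f T"
proof -
  note t = mprimeD(1)[OF T]
  let ?F = "rten C B f (self_mod C) N"
  have F: "?F \<in> modules K C" by (rule rten_modules[OF B C f self_mod_modules[OF C] N])
  have "rten C B f L N \<in> T \<longleftrightarrow> rten C C (\<I> (robj C)) L ?F \<in> T"
    using rten_extension[OF B C f L N] mthickD(5)[OF t] by blast
  also have "\<dots> \<longleftrightarrow> L \<in> T \<or> ?F \<in> T"
    using mprimeD(4)[OF T L F] mthickD(6)[OF t L, of ?F] mthickD(6)[OF t F, of L] mthick_comm[OF C t F L] by blast
  finally show ?thesis using N by (simp add: pull_def)
qed

lemma mprime_pull:
  assumes T: "mprime C T"
  shows "mprime B (pull C B f T)"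
  unfolding mprime_def
proof (intro conjI ballI impI)
  note t = mprimeD(1)[OF T] and S = self_mod_modules[OF C]
  show "mthick B (pull C B f T)" by (rule pull_mthick[OF t])
  show "self_mod B \<notin> pull C B f T"
    using miso_mthick[OF t rten_right_unit[OF B C f S]] mprimeD(2)[OF T] by (simp add: pull_def)
  fix M N assume M: "M \<in> modules K B" and N: "N \<in> modules K B" and MN: "rten B B (\<I> (robj B)) M N \<in> pull C B f T"
  then have "rten C B f (rten C B f (self_mod C) M) N \<in> T"
    using miso_mthick[OF t rten_rten[OF B C f S M N]] by (simp add: pull_def)
  then show "M \<in> pull C B f T \<or> N \<in> pull C B f T"
    using prime_rten[OF T rten_modules[OF B C f S M] N] M by (auto simp: pull_def)
qed

text \<open>\<open>rten_retract\<close> for the \<open>C\<close>-module \<open>C\<close> itself,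
  combined with the isomorphism of \<open>C \<otimes>\<^sub>C L\<close> and
  \<open>L\<close>.\<close>

lemma res_mod_pull:
  assumes T: "mthick C T" and L: "L \<in> modules K C" and r: "res_mod f L \<in> pull C B f T"
  shows "L \<in> T"
proof -
  have "rten C B f (self_mod C) (res_mod f L) \<in> T" using r by (simp add: pull_def)
  then have "rten C C (\<I> (robj C)) (self_mod C) L \<in> T"
    using mthickD(5)[OF T rten_retract[OF B C f self_mod_modules[OF C] L]] by blast
  then show ?thesis using miso_mthick[OF T rten_left_unit[OF C L]] by blast
qed

text \<open>Projection formula: by \<open>res_mod_rten\<close> the restriction of
  \<open>L \<otimes>\<^sub>B N\<close> is the product over \<open>B\<close> of the restriction of
  \<open>L\<close> with \<open>N\<close>.\<close>

lemma res_rten_prime: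
  assumes Q: "mprime B Q" and L: "L \<in> modules K C" and N: "N \<in> modules K B"
  shows "res_mod f (rten C B f L N) \<in> Q \<longleftrightarrow> res_mod f L \<in> Q \<or> N \<in> Q"
proof -
  note q = mprimeD(1)[OF Q] and R = res_mod_modules[OF B C f L]
  show ?thesis
    unfolding res_mod_rten[OF B C f L N]
    using mprimeD(4)[OF Q R N] mthickD(6)[OF q R, of N] mthickD(6)[OF q N, of "res_mod f L"] mthick_comm[OF B q R N] by blast
qed

text \<open>The prime \<open>T'\<close> contains \<open>?J\<close> and avoids the modules
  \<open>L \<otimes>\<^sub>B N\<close> with \<open>L\<close> outside \<open>T\<close> and
  \<open>N\<close> outside \<open>Q\<close>. The case \<open>N = B\<close> gives
  \<open>T' \<subseteq> T\<close>, the case \<open>L = C\<close> one half of the trace, and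
  \<open>?J\<close> the other half. Disjointness uses \<open>Q \<subseteq> pull C B f T\<close>: a
  module whose restriction lies in \<open>Q\<close> already lies in \<open>T\<close>.\<close>

lemma going_up:
  assumes T: "mprime C T" and Q: "mprime B Q" and QT: "Q \<subseteq> pull C B f T"
  shows "\<exists>T'. mprime C T' \<and> T' \<subseteq> T \<and> pull C B f T' = Q"
proof -
  note t = mprimeD(1)[OF T] and q = mprimeD(1)[OF Q] and S = self_mod_modules[OF C] and SB = self_mod_modules[OF B]
  let ?J = "{L \<in> modules K C. res_mod f L \<in> Q}"
  let ?S = "{rten C B f L N | L N. L \<in> modules K C \<and> L \<notin> T \<and> N \<in> modules K B \<and> N \<notin> Q}"
  have "\<exists>T'. mprime C T' \<and> ?J \<subseteq> T' \<and> T' \<inter> ?S = {}"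
  proof (rule mprime_exists[OF C mthick_vimage_res[OF B C f q]])
    show "?S \<subseteq> modules K C" using rten_modules[OF B C f] by blast
    show "?S \<noteq> {}" using S SB mprimeD(2)[OF T] mprimeD(2)[OF Q] by blast
    show "?S \<inter> ?J = {}"
    proof -
      have "res_mod f (rten C B f L N) \<notin> Q" if "L \<in> modules K C" "L \<notin> T" "N \<in> modules K B" "N \<notin> Q" for L N
        using res_rten_prime[OF Q that(1,3)] res_mod_pull[OF t that(1)] QT that by blast
      then show ?thesis by blast
    qed
    fix s s' assume "s \<in> ?S" "s' \<in> ?S"
    then obtain L N L' N' where s: "s = rten C B f L N" "L \<in> modules K C" "L \<notin> T" "N \<in> modules K B" "N \<notin> Q"
      and s': "s' = rten C B f L' N'" "L' \<in> modules K C" "L' \<notin> T" "N' \<in> modules K B" "N' \<notin> Q" by blast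
    let ?u = "rten C B f (rten C C (\<I> (robj C)) L' L) (rten B B (\<I> (robj B)) N N')"
    have "?u \<in> ?S"
      using rten_modules[OF C C ring_hom_ident[OF C] s'(2) s(2)] rten_modules[OF B B ring_hom_ident[OF B] s(4) s'(4)]
        mprimeD(4)[OF T s'(2) s(2)] mprimeD(4)[OF Q s(4) s'(4)] s s' by blast
    moreover have "mret C ?u (rten C C (\<I> (robj C)) s s')"
      unfolding s(1) s'(1) by (rule rten_product_mret[OF B C f s(2) s'(2) s(4) s'(4)])
    ultimately show "\<exists>u\<in>?S. \<forall>J. mthick C J \<longrightarrow> rten C C (\<I> (robj C)) s s' \<in> J \<longrightarrow> u \<in> J"
      using mthickD(5) by blast
  qed
  then obtain T' where T': "mprime C T'" "?J \<subseteq> T'" "T' \<inter> ?S = {}" by blast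
  note t' = mprimeD(1)[OF T'(1)]
  have "T' \<subseteq> T"
  proof
    fix L assume L: "L \<in> T'"
    then have Lm: "L \<in> modules K C" using mprimeD(3)[OF T'(1)] by blast
    have "rten C B f L (self_mod B) \<in> T'" using miso_mthick[OF t' rten_right_unit[OF B C f Lm]] L by blast
    then show "L \<in> T" using T'(3) Lm SB mprimeD(2)[OF Q] by blast
  qed
  moreover have "pull C B f T' = Q"
  proof (intro equalityI subsetI)
    fix N assume "N \<in> pull C B f T'"
    then have "N \<in> modules K B" "rten C B f (self_mod C) N \<in> T'" by (simp_all add: pull_def)
    then show "N \<in> Q" using T'(3) S mprimeD(2)[OF T] by blast
  next
    fix N assume N: "N \<in> Q"
    then have Nm: "N \<in> modules K B" using mprimeD(3)[OF Q] by blast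
    have "rten C B f (self_mod C) N \<in> ?J"
      using res_rten_prime[OF Q S Nm] N rten_modules[OF B C f S Nm] by blast
    then show "N \<in> pull C B f T'" using T'(2) Nm by (auto simp: pull_def)
  qed
  ultimately show ?thesis using T'(1) by blast
qed

lemma lying_over:
  assumes Q: "mprime B Q" and s: "res_mod f (self_mod C) \<notin> Q"
  shows "\<exists>T. mprime C T \<and> pull C B f T = Q"
proof -
  note q = mprimeD(1)[OF Q] and S = self_mod_modules[OF C] and SB = self_mod_modules[OF B]
  let ?F = "rten C B f (self_mod C)"
  let ?J = "{L \<in> modules K C. res_mod f L \<in> Q}"
  let ?S = "{?F N | N. N \<in> modules K B \<and> N \<notin> Q}"
  have "\<exists>T'. mprime C T' \<and> ?J \<subseteq> T' \<and> T' \<inter> ?S = {}"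
  proof (rule mprime_exists[OF C mthick_vimage_res[OF B C f q]])
    show "?S \<subseteq> modules K C" using rten_modules[OF B C f S] by blast
    show "?S \<noteq> {}" using SB mprimeD(2)[OF Q] by blast
    show "?S \<inter> ?J = {}" using res_rten_prime[OF Q S] s by blast
    fix s s' assume "s \<in> ?S" "s' \<in> ?S"
    then obtain N N' where N: "s = ?F N" "N \<in> modules K B" "N \<notin> Q" and N': "s' = ?F N'" "N' \<in> modules K B" "N' \<notin> Q" by blast
    let ?u = "?F (rten B B (\<I> (robj B)) N N')" let ?SS = "rten C C (\<I> (robj C)) (self_mod C) (self_mod C)"
    have "?u \<in> ?S"
      using rten_modules[OF B B ring_hom_ident[OF B] N(2) N'(2)] mprimeD(4)[OF Q N(2) N'(2)] N N' by blast
    moreover have "mret C ?u (rten C C (\<I> (robj C)) s s')"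
      unfolding N(1) N'(1)
      by (rule mret_trans[OF C _ rten_product_mret[OF B C f S S N(2) N'(2)]],
          rule mret_rten[OF B C f mret_rten_right_unit(1)[OF C S] mret_refl[OF B rten_modules[OF B B ring_hom_ident[OF B] N(2) N'(2)]]])
    ultimately show "\<exists>u\<in>?S. \<forall>J. mthick C J \<longrightarrow> rten C C (\<I> (robj C)) s s' \<in> J \<longrightarrow> u \<in> J"
      using mthickD(5) by blast
  qed
  then obtain T' where T': "mprime C T'" "?J \<subseteq> T'" "T' \<inter> ?S = {}" by blast
  have "pull C B f T' = Q"
  proof (intro equalityI subsetI)
    fix N assume "N \<in> pull C B f T'"
    then have "N \<in> modules K B" "?F N \<in> T'" by (simp_all add: pull_def)
    then show "N \<in> Q" using T'(3) by blast
  next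
    fix N assume N: "N \<in> Q"
    then have Nm: "N \<in> modules K B" using mprimeD(3)[OF Q] by blast
    have "?F N \<in> ?J" using res_rten_prime[OF Q S Nm] N rten_modules[OF B C f S Nm] by blast
    then have "?F N \<in> T'" using T'(2) by blast
    then show "N \<in> pull C B f T'" using Nm by (simp add: pull_def)
  qed
  then show ?thesis using T'(1) by blast
qed

text \<open>Zorn's lemma is applied to complements, since a minimal element is wanted. The
  intersection of a chain of primes is prime, and \<open>pull\<close> commutes with
  intersections.\<close>

lemma minimal_over:
  assumes T: "mprime C T"
  shows "\<exists>T'. mprime C T' \<and> T' \<subseteq> T \<and> pull C B f T' = pull C B f T \<and>
    (\<forall>R. mprime C R \<and> R \<subseteq> T' \<and> pull C B f R = pull C B f T \<longrightarrow> R = T')"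
proof -
  let ?P = "\<lambda>R. mprime C R \<and> R \<subseteq> T \<and> pull C B f R = pull C B f T"
  let ?A = "{modules K C - R | R. ?P R}"
  have inj: "R = R'" if "modules K C - R = modules K C - R'" "?P R" "?P R'" for R R'
    using that mprimeD(3)[of C R] mprimeD(3)[of C R'] by blast
  have "\<exists>M\<in>?A. \<forall>X\<in>?A. M \<subseteq> X \<longrightarrow> X = M"
  proof (rule subset_Zorn_nonempty)
    show "?A \<noteq> {}" using T by blast
    fix \<C> assume ne: "\<C> \<noteq> {}" and ch: "subset.chain ?A \<C>"
    then have sub: "\<C> \<subseteq> ?A" and tot: "\<And>I J. I \<in> \<C> \<Longrightarrow> J \<in> \<C> \<Longrightarrow> I \<subseteq> J \<or> J \<subseteq> I"
      unfolding subset_chain_def by blast+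
    define D where "D = {R. ?P R \<and> modules K C - R \<in> \<C>}"
    have DP: "mprime C R" "R \<subseteq> T" "pull C B f R = pull C B f T" if "R \<in> D" for R
      using that unfolding D_def by blast+
    have D: "D \<noteq> {}" using ne sub unfolding D_def by blast
    have chD: "I \<subseteq> J \<or> J \<subseteq> I" if I: "I \<in> D" and J: "J \<in> D" for I J
    proof -
      have "modules K C - I \<subseteq> modules K C - J \<or> modules K C - J \<subseteq> modules K C - I"
        using tot I J unfolding D_def by blast
      then show ?thesis using mprimeD(3)[OF DP(1)[OF I]] mprimeD(3)[OF DP(1)[OF J]] by blast
    qed
    have pr: "mprime C (\<Inter>D)"
      unfolding mprime_def
    proof (intro conjI ballI impI)
      show "mthick C (\<Inter>D)" by (rule mthick_Inter[OF D mprimeD(1)[OF DP(1)]])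
      show "self_mod C \<notin> \<Inter>D" using D mprimeD(2)[OF DP(1)] by blast
      fix M N assume M: "M \<in> modules K C" and N: "N \<in> modules K C" and MN: "rten C C (\<I> (robj C)) M N \<in> \<Inter>D"
      show "M \<in> \<Inter>D \<or> N \<in> \<Inter>D"
      proof (rule ccontr)
        assume "\<not> (M \<in> \<Inter>D \<or> N \<in> \<Inter>D)"
        then obtain I J where I: "I \<in> D" "M \<notin> I" and J: "J \<in> D" "N \<notin> J" by blast
        \<comment> \<open>Of two primes in a chain, the smaller one misses both \<open>M\<close> and
          \<open>N\<close>.\<close>
        then obtain R where R: "R \<in> D" "M \<notin> R" "N \<notin> R" using chD[OF I(1) J(1)] by blast
        then show False using MN mprimeD(4)[OF DP(1)[OF R(1)] M N] by blast
      qed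
    qed
    have sT: "\<Inter>D \<subseteq> T" using D DP(2) by blast
    have "pull C B f (\<Inter>D) = \<Inter>(pull C B f ` D)" using D unfolding pull_def by blast
    also have "\<dots> = pull C B f T" using D DP(3) by simp
    finally have "?P (\<Inter>D)" using pr sT by blast
    moreover have "\<Union>\<C> = modules K C - \<Inter>D"
      using sub unfolding D_def by blast
    ultimately show "\<Union>\<C> \<in> ?A" by blast
  qed
  then obtain M where M: "M \<in> ?A" and mx: "\<forall>X\<in>?A. M \<subseteq> X \<longrightarrow> X = M" by (rule bexE)
  from M obtain T' where T': "?P T'" and MT: "M = modules K C - T'" by blast
  have "R = T'" if R: "mprime C R \<and> R \<subseteq> T' \<and> pull C B f R = pull C B f T" for R
  proof -
    have P: "?P R" using R T' by blast
    then have A: "modules K C - R \<in> ?A" by blast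
    have "modules K C - R = modules K C - T'"
      using bspec[OF mx A] R unfolding MT by blast
    then show ?thesis using inj P T' by blast
  qed
  then show ?thesis using T' by blast
qed

end

text \<open>Transitivity of extension of scalars, which is \<open>rten_assoc\<close> for the modules
  \<open>D\<close> and \<open>C\<close>.\<close>

lemma pull_comp:
  assumes B: "tt_ring K B" and C: "tt_ring K C" and D: "tt_ring K D"
    and f: "ring_hom K B C f" and g: "ring_hom K C D g" and T: "mthick D T"
  shows "pull D B (g \<cdot> f) T = pull C B f (pull D C g T)"
proof -
  note S = self_mod_modules[OF D] and SC = self_mod_modules[OF C]
  note u = rten_right_unit[OF C D g S]
  note gf = ring_hom_comp[OF B C D f g]
  have "rten D B (g \<cdot> f) (self_mod D) N \<in> T \<longleftrightarrow> rten D C g (self_mod D) (rten C B f (self_mod C) N) \<in> T"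
    if N: "N \<in> modules K B" for N
  proof -
    have 1: "mret D (rten D B (g \<cdot> f) (self_mod D) N) (rten D B (g \<cdot> f) (rten D C g (self_mod D) (self_mod C)) N)"
      and 2: "mret D (rten D B (g \<cdot> f) (rten D C g (self_mod D) (self_mod C)) N) (rten D B (g \<cdot> f) (self_mod D) N)"
      by (rule mret_rten[OF B D gf miso_mret[OF miso_sym[OF u]] mret_refl[OF B N]], rule mret_rten[OF B D gf miso_mret[OF u] mret_refl[OF B N]])
    show ?thesis
      using miso_mthick[OF T rten_assoc[OF B C D f g S SC N]] mthickD(5)[OF T 1] mthickD(5)[OF T 2] by blast
  qed
  then show ?thesis using rten_modules[OF B C f SC] by (auto simp: pull_def)
qed

end

section \<open>Split triangles and direct sums in ideals\<close>

context triangulated_category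
begin

lemma biproductD:
  assumes "biproduct K x y s i j p q" "x \<in> Ob K" "y \<in> Ob K"
  shows "s \<in> Ob K" "i \<in> Ar K" "Dom K i = x" "Cod K i = s" "j \<in> Ar K" "Dom K j = y" "Cod K j = s"
    "p \<in> Ar K" "Dom K p = s" "Cod K p = x" "q \<in> Ar K" "Dom K q = s" "Cod K q = y"
    "p \<cdot> i = \<I> x" "q \<cdot> j = \<I> y" "p \<cdot> j = Zero K y x" "q \<cdot> i = Zero K x y"
    "(i \<cdot> p) \<oplus> (j \<cdot> q) = \<I> s"
  using assms by (simp_all add: biproduct_def)

text \<open>Direct sums enter thick ideals through this triangle. The cone of the split monomorphism
  \<open>i\<close> has zero third arrow \<open>h\<close>, and the map \<open>v\<close> from the cone
  to \<open>y\<close> has inverse \<open>g \<cdot> j\<close>.\<close>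

lemma biproduct_Tri:
  assumes bp: "biproduct K x y s i j p q" and [simp]: "x \<in> Ob K" "y \<in> Ob K"
  shows "(i, q, Zero K y (\<Sigma> x)) \<in> Tri K"
proof -
  note [simp] = biproductD(1-17)[OF bp assms(2,3)]
  note sum = biproductD(18)[OF bp assms(2,3)]
  obtain g h where t: "(i, g, h) \<in> Tri K" using Tri_exists[of i] by auto
  note T = Tri_simps[OF t, simplified]
  define z where "z = Cod K g"
  have gt [simp]: "g \<in> Ar K" "Dom K g = s" "Cod K g = z" "h \<in> Ar K" "Dom K h = z" "Cod K h = \<Sigma> x"
    using T by (simp_all add: z_def)
  have [simp]: "z \<in> Ob K" using Cod_Ob[of g] by simp
  have gi: "g \<cdot> i = Zero K x z" using Tri_comp_Zero[OF t] by simp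
  have "neg (\<S> i) \<cdot> h = Zero K z (\<Sigma> s)" using Tri_comp_Zero2[OF Tri_rotated[OF t]] by simp
  then have "\<S> p \<cdot> (neg (\<S> i) \<cdot> h) = Zero K z (\<Sigma> x)" by simp
  moreover have n: "\<S> p \<cdot> neg (\<S> i) = neg (\<I> (\<Sigma> x))"
  proof -
    have "(\<S> p \<cdot> \<S> i) \<oplus> (\<S> p \<cdot> neg (\<S> i)) = \<S> p \<cdot> (\<S> i \<oplus> neg (\<S> i))" by (rule comp_add'[symmetric]) simp_all
    then show ?thesis by (intro eq_neg) (simp_all add: merge_S)
  qed
  ultimately have "neg (\<I> (\<Sigma> x)) \<cdot> h = Zero K z (\<Sigma> x)" by (simp add: n[THEN reassoc])
  moreover have "(\<I> (\<Sigma> x) \<cdot> h) \<oplus> (neg (\<I> (\<Sigma> x)) \<cdot> h) = (\<I> (\<Sigma> x) \<oplus> neg (\<I> (\<Sigma> x))) \<cdot> h" by (rule add_comp'[symmetric]) simp_all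
  ultimately have h0: "h = Zero K z (\<Sigma> x)" by simp
  obtain v where v: "v \<in> Hom z y" and vg: "v \<cdot> g = q"
  proof -
    obtain o' where o: "zero_object K o'" using zero_object_exists by blast
    then have [simp]: "o' \<in> Ob K" by (simp add: zero_object_ident)
    have "(\<I> y, Zero K y (\<Sigma> o'), Zero K (\<Sigma> o') (\<Sigma> y)) \<in> Tri K"
      by (rule Tri_ident[OF _ zero_object_Susp[OF o]]) simp
    then have u: "(Zero K o' y, \<I> y, Zero K y (\<Sigma> o')) \<in> Tri K"
      using Tri_rotate[of "Zero K o' y" o' y "\<I> y" y "Zero K y (\<Sigma> o')" "Zero K (\<Sigma> o') (\<Sigma> y)"] by simp
    have "\<exists>c\<in>Hom (Cod K g) (Cod K (\<I> y)). c \<cdot> g = \<I> y \<cdot> q \<and> \<S> (Zero K x o') \<cdot> h = Zero K y (\<Sigma> o') \<cdot> c"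
      by (rule Tri_morphism[OF t u]) simp_all
    then obtain c where "c \<in> Hom (Cod K g) (Cod K (\<I> y))" "c \<cdot> g = \<I> y \<cdot> q" by blast
    then show ?thesis using that[of c] by simp
  qed
  note [simp] = v[unfolded Hom_iff]
  have vgj: "v \<cdot> (g \<cdot> j) = \<I> y" by (simp add: vg[THEN reassoc])
  have gjq: "g \<cdot> j \<cdot> q = g"
  proof -
    have "g = g \<cdot> ((i \<cdot> p) \<oplus> (j \<cdot> q))" unfolding sum by simp
    also have "\<dots> = (g \<cdot> i \<cdot> p) \<oplus> (g \<cdot> j \<cdot> q)" by (simp add: comp_add')
    also have "g \<cdot> i \<cdot> p = Zero K s z" by (simp add: gi[THEN reassoc])
    finally show ?thesis by simp
  qed
  \<comment> \<open>The difference of \<open>g \<cdot> j \<cdot> v\<close> and the identity kills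
    \<open>g\<close>, so it factors through \<open>h\<close>, which is zero.\<close>
  have "\<exists>c\<in>Hom (\<Sigma> (Dom K i)) (Cod K ((g \<cdot> j \<cdot> v) \<oplus> neg (\<I> z))). (g \<cdot> j \<cdot> v) \<oplus> neg (\<I> z) = c \<cdot> h"
  proof (rule Tri_colift[OF t])
    have n: "neg (\<I> z) \<cdot> g = neg g"
    proof -
      have "(\<I> z \<cdot> g) \<oplus> (neg (\<I> z) \<cdot> g) = (\<I> z \<oplus> neg (\<I> z)) \<cdot> g" by (rule add_comp'[symmetric]) simp_all
      then show ?thesis by (intro eq_neg) simp_all
    qed
    show "((g \<cdot> j \<cdot> v) \<oplus> neg (\<I> z)) \<cdot> g = Zero K (Dom K g) (Cod K ((g \<cdot> j \<cdot> v) \<oplus> neg (\<I> z)))"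
      by (simp add: add_comp' vg gjq n)
  qed simp_all
  then have d: "(g \<cdot> j \<cdot> v) \<oplus> neg (\<I> z) = Zero K z z" unfolding h0 by auto
  have e: "neg (\<I> z) \<oplus> \<I> z = Zero K z z" by simp
  have "(g \<cdot> j) \<cdot> v = ((g \<cdot> j \<cdot> v) \<oplus> neg (\<I> z)) \<oplus> \<I> z" by (simp add: add_assoc' e del: neg_add)
  then have gv: "(g \<cdot> j) \<cdot> v = \<I> z" unfolding d by simp
  have "iso K v" by (rule isoI[of v z y "g \<cdot> j"]) (use vgj gv in simp_all)
  show ?thesis
    by (rule Tri_iso[OF t, of i x s q y "Zero K y (\<Sigma> x)" "\<I> x" "\<I> s" v]) (simp_all add: \<open>iso K v\<close> vg h0)
qed

end

context tt_category
begin

text \<open>\<open>Ten_additive\<close> concerns the second variable; the symmetry carries it to the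
  first.\<close>

lemma TenA_additive_right:
  assumes [simp]: "y \<in> Ob K" and f: "f \<in> Hom x z" and g: "g \<in> Hom x z"
  shows "(f \<oplus> g) \<odot> \<I> y = (f \<odot> \<I> y) \<oplus> (g \<odot> \<I> y)"
proof -
  have [simp]: "f \<in> Ar K" "g \<in> Ar K" "Dom K f = x" "Dom K g = x" "Cod K f = z" "Cod K g = z" using f g by simp_all
  have [simp]: "x \<in> Ob K" "z \<in> Ob K" using Dom_Ob[of f] Cod_Ob[of f] by simp_all
  have b: "h \<odot> \<I> y = \<gamma> y z \<cdot> (\<I> y \<odot> h) \<cdot> \<gamma> x y" if "h \<in> Ar K" "Dom K h = x" "Cod K h = z" for h
  proof -
    have "\<gamma> y z \<cdot> (\<I> y \<odot> h) \<cdot> \<gamma> x y = (\<gamma> y z \<cdot> (\<I> y \<odot> h)) \<cdot> \<gamma> x y" using that by simp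
    also have "\<dots> = h \<odot> \<I> y" using that by (simp add: braid_nat)
    finally show ?thesis ..
  qed
  have "(f \<oplus> g) \<odot> \<I> y = \<gamma> y z \<cdot> ((\<I> y \<odot> f) \<oplus> (\<I> y \<odot> g)) \<cdot> \<gamma> x y"
    using Ten_additive[OF _ f g, of y] by (simp add: b)
  also have "\<dots> = (\<gamma> y z \<cdot> (\<I> y \<odot> f) \<cdot> \<gamma> x y) \<oplus> (\<gamma> y z \<cdot> (\<I> y \<odot> g) \<cdot> \<gamma> x y)"
    by (simp add: comp_add' add_comp')
  finally show ?thesis by (simp add: b)
qed

lemma Zero_TenA [simp]:
  assumes [simp]: "x \<in> Ob K" "y \<in> Ob K" "z \<in> Ob K"
  shows "Zero K y z \<odot> \<I> x = Zero K (y \<otimes> x) (z \<otimes> x)"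
proof -
  have "(Zero K y z \<odot> \<I> x) \<oplus> (Zero K y z \<odot> \<I> x) = Zero K y z \<odot> \<I> x"
    using TenA_additive_right[of x "Zero K y z" y z "Zero K y z"] by simp
  from add_idem_Zero[OF this] show ?thesis by simp
qed

text \<open>A module whose identity is a sum of endomorphisms through \<open>N\<close> and
  \<open>P\<close> is a retract of their direct sum, which lies in \<open>J\<close> by the triangle
  of \<open>biproduct_Tri\<close>. The action on the biproduct \<open>s\<close> is built by hand,
  with equations into \<open>s\<close> tested on the two projections.\<close>

lemma mthick_sum:
  assumes B: "tt_ring K B" and J: "mthick B J" and N: "N \<in> J" and P: "P \<in> J"
    and k1: "mhom B G N k1" and k2: "mhom B G P k2" and l1: "mhom B N G l1" and l2: "mhom B P G l2"
    and s1: "(l1 \<cdot> k1) \<oplus> (l2 \<cdot> k2) = \<I> (fst G)"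
  shows "G \<in> J"
proof -
  note GN = mhomD(1,2)[OF k1] and PM = mhomD(2)[OF k2]
  let ?x = "fst N" let ?y = "fst P" let ?b = "robj B"
  note [simp] = tt_ringD[OF B] modulesD(1-4)[OF B GN(1)] modulesD(1-4)[OF B GN(2)] modulesD(1-4)[OF B PM]
    mhomD(3-5)[OF k1] mhomD(3-5)[OF k2] mhomD(3-5)[OF l1] mhomD(3-5)[OF l2]
  obtain s i j p q where bp: "biproduct K ?x ?y s i j p q"
    using biproduct_exists[of ?x ?y] by auto
  note bpD = biproductD[OF bp modulesD(1)[OF B GN(2)] modulesD(1)[OF B PM]]
  note [simp] = bpD(1-17)
  have sum: "(i \<cdot> p) \<oplus> (j \<cdot> q) = \<I> s" by (rule bpD(18))
  have joint: "f = g" if "p \<cdot> f = p \<cdot> g" "q \<cdot> f = q \<cdot> g" "f \<in> Ar K" "g \<in> Ar K" "Cod K f = s" "Cod K g = s" "Dom K f = Dom K g" for f g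
  proof -
    have d: "h = (i \<cdot> (p \<cdot> h)) \<oplus> (j \<cdot> (q \<cdot> h))" if "h \<in> Ar K" "Cod K h = s" for h
    proof -
      have "((i \<cdot> p) \<oplus> (j \<cdot> q)) \<cdot> h = (i \<cdot> (p \<cdot> h)) \<oplus> (j \<cdot> (q \<cdot> h))" using that by (simp add: add_comp')
      then show ?thesis unfolding sum using that by simp
    qed
    have "f = (i \<cdot> (p \<cdot> f)) \<oplus> (j \<cdot> (q \<cdot> f))" by (rule d) (use that in simp_all)
    also have "\<dots> = g" unfolding that(1,2) by (rule d[symmetric]) (use that in simp_all)
    finally show ?thesis .
  qed
  define k where "k = (i \<cdot> snd N \<cdot> (\<I> ?b \<odot> p)) \<oplus> (j \<cdot> snd P \<cdot> (\<I> ?b \<odot> q))"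
  have [simp]: "k \<in> Ar K" "Dom K k = ?b \<otimes> s" "Cod K k = s" by (simp_all add: k_def)
  have pk: "p \<cdot> k = snd N \<cdot> (\<I> ?b \<odot> p)" and qk: "q \<cdot> k = snd P \<cdot> (\<I> ?b \<odot> q)"
    by (simp_all add: k_def comp_add' bpD(14-17)[THEN reassoc])
  have "action B s k"
  proof -
    have 1: "u \<cdot> (k \<cdot> ext ?b ?b (mult B) s) = u \<cdot> (k \<cdot> (\<I> ?b \<odot> k))"
      if u [simp]: "u \<in> Ar K" "Dom K u = s" "Cod K u = fst M" and uk: "u \<cdot> k = snd M \<cdot> (\<I> ?b \<odot> u)" and M: "M \<in> modules K B" for u M
    proof -
      note [simp] = modulesD(1-4)[OF B M]
      have "u \<cdot> (k \<cdot> ext ?b ?b (mult B) s) = (snd M \<cdot> ext ?b ?b (mult B) (fst M)) \<cdot> (\<I> ?b \<odot> (\<I> ?b \<odot> u))"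
        by (simp add: uk[THEN reassoc] ext_nat_right)
      also have "\<dots> = snd M \<cdot> (\<I> ?b \<odot> (u \<cdot> k))"
        unfolding modulesD(5)[OF B M] uk by (simp add: merge)
      also have "\<dots> = u \<cdot> (k \<cdot> (\<I> ?b \<odot> k))" by (simp add: uk[THEN reassoc] merge)
      finally show ?thesis .
    qed
    have 2: "u \<cdot> (k \<cdot> uext (unit B) s) = u \<cdot> \<I> s"
      if u [simp]: "u \<in> Ar K" "Dom K u = s" "Cod K u = fst M" and uk: "u \<cdot> k = snd M \<cdot> (\<I> ?b \<odot> u)" and M: "M \<in> modules K B" for u M
    proof -
      note [simp] = modulesD(1-4)[OF B M]
      have "u \<cdot> (k \<cdot> uext (unit B) s) = (snd M \<cdot> uext (unit B) (fst M)) \<cdot> u"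
        by (simp add: uk[THEN reassoc] uext_nat)
      then show ?thesis unfolding modulesD(6)[OF B M] by simp
    qed
    have "k \<cdot> ext ?b ?b (mult B) s = k \<cdot> (\<I> ?b \<odot> k)"
      by (rule joint, rule 1[of p N], simp_all add: pk GN, rule 1[of q P, simplified], simp_all add: qk PM)
    moreover have "k \<cdot> uext (unit B) s = \<I> s"
      by (rule joint, rule 2[of p N], simp_all add: pk GN, rule 2[of q P, simplified], simp_all add: qk PM)
    ultimately show ?thesis by (simp add: action_def)
  qed
  then have S: "(s, k) \<in> modules K B" by (simp add: modules_iff[OF B])
  have mp: "mhom B (s, k) N p" and mq: "mhom B (s, k) P q" using S GN PM pk qk by (simp_all add: mhom_def)
  have mi: "mhom B N (s, k) i"
  proof -
    have "i \<cdot> snd N = k \<cdot> (\<I> ?b \<odot> i)"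
      by (rule joint) (simp_all add: pk[THEN reassoc] qk[THEN reassoc] merge bpD(14-17)[THEN reassoc])
    then show ?thesis using S GN by (simp add: mhom_def)
  qed
  have mj: "mhom B P (s, k) j"
  proof -
    have "j \<cdot> snd P = k \<cdot> (\<I> ?b \<odot> j)"
      by (rule joint) (simp_all add: pk[THEN reassoc] qk[THEN reassoc] merge bpD(14-17)[THEN reassoc])
    then show ?thesis using S PM by (simp add: mhom_def)
  qed
  have z: "mhom B P (susp_mod K B N) (Zero K ?y (\<Sigma> ?x))"
    using mhom_Zero[OF B PM susp_mod_modules[OF B GN(2)]] by simp
  have "(s, k) \<in> J"
    using mthickD(4)[OF J mi mq z biproduct_Tri[OF bp]] N P by simp
  moreover have "mret B G (s, k)"
  proof (rule mretI)
    show "mhom B G (s, k) ((i \<cdot> k1) \<oplus> (j \<cdot> k2))"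
      by (intro mhom_add[OF B] mhom_comp[OF B k1 mi] mhom_comp[OF B k2 mj])
    show "mhom B (s, k) G ((l1 \<cdot> p) \<oplus> (l2 \<cdot> q))"
      by (intro mhom_add[OF B] mhom_comp[OF B mp l1] mhom_comp[OF B mq l2])
    have "((l1 \<cdot> p) \<oplus> (l2 \<cdot> q)) \<cdot> ((i \<cdot> k1) \<oplus> (j \<cdot> k2)) = (l1 \<cdot> k1) \<oplus> (l2 \<cdot> k2)"
      by (simp add: comp_add' add_comp' bpD(14-17)[THEN reassoc])
    then show "((l1 \<cdot> p) \<oplus> (l2 \<cdot> q)) \<cdot> ((i \<cdot> k1) \<oplus> (j \<cdot> k2)) = \<I> (fst G)" unfolding s1 .
  qed
  ultimately show ?thesis using mthickD(5)[OF J] by blast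
qed

end

context symmetric_monoidal_category
begin

lemma assoc_uext:
  assumes [simp]: "x \<in> Ob K" "w \<in> Ob K" "n \<in> Ar K" "Dom K n = \<one>" and t: "Cod K n = t"
  shows "\<alpha> t x w \<cdot> (uext n x \<odot> \<I> w) = uext n (x \<otimes> w)"
proof -
  have [simp]: "t \<in> Ob K" using t by auto
  have "ext t x (\<I> (t \<otimes> x)) w \<cdot> uext n (x \<otimes> w) = (\<I> (t \<otimes> x) \<cdot> uext n x) \<odot> \<I> w"
    by (rule ext_uext) (simp_all add: t)
  then have "\<alpha> t x w \<cdot> (ai t x w \<cdot> uext n (x \<otimes> w)) = \<alpha> t x w \<cdot> (uext n x \<odot> \<I> w)"
    using t by (simp add: ext_def)
  then show ?thesis using t by simp
qed

end

section \<open>A step of the splitting tower\<close>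

text \<open>\<open>Q\<close> presents \<open>E = B \<otimes>\<^sub>A B\<close> and has the section
  \<open>S\<close>; \<open>l1\<close> and \<open>l2\<close> are the actions of \<open>B\<close> on
  the two factors of \<open>B \<otimes> B\<close>, and \<open>a1\<close>, \<open>a2\<close> their
  restrictions along \<open>t\<close>, which \<open>Q\<close> identifies.\<close>

locale ring_extension = tt_category K for K :: "('o, 'm) tt_data" (structure) +
  fixes A B :: "('o, 'm) ring_object" and t :: 'm
  assumes A: "tt_ring K A" and B: "tt_ring K B" and t: "ring_hom K A B t"
begin

abbreviation (input) "bt \<equiv> res_mod t (self_mod B)"
abbreviation (input) "Q \<equiv> self_quot K A t B"
abbreviation (input) "E \<equiv> Cod K (self_quot K A t B)"
abbreviation (input) "S \<equiv> tsec A (res_mod t (self_mod B)) (res_mod t (self_mod B))"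
abbreviation (input) "l1 \<equiv> ext (robj B) (robj B) (mult B) (robj B)"
abbreviation (input) "l2 \<equiv> lift (robj B) (robj B) (mult B) (robj B)"
abbreviation (input) "a1 \<equiv> ext (robj A) (robj B) (mult B \<cdot> (t \<odot> \<I> (robj B))) (robj B)"
abbreviation (input) "a2 \<equiv> lift (robj B) (robj A) (mult B \<cdot> (t \<odot> \<I> (robj B))) (robj B)"

lemma self_quot_eq: "Q = tensor_quot K A bt bt"
  by (simp add: self_quot_def restrict_mod_def res_mod_def)

lemma bt_modules: "bt \<in> modules K A"
  by (rule res_mod_modules[OF A B t self_mod_modules[OF B]])

lemma bt_simps [simp]: "fst bt = robj B" "snd bt = mult B \<cdot> (t \<odot> \<I> (robj B))"
  by (simp_all add: res_mod_def)

lemma base_simps [simp]: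
  "robj A \<in> Ob K" "robj B \<in> Ob K" "mult B \<in> Ar K" "Dom K (mult B) = robj B \<otimes> robj B" "Cod K (mult B) = robj B"
  "unit B \<in> Ar K" "Dom K (unit B) = \<one>" "Cod K (unit B) = robj B" "t \<in> Ar K" "Dom K t = robj A" "Cod K t = robj B"
  using tt_ringD[OF A] tt_ringD[OF B] ring_homD[OF t] by simp_all

lemma Q_simps [simp]:
  "Q \<in> Ar K" "Dom K Q = robj B \<otimes> robj B" "S \<in> Ar K" "Dom K S = E" "Cod K S = robj B \<otimes> robj B" "Q \<cdot> S = \<I> E"
  unfolding self_quot_eq using tensor_quot[OF A bt_modules bt_modules] by simp_all

lemma Q_balanced: "Q \<cdot> a1 = Q \<cdot> a2"
  unfolding self_quot_eq using tensor_quot(3)[OF A bt_modules bt_modules] by simp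

lemmas Q_epi = rq_epi[OF A B t self_mod_modules[OF B] bt_modules, folded self_quot_eq]
lemmas Q_epi_left = rq_epi_left[OF A B t self_mod_modules[OF B] bt_modules, folded self_quot_eq]
lemmas Q_epi_left2 = rq_epi_left2[OF A B t self_mod_modules[OF B] bt_modules, folded self_quot_eq]
lemmas Q_epi_left_right = rq_epi_left_right[OF A B t self_mod_modules[OF B] bt_modules, folded self_quot_eq]
lemmas Q_desc_left = tensor_quot_descend_left[OF A bt_modules bt_modules, folded self_quot_eq, unfolded bt_simps]
lemmas Q_desc_right = tensor_quot_descend_right[OF A bt_modules bt_modules, folded self_quot_eq, unfolded bt_simps]

lemma l1_t: "l1 \<cdot> (t \<odot> \<I> (robj B \<otimes> robj B)) = a1"
  by (simp add: ext_TenA)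

lemma l2_t: "l2 \<cdot> (t \<odot> \<I> (robj B \<otimes> robj B)) = a2"
  by (simp add: lift_TenA)

lemma l_action: "action B (robj B \<otimes> robj B) l1" "action B (robj B \<otimes> robj B) l2"
  by (rule action_ext[OF B action_self[OF B]], simp, rule action_lift[OF B action_self[OF B]], simp)

text \<open>The actions of \<open>B\<close> on \<open>E\<close> through its two factors:
  \<open>l1\<close> and \<open>l2\<close> commute with \<open>a1\<close> and \<open>a2\<close>, so
  they descend along \<open>Q\<close>, and \<open>S\<close> gives the formula.\<close>

definition "k1 = Q \<cdot> l1 \<cdot> (\<I> (robj B) \<odot> S)"
definition "k2 = Q \<cdot> l2 \<cdot> (\<I> (robj B) \<odot> S)"

lemma k_simps [simp]:
  "k1 \<in> Ar K" "Dom K k1 = robj B \<otimes> E" "Cod K k1 = E" "k2 \<in> Ar K" "Dom K k2 = robj B \<otimes> E" "Cod K k2 = E"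
  by (simp_all add: k1_def k2_def)

lemma k_Q_aux:
  assumes l: "l \<in> Ar K" "Dom K l = robj B \<otimes> (robj B \<otimes> robj B)" "Cod K l = robj B \<otimes> robj B"
    and c1: "commute (robj A) (robj B) (robj B \<otimes> robj B) a1 l" and c2: "commute (robj A) (robj B) (robj B \<otimes> robj B) a2 l"
  shows "Q \<cdot> l \<cdot> (\<I> (robj B) \<odot> S) \<cdot> (\<I> (robj B) \<odot> Q) = Q \<cdot> l"
proof -
  note [simp] = l
  let ?a = "robj A" let ?b = "robj B"
  have c1': "l \<cdot> (\<I> ?b \<odot> a1) = a1 \<cdot> (\<I> ?a \<odot> l) \<cdot> sw ?b ?a (?b \<otimes> ?b)"
    and c2': "l \<cdot> (\<I> ?b \<odot> a2) = a2 \<cdot> (\<I> ?a \<odot> l) \<cdot> sw ?b ?a (?b \<otimes> ?b)"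
    using commute_sym[OF c1] commute_sym[OF c2] by (simp_all add: commute_def)
  have "(Q \<cdot> l) \<cdot> (\<I> ?b \<odot> S) \<cdot> (\<I> ?b \<odot> Q) = Q \<cdot> l"
  proof (rule Q_desc_left)
    show "(Q \<cdot> l) \<cdot> (\<I> ?b \<odot> a1) = (Q \<cdot> l) \<cdot> (\<I> ?b \<odot> a2)"
      by (simp add: c1' c2' Q_balanced[THEN reassoc])
  qed simp_all
  then show ?thesis by simp
qed

lemma k_Q: "k1 \<cdot> (\<I> (robj B) \<odot> Q) = Q \<cdot> l1" "k2 \<cdot> (\<I> (robj B) \<odot> Q) = Q \<cdot> l2"
proof -
  let ?a = "robj A" let ?b = "robj B"
  have s1: "commute ?a ?b (?b \<otimes> ?b) (l1 \<cdot> (t \<odot> \<I> (?b \<otimes> ?b))) l1"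
    by (rule commute_restrict[OF commute_self[OF B l_action(1)]]) simp_all
  have s2: "commute ?a ?b (?b \<otimes> ?b) (l2 \<cdot> (t \<odot> \<I> (?b \<otimes> ?b))) l2"
    by (rule commute_restrict[OF commute_self[OF B l_action(2)]]) simp_all
  have x: "commute ?b ?a (?b \<otimes> ?b) l1 a2" by (rule commute_ext_lift) simp_all
  have x1: "commute ?a ?b (?b \<otimes> ?b) a2 l1" by (rule commute_sym[OF x]) simp_all
  have x2: "commute ?a ?b (?b \<otimes> ?b) a1 l2" by (rule commute_ext_lift) simp_all
  show "k1 \<cdot> (\<I> ?b \<odot> Q) = Q \<cdot> l1"
    using k_Q_aux[OF _ _ _ s1[unfolded l1_t] x1] by (simp add: k1_def)
  show "k2 \<cdot> (\<I> ?b \<odot> Q) = Q \<cdot> l2"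
    using k_Q_aux[OF _ _ _ x2 s2[unfolded l2_t]] by (simp add: k2_def)
qed

lemma k_Q_TenA:
  assumes [simp]: "g \<in> Ar K" "Cod K g = robj B"
  shows "k1 \<cdot> (g \<odot> Q) = Q \<cdot> l1 \<cdot> (g \<odot> \<I> (robj B \<otimes> robj B))" "k2 \<cdot> (g \<odot> Q) = Q \<cdot> l2 \<cdot> (g \<odot> \<I> (robj B \<otimes> robj B))"
    "f \<in> Ar K \<Longrightarrow> Cod K f = robj B \<otimes> robj B \<Longrightarrow> k1 \<cdot> (g \<odot> (Q \<cdot> f)) = Q \<cdot> l1 \<cdot> (g \<odot> f)"
    "f \<in> Ar K \<Longrightarrow> Cod K f = robj B \<otimes> robj B \<Longrightarrow> k2 \<cdot> (g \<odot> (Q \<cdot> f)) = Q \<cdot> l2 \<cdot> (g \<odot> f)"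
proof -
  have 1: "k \<cdot> (g \<odot> (Q \<cdot> f)) = (k \<cdot> (\<I> (robj B) \<odot> Q)) \<cdot> (g \<odot> f)"
    if "k \<in> Ar K" "Dom K k = robj B \<otimes> E" "f \<in> Ar K" "Cod K f = robj B \<otimes> robj B" for k f
    using that by (simp add: merge)
  have 2: "k \<cdot> (g \<odot> Q) = (k \<cdot> (\<I> (robj B) \<odot> Q)) \<cdot> (g \<odot> \<I> (robj B \<otimes> robj B))"
    if "k \<in> Ar K" "Dom K k = robj B \<otimes> E" for k
    using that by (simp add: merge)
  show "k1 \<cdot> (g \<odot> Q) = Q \<cdot> l1 \<cdot> (g \<odot> \<I> (robj B \<otimes> robj B))"
    using 2[of k1] unfolding k_Q by simp
  show "k2 \<cdot> (g \<odot> Q) = Q \<cdot> l2 \<cdot> (g \<odot> \<I> (robj B \<otimes> robj B))"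
    using 2[of k2] unfolding k_Q by simp
  show "k1 \<cdot> (g \<odot> (Q \<cdot> f)) = Q \<cdot> l1 \<cdot> (g \<odot> f)" if "f \<in> Ar K" "Cod K f = robj B \<otimes> robj B"
    using 1[of k1 f] that unfolding k_Q by simp
  show "k2 \<cdot> (g \<odot> (Q \<cdot> f)) = Q \<cdot> l2 \<cdot> (g \<odot> f)" if "f \<in> Ar K" "Cod K f = robj B \<otimes> robj B"
    using 1[of k2 f] that unfolding k_Q by simp
qed

lemmas k_merge = merge k_Q_TenA k_Q_TenA[THEN reassoc]

lemma k_t: "k1 \<cdot> (t \<odot> \<I> E) = k2 \<cdot> (t \<odot> \<I> E)"
proof (rule Q_epi_left)
  have "(k1 \<cdot> (t \<odot> \<I> E)) \<cdot> (\<I> (robj A) \<odot> Q) = (k1 \<cdot> (\<I> (robj B) \<odot> Q)) \<cdot> (t \<odot> \<I> (robj B \<otimes> robj B))"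
    by (simp add: merge)
  also have "\<dots> = Q \<cdot> a1" unfolding k_Q using l1_t by simp
  also have "\<dots> = Q \<cdot> a2" by (rule Q_balanced)
  also have "\<dots> = (k2 \<cdot> (\<I> (robj B) \<odot> Q)) \<cdot> (t \<odot> \<I> (robj B \<otimes> robj B))" unfolding k_Q using l2_t by simp
  also have "\<dots> = (k2 \<cdot> (t \<odot> \<I> E)) \<cdot> (\<I> (robj A) \<odot> Q)" by (simp add: merge)
  finally show "(k1 \<cdot> (t \<odot> \<I> E)) \<cdot> (\<I> (robj A) \<odot> Q) = (k2 \<cdot> (t \<odot> \<I> E)) \<cdot> (\<I> (robj A) \<odot> Q)" .
qed simp_all

lemma k_unit: "k1 \<cdot> uext (unit B) E = \<I> E" "k2 \<cdot> uext (unit B) E = \<I> E"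
proof -
  have "k \<cdot> uext (unit B) E = \<I> E" if [simp]: "k \<in> Ar K" "Dom K k = robj B \<otimes> E" "Cod K k = E"
    and kQ: "k \<cdot> (\<I> (robj B) \<odot> Q) = Q \<cdot> l" and l: "action B (robj B \<otimes> robj B) l" for k l
  proof (rule Q_epi)
    note [simp] = actionD(1-4)[OF l]
    have "(k \<cdot> uext (unit B) E) \<cdot> Q = (k \<cdot> (\<I> (robj B) \<odot> Q)) \<cdot> uext (unit B) (robj B \<otimes> robj B)"
      by (simp add: uext_nat)
    then show "(k \<cdot> uext (unit B) E) \<cdot> Q = \<I> E \<cdot> Q"
      unfolding kQ by (simp add: actionD(6)[OF l])
  qed simp_all
  from this[OF k_simps(1-3) k_Q(1) l_action(1)] this[OF k_simps(4-6) k_Q(2) l_action(2)]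
  show "k1 \<cdot> uext (unit B) E = \<I> E" "k2 \<cdot> uext (unit B) E = \<I> E" .
qed

lemma k1_action: "k1 \<cdot> ext (robj B) (robj B) (mult B) E = k1 \<cdot> (\<I> (robj B) \<odot> k1)"
proof (rule Q_epi_left2)
  let ?b = "robj B"
  have "(k1 \<cdot> ext ?b ?b (mult B) E) \<cdot> (\<I> ?b \<odot> (\<I> ?b \<odot> Q)) = k1 \<cdot> (\<I> ?b \<odot> Q) \<cdot> ext ?b ?b (mult B) (?b \<otimes> ?b)"
    by (simp add: ext_nat_right)
  also have "\<dots> = Q \<cdot> (l1 \<cdot> ext ?b ?b (mult B) (?b \<otimes> ?b))" by (simp add: k_Q[THEN reassoc])
  also have "\<dots> = (k1 \<cdot> (\<I> ?b \<odot> k1)) \<cdot> (\<I> ?b \<odot> (\<I> ?b \<odot> Q))"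
    unfolding actionD(5)[OF l_action(1)] by (simp add: k_merge)
  finally show "(k1 \<cdot> ext ?b ?b (mult B) E) \<cdot> (\<I> ?b \<odot> (\<I> ?b \<odot> Q)) = (k1 \<cdot> (\<I> ?b \<odot> k1)) \<cdot> (\<I> ?b \<odot> (\<I> ?b \<odot> Q))" .
qed simp_all

abbreviation (input) "mE \<equiv> mult (self_tensor_ring K A t B)"
abbreviation (input) "uE \<equiv> unit (self_tensor_ring K A t B)"

lemma robj_E: "robj (self_tensor_ring K A t B) = E"
  by (simp add: self_tensor_ring_def Let_def)

text \<open>The multiplication of \<open>B \<otimes>\<^sub>A B\<close> is \<open>(x \<otimes> y) \<cdot> e = x \<cdot>\<^sub>1 (y \<cdot>\<^sub>2 e)\<close> for the two actions of \<open>B\<close>.\<close>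

lemma mE: "mE \<in> Ar K" "Dom K mE = E \<otimes> E" "Cod K mE = E"
  "mE \<cdot> (Q \<odot> \<I> E) = k1 \<cdot> (\<I> (robj B) \<odot> k2) \<cdot> \<alpha> (robj B) (robj B) E"
proof -
  let ?a = "robj A" let ?b = "robj B" let ?m = "mult B"
  define F where "F = k1 \<cdot> (\<I> ?b \<odot> k2) \<cdot> \<alpha> ?b ?b E"
  have [simp]: "F \<in> Ar K" "Dom K F = (?b \<otimes> ?b) \<otimes> E" "Cod K F = E" by (simp_all add: F_def)
  define h where "h = Q \<cdot> (?m \<odot> ?m) \<cdot> interchange K ?b ?b ?b ?b"
  have [simp]: "h \<in> Ar K" "Dom K h = (?b \<otimes> ?b) \<otimes> (?b \<otimes> ?b)" "Cod K h = E" by (simp_all add: h_def interchange_def merge)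
  have ic: "interchange K ?b ?b ?b ?b = ai ?b ?b (?b \<otimes> ?b) \<cdot> (\<I> ?b \<odot> sw ?b ?b ?b) \<cdot> \<alpha> ?b ?b (?b \<otimes> ?b)"
    by (simp add: interchange_def sw_def)
  have mm: "(?m \<odot> ?m) \<cdot> ai ?b ?b (?b \<otimes> ?b) = l1 \<cdot> (\<I> ?b \<odot> (\<I> ?b \<odot> ?m))"
    by (simp add: ext_nat_right) (simp add: ext_def merge)
  have h: "h = F \<cdot> (\<I> (?b \<otimes> ?b) \<odot> Q)"
  proof -
    have aQ: "\<alpha> ?b ?b E \<cdot> (\<I> (?b \<otimes> ?b) \<odot> Q) = (\<I> ?b \<odot> (\<I> ?b \<odot> Q)) \<cdot> \<alpha> ?b ?b (?b \<otimes> ?b)"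
      using assoc_nat[of "\<I> ?b" "\<I> ?b" Q ?b ?b E] by simp
    have "F \<cdot> (\<I> (?b \<otimes> ?b) \<odot> Q) = k1 \<cdot> (\<I> ?b \<odot> (k2 \<cdot> (\<I> ?b \<odot> Q))) \<cdot> \<alpha> ?b ?b (?b \<otimes> ?b)"
      by (simp add: F_def aQ merge)
    also have "\<dots> = (k1 \<cdot> (\<I> ?b \<odot> Q)) \<cdot> (\<I> ?b \<odot> l2) \<cdot> \<alpha> ?b ?b (?b \<otimes> ?b)"
      unfolding k_Q(2) by (simp add: merge)
    also have "\<dots> = Q \<cdot> l1 \<cdot> (\<I> ?b \<odot> l2) \<cdot> \<alpha> ?b ?b (?b \<otimes> ?b)" unfolding k_Q(1) by simp
    also have "\<I> ?b \<odot> l2 = (\<I> ?b \<odot> (\<I> ?b \<odot> ?m)) \<cdot> (\<I> ?b \<odot> sw ?b ?b ?b)"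
      by (simp add: lift_def merge)
    finally show ?thesis by (simp add: h_def ic mm[THEN reassoc])
  qed
  \<comment> \<open>\<open>F\<close> is balanced over \<open>A\<close> in its first argument: a
    scalar acting through \<open>k1\<close> may act through \<open>k2\<close> instead, by
    \<open>k_t\<close>.\<close>
  have A1: "F \<cdot> ext ?a (?b \<otimes> ?b) a1 E = F \<cdot> ext ?a (?b \<otimes> ?b) a2 E"
  proof -
    let ?mt = "?m \<cdot> (t \<odot> \<I> ?b)"
    have e1: "ext ?a ?b ?mt E = ext ?b ?b ?m E \<cdot> (t \<odot> \<I> (?b \<otimes> E))" by (simp add: ext_TenA)
    have x1: "k1 \<cdot> ext ?a ?b ?mt E = k1 \<cdot> (t \<odot> \<I> E) \<cdot> (\<I> ?a \<odot> k1)"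
    proof -
      have "k1 \<cdot> ext ?a ?b ?mt E = (k1 \<cdot> ext ?b ?b ?m E) \<cdot> (t \<odot> \<I> (?b \<otimes> E))" by (simp add: e1)
      then show ?thesis unfolding k1_action by (simp add: merge)
    qed
    have x2: "k2 \<cdot> ext ?a ?b ?mt E = k2 \<cdot> (t \<odot> \<I> E) \<cdot> (\<I> ?a \<odot> k2)"
    proof (rule Q_epi_left2)
      have "(k2 \<cdot> ext ?a ?b ?mt E) \<cdot> (\<I> ?a \<odot> (\<I> ?b \<odot> Q)) = (k2 \<cdot> (\<I> ?b \<odot> Q)) \<cdot> ext ?a ?b ?mt (?b \<otimes> ?b)"
        by (simp add: ext_nat_right)
      also have "\<dots> = Q \<cdot> (l2 \<cdot> ext ?b ?b ?m (?b \<otimes> ?b)) \<cdot> (t \<odot> \<I> (?b \<otimes> (?b \<otimes> ?b)))"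
        unfolding k_Q by (simp add: ext_TenA)
      also have "\<dots> = (k2 \<cdot> (t \<odot> \<I> E) \<cdot> (\<I> ?a \<odot> k2)) \<cdot> (\<I> ?a \<odot> (\<I> ?b \<odot> Q))"
        unfolding actionD(5)[OF l_action(2)] by (simp add: k_merge)
      finally show "(k2 \<cdot> ext ?a ?b ?mt E) \<cdot> (\<I> ?a \<odot> (\<I> ?b \<odot> Q)) = (k2 \<cdot> (t \<odot> \<I> E) \<cdot> (\<I> ?a \<odot> k2)) \<cdot> (\<I> ?a \<odot> (\<I> ?b \<odot> Q))" .
    qed simp_all
    have "commute ?a ?b E (k1 \<cdot> (t \<odot> \<I> E)) k1"
    proof -
      have "commute ?b ?b E k1 k1"
        by (rule commute_self[OF B]) (simp add: action_def k1_action k_unit)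
      then show ?thesis by (rule commute_restrict) simp_all
    qed
    then have c: "k1 \<cdot> (\<I> ?b \<odot> (k2 \<cdot> (t \<odot> \<I> E))) \<cdot> sw ?a ?b E = k1 \<cdot> (t \<odot> \<I> E) \<cdot> (\<I> ?a \<odot> k1)"
      unfolding k_t[symmetric] by (simp add: commute_def)
    have "F \<cdot> ext ?a (?b \<otimes> ?b) a1 E = k1 \<cdot> (\<I> ?b \<odot> k2) \<cdot> ext ?a ?b ?mt (?b \<otimes> E) \<cdot> (\<I> ?a \<odot> \<alpha> ?b ?b E)"
      by (simp add: F_def assoc_ext)
    also have "\<dots> = (k1 \<cdot> ext ?a ?b ?mt E) \<cdot> (\<I> ?a \<odot> (\<I> ?b \<odot> k2)) \<cdot> (\<I> ?a \<odot> \<alpha> ?b ?b E)"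
      by (simp add: ext_nat_right[THEN reassoc])
    also have "\<dots> = (k1 \<cdot> (\<I> ?b \<odot> (k2 \<cdot> (t \<odot> \<I> E))) \<cdot> sw ?a ?b E) \<cdot> (\<I> ?a \<odot> (\<I> ?b \<odot> k2)) \<cdot> (\<I> ?a \<odot> \<alpha> ?b ?b E)"
      unfolding x1 c by simp
    also have "\<dots> = k1 \<cdot> (\<I> ?b \<odot> (k2 \<cdot> (t \<odot> \<I> E) \<cdot> (\<I> ?a \<odot> k2))) \<cdot> sw ?a ?b (?b \<otimes> E) \<cdot> (\<I> ?a \<odot> \<alpha> ?b ?b E)"
      by (simp add: sw_nat[THEN reassoc]) (simp add: merge)
    also have "\<dots> = k1 \<cdot> (\<I> ?b \<odot> k2) \<cdot> lift ?b ?a (ext ?a ?b ?mt E) (?b \<otimes> E) \<cdot> (\<I> ?a \<odot> \<alpha> ?b ?b E)"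
      unfolding x2[symmetric] by (simp add: lift_def merge)
    also have "\<dots> = F \<cdot> ext ?a (?b \<otimes> ?b) a2 E"
      by (simp add: F_def assoc_ext_lift)
    finally show ?thesis .
  qed
  have FS: "F \<cdot> (S \<odot> \<I> E) \<cdot> (Q \<odot> \<I> E) = F"
  proof (rule Q_desc_right)
    have e: "l \<odot> \<I> E = ext ?a (?b \<otimes> ?b) l E \<cdot> \<alpha> ?a (?b \<otimes> ?b) E"
      if "l \<in> Ar K" "Dom K l = ?a \<otimes> (?b \<otimes> ?b)" for l using that by (simp add: ext_def)
    show "F \<cdot> (a1 \<odot> \<I> E) = F \<cdot> (a2 \<odot> \<I> E)"
      by (simp add: e A1[THEN reassoc])
  qed simp_all
  have hF: "h = F \<cdot> (S \<odot> \<I> E) \<cdot> (Q \<odot> Q)"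
  proof -
    have "h = (F \<cdot> (S \<odot> \<I> E) \<cdot> (Q \<odot> \<I> E)) \<cdot> (\<I> (?b \<otimes> ?b) \<odot> Q)" unfolding FS by (rule h)
    then show ?thesis by (simp add: merge)
  qed
  have "induced K (Q \<odot> Q) h = h \<cdot> (S \<odot> S)"
  proof (rule induced_eq)
    have QSQ: "Q \<cdot> S \<cdot> Q = Q" using Q_simps(6)[THEN reassoc, of Q] by simp
    show "h \<cdot> (S \<odot> S) \<cdot> (Q \<odot> Q) = h" by (simp add: hF merge QSQ)
  qed (simp_all add: merge)
  also have "\<dots> = F \<cdot> (S \<odot> \<I> E)" by (simp add: hF merge)
  finally have m: "mE = F \<cdot> (S \<odot> \<I> E)"
    by (simp add: self_tensor_ring_def Let_def h_def)
  show "mE \<in> Ar K" "Dom K mE = E \<otimes> E" "Cod K mE = E" by (simp_all add: m)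
  show "mE \<cdot> (Q \<odot> \<I> E) = k1 \<cdot> (\<I> ?b \<odot> k2) \<cdot> \<alpha> ?b ?b E"
    using FS unfolding m F_def by simp
qed

text \<open>The maps \<open>b \<mapsto> b \<otimes> 1\<close> and
  \<open>b \<mapsto> 1 \<otimes> b\<close> into \<open>E\<close>. By \<open>i1_eq\<close>,
  \<open>i1\<close> is the arrow \<open>1 \<otimes> \<eta>\<close> in the definition of the
  tower.\<close>

definition "i1 = Q \<cdot> \<gamma> (robj B) (robj B) \<cdot> uext (unit B) (robj B)"
definition "i2 = Q \<cdot> uext (unit B) (robj B)"

lemma i_simps [simp]: "i1 \<in> Ar K" "Dom K i1 = robj B" "Cod K i1 = E" "i2 \<in> Ar K" "Dom K i2 = robj B" "Cod K i2 = E"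
  by (simp_all add: i1_def i2_def)

lemma inv_runit_eq:
  assumes [simp]: "x \<in> Ob K"
  shows "inv_arrow K (\<rho>\<rho> x) = \<gamma> \<one> x \<cdot> inv_arrow K (\<lambda>\<lambda> x)"
  by (rule inv_arrow_eq[of _ "x \<otimes> \<one>" x])
    (simp_all add: lunit_braid[symmetric] flip: lunit_braid)

lemma i1_eq: "Q \<cdot> (\<I> (robj B) \<odot> unit B) \<cdot> inv_arrow K (\<rho>\<rho> (robj B)) = i1"
proof -
  have "(\<I> (robj B) \<odot> unit B) \<cdot> \<gamma> \<one> (robj B) = \<gamma> (robj B) (robj B) \<cdot> (unit B \<odot> \<I> (robj B))"
    by (simp add: braid_nat)
  from this[THEN reassoc, of "inv_arrow K (\<lambda>\<lambda> (robj B))"] show ?thesis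
    by (simp add: i1_def uext_def inv_runit_eq)
qed

lemma mE_i: "mE \<cdot> (i1 \<odot> \<I> E) = k1" "mE \<cdot> (i2 \<odot> \<I> E) = k2"
proof -
  let ?b = "robj B" let ?u = "uext (unit B)"
  note [simp] = mE(1-3)
  have g: "\<alpha> ?b ?b E \<cdot> (\<gamma> ?b ?b \<odot> \<I> E) = sw ?b ?b E \<cdot> \<alpha> ?b ?b E" by (simp add: sw_def)
  have "mE \<cdot> (i1 \<odot> \<I> E) = (mE \<cdot> (Q \<odot> \<I> E)) \<cdot> (\<gamma> ?b ?b \<odot> \<I> E) \<cdot> (?u ?b \<odot> \<I> E)"
    by (simp add: i1_def merge)
  also have "\<dots> = k1 \<cdot> (\<I> ?b \<odot> k2) \<cdot> sw ?b ?b E \<cdot> ?u (?b \<otimes> E)"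
    unfolding mE(4) by (simp add: g[THEN reassoc] assoc_uext)
  also have "\<dots> = k1 \<cdot> (\<I> ?b \<odot> (k2 \<cdot> ?u E))" by (simp add: uext_sw merge)
  finally show "mE \<cdot> (i1 \<odot> \<I> E) = k1" by (simp add: k_unit)
  have "mE \<cdot> (i2 \<odot> \<I> E) = (mE \<cdot> (Q \<odot> \<I> E)) \<cdot> (?u ?b \<odot> \<I> E)"
    by (simp add: i2_def merge)
  also have "\<dots> = k1 \<cdot> (\<I> ?b \<odot> k2) \<cdot> ?u (?b \<otimes> E)"
    unfolding mE(4) by (simp add: assoc_uext)
  also have "\<dots> = (k1 \<cdot> ?u E) \<cdot> k2" by (simp add: uext_nat)
  finally show "mE \<cdot> (i2 \<odot> \<I> E) = k2" by (simp add: k_unit)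
qed

lemma k_i: "k1 \<cdot> (\<I> (robj B) \<odot> i1) = i1 \<cdot> mult B" "k2 \<cdot> (\<I> (robj B) \<odot> i2) = i2 \<cdot> mult B"
proof -
  let ?b = "robj B" let ?u = "uext (unit B)"
  have b: "l1 \<cdot> (\<I> ?b \<odot> \<gamma> ?b ?b) = \<gamma> ?b ?b \<cdot> l2" by (simp add: braid_lift)
  have l: "l2 \<cdot> (\<I> ?b \<odot> ?u ?b) = ?u ?b \<cdot> mult B"
    by (simp add: lift_def sw_uext uext_nat)
  have "k1 \<cdot> (\<I> ?b \<odot> i1) = (k1 \<cdot> (\<I> ?b \<odot> Q)) \<cdot> (\<I> ?b \<odot> \<gamma> ?b ?b) \<cdot> (\<I> ?b \<odot> ?u ?b)"
    by (simp add: i1_def merge)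
  also have "\<dots> = i1 \<cdot> mult B" unfolding k_Q by (simp add: b[THEN reassoc] l i1_def)
  finally show "k1 \<cdot> (\<I> ?b \<odot> i1) = i1 \<cdot> mult B" .
  have "k2 \<cdot> (\<I> ?b \<odot> i2) = (k2 \<cdot> (\<I> ?b \<odot> Q)) \<cdot> (\<I> ?b \<odot> ?u ?b)"
    by (simp add: i2_def merge)
  also have "\<dots> = i2 \<cdot> mult B" unfolding k_Q by (simp add: l i2_def)
  finally show "k2 \<cdot> (\<I> ?b \<odot> i2) = i2 \<cdot> mult B" .
qed

lemma i_mult: "i1 \<cdot> mult B = mE \<cdot> (i1 \<odot> i1)" "i2 \<cdot> mult B = mE \<cdot> (i2 \<odot> i2)"
proof -
  note [simp] = mE(1-3)
  have "mE \<cdot> (i \<odot> i) = (mE \<cdot> (i \<odot> \<I> E)) \<cdot> (\<I> (robj B) \<odot> i)" if "i \<in> Ar K" "Dom K i = robj B" "Cod K i = E" for i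
    using that by (simp add: merge)
  from this[of i1] this[of i2] show "i1 \<cdot> mult B = mE \<cdot> (i1 \<odot> i1)" "i2 \<cdot> mult B = mE \<cdot> (i2 \<odot> i2)"
    unfolding mE_i k_i by simp_all
qed

lemma uE: "uE \<in> Ar K" "Dom K uE = \<one>" "Cod K uE = E" "i1 \<cdot> unit B = uE" "i2 \<cdot> unit B = uE"
proof -
  let ?b = "robj B"
  have u: "uE = Q \<cdot> (unit B \<odot> unit B) \<cdot> inv_arrow K (\<lambda>\<lambda> \<one>)"
    by (simp add: self_tensor_ring_def Let_def)
  show "uE \<in> Ar K" "Dom K uE = \<one>" "Cod K uE = E" by (simp_all add: u)
  show 2: "i2 \<cdot> unit B = uE"
    by (simp add: u i2_def uext_nat) (simp add: uext_def merge)
  have "inv_arrow K (\<lambda>\<lambda> \<one>) = \<gamma> \<one> \<one> \<cdot> inv_arrow K (\<lambda>\<lambda> \<one>)"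
    using inv_runit_eq[of \<one>] by (simp flip: lunit_eq_runit)
  then have g: "\<gamma> ?b ?b \<cdot> (unit B \<odot> unit B) \<cdot> inv_arrow K (\<lambda>\<lambda> \<one>) = (unit B \<odot> unit B) \<cdot> inv_arrow K (\<lambda>\<lambda> \<one>)"
    by (simp add: braid_nat[THEN reassoc])
  have "i1 \<cdot> unit B = Q \<cdot> (\<gamma> ?b ?b \<cdot> (unit B \<odot> unit B) \<cdot> inv_arrow K (\<lambda>\<lambda> \<one>))"
    by (simp add: i1_def uext_nat) (simp add: uext_def merge)
  then show "i1 \<cdot> unit B = uE" unfolding g u .
qed

text \<open>By \<open>k_i\<close> and \<open>uE\<close>, \<open>i1\<close> and \<open>i2\<close> are
  obtained by letting \<open>B\<close> act on the unit of \<open>E\<close> through \<open>k1\<close>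
  and \<open>k2\<close>, and these actions agree on \<open>A\<close> by \<open>k_t\<close>.\<close>

lemma i_t: "i1 \<cdot> t = i2 \<cdot> t"
proof -
  let ?b = "robj B" let ?a = "robj A"
  note [simp] = uE(1-3)
  have ru: "mult B \<cdot> (\<I> ?b \<odot> unit B) = \<rho>\<rho> ?b"
    using B by (simp add: tt_ring_def is_ring_def)
  have e: "k \<cdot> (\<I> ?b \<odot> uE) = i \<cdot> \<rho>\<rho> ?b"
    if "k \<cdot> (\<I> ?b \<odot> i) = i \<cdot> mult B" "i \<cdot> unit B = uE" "i \<in> Ar K" "Dom K i = ?b" "Cod K i = E"
      "k \<in> Ar K" "Dom K k = ?b \<otimes> E" "Cod K k = E" for k i
  proof -
    have "k \<cdot> (\<I> ?b \<odot> uE) = (k \<cdot> (\<I> ?b \<odot> i)) \<cdot> (\<I> ?b \<odot> unit B)"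
      using that(3-) by (simp add: merge flip: that(2))
    then show ?thesis unfolding that(1) using that(3-) by (simp add: ru)
  qed
  have 1: "k1 \<cdot> (\<I> ?b \<odot> uE) = i1 \<cdot> \<rho>\<rho> ?b" by (rule e) (simp_all add: k_i uE)
  have 2: "k2 \<cdot> (\<I> ?b \<odot> uE) = i2 \<cdot> \<rho>\<rho> ?b" by (rule e) (simp_all add: k_i uE)
  have "(i1 \<cdot> t) \<cdot> \<rho>\<rho> ?a = (i1 \<cdot> \<rho>\<rho> ?b) \<cdot> (t \<odot> \<I> \<one>)" by (simp add: runit_nat)
  also have "\<dots> = (k1 \<cdot> (t \<odot> \<I> E)) \<cdot> (\<I> ?a \<odot> uE)" unfolding 1[symmetric] by (simp add: merge)
  also have "\<dots> = (i2 \<cdot> \<rho>\<rho> ?b) \<cdot> (t \<odot> \<I> \<one>)" unfolding k_t 2[symmetric] by (simp add: merge)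
  also have "\<dots> = (i2 \<cdot> t) \<cdot> \<rho>\<rho> ?a" by (simp add: runit_nat)
  finally show ?thesis by (rule iso_cancel_right[rotated]) simp_all
qed

lemma mult_Q: "induced K Q (mult B) \<cdot> Q = mult B" "induced K Q (mult B) \<in> Hom E (robj B)"
proof -
  let ?b = "robj B" let ?a = "robj A" let ?mt = "mult B \<cdot> (t \<odot> \<I> ?b)"
  have s: "commute ?b ?b ?b (mult B) (mult B)" by (rule commute_self[OF B action_self[OF B]])
  have "commute ?a ?b ?b ?mt (mult B)" by (rule commute_restrict[OF s]) simp_all
  then have c: "mult B \<cdot> (\<I> ?b \<odot> ?mt) \<cdot> sw ?a ?b ?b = ?mt \<cdot> (\<I> ?a \<odot> mult B)"
    using commute_sym[of ?a ?b ?b ?mt "mult B"] by (simp add: commute_def)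
  have "mult B \<cdot> a1 = (mult B \<cdot> ext ?b ?b (mult B) ?b) \<cdot> (t \<odot> \<I> (?b \<otimes> ?b))" by (simp add: ext_TenA)
  also have "\<dots> = ?mt \<cdot> (\<I> ?a \<odot> mult B)" unfolding tt_ring_eqs(3)[OF B] by (simp add: merge)
  also have "\<dots> = mult B \<cdot> a2" using c by (simp add: lift_def)
  finally have "mult B \<cdot> a1 = mult B \<cdot> a2" .
  then have d: "mult B \<cdot> S \<cdot> Q = mult B"
    using tensor_quot_descend[OF A bt_modules bt_modules, of "mult B"] by (simp flip: self_quot_eq)
  have "induced K Q (mult B) = mult B \<cdot> S"
    by (rule induced_eq) (simp_all add: d)
  then show "induced K Q (mult B) \<cdot> Q = mult B" "induced K Q (mult B) \<in> Hom E ?b" using d by simp_all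
qed

section \<open>The decomposition of \<open>B \<otimes>\<^sub>A N\<close>\<close>

context
  fixes N
  assumes N: "N \<in> modules K B"
begin

abbreviation (input) "rt \<equiv> res_mod t N"
abbreviation (input) "G \<equiv> rten B A t (self_mod B) (res_mod t N)"
abbreviation (input) "qG \<equiv> tensor_quot K A (res_mod t (self_mod B)) (res_mod t N)"
abbreviation (input) "y \<equiv> fst N"
abbreviation (input) "r \<equiv> snd N"
abbreviation (input) "R \<equiv> lift (robj B) (robj B) (snd N) (fst N)"

lemma rt_modules: "rt \<in> modules K A"
  by (rule res_mod_modules[OF A B t N])

lemmas qG = rq[OF A B t self_mod_modules[OF B] rt_modules, simplified]
lemmas fst_G = rten_fst[OF A B t self_mod_modules[OF B] rt_modules]
lemmas snd_G = rten_snd[OF A B t self_mod_modules[OF B] rt_modules, simplified]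
lemmas G_modules = rten_modules[OF A B t self_mod_modules[OF B] rt_modules]
lemmas N_simps = modulesD(1-4)[OF B N]
lemmas G_univ = rten_univ[OF A B t self_mod_modules[OF B] rt_modules, simplified]

lemma action_N: "action B y r"
  using N modules_iff[OF B] by simp

lemma snd_rt: "snd rt = r \<cdot> (t \<odot> \<I> y)"
  by (simp add: res_mod_def)

lemma action_R: "action B (robj B \<otimes> y) R"
  by (rule action_lift[OF B action_N]) simp

lemma qG_balanced: "qG \<cdot> ext (robj A) (robj B) (mult B \<cdot> (t \<odot> \<I> (robj B))) y = qG \<cdot> R \<cdot> (t \<odot> \<I> (robj B \<otimes> y))"
  using qG(3) N_simps by (simp add: snd_rt lift_TenA)

text \<open>The arrow \<open>(B \<otimes>\<^sub>A B) \<otimes> N \<rightarrow> B \<otimes>\<^sub>A N\<close> given by \<open>(b \<otimes> b') \<otimes> n \<mapsto> b' \<otimes> b n\<close>.\<close>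

definition "eps = qG \<cdot> R \<cdot> \<alpha> (robj B) (robj B) y \<cdot> (S \<odot> \<I> y)"

lemma eps_simps [simp]: "eps \<in> Ar K" "Dom K eps = E \<otimes> y" "Cod K eps = Cod K qG"
  using N_simps qG(1,2) by (simp_all add: eps_def)

text \<open>\<open>b' \<otimes> b n\<close> is balanced in \<open>b\<close> and \<open>b'\<close>
  over \<open>A\<close>: a scalar on \<open>b\<close> ends up on \<open>n\<close>, a scalar on
  \<open>b'\<close> stays on the left factor, and \<open>B \<otimes>\<^sub>A N\<close> identifies
  the two.\<close>

lemma eps_Q: "eps \<cdot> (Q \<odot> \<I> y) = qG \<cdot> R \<cdot> \<alpha> (robj B) (robj B) y"
proof -
  let ?a = "robj A" let ?b = "robj B" let ?mt = "mult B \<cdot> (t \<odot> \<I> ?b)"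
  note [simp] = N_simps qG(1,2)
  have c: "R \<cdot> (\<I> ?b \<odot> ext ?a ?b ?mt y) \<cdot> sw ?a ?b (?b \<otimes> y) = ext ?a ?b ?mt y \<cdot> (\<I> ?a \<odot> R)"
    using commute_ext_lift[of ?a ?b ?b y ?mt r] by (simp add: commute_def)
  have "(qG \<cdot> R) \<cdot> ext ?a ?b ?mt (?b \<otimes> y) = qG \<cdot> (R \<cdot> ext ?b ?b (mult B) (?b \<otimes> y)) \<cdot> (t \<odot> \<I> (?b \<otimes> (?b \<otimes> y)))"
    by (simp add: ext_TenA)
  also have "\<dots> = (qG \<cdot> R \<cdot> (t \<odot> \<I> (?b \<otimes> y))) \<cdot> (\<I> ?a \<odot> R)"
    unfolding actionD(5)[OF action_R] by (simp add: merge)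
  also have "\<dots> = qG \<cdot> (ext ?a ?b ?mt y \<cdot> (\<I> ?a \<odot> R))" unfolding qG_balanced[symmetric] by simp
  also have "\<dots> = (qG \<cdot> R) \<cdot> lift ?b ?a (ext ?a ?b ?mt y) (?b \<otimes> y)" unfolding c[symmetric] by (simp add: lift_def)
  finally have b: "(qG \<cdot> R) \<cdot> ext ?a ?b ?mt (?b \<otimes> y) = (qG \<cdot> R) \<cdot> lift ?b ?a (ext ?a ?b ?mt y) (?b \<otimes> y)" .
  have e: "l \<odot> \<I> y = ext ?a (?b \<otimes> ?b) l y \<cdot> \<alpha> ?a (?b \<otimes> ?b) y"
    if "l \<in> Ar K" "Dom K l = ?a \<otimes> (?b \<otimes> ?b)" for l using that by (simp add: ext_def)
  have "(qG \<cdot> R \<cdot> \<alpha> ?b ?b y) \<cdot> (S \<odot> \<I> y) \<cdot> (Q \<odot> \<I> y) = qG \<cdot> R \<cdot> \<alpha> ?b ?b y"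
  proof (rule Q_desc_right)
    have "(qG \<cdot> R \<cdot> \<alpha> ?b ?b y) \<cdot> (a1 \<odot> \<I> y) = ((qG \<cdot> R) \<cdot> ext ?a ?b ?mt (?b \<otimes> y)) \<cdot> (\<I> ?a \<odot> \<alpha> ?b ?b y) \<cdot> \<alpha> ?a (?b \<otimes> ?b) y"
      by (simp add: e assoc_ext[THEN reassoc])
    also have "\<dots> = (qG \<cdot> R \<cdot> \<alpha> ?b ?b y) \<cdot> (a2 \<odot> \<I> y)"
      unfolding b by (simp add: e assoc_ext_lift[THEN reassoc])
    finally show "(qG \<cdot> R \<cdot> \<alpha> ?b ?b y) \<cdot> (a1 \<odot> \<I> y) = (qG \<cdot> R \<cdot> \<alpha> ?b ?b y) \<cdot> (a2 \<odot> \<I> y)" .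
  qed simp_all
  then show ?thesis by (simp add: eps_def)
qed

lemma eps_i2: "eps \<cdot> (i2 \<odot> \<I> y) = qG"
proof -
  let ?b = "robj B"
  note [simp] = N_simps qG(1,2)
  have "eps \<cdot> (i2 \<odot> \<I> y) = (eps \<cdot> (Q \<odot> \<I> y)) \<cdot> (uext (unit B) ?b \<odot> \<I> y)"
    by (simp add: i2_def merge)
  also have "\<dots> = qG \<cdot> (R \<cdot> uext (unit B) (?b \<otimes> y))" unfolding eps_Q by (simp add: assoc_uext)
  finally show ?thesis unfolding actionD(6)[OF action_R] by simp
qed

text \<open>This balances \<open>eps\<close> over \<open>B\<close> when \<open>E\<close> is a module
  through \<open>k1\<close>, and \<open>eps_k2\<close> makes it linear for \<open>k2\<close>. So
  \<open>eps\<close> represents the base change map from \<open>E \<otimes>\<^sub>B N\<close> to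
  \<open>B \<otimes>\<^sub>A N\<close>.\<close>

lemma eps_k1: "eps \<cdot> ext (robj B) E k1 y = eps \<cdot> lift E (robj B) r y"
proof (rule Q_epi_left_right)
  let ?b = "robj B"
  note [simp] = N_simps qG(1,2)
  have s: "R \<cdot> (\<I> ?b \<odot> R) \<cdot> sw ?b ?b (?b \<otimes> y) = R \<cdot> (\<I> ?b \<odot> R)"
    using commute_self[OF B action_R] by (simp add: commute_def)
  have q: "(Q \<odot> \<I> y) \<cdot> ext ?b (?b \<otimes> ?b) l1 y = ext ?b E k1 y \<cdot> (\<I> ?b \<odot> (Q \<odot> \<I> y))"
    by (rule ext_map) (simp_all add: k_Q)
  have "(eps \<cdot> ext ?b E k1 y) \<cdot> (\<I> ?b \<odot> (Q \<odot> \<I> y)) = (eps \<cdot> (Q \<odot> \<I> y)) \<cdot> ext ?b (?b \<otimes> ?b) l1 y"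
    using q by simp
  also have "\<dots> = qG \<cdot> (R \<cdot> ext ?b ?b (mult B) (?b \<otimes> y)) \<cdot> (\<I> ?b \<odot> \<alpha> ?b ?b y)"
    unfolding eps_Q by (simp add: assoc_ext)
  also have "\<dots> = qG \<cdot> (R \<cdot> (\<I> ?b \<odot> R) \<cdot> sw ?b ?b (?b \<otimes> y)) \<cdot> (\<I> ?b \<odot> \<alpha> ?b ?b y)"
    unfolding actionD(5)[OF action_R] s ..
  also have "\<dots> = (qG \<cdot> R \<cdot> \<alpha> ?b ?b y) \<cdot> lift (?b \<otimes> ?b) ?b r y"
    by (simp add: assoc_lift lift_def[of ?b ?b R])
  also have "\<dots> = (eps \<cdot> lift E ?b r y) \<cdot> (\<I> ?b \<odot> (Q \<odot> \<I> y))"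
    unfolding eps_Q[symmetric] by (simp add: lift_nat) (simp add: lift_def merge)
  finally show "(eps \<cdot> ext ?b E k1 y) \<cdot> (\<I> ?b \<odot> (Q \<odot> \<I> y)) = (eps \<cdot> lift E ?b r y) \<cdot> (\<I> ?b \<odot> (Q \<odot> \<I> y))" .
qed (use N_simps qG(1,2) in simp_all)

lemma eps_k2: "eps \<cdot> ext (robj B) E k2 y = snd G \<cdot> (\<I> (robj B) \<odot> eps)"
proof (rule Q_epi_left_right)
  let ?b = "robj B"
  note [simp] = N_simps qG(1,2) modulesD(2-4)[OF B G_modules, unfolded fst_G]
  have c: "R \<cdot> (\<I> ?b \<odot> ext ?b ?b (mult B) y) \<cdot> sw ?b ?b (?b \<otimes> y) = ext ?b ?b (mult B) y \<cdot> (\<I> ?b \<odot> R)"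
    using commute_ext_lift[of ?b ?b ?b y "mult B" r] by (simp add: commute_def)
  have q: "(Q \<odot> \<I> y) \<cdot> ext ?b (?b \<otimes> ?b) l2 y = ext ?b E k2 y \<cdot> (\<I> ?b \<odot> (Q \<odot> \<I> y))"
    by (rule ext_map) (simp_all add: k_Q)
  have "(eps \<cdot> ext ?b E k2 y) \<cdot> (\<I> ?b \<odot> (Q \<odot> \<I> y)) = (eps \<cdot> (Q \<odot> \<I> y)) \<cdot> ext ?b (?b \<otimes> ?b) l2 y"
    using q by simp
  also have "\<dots> = qG \<cdot> (R \<cdot> (\<I> ?b \<odot> ext ?b ?b (mult B) y) \<cdot> sw ?b ?b (?b \<otimes> y)) \<cdot> (\<I> ?b \<odot> \<alpha> ?b ?b y)"
    unfolding eps_Q by (simp add: assoc_ext_lift lift_def[of ?b ?b "ext ?b ?b (mult B) y"])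
  also have "\<dots> = (snd G \<cdot> (\<I> ?b \<odot> qG)) \<cdot> (\<I> ?b \<odot> R) \<cdot> (\<I> ?b \<odot> \<alpha> ?b ?b y)"
    unfolding c snd_G(2) by simp
  also have "\<dots> = snd G \<cdot> (\<I> ?b \<odot> (eps \<cdot> (Q \<odot> \<I> y)))" unfolding eps_Q by (simp add: merge)
  also have "\<dots> = (snd G \<cdot> (\<I> ?b \<odot> eps)) \<cdot> (\<I> ?b \<odot> (Q \<odot> \<I> y))" by (simp add: merge)
  finally show "(eps \<cdot> ext ?b E k2 y) \<cdot> (\<I> ?b \<odot> (Q \<odot> \<I> y)) = (snd G \<cdot> (\<I> ?b \<odot> eps)) \<cdot> (\<I> ?b \<odot> (Q \<odot> \<I> y))" .
qed (use N_simps qG(1,2) modulesD(2-4)[OF B G_modules, unfolded fst_G] in simp_all)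

text \<open>Applied to both factors \<open>B\<close> and \<open>C\<close> of \<open>B \<otimes>\<^sub>A B\<close>, with \<open>j\<close> the inclusion of the factor.\<close>

lemma tower_summand:
  assumes C: "tt_ring K C" and f1: "ring_hom K B C f1" and f2: "ring_hom K B C f2" and ft: "f1 \<cdot> t = f2 \<cdot> t"
    and j: "j \<in> Hom (robj C) E"
    and jk1: "k1 \<cdot> (\<I> (robj B) \<odot> j) = j \<cdot> mult C \<cdot> (f1 \<odot> \<I> (robj C))"
    and jk2: "k2 \<cdot> (\<I> (robj B) \<odot> j) = j \<cdot> mult C \<cdot> (f2 \<odot> \<I> (robj C))"
  shows "\<exists>k l. mhom B G (res_mod f2 (rten C B f1 (self_mod C) N)) k \<and>
    mhom B (res_mod f2 (rten C B f1 (self_mod C) N)) G l \<and> (l \<cdot> k) \<cdot> qG = eps \<cdot> ((j \<cdot> f2) \<odot> \<I> y)"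
proof -
  let ?a = "robj A" let ?b = "robj B" let ?c = "robj C"
  let ?P = "rten C B f1 (self_mod C) N"
  let ?qP = "tensor_quot K B (res_mod f1 (self_mod C)) N"
  let ?M = "res_mod f2 ?P"
  note sC = self_mod_modules[OF C]
  note Pq = rq[OF B C f1 sC N, simplified]
  note PM = rten_modules[OF B C f1 sC N]
  note fP = rten_fst[OF B C f1 sC N]
  have jj [simp]: "j \<in> Ar K" "Dom K j = ?c" "Cod K j = E" using j by simp_all
  note [simp] = N_simps qG(1,2) Pq(1,2) tt_ringD[OF C] ring_homD[OF f1] ring_homD[OF f2] fst_G fP
    modulesD(2-4)[OF B G_modules, unfolded fst_G] modulesD(2-4)[OF C PM, unfolded fP]
  have MB: "?M \<in> modules K B" by (rule res_mod_modules[OF B C f2 PM])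
  have snd_M: "snd ?M = snd ?P \<cdot> (f2 \<odot> \<I> (Cod K ?qP))" by (simp add: res_mod_def)
  have sPq: "snd ?P \<cdot> (f2 \<odot> ?qP) = ?qP \<cdot> ext ?b ?c (mult C \<cdot> (f2 \<odot> \<I> ?c)) y"
  proof -
    have "snd ?P \<cdot> (f2 \<odot> ?qP) = (snd ?P \<cdot> (\<I> ?c \<odot> ?qP)) \<cdot> (f2 \<odot> \<I> (?c \<otimes> y))" by (simp add: merge)
    then show ?thesis unfolding rten_snd(2)[OF B C f1 sC N] by (simp add: ext_TenA)
  qed
  have bal: "?qP \<cdot> ext ?b ?c (mult C \<cdot> (f1 \<odot> \<I> ?c)) y = ?qP \<cdot> lift ?c ?b r y"
    using Pq(3) by (simp add: res_mod_def)
  \<comment> \<open>The component \<open>b \<otimes> n \<mapsto> f2 b \<otimes> n\<close> into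
    \<open>C \<otimes>\<^sub>B N\<close>. It is balanced over \<open>A\<close> because
    \<open>f1\<close> and \<open>f2\<close> agree there, which lets a scalar cross to
    \<open>n\<close> along \<open>f1\<close>.\<close>
  define g where "g = ?qP \<cdot> (f2 \<odot> \<I> y)"
  have [simp]: "g \<in> Ar K" "Dom K g = ?b \<otimes> y" "Cod K g = Cod K ?qP" by (simp_all add: g_def)
  have f2m: "f2 \<cdot> mult B = mult C \<cdot> (f2 \<odot> f2)" and f1m: "f1 \<cdot> mult B = mult C \<cdot> (f1 \<odot> f1)"
    using f1 f2 by (simp_all add: ring_hom_def)
  have g1: "g \<cdot> lact A (res_mod t (self_mod B)) (fst rt) = g \<cdot> ract A ?b rt"
  proof -
    have e: "(f2 \<odot> \<I> y) \<cdot> ext ?a ?b (mult B \<cdot> (t \<odot> \<I> ?b)) y =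
        ext ?a ?c (mult C \<cdot> ((f1 \<cdot> t) \<odot> \<I> ?c)) y \<cdot> (\<I> ?a \<odot> (f2 \<odot> \<I> y))"
      by (rule ext_map) (simp_all add: f2m[THEN reassoc] ft merge)
    have "g \<cdot> ext ?a ?b (mult B \<cdot> (t \<odot> \<I> ?b)) y = ?qP \<cdot> ((f2 \<odot> \<I> y) \<cdot> ext ?a ?b (mult B \<cdot> (t \<odot> \<I> ?b)) y)"
      by (simp add: g_def)
    also have "\<dots> = (?qP \<cdot> ext ?b ?c (mult C \<cdot> (f1 \<odot> \<I> ?c)) y) \<cdot> (t \<odot> (f2 \<odot> \<I> y))"
      unfolding e by (simp add: ext_TenA merge)
    also have "\<dots> = ?qP \<cdot> lift ?c ?b r y \<cdot> (t \<odot> (f2 \<odot> \<I> y))" unfolding bal by simp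
    also have "\<dots> = g \<cdot> lift ?b ?a (r \<cdot> (t \<odot> \<I> y)) y"
    proof -
      have "(f2 \<odot> \<I> y) \<cdot> lift ?b ?b r y = lift ?c ?b r y \<cdot> (\<I> ?b \<odot> (f2 \<odot> \<I> y))"
        by (rule lift_map) simp_all
      from this[THEN reassoc, of "t \<odot> \<I> (?b \<otimes> y)"] show ?thesis by (simp add: g_def lift_TenA merge)
    qed
    finally show ?thesis by (simp add: snd_rt)
  qed
  have g2: "g \<cdot> lact B (self_mod B) (fst rt) = snd ?M \<cdot> (\<I> ?b \<odot> g)"
  proof -
    have e: "(f2 \<odot> \<I> y) \<cdot> ext ?b ?b (mult B) y = ext ?b ?c (mult C \<cdot> (f2 \<odot> \<I> ?c)) y \<cdot> (\<I> ?b \<odot> (f2 \<odot> \<I> y))"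
      by (rule ext_map) (simp_all add: f2m merge)
    have "snd ?M \<cdot> (\<I> ?b \<odot> g) = (snd ?P \<cdot> (f2 \<odot> ?qP)) \<cdot> (\<I> ?b \<odot> (f2 \<odot> \<I> y))"
      by (simp add: snd_M g_def merge)
    then show ?thesis unfolding sPq by (simp add: e g_def)
  qed
  have k: "mhom B G ?M (g \<cdot> tsec A (res_mod t (self_mod B)) rt)" "g \<cdot> tsec A (res_mod t (self_mod B)) rt \<cdot> qG = g"
    by (rule G_univ[OF MB _ g1[simplified] g2[simplified]]; simp)+
  \<comment> \<open>In the other direction, the restriction of \<open>eps\<close> to the factor
    \<open>C\<close>: \<open>jk1\<close> makes it balanced over \<open>B\<close>, and
    \<open>jk2\<close> makes it linear.\<close>
  define h where "h = eps \<cdot> (j \<odot> \<I> y)"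
  have [simp]: "h \<in> Ar K" "Dom K h = ?c \<otimes> y" "Cod K h = Cod K qG" by (simp_all add: h_def)
  have h1: "h \<cdot> lact B (res_mod f1 (self_mod C)) y = h \<cdot> ract B ?c N"
  proof -
    have e: "(j \<odot> \<I> y) \<cdot> ext ?b ?c (mult C \<cdot> (f1 \<odot> \<I> ?c)) y = ext ?b E k1 y \<cdot> (\<I> ?b \<odot> (j \<odot> \<I> y))"
      by (rule ext_map) (simp_all add: jk1)
    have "h \<cdot> ext ?b ?c (mult C \<cdot> (f1 \<odot> \<I> ?c)) y = (eps \<cdot> ext ?b E k1 y) \<cdot> (\<I> ?b \<odot> (j \<odot> \<I> y))"
      by (simp add: h_def e)
    also have "\<dots> = h \<cdot> lift ?c ?b r y"
      unfolding eps_k1 by (simp add: h_def lift_nat) (simp add: lift_def merge)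
    finally show ?thesis by (simp add: res_mod_def)
  qed
  define l where "l = h \<cdot> tsec B (res_mod f1 (self_mod C)) N"
  have [simp]: "l \<in> Ar K" "Dom K l = Cod K ?qP" "Cod K l = Cod K qG"
    using Pq(4-6) by (simp_all add: l_def)
  have lq: "l \<cdot> ?qP = h"
    using rq_desc[OF B C f1 sC N, of h] h1 Pq(4-6) by (simp add: l_def)
  have "l \<cdot> snd ?M = snd G \<cdot> (\<I> ?b \<odot> l)"
  proof (rule rq_epi_left[OF B C f1 sC N])
    have e: "(j \<odot> \<I> y) \<cdot> ext ?b ?c (mult C \<cdot> (f2 \<odot> \<I> ?c)) y = ext ?b E k2 y \<cdot> (\<I> ?b \<odot> (j \<odot> \<I> y))"
      by (rule ext_map) (simp_all add: jk2)
    have "(l \<cdot> snd ?M) \<cdot> (\<I> ?b \<odot> ?qP) = l \<cdot> (snd ?P \<cdot> (f2 \<odot> ?qP))" by (simp add: snd_M merge)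
    also have "\<dots> = h \<cdot> ext ?b ?c (mult C \<cdot> (f2 \<odot> \<I> ?c)) y" unfolding sPq by (simp add: lq[THEN reassoc])
    also have "\<dots> = (eps \<cdot> ext ?b E k2 y) \<cdot> (\<I> ?b \<odot> (j \<odot> \<I> y))" by (simp add: h_def e)
    also have "\<dots> = snd G \<cdot> (\<I> ?b \<odot> (l \<cdot> ?qP))" unfolding eps_k2 lq by (simp add: h_def merge)
    also have "\<dots> = (snd G \<cdot> (\<I> ?b \<odot> l)) \<cdot> (\<I> ?b \<odot> ?qP)" by (simp add: merge)
    finally show "(l \<cdot> snd ?M) \<cdot> (\<I> ?b \<odot> ?qP) = (snd G \<cdot> (\<I> ?b \<odot> l)) \<cdot> (\<I> ?b \<odot> ?qP)" .
  qed (simp_all add: snd_M)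
  then have l: "mhom B ?M G l"
    using MB G_modules by (simp add: mhom_def)
  have "(l \<cdot> (g \<cdot> tsec A (res_mod t (self_mod B)) rt)) \<cdot> qG = l \<cdot> g"
    using k(2) qG(4-6) by simp
  also have "\<dots> = (l \<cdot> ?qP) \<cdot> (f2 \<odot> \<I> y)" by (simp add: g_def)
  also have "\<dots> = eps \<cdot> ((j \<cdot> f2) \<odot> \<I> y)" unfolding lq by (simp add: h_def merge)
  finally show ?thesis using k(1) l by blast
qed

end

text \<open>\<open>j1\<close> and \<open>j2\<close> include the factors \<open>B\<close> and
  \<open>C\<close> into \<open>E\<close> through the inverse of the ring isomorphism;
  \<open>t'\<close> and \<open>f\<close> are the second components of \<open>i1\<close> and
  \<open>i2\<close>. Since the multiplication is a left inverse of \<open>i2\<close>, the element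
  \<open>1 \<otimes> b\<close> has components \<open>b\<close> and \<open>f b\<close>, which is the
  formula for \<open>i2\<close>.\<close>

lemma tower_components:
  assumes "tower_step K A t B t' C"
  shows "tt_ring K C \<and> ring_hom K B C t' \<and> (\<exists>f j1 j2. ring_hom K B C f \<and> t' \<cdot> t = f \<cdot> t \<and>
    j1 \<in> Hom (robj B) E \<and> j2 \<in> Hom (robj C) E \<and> i2 = j1 \<oplus> (j2 \<cdot> f) \<and>
    k1 \<cdot> (\<I> (robj B) \<odot> j1) = j1 \<cdot> mult B \<and> k2 \<cdot> (\<I> (robj B) \<odot> j1) = j1 \<cdot> mult B \<and>
    k1 \<cdot> (\<I> (robj B) \<odot> j2) = j2 \<cdot> mult C \<cdot> (t' \<odot> \<I> (robj C)) \<and>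
    k2 \<cdot> (\<I> (robj B) \<odot> j2) = j2 \<cdot> mult C \<cdot> (f \<odot> \<I> (robj C)))"
proof -
  from assms obtain s i j p q h where C: "tt_ring K C" and bp: "biproduct K (robj B) (robj C) s i j p q"
    and h: "ring_hom K (self_tensor_ring K A t B) (product_ring K B C s i j p q) h" and ih: "iso K h"
    and ph: "p \<cdot> h = induced K Q (mult B)"
    and t': "t' = (q \<cdot> h) \<cdot> Q \<cdot> (\<I> (robj B) \<odot> unit B) \<cdot> inv_arrow K (\<rho>\<rho> (robj B))"
    unfolding tower_step_def by (elim conjE exE) (rule that)
  let ?b = "robj B" let ?c = "robj C"
  note [simp] = tt_ringD[OF C]
  note bpD = biproductD[OF bp base_simps(2) tt_ringD(1)[OF C]]
  note [simp] = bpD mE(1-3) uE(1-3)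
  have [simp]: "h \<in> Ar K" "Dom K h = E" "Cod K h = s" using ring_homD[OF h] by (simp_all add: robj_E product_ring_def)
  have hm: "h \<cdot> mE = ((i \<cdot> mult B \<cdot> (p \<odot> p)) \<oplus> (j \<cdot> mult C \<cdot> (q \<odot> q))) \<cdot> (h \<odot> h)"
    and hu: "h \<cdot> uE = (i \<cdot> unit B) \<oplus> (j \<cdot> unit C)"
    using h by (simp_all add: ring_hom_def product_ring_def)
  define p1 p2 where "p1 = p \<cdot> h" and "p2 = q \<cdot> h"
  have [simp]: "p1 \<in> Ar K" "Dom K p1 = E" "Cod K p1 = ?b" "p2 \<in> Ar K" "Dom K p2 = E" "Cod K p2 = ?c"
    by (simp_all add: p1_def p2_def)
  have m1: "p1 \<cdot> mE = mult B \<cdot> (p1 \<odot> p1)"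
    by (simp add: p1_def hm add_comp' comp_add' bpD(14,16)[THEN reassoc] merge)
  have m2: "p2 \<cdot> mE = mult C \<cdot> (p2 \<odot> p2)"
    by (simp add: p2_def hm add_comp' comp_add' bpD(15,17)[THEN reassoc] merge)
  have u2: "p2 \<cdot> uE = unit C"
    by (simp add: p2_def hu comp_add' bpD(15,17)[THEN reassoc])
  have pQ: "p1 \<cdot> Q = mult B" using mult_Q(1) by (simp add: p1_def flip: ph)
  have p1i: "p1 \<cdot> i1 = \<I> ?b" "p1 \<cdot> i2 = \<I> ?b"
    by (simp_all add: i1_def i2_def pQ[THEN reassoc] tt_ring_eqs(1)[OF B, THEN reassoc] tt_ring_eqs(2)[OF B])
  define f1 f2 where "f1 = p2 \<cdot> i1" and "f2 = p2 \<cdot> i2"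
  have [simp]: "f1 \<in> Ar K" "Dom K f1 = ?b" "Cod K f1 = ?c" "f2 \<in> Ar K" "Dom K f2 = ?b" "Cod K f2 = ?c"
    by (simp_all add: f1_def f2_def)
  have t'f: "t' = f1" unfolding t' f1_def p2_def using i1_eq by simp
  have "f1 \<cdot> mult B = mult C \<cdot> (f1 \<odot> f1)" "f2 \<cdot> mult B = mult C \<cdot> (f2 \<odot> f2)"
    by (simp_all add: f1_def f2_def i_mult m2[THEN reassoc] merge)
  moreover have "f1 \<cdot> unit B = unit C" "f2 \<cdot> unit B = unit C"
    by (simp_all add: f1_def f2_def uE u2)
  ultimately have f: "ring_hom K B C f1" "ring_hom K B C f2" by (simp_all add: ring_hom_def)
  have ft: "f1 \<cdot> t = f2 \<cdot> t" by (simp add: f1_def f2_def i_t)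
  have "\<exists>g. g \<in> Hom s E \<and> g \<cdot> h = \<I> E \<and> h \<cdot> g = \<I> s"
    using ih unfolding iso_def inverse_arrows_def by (elim ex_forward) simp
  then obtain g where g: "g \<in> Hom s E" "g \<cdot> h = \<I> E" "h \<cdot> g = \<I> s" by (elim exE conjE)
  then have [simp]: "g \<in> Ar K" "Dom K g = s" "Cod K g = E" by simp_all
  define j1 j2 where "j1 = g \<cdot> i" and "j2 = g \<cdot> j"
  have [simp]: "j1 \<in> Ar K" "Dom K j1 = ?b" "Cod K j1 = E" "j2 \<in> Ar K" "Dom K j2 = ?c" "Cod K j2 = E"
    by (simp_all add: j1_def j2_def)
  have pj: "p1 \<cdot> j1 = \<I> ?b" "p2 \<cdot> j2 = \<I> ?c" "p1 \<cdot> j2 = Zero K ?c ?b" "p2 \<cdot> j1 = Zero K ?b ?c"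
    by (simp_all add: p1_def p2_def j1_def j2_def g(3)[THEN reassoc])
  have sm: "(j1 \<cdot> p1) \<oplus> (j2 \<cdot> p2) = \<I> E"
  proof -
    have "(j1 \<cdot> p1) \<oplus> (j2 \<cdot> p2) = g \<cdot> (((i \<cdot> p) \<oplus> (j \<cdot> q)) \<cdot> h)"
      by (simp add: p1_def p2_def j1_def j2_def add_comp' comp_add' del: bpD(18))
    then show ?thesis using g(2) by (simp add: bpD(18))
  qed
  have dec: "x = (j1 \<cdot> (p1 \<cdot> x)) \<oplus> (j2 \<cdot> (p2 \<cdot> x))" if "x \<in> Ar K" "Cod K x = E" for x
  proof -
    have "((j1 \<cdot> p1) \<oplus> (j2 \<cdot> p2)) \<cdot> x = (j1 \<cdot> (p1 \<cdot> x)) \<oplus> (j2 \<cdot> (p2 \<cdot> x))"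
      using that by (simp add: add_comp')
    then show ?thesis unfolding sm using that by simp
  qed
  have pk: "p1 \<cdot> k1 = mult B \<cdot> (\<I> ?b \<odot> p1)" "p1 \<cdot> k2 = mult B \<cdot> (\<I> ?b \<odot> p1)"
    "p2 \<cdot> k1 = mult C \<cdot> (f1 \<odot> p2)" "p2 \<cdot> k2 = mult C \<cdot> (f2 \<odot> p2)"
    unfolding mE_i[symmetric] by (simp_all add: m1[THEN reassoc] m2[THEN reassoc] merge p1i f1_def f2_def)
  have fZ: "f1 \<odot> Zero K ?b ?c = Zero K (?b \<otimes> ?b) (?c \<otimes> ?c)" "f2 \<odot> Zero K ?b ?c = Zero K (?b \<otimes> ?b) (?c \<otimes> ?c)"
  proof -
    have "f \<odot> Zero K ?b ?c = (f \<odot> \<I> ?c) \<cdot> (\<I> ?b \<odot> Zero K ?b ?c)" if "f \<in> Ar K" "Dom K f = ?b" for f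
      using that by (simp add: merge del: TenA_Zero)
    from this[of f1] this[of f2]
    show "f1 \<odot> Zero K ?b ?c = Zero K (?b \<otimes> ?b) (?c \<otimes> ?c)" "f2 \<odot> Zero K ?b ?c = Zero K (?b \<otimes> ?b) (?c \<otimes> ?c)"
      by simp_all
  qed
  \<comment> \<open>Equality in \<open>E\<close> is tested on the projections \<open>p1\<close> and
    \<open>p2\<close>, which turn both actions into multiplication in the factors.\<close>
  have "k1 \<cdot> (\<I> ?b \<odot> j1) = j1 \<cdot> mult B" "k2 \<cdot> (\<I> ?b \<odot> j1) = j1 \<cdot> mult B"
    by (subst dec; simp add: pk[THEN reassoc] merge pj fZ)+
  moreover have "k1 \<cdot> (\<I> ?b \<odot> j2) = j2 \<cdot> mult C \<cdot> (f1 \<odot> \<I> ?c)" "k2 \<cdot> (\<I> ?b \<odot> j2) = j2 \<cdot> mult C \<cdot> (f2 \<odot> \<I> ?c)"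
    by (subst dec; simp add: pk[THEN reassoc] merge pj)+
  moreover have "i2 = j1 \<oplus> (j2 \<cdot> f2)"
    using dec[of i2] by (simp add: p1i f2_def)
  ultimately show ?thesis unfolding t'f using C f ft by (intro conjI exI[of _ f2] exI[of _ j1] exI[of _ j2]) simp_all
qed

text \<open>By \<open>eps_i2\<close> and the formula for \<open>i2\<close>, the identity of
  \<open>B \<otimes>\<^sub>A N\<close> is a sum of one map through
  \<open>B \<otimes>\<^sub>B N\<close>, that is \<open>N\<close>, and one through the restriction of
  \<open>C \<otimes>\<^sub>B N\<close>. Then \<open>mthick_sum\<close> applies.\<close>

lemma tower_ideal:
  assumes C: "tt_ring K C" and t': "ring_hom K B C t'" and f: "ring_hom K B C f" and ft: "t' \<cdot> t = f \<cdot> t"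
    and j: "j1 \<in> Hom (robj B) E" "j2 \<in> Hom (robj C) E" "i2 = j1 \<oplus> (j2 \<cdot> f)"
    and j1: "k1 \<cdot> (\<I> (robj B) \<odot> j1) = j1 \<cdot> mult B" "k2 \<cdot> (\<I> (robj B) \<odot> j1) = j1 \<cdot> mult B"
    and j2: "k1 \<cdot> (\<I> (robj B) \<odot> j2) = j2 \<cdot> mult C \<cdot> (t' \<odot> \<I> (robj C))"
      "k2 \<cdot> (\<I> (robj B) \<odot> j2) = j2 \<cdot> mult C \<cdot> (f \<odot> \<I> (robj C))"
    and J: "mthick B J" and N: "N \<in> J" "res_mod f (rten C B t' (self_mod C) N) \<in> J"
  shows "rten B A t (self_mod B) (res_mod t N) \<in> J"
proof -
  have NB: "N \<in> modules K B" using N(1) mthickD(1)[OF J] by blast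
  let ?P = "rten B B (\<I> (robj B)) (self_mod B) N"
  let ?M = "res_mod f (rten C B t' (self_mod C) N)"
  let ?G = "rten B A t (self_mod B) (res_mod t N)"
  let ?q = "tensor_quot K A (res_mod t (self_mod B)) (res_mod t N)"
  note I = ring_hom_ident[OF B]
  have rI: "res_mod (\<I> (robj B)) ?P = ?P"
    by (rule res_mod_ident[OF B rten_modules[OF B B I self_mod_modules[OF B] NB]])
  have PJ: "?P \<in> J" using miso_mthick[OF J rten_left_unit[OF B NB]] N(1) by simp
  have [simp]: "j1 \<in> Ar K" "Dom K j1 = robj B" "Cod K j1 = E" "j2 \<in> Ar K" "Dom K j2 = robj C" "Cod K j2 = E"
    using j by simp_all
  note [simp] = N_simps[OF NB] ring_homD[OF f] qG(1,2)[OF NB] fst_G[OF NB] eps_simps[OF NB]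
  \<comment> \<open>The factor \<open>B\<close> of \<open>E\<close> is the case of
    \<open>tower_summand\<close> where both homomorphisms are the identity.\<close>
  have "\<exists>k l. mhom B ?G (res_mod (\<I> (robj B)) ?P) k \<and> mhom B (res_mod (\<I> (robj B)) ?P) ?G l \<and>
      (l \<cdot> k) \<cdot> ?q = eps N \<cdot> ((j1 \<cdot> \<I> (robj B)) \<odot> \<I> (fst N))"
    by (rule tower_summand[OF NB B I I refl j(1)]) (simp_all add: j1)
  then obtain ka la where a: "mhom B ?G ?P ka" "mhom B ?P ?G la" "(la \<cdot> ka) \<cdot> ?q = eps N \<cdot> (j1 \<odot> \<I> (fst N))"
    unfolding rI by (elim exE conjE) simp
  have "\<exists>k l. mhom B ?G ?M k \<and> mhom B ?M ?G l \<and> (l \<cdot> k) \<cdot> ?q = eps N \<cdot> ((j2 \<cdot> f) \<odot> \<I> (fst N))"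
    by (rule tower_summand[OF NB C t' f ft j(2) j2])
  then obtain kb lb where b: "mhom B ?G ?M kb" "mhom B ?M ?G lb" "(lb \<cdot> kb) \<cdot> ?q = eps N \<cdot> ((j2 \<cdot> f) \<odot> \<I> (fst N))"
    by (elim exE conjE)
  note [simp] = mhomD(3-5)[OF a(1)] mhomD(3-5)[OF a(2)] mhomD(3-5)[OF b(1)] mhomD(3-5)[OF b(2)]
  have "(la \<cdot> ka) \<oplus> (lb \<cdot> kb) = \<I> (Cod K ?q)"
  proof (rule rq_epi[OF A B t self_mod_modules[OF B] rt_modules[OF NB]])
    have "((la \<cdot> ka) \<oplus> (lb \<cdot> kb)) \<cdot> ?q = ((la \<cdot> ka) \<cdot> ?q) \<oplus> ((lb \<cdot> kb) \<cdot> ?q)"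
      by (simp add: add_comp')
    also have "\<dots> = eps N \<cdot> (i2 \<odot> \<I> (fst N))"
      unfolding a(3) b(3) j(3) by (subst TenA_additive_right) (simp_all add: comp_add')
    finally show "((la \<cdot> ka) \<oplus> (lb \<cdot> kb)) \<cdot> ?q = \<I> (Cod K ?q) \<cdot> ?q"
      unfolding eps_i2[OF NB] by simp
  qed simp_all
  then show ?thesis
    using mthick_sum[OF B J PJ N(2) a(1) b(1) a(2) b(2)] by simp
qed

end

section \<open>Primes over a step of the tower\<close>

context tt_category
begin

text \<open>What the fiber arguments use of a tower step; \<open>t'\<close> and \<open>f\<close>
  stem from the two inclusions of \<open>B\<close> into
  \<open>B \<otimes>\<^sub>A B\<close>.\<close>

definition splits where
  "splits A t B t' C f \<longleftrightarrow> ring_hom K B C f \<and> t' \<cdot> t = f \<cdot> t \<and>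
    (\<forall>Q Q'. mprime B Q \<and> mprime B Q' \<and> pull B A t Q = pull B A t Q' \<longrightarrow>
       Q \<subseteq> Q' \<or> (\<exists>T. mprime C T \<and> pull C B f T = Q \<and> pull C B t' T \<subseteq> Q'))"

text \<open>Lying over along \<open>f\<close>, with the multiplicative set enlarged by the
  extensions along \<open>f1\<close> of all modules outside \<open>Q'\<close>, which forces the
  trace along \<open>f1\<close> into \<open>Q'\<close>. Premise \<open>n\<close> keeps the enlarged
  set away from the modules with restriction in \<open>Q\<close>.\<close>

lemma prime_pair_over:
  assumes B: "tt_ring K B" and C: "tt_ring K C" and f1: "ring_hom K B C f1" and f: "ring_hom K B C f"
    and Q: "mprime B Q" and Q': "mprime B Q'"
    and n: "\<And>N. N \<in> modules K B \<Longrightarrow> N \<notin> Q' \<Longrightarrow> res_mod f (rten C B f1 (self_mod C) N) \<notin> Q"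
  shows "\<exists>T. mprime C T \<and> pull C B f T = Q \<and> pull C B f1 T \<subseteq> Q'"
proof -
  let ?t = "rten B B (\<I> (robj B))" and ?T = "rten C C (\<I> (robj C))"
  let ?L = "rten C B f1 (self_mod C)"
  note IB = ring_hom_ident[OF B] and IC = ring_hom_ident[OF C]
  note sB = self_mod_modules[OF B] and sC = self_mod_modules[OF C]
  note LM = rten_modules[OF B C f1 sC]
  define J0 where "J0 = {L \<in> modules K C. res_mod f L \<in> Q}"
  define S where "S = {rten C B f (?L N') N | N N'. N \<in> modules K B - Q \<and> N' \<in> modules K B - Q'}"
  have SI: "rten C B f (?L N') N \<in> S" if "N \<in> modules K B" "N \<notin> Q" "N' \<in> modules K B" "N' \<notin> Q'" for N N'
    using that unfolding S_def by blast
  have J0: "mthick C J0" unfolding J0_def by (rule mthick_vimage_res[OF B C f mprimeD(1)[OF Q]])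
  have SM: "S \<subseteq> modules K C"
    unfolding S_def by (rule subsetI, elim CollectE exE conjE) (simp add: rten_modules[OF B C f LM])
  have Sne: "S \<noteq> {}" using SI[OF sB mprimeD(2)[OF Q] sB mprimeD(2)[OF Q']] by blast
  have "res_mod f (rten C B f (?L N') N) \<notin> Q"
    if "N \<in> modules K B" "N \<notin> Q" "N' \<in> modules K B" "N' \<notin> Q'" for N N'
    unfolding res_rten_prime[OF B C f Q LM[OF that(3)] that(1)] using n[OF that(3,4)] that(2) by simp
  then have disj: "S \<inter> J0 = {}"
    unfolding S_def J0_def by (intro equals0I, elim IntE CollectE exE conjE) simp
  have mult: "\<exists>u\<in>S. \<forall>J. mthick C J \<longrightarrow> ?T s t \<in> J \<longrightarrow> u \<in> J" if st: "s \<in> S" "t \<in> S" for s t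
  proof -
    from st(1) obtain N1 N1' where 1: "s = rten C B f (?L N1') N1" "N1 \<in> modules K B" "N1 \<notin> Q" "N1' \<in> modules K B" "N1' \<notin> Q'"
      unfolding S_def by (elim CollectE exE conjE DiffE) (rule that)
    from st(2) obtain N2 N2' where 2: "t = rten C B f (?L N2') N2" "N2 \<in> modules K B" "N2 \<notin> Q" "N2' \<in> modules K B" "N2' \<notin> Q'"
      unfolding S_def by (elim CollectE exE conjE DiffE) (rule that)
    let ?N = "?t N1 N2" and ?N' = "?t N2' N1'"
    have NM: "?N \<in> modules K B" "?N' \<in> modules K B"
      by (rule rten_modules[OF B B IB 1(2) 2(2)], rule rten_modules[OF B B IB 2(4) 1(4)])
    have NQ: "?N \<notin> Q" "?N' \<notin> Q'"
      using mprimeD(4)[OF Q 1(2) 2(2)] mprimeD(4)[OF Q' 2(4) 1(4)] 1(3,5) 2(3,5) by blast+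
    have m1: "mret C (?L ?N') (rten C B f1 (?T (self_mod C) (self_mod C)) ?N')"
      by (rule mret_rten[OF B C f1 mret_rten_right_unit(1)[OF C sC] mret_refl[OF B NM(2)]])
    have "mret C (?L ?N') (?T (?L N2') (?L N1'))"
      by (rule mret_trans[OF C m1 rten_product_mret[OF B C f1 sC sC 2(4) 1(4)]])
    then have "mret C (rten C B f (?L ?N') ?N) (rten C B f (?T (?L N2') (?L N1')) ?N)"
      by (rule mret_rten[OF B C f _ mret_refl[OF B NM(1)]])
    then have "mret C (rten C B f (?L ?N') ?N) (?T s t)"
      unfolding 1(1) 2(1)
      by (rule mret_trans[OF C _ rten_product_mret[OF B C f LM[OF 1(4)] LM[OF 2(4)] 1(2) 2(2)]])
    then have "\<forall>J. mthick C J \<longrightarrow> ?T s t \<in> J \<longrightarrow> rten C B f (?L ?N') ?N \<in> J"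
      by (intro allI impI) (rule mthickD(5))
    then show ?thesis using SI[OF NM(1) NQ(1) NM(2) NQ(2)] by blast
  qed
  have "\<exists>T. mprime C T \<and> J0 \<subseteq> T \<and> T \<inter> S = {}"
    by (rule mprime_exists[OF C J0 SM Sne disj mult])
  then obtain T where T: "mprime C T" "J0 \<subseteq> T" "T \<inter> S = {}" by (elim exE conjE)
  have "pull C B f T \<subseteq> Q"
  proof (rule subsetI, rule ccontr)
    fix N assume N: "N \<in> pull C B f T" "N \<notin> Q"
    then have NM: "N \<in> modules K B" by (simp add: pull_def)
    have "rten C B f (?L (self_mod B)) N \<in> T"
      unfolding prime_rten[OF B C f T(1) LM[OF sB] NM] using N(1) by simp
    then show False using SI[OF NM N(2) sB mprimeD(2)[OF Q']] T(3) by blast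
  qed
  moreover have "Q \<subseteq> pull C B f T"
  proof
    fix N assume N: "N \<in> Q"
    then have NM: "N \<in> modules K B" using mprimeD(3)[OF Q] by blast
    have "res_mod f (rten C B f (self_mod C) N) \<in> Q"
      unfolding res_rten_prime[OF B C f Q sC NM] using N by simp
    then show "N \<in> pull C B f T"
      using T(2) NM rten_modules[OF B C f sC NM] unfolding pull_def J0_def by blast
  qed
  moreover have "pull C B f1 T \<subseteq> Q'"
  proof (rule subsetI, rule ccontr)
    fix N assume N: "N \<in> pull C B f1 T" "N \<notin> Q'"
    then have NM: "N \<in> modules K B" "?L N \<in> T" by (simp_all add: pull_def)
    have "rten C B f (?L N) (self_mod B) \<in> T"
      unfolding prime_rten[OF B C f T(1) LM[OF NM(1)] sB] using NM(2) by simp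
    then show False using SI[OF sB mprimeD(2)[OF Q] NM(1) N(2)] T(3) by blast
  qed
  ultimately show ?thesis using T(1) by blast
qed

text \<open>Either \<open>prime_pair_over\<close> applies, or for some \<open>N0\<close> outside
  \<open>Q'\<close> the restriction of \<open>C \<otimes>\<^sub>B N0\<close> lies in
  \<open>Q\<close>. In the latter case, for \<open>N\<close> in \<open>Q\<close> both summands of
  \<open>B \<otimes>\<^sub>A (N \<otimes> N0)\<close> lie in \<open>Q\<close>; as the traces on
  \<open>A\<close> agree, \<open>N \<otimes> N0\<close> lies in \<open>Q'\<close>, and so does
  \<open>N\<close>.\<close>

lemma tower_step_splits:
  assumes A: "tt_ring K A" and B: "tt_ring K B" and t: "ring_hom K A B t" and s: "tower_step K A t B t' C"
  shows "tt_ring K C \<and> ring_hom K B C t' \<and> (\<exists>f. splits A t B t' C f)"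
proof -
  interpret e: ring_extension K A B t by unfold_locales (fact A B t)+
  from e.tower_components[OF s] obtain f j1 j2 where C: "tt_ring K C" and t': "ring_hom K B C t'" and f: "ring_hom K B C f" "t' \<cdot> t = f \<cdot> t"
    and j: "j1 \<in> Hom (robj B) (Cod K (self_quot K A t B))" "j2 \<in> Hom (robj C) (Cod K (self_quot K A t B))"
      "e.i2 = j1 \<oplus> (j2 \<cdot> f)"
    and j1: "e.k1 \<cdot> (\<I> (robj B) \<odot> j1) = j1 \<cdot> mult B" "e.k2 \<cdot> (\<I> (robj B) \<odot> j1) = j1 \<cdot> mult B"
    and j2: "e.k1 \<cdot> (\<I> (robj B) \<odot> j2) = j2 \<cdot> mult C \<cdot> (t' \<odot> \<I> (robj C))"
      "e.k2 \<cdot> (\<I> (robj B) \<odot> j2) = j2 \<cdot> mult C \<cdot> (f \<odot> \<I> (robj C))"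
    by (elim exE conjE) (rule that)
  note ideal = e.tower_ideal[OF C t' f j j1 j2]
  note sC = self_mod_modules[OF C]
  have "Q \<subseteq> Q' \<or> (\<exists>T. mprime C T \<and> pull C B f T = Q \<and> pull C B t' T \<subseteq> Q')"
    if Q: "mprime B Q" and Q': "mprime B Q'" and p: "pull B A t Q = pull B A t Q'" for Q Q'
  proof (cases "\<exists>N0\<in>modules K B. N0 \<notin> Q' \<and> res_mod f (rten C B t' (self_mod C) N0) \<in> Q")
    case True
    then obtain N0 where N0: "N0 \<in> modules K B" "N0 \<notin> Q'" "res_mod f (rten C B t' (self_mod C) N0) \<in> Q" by blast
    have "Q \<subseteq> Q'"
    proof
      fix N assume N: "N \<in> Q"
      then have NM: "N \<in> modules K B" using mprimeD(3)[OF Q] by blast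
      let ?M = "rten B B (\<I> (robj B)) N N0"
      have MM: "?M \<in> modules K B" by (rule rten_modules[OF B B ring_hom_ident[OF B] NM N0(1)])
      let ?J = "{X \<in> modules K B. rten C B t' (self_mod C) X \<in> {L \<in> modules K C. res_mod f L \<in> Q}}"
      have J: "mthick B ?J"
        by (rule mthick_vimage_rten[OF B C t' mthick_vimage_res[OF B C f(1) mprimeD(1)[OF Q]] sC])
      have "N0 \<in> ?J" using N0(1,3) rten_modules[OF B C t' sC N0(1)] by simp
      from mthickD(6)[OF J NM this] have 1: "res_mod f (rten C B t' (self_mod C) ?M) \<in> Q" by simp
      have 2: "?M \<in> Q"
        unfolding mthick_comm[OF B mprimeD(1)[OF Q] NM N0(1)] by (rule mthickD(6)[OF mprimeD(1)[OF Q] N0(1) N])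
      have "res_mod t ?M \<in> pull B A t Q"
        using ideal[OF mprimeD(1)[OF Q] 2 1] res_mod_modules[OF A B t MM] by (simp add: pull_def)
      then have "?M \<in> Q'" unfolding p by (rule res_mod_pull[OF A B t mprimeD(1)[OF Q'] MM])
      then show "N \<in> Q'" using mprimeD(4)[OF Q' NM N0(1)] N0(2) by blast
    qed
    then show ?thesis ..
  next
    case False
    then show ?thesis using prime_pair_over[OF B C t' f(1) Q Q'] by blast
  qed
  then have "splits A t B t' C f" unfolding splits_def using f by blast
  then show ?thesis using C t' by blast
qed

end

context symmetric_monoidal_category
begin

lemma unit_ring_simps [simp]: "robj (unit_ring K) = \<one>" "mult (unit_ring K) = \<lambda>\<lambda> \<one>" "unit (unit_ring K) = \<I> \<one>"
  by (simp_all add: unit_ring_def)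

section \<open>Fibers over rings of finite degree\<close>

lemma tt_ring_unit_ring: "tt_ring K (unit_ring K)"
proof -
  have t: "(\<I> \<one> \<odot> \<lambda>\<lambda> \<one>) \<cdot> \<alpha> \<one> \<one> \<one> = \<lambda>\<lambda> \<one> \<odot> \<I> \<one>"
    using triangle[of \<one> \<one>] by (simp add: lunit_eq_runit)
  have t': "(\<lambda>\<lambda> \<one> \<odot> \<I> \<one>) \<cdot> ai \<one> \<one> \<one> = \<I> \<one> \<odot> \<lambda>\<lambda> \<one>"
    unfolding t[symmetric] by simp
  have "is_ring K (unit_ring K)"
    unfolding is_ring_def by (simp add: t) (rule lunit_eq_runit)
  moreover have "separable K (unit_ring K)"
    unfolding separable_def
  proof (rule bexI[of _ "inv_arrow K (\<lambda>\<lambda> \<one>)"], intro conjI)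
    let ?s = "inv_arrow K (\<lambda>\<lambda> \<one>)"
    show "(\<I> (robj (unit_ring K)) \<odot> mult (unit_ring K)) \<cdot> \<alpha> (robj (unit_ring K)) (robj (unit_ring K)) (robj (unit_ring K)) \<cdot>
        (?s \<odot> \<I> (robj (unit_ring K))) = ?s \<cdot> mult (unit_ring K)"
      by (simp add: t[THEN reassoc] merge)
    show "(mult (unit_ring K) \<odot> \<I> (robj (unit_ring K))) \<cdot>
        ai (robj (unit_ring K)) (robj (unit_ring K)) (robj (unit_ring K)) \<cdot> (\<I> (robj (unit_ring K)) \<odot> ?s) = ?s \<cdot> mult (unit_ring K)"
      by (simp add: t'[THEN reassoc] merge)
  qed simp_all
  ultimately show ?thesis
    unfolding tt_ring_def using lunit_braid[of \<one>] by (simp flip: lunit_eq_runit)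
qed

lemma ring_hom_unit:
  assumes A: "tt_ring K A"
  shows "ring_hom K (unit_ring K) A (unit A)"
proof -
  note [simp] = tt_ringD[OF A]
  have l: "mult A \<cdot> (unit A \<odot> \<I> (robj A)) = \<lambda>\<lambda> (robj A)"
    using A by (simp add: tt_ring_def is_ring_def)
  have "mult A \<cdot> (unit A \<odot> unit A) = (mult A \<cdot> (unit A \<odot> \<I> (robj A))) \<cdot> (\<I> \<one> \<odot> unit A)"
    by (simp add: merge)
  also have "\<dots> = unit A \<cdot> \<lambda>\<lambda> \<one>" unfolding l by (simp add: lunit_nat)
  finally show ?thesis by (simp add: ring_hom_def)
qed

end

context tt_category
begin

definition incomparable_fibers where
  "incomparable_fibers B A t \<longleftrightarrow> (\<forall>Q Q'. mprime B Q \<and> mprime B Q' \<and> pull B A t Q = pull B A t Q' \<and> Q' \<subseteq> Q \<longrightarrow> Q = Q')"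

definition fibers_card_le where
  "fibers_card_le B A t k \<longleftrightarrow> (\<forall>P. finite {Q. mprime B Q \<and> pull B A t Q = P} \<and> card {Q. mprime B Q \<and> pull B A t Q = P} \<le> k)"

text \<open>\<open>splits\<close> gives an inclusion of traces only. To upgrade it, \<open>Q\<close>
  is compared with a prime \<open>M\<close> minimal in the fiber. A prime \<open>T\<close> over
  \<open>Q\<close> along \<open>f\<close> has trace \<open>M\<close> along \<open>t'\<close> by
  minimality; going up along \<open>f\<close> gives \<open>T1 \<subseteq> T\<close> over
  \<open>M\<close>, whose trace along \<open>t'\<close> is again \<open>M\<close>; incomparability
  for \<open>t'\<close> forces \<open>T = T1\<close>, hence \<open>Q = M\<close>. For the bound, fix
  \<open>Q0\<close> in the fiber: by incomparability every other member comes from a prime of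
  \<open>C\<close> over \<open>Q0\<close>.\<close>

lemma fibers_step:
  assumes A: "tt_ring K A" and B: "tt_ring K B" and t: "ring_hom K A B t"
    and C: "tt_ring K C" and t': "ring_hom K B C t'" and s: "splits A t B t' C f"
    and i: "incomparable_fibers C B t'" and c: "fibers_card_le C B t' k"
  shows "incomparable_fibers B A t" "fibers_card_le B A t (Suc k)"
proof -
  from s have f: "ring_hom K B C f" and tf: "t' \<cdot> t = f \<cdot> t"
    and sp: "\<And>Q Q'. mprime B Q \<Longrightarrow> mprime B Q' \<Longrightarrow> pull B A t Q = pull B A t Q' \<Longrightarrow>
       Q \<subseteq> Q' \<or> (\<exists>T. mprime C T \<and> pull C B f T = Q \<and> pull C B t' T \<subseteq> Q')"
    unfolding splits_def by blast+
  have pt: "pull B A t (pull C B t' T) = pull B A t (pull C B f T)" if "mprime C T" for T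
    using pull_comp[OF A B C t t' mprimeD(1)[OF that]] pull_comp[OF A B C t f mprimeD(1)[OF that]] tf by simp
  have inc: "Q = Q'" if Q: "mprime B Q" and Q': "mprime B Q'" and p: "pull B A t Q = pull B A t Q'" and le: "Q' \<subseteq> Q" for Q Q'
  proof -
    from minimal_over[OF A B t Q'] obtain M where M: "mprime B M" "M \<subseteq> Q'" "pull B A t M = pull B A t Q'"
      and min: "\<And>R. mprime B R \<Longrightarrow> R \<subseteq> M \<Longrightarrow> pull B A t R = pull B A t Q' \<Longrightarrow> R = M" by blast
    from sp[OF Q M(1)] p M(3) consider "Q \<subseteq> M" | T where "mprime C T" "pull C B f T = Q" "pull C B t' T \<subseteq> M" by force
    then have "Q = M"
    proof cases
      case 1 then show ?thesis using M(2) le by blast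
    next
      case 2
      have 3: "pull C B t' T = M"
        using pt[OF 2(1)] 2 p by (intro min mprime_pull[OF B C t']) simp_all
      have "M \<subseteq> pull C B f T" using 2(2) M(2) le by blast
      from going_up[OF B C f 2(1) M(1) this] obtain T1 where T1: "mprime C T1" "T1 \<subseteq> T" "pull C B f T1 = M" by blast
      have "pull C B t' T1 \<subseteq> M" using T1(2) 3 unfolding pull_def by blast
      then have "pull C B t' T1 = M"
        using pt[OF T1(1)] T1(3) M(3) by (intro min mprime_pull[OF B C t' T1(1)]) simp_all
      then have "T = T1" using i 2(1) T1(1,2) 3 unfolding incomparable_fibers_def by blast
      then show ?thesis using T1(3) 2(2) by simp
    qed
    then show ?thesis using M(2) le by blast
  qed
  then show "incomparable_fibers B A t" unfolding incomparable_fibers_def by blast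
  show "fibers_card_le B A t (Suc k)" unfolding fibers_card_le_def
  proof
    fix P
    let ?F = "{Q. mprime B Q \<and> pull B A t Q = P}"
    show "finite ?F \<and> card ?F \<le> Suc k"
    proof (cases "?F = {}")
      case False
      then obtain Q0 where Q0: "mprime B Q0" "pull B A t Q0 = P" by blast
      let ?H = "{T. mprime C T \<and> pull C B t' T = Q0}"
      \<comment> \<open>This accounts for \<open>Suc k\<close>: the prime \<open>Q0\<close> itself,
        and the images under \<open>pull C B f\<close> of the at most \<open>k\<close> primes over
        \<open>Q0\<close>.\<close>
      have sub: "?F \<subseteq> insert Q0 (pull C B f ` ?H)"
      proof
        fix Q assume "Q \<in> ?F"
        then have Q: "mprime B Q" "pull B A t Q = P" by blast+
        from sp[OF Q(1) Q0(1)] Q(2) Q0(2) consider "Q \<subseteq> Q0" | T where "mprime C T" "pull C B f T = Q" "pull C B t' T \<subseteq> Q0" by force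
        then show "Q \<in> insert Q0 (pull C B f ` ?H)"
        proof cases
          case 1
          have "pull B A t Q0 = pull B A t Q" unfolding Q(2) Q0(2) ..
          then have "Q0 = Q" by (rule inc[OF Q0(1) Q(1) _ 1])
          then show ?thesis by simp
        next
          case 2
          have "pull B A t Q0 = pull B A t (pull C B t' T)" unfolding pt[OF 2(1)] 2(2) Q(2) Q0(2) ..
          then have "Q0 = pull C B t' T" by (rule inc[OF Q0(1) mprime_pull[OF B C t' 2(1)] _ 2(3)])
          then show ?thesis using 2(1,2) by blast
        qed
      qed
      have H: "finite ?H" "card ?H \<le> k" using c unfolding fibers_card_le_def by blast+
      have "card ?F \<le> card (insert Q0 (pull C B f ` ?H))" by (rule card_mono[OF _ sub]) (simp add: H)
      also have "\<dots> \<le> Suc (card (pull C B f ` ?H))" by (rule card_insert_le_m1) (simp_all add: H)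
      also have "\<dots> \<le> Suc k" using card_image_le[OF H(1), of "pull C B f"] H(2) by simp
      finally show ?thesis using finite_subset[OF sub] H(1) by simp
    next
      case True
      show ?thesis unfolding True by simp
    qed
  qed
qed

lemma no_mprime_zero:
  assumes C: "tt_ring K C" and z: "zero_object K (robj C)"
  shows "\<not> mprime C Q"
  using mthickD(2)[of C Q "self_mod C"] self_mod_modules[OF C] z mprimeD(1,2)[of C Q] by auto

lemma splitting_tower_rings:
  assumes A: "tt_ring K A" and s: "splitting_tower K A R t"
  shows "tt_ring K (R n) \<and> tt_ring K (R (Suc n)) \<and> ring_hom K (R n) (R (Suc n)) (t n)"
proof (induction n)
  case 0
  show ?case using s tt_ring_unit_ring A ring_hom_unit[OF A] by (simp add: splitting_tower_def)
next
  case (Suc n)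
  have "tower_step K (R n) (t n) (R (Suc n)) (t (Suc n)) (R (Suc (Suc n)))"
    using s unfolding splitting_tower_def by (elim conjE allE[of _ "Suc n"]) simp
  then show ?case using tower_step_splits[of "R n" "R (Suc n)" "t n"] Suc.IH by blast
qed

text \<open>Induction down the tower. The arrow \<open>t d\<close> has empty fibers since its target
  \<open>R (d + 1)\<close> is zero, each step down adds one point, and \<open>t 0\<close> is the
  unit of \<open>A\<close>.\<close>

lemma has_degree_fibers:
  assumes A: "tt_ring K A" and d: "has_degree K A d"
  shows "incomparable_fibers A (unit_ring K) (unit A) \<and> fibers_card_le A (unit_ring K) (unit A) d"
proof -
  from d obtain R t where s: "splitting_tower K A R t" and z: "zero_object K (robj (R (Suc d)))"
    unfolding has_degree_def by auto
  note r = splitting_tower_rings[OF A s]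
  have base: "incomparable_fibers (R (Suc d)) (R d) (t d) \<and> fibers_card_le (R (Suc d)) (R d) (t d) 0"
    unfolding incomparable_fibers_def fibers_card_le_def
    using no_mprime_zero[of "R (Suc d)"] r[of d] z by simp
  have "m \<le> d \<Longrightarrow> incomparable_fibers (R (Suc m)) (R m) (t m) \<and> fibers_card_le (R (Suc m)) (R m) (t m) (d - m)" for m
  proof (induction rule: inc_induct)
    case base
    show ?case using \<open>incomparable_fibers (R (Suc d)) (R d) (t d) \<and> fibers_card_le (R (Suc d)) (R d) (t d) 0\<close> by simp
  next
    case (step m)
    have ts: "tower_step K (R m) (t m) (R (Suc m)) (t (Suc m)) (R (Suc (Suc m)))"
      using s unfolding splitting_tower_def by (elim conjE allE[of _ "Suc m"]) simp
    from tower_step_splits[OF _ _ _ ts] r[of m] obtain f where f: "splits (R m) (t m) (R (Suc m)) (t (Suc m)) (R (Suc (Suc m))) f" by blast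
    have "Suc (d - Suc m) = d - m" using step.hyps by simp
    then show ?case
      using fibers_step[of "R m" "R (Suc m)" "t m" "R (Suc (Suc m))" "t (Suc m)" f "d - Suc m"] r[of m] r[of "Suc m"] f step.IH by simp
  qed
  from this[of 0] show ?thesis using s by (simp add: splitting_tower_def)
qed

end

context symmetric_monoidal_category
begin

section \<open>Modules over the unit\<close>

lemma ext_lunit:
  assumes [simp]: "x \<in> Ob K" "y \<in> Ob K"
  shows "ext \<one> x (\<lambda>\<lambda> x) y = \<lambda>\<lambda> (x \<otimes> y)"
  unfolding ext_def lunit_tensor[OF assms, symmetric] by simp

lemma lift_lunit:
  assumes [simp]: "x \<in> Ob K" "y \<in> Ob K"
  shows "lift x \<one> (\<lambda>\<lambda> y) y = \<lambda>\<lambda> (x \<otimes> y)"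
proof -
  have r: "\<rho>\<rho> x \<cdot> \<gamma> \<one> x = \<lambda>\<lambda> x"
    unfolding lunit_braid[OF assms(1), symmetric] by simp
  have "lift x \<one> (\<lambda>\<lambda> y) y = ((\<I> x \<odot> \<lambda>\<lambda> y) \<cdot> \<alpha> x \<one> y) \<cdot> (\<gamma> \<one> x \<odot> \<I> y) \<cdot> ai \<one> x y"
    by (simp add: lift_def sw_def)
  also have "\<dots> = ((\<rho>\<rho> x \<cdot> \<gamma> \<one> x) \<odot> \<I> y) \<cdot> ai \<one> x y"
    using triangle[OF assms] by (simp add: merge)
  also have "\<dots> = ext \<one> x (\<lambda>\<lambda> x) y" unfolding r by (simp add: ext_def)
  finally show ?thesis unfolding ext_lunit[OF assms] .
qed

text \<open>Objects of \<open>K\<close> as modules over the unit ring. Through this identification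
  the results on a ring map \<open>B \<rightarrow> C\<close> apply to \<open>unit A\<close>, and
  \<open>pull\<close> becomes \<open>phi\<close>.\<close>

definition triv :: "'a \<Rightarrow> 'a \<times> 'b" where
  "triv x = (x, \<lambda>\<lambda> x)"

lemma triv_simps [simp]: "fst (triv x) = x" "snd (triv x) = \<lambda>\<lambda> x" "triv x = triv y \<longleftrightarrow> x = y"
  by (auto simp: triv_def)

lemma uext_ident: "x \<in> Ob K \<Longrightarrow> uext (\<I> \<one>) x = inv_arrow K (\<lambda>\<lambda> x)"
  by (simp add: uext_def)

lemma triv_modules: "x \<in> Ob K \<Longrightarrow> triv x \<in> modules K (unit_ring K)"
  unfolding modules_iff[OF tt_ring_unit_ring] action_def
  by (simp add: uext_ident ext_lunit lunit_nat)

lemma modules_unit_ring: "modules K (unit_ring K) = triv ` Ob K"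
proof (intro set_eqI iffI)
  fix M assume M: "M \<in> modules K (unit_ring K)"
  note [simp] = modulesD(1-4)[OF tt_ring_unit_ring M, simplified]
  have u: "snd M \<cdot> inv_arrow K (\<lambda>\<lambda> (fst M)) = \<I> (fst M)"
    using modulesD(6)[OF tt_ring_unit_ring M] by (simp add: uext_ident)
  have "(snd M \<cdot> inv_arrow K (\<lambda>\<lambda> (fst M))) \<cdot> \<lambda>\<lambda> (fst M) = snd M" by simp
  then have "M = triv (fst M)" unfolding u by (simp add: triv_def prod_eq_iff)
  then show "M \<in> triv ` Ob K" using \<open>fst M \<in> Ob K\<close> by blast
qed (auto simp: triv_modules)

lemma mhom_triv:
  assumes "x \<in> Ob K" "y \<in> Ob K"
  shows "mhom (unit_ring K) (triv x) (triv y) f \<longleftrightarrow> f \<in> Hom x y"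
  using assms triv_modules by (auto simp: mhom_def lunit_nat)

lemma self_mod_unit_ring: "self_mod (unit_ring K) = triv \<one>"
  by (simp add: self_mod_def triv_def)

end

context tt_category
begin

abbreviation (input) "O1 \<equiv> unit_ring K"

text \<open>Over the unit ring both actions on \<open>fst L \<otimes> y\<close> are the left unitor,
  so the identity is balanced and the quotient map is invertible.\<close>

lemma rten_triv:
  assumes C: "tt_ring K C" and L: "L \<in> modules K C" and y: "y \<in> Ob K"
  shows "miso C (rten C O1 (unit C) L (triv y)) (fst L \<otimes> y, ext (robj C) (fst L) (snd L) y)"
proof -
  note O = tt_ring_unit_ring and u = ring_hom_unit[OF C] and Y = triv_modules[OF y]
  note [simp] = y tt_ringD[OF C] modulesD(1-4)[OF C L]
  let ?q = "tensor_quot K O1 (res_mod (unit C) L) (triv y)"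
  let ?M = "(fst L \<otimes> y, ext (robj C) (fst L) (snd L) y)"
  have aL: "action C (fst L) (snd L)" using L modules_iff[OF C] by simp
  then have M: "?M \<in> modules K C"
    unfolding modules_iff[OF C] using action_ext[OF C aL y] by simp
  have s: "snd L \<cdot> (unit C \<odot> \<I> (fst L)) = \<lambda>\<lambda> (fst L)"
    using L by (auto simp: modules_def)
  have b: "\<I> (fst L \<otimes> y) \<cdot> lact O1 (res_mod (unit C) L) (fst (triv y)) = \<I> (fst L \<otimes> y) \<cdot> ract O1 (fst L) (triv y)"
    by (simp add: res_mod_def s ext_lunit lift_lunit)
  note q = rq[OF O C u L Y, simplified]
  have 1: "mhom C (rten C O1 (unit C) L (triv y)) ?M (\<I> (fst L \<otimes> y) \<cdot> tsec O1 (res_mod (unit C) L) (triv y))"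
    "\<I> (fst L \<otimes> y) \<cdot> tsec O1 (res_mod (unit C) L) (triv y) \<cdot> ?q = \<I> (fst L \<otimes> y)"
    by (rule rten_univ[OF O C u L Y M _ b]; simp)+
  have h: "mhom C (rten C O1 (unit C) L (triv y)) ?M (tsec O1 (res_mod (unit C) L) (triv y))"
    using 1(1) q(4-6) by simp
  show ?thesis
    by (rule misoI[OF C h, of ?q]) (use 1(2) q(1,2,4-7) rten_fst[OF O C u L Y] in simp_all)
qed

lemma rten_triv_triv:
  assumes x: "x \<in> Ob K" and y: "y \<in> Ob K"
  shows "miso O1 (rten O1 O1 (\<I> \<one>) (triv x) (triv y)) (triv (x \<otimes> y))"
  using rten_triv[OF tt_ring_unit_ring triv_modules[OF x] y] x y by (simp add: ext_lunit triv_def[of "x \<otimes> y"])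

lemma rten_triv_self:
  assumes C: "tt_ring K C" and y: "y \<in> Ob K"
  shows "miso C (rten C O1 (unit C) (self_mod C) (triv y)) (extension K C y)"
  using rten_triv[OF C self_mod_modules[OF C] y] by (simp add: extension_def ext_def)

lemma susp_mod_triv:
  assumes "x \<in> Ob K"
  shows "susp_mod K O1 (triv x) = triv (\<Sigma> x)"
proof -
  obtain z where z: "susp_mod K O1 (triv x) = triv z"
    using susp_mod_modules[OF tt_ring_unit_ring triv_modules[OF assms]] unfolding modules_unit_ring by blast
  have "z = \<Sigma> x" using arg_cong[OF z, of fst] by simp
  then show ?thesis unfolding z by simp
qed

lemma triv_mem [simp]: "triv x \<in> triv ` J \<longleftrightarrow> x \<in> J"
  by auto

lemma triv_image_eq: "triv ` P = triv ` P' \<longleftrightarrow> P = P'" "triv ` P \<subseteq> triv ` P' \<longleftrightarrow> P \<subseteq> P'"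
proof -
  have "inj triv" by (rule injI) simp
  then show "triv ` P = triv ` P' \<longleftrightarrow> P = P'" "triv ` P \<subseteq> triv ` P' \<longleftrightarrow> P \<subseteq> P'"
    by (rule inj_image_eq_iff, rule inj_image_subset_iff)
qed

lemma thick_idealD:
  assumes "thick_ideal K J"
  shows "J \<subseteq> Ob K" "\<And>z. zero_object K z \<Longrightarrow> z \<in> J" "\<And>x. x \<in> Ob K \<Longrightarrow> \<Sigma> x \<in> J \<longleftrightarrow> x \<in> J"
    "\<And>f g h. (f, g, h) \<in> Tri K \<Longrightarrow> Dom K f \<in> J \<Longrightarrow> Cod K f \<in> J \<Longrightarrow> Cod K g \<in> J"
    "\<And>f g h. (f, g, h) \<in> Tri K \<Longrightarrow> Cod K f \<in> J \<Longrightarrow> Cod K g \<in> J \<Longrightarrow> Dom K f \<in> J"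
    "\<And>f g h. (f, g, h) \<in> Tri K \<Longrightarrow> Dom K f \<in> J \<Longrightarrow> Cod K g \<in> J \<Longrightarrow> Cod K f \<in> J"
    "\<And>x y. x \<in> Ob K \<Longrightarrow> y \<in> J \<Longrightarrow> x \<otimes> y \<in> J"
proof -
  show "J \<subseteq> Ob K" using assms unfolding thick_ideal_def by (elim conjE)
  have "\<forall>z. zero_object K z \<longrightarrow> z \<in> J" using assms unfolding thick_ideal_def by (elim conjE)
  moreover have "\<forall>x\<in>Ob K. \<Sigma> x \<in> J \<longleftrightarrow> x \<in> J" using assms unfolding thick_ideal_def by (elim conjE)
  moreover have "\<forall>x\<in>Ob K. \<forall>y\<in>J. x \<otimes> y \<in> J" using assms unfolding thick_ideal_def by (elim conjE)
  ultimately show "\<And>z. zero_object K z \<Longrightarrow> z \<in> J" "\<And>x. x \<in> Ob K \<Longrightarrow> \<Sigma> x \<in> J \<longleftrightarrow> x \<in> J"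
    "\<And>x y. x \<in> Ob K \<Longrightarrow> y \<in> J \<Longrightarrow> x \<otimes> y \<in> J"
    by blast+
  have t: "\<forall>f g h. (f, g, h) \<in> Tri K \<longrightarrow>
        (Dom K f \<in> J \<and> Cod K f \<in> J \<longrightarrow> Cod K g \<in> J) \<and>
        (Cod K f \<in> J \<and> Cod K g \<in> J \<longrightarrow> Dom K f \<in> J) \<and>
        (Dom K f \<in> J \<and> Cod K g \<in> J \<longrightarrow> Cod K f \<in> J)"
    using assms unfolding thick_ideal_def by (elim conjE)
  show "\<And>f g h. (f, g, h) \<in> Tri K \<Longrightarrow> Dom K f \<in> J \<Longrightarrow> Cod K f \<in> J \<Longrightarrow> Cod K g \<in> J"
    "\<And>f g h. (f, g, h) \<in> Tri K \<Longrightarrow> Cod K f \<in> J \<Longrightarrow> Cod K g \<in> J \<Longrightarrow> Dom K f \<in> J"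
    "\<And>f g h. (f, g, h) \<in> Tri K \<Longrightarrow> Dom K f \<in> J \<Longrightarrow> Cod K g \<in> J \<Longrightarrow> Cod K f \<in> J"
    by (drule t[THEN spec, THEN spec, THEN spec, THEN mp], elim conjE, erule mp, rule conjI; assumption)+
qed

lemma mthick_triv:
  assumes J: "J \<subseteq> Ob K"
  shows "mthick O1 (triv ` J) \<longleftrightarrow> thick_ideal K J"
proof
  assume t: "mthick O1 (triv ` J)"
  note D = mthickD[OF t]
  show "thick_ideal K J"
    unfolding thick_ideal_def
  proof (intro conjI ballI allI impI)
    show "J \<subseteq> Ob K" by (rule J)
    show "z \<in> J" if "zero_object K z" for z
      using D(2)[of "triv z"] that triv_modules[of z] by (simp add: zero_object_def)
    show "\<Sigma> x \<in> J \<longleftrightarrow> x \<in> J" if "x \<in> Ob K" for x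
      using D(3)[OF triv_modules[OF that]] by (simp add: susp_mod_triv[OF that])
    fix f g h assume T: "(f, g, h) \<in> Tri K"
    note [simp] = Tri_simps[OF T]
    have "(triv (Dom K f) \<in> triv ` J \<and> triv (Cod K f) \<in> triv ` J \<longrightarrow> triv (Cod K g) \<in> triv ` J) \<and>
      (triv (Cod K f) \<in> triv ` J \<and> triv (Cod K g) \<in> triv ` J \<longrightarrow> triv (Dom K f) \<in> triv ` J) \<and>
      (triv (Dom K f) \<in> triv ` J \<and> triv (Cod K g) \<in> triv ` J \<longrightarrow> triv (Cod K f) \<in> triv ` J)"
      by (rule D(4)[OF _ _ _ T]) (simp_all add: mhom_triv susp_mod_triv)
    then show "Dom K f \<in> J \<and> Cod K f \<in> J \<Longrightarrow> Cod K g \<in> J" "Cod K f \<in> J \<and> Cod K g \<in> J \<Longrightarrow> Dom K f \<in> J"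
      "Dom K f \<in> J \<and> Cod K g \<in> J \<Longrightarrow> Cod K f \<in> J"
      by simp_all
  next
    fix x y s i j p q assume x: "x \<in> Ob K" and y: "y \<in> Ob K" and s: "s \<in> J" and b: "biproduct K x y s i j p q"
    note [simp] = x y biproductD[OF b x y]
    show "x \<in> J" using D(5)[of "triv x" "triv s", OF mretI[of _ _ _ i p]] s by (simp add: mhom_triv)
    show "y \<in> J" using D(5)[of "triv y" "triv s", OF mretI[of _ _ _ j q]] s by (simp add: mhom_triv)
  next
    fix x y assume x: "x \<in> Ob K" and y: "y \<in> J"
    then have yO: "y \<in> Ob K" using J by blast
    show "x \<otimes> y \<in> J"
      using D(6)[OF triv_modules[OF x], of "triv y"] y miso_mthick[OF t rten_triv_triv[OF x yO]] by simp
  qed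
next
  assume t: "thick_ideal K J"
  have Ob: "x \<in> Ob K" if "x \<in> J" for x using that J by blast
  \<comment> \<open>\<open>thick_ideal\<close> speaks of biproducts, so the retract is completed by
    its complement.\<close>
  have mret: "M \<in> triv ` J" if r: "mret O1 M N" and N: "N \<in> triv ` J" for M N
  proof -
    from mret_biproduct[OF tt_ring_unit_ring r] obtain M' I J' P Q where M': "M' \<in> modules K O1" "biproduct (Mod K O1) M M' N I J' P Q"
      by blast
    from M'(2) obtain i j p q where b: "mhom O1 M N i" "mhom O1 M' N j" "mhom O1 N M p" "mhom O1 N M' q"
      "p \<cdot> i = \<I> (fst M)" "q \<cdot> j = \<I> (fst M')" "p \<cdot> j = Zero K (fst M') (fst M)" "q \<cdot> i = Zero K (fst M) (fst M')"
       "(i \<cdot> p) \<oplus> (j \<cdot> q) = \<I> (fst N)"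
      unfolding biproduct_Mod by (elim conjE exE) (rule that)
    have MM: "M \<in> modules K O1" using mhomD(1)[OF b(1)] .
    from MM obtain x where x: "M = triv x" "x \<in> Ob K" unfolding modules_unit_ring by blast
    from M'(1) obtain y where y: "M' = triv y" "y \<in> Ob K" unfolding modules_unit_ring by blast
    from N obtain s where s: "N = triv s" "s \<in> J" by blast
    have "biproduct K x y s i j p q"
      unfolding biproduct_def using b Ob[OF s(2)] x(2) y(2) unfolding x(1) y(1) s(1) by (simp add: mhom_triv)
    then have "x \<in> J" using t x(2) y(2) s(2) unfolding thick_ideal_def by blast
    then show ?thesis using x(1) by simp
  qed
  show "mthick O1 (triv ` J)"
  proof (rule mthickI)
    show "triv ` J \<subseteq> modules K O1" using J by (auto simp: triv_modules)
    show "M \<in> triv ` J" if "M \<in> modules K O1" "zero_object K (fst M)" for M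
      using that t unfolding modules_unit_ring thick_ideal_def by auto
    show "susp_mod K O1 M \<in> triv ` J \<longleftrightarrow> M \<in> triv ` J" if M: "M \<in> modules K O1" for M
    proof -
      from M obtain x where x: "M = triv x" "x \<in> Ob K" unfolding modules_unit_ring by blast
      then show ?thesis using t unfolding x(1) susp_mod_triv[OF x(2)] thick_ideal_def by simp
    qed
    show "M \<in> triv ` J" if "mret O1 M N" "N \<in> triv ` J" for M N by (rule mret[OF that])
    show "rten O1 O1 (\<I> (robj O1)) M N \<in> triv ` J" if M: "M \<in> modules K O1" and N: "N \<in> triv ` J" for M N
    proof -
      from M obtain x where x: "M = triv x" "x \<in> Ob K" unfolding modules_unit_ring by blast
      from N obtain y where y: "N = triv y" "y \<in> J" by blast
      have "triv (x \<otimes> y) \<in> triv ` J" using t x(2) y(2) unfolding thick_ideal_def by simp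
      from mret[OF miso_mret[OF rten_triv_triv[OF x(2) Ob[OF y(2)]]] this] show ?thesis unfolding x y by simp
    qed
    show "(L \<in> triv ` J \<and> M \<in> triv ` J \<longrightarrow> N \<in> triv ` J) \<and> (M \<in> triv ` J \<and> N \<in> triv ` J \<longrightarrow> L \<in> triv ` J) \<and>
        (L \<in> triv ` J \<and> N \<in> triv ` J \<longrightarrow> M \<in> triv ` J)"
      if h: "mhom O1 L M f" "mhom O1 M N g" "mhom O1 N (susp_mod K O1 L) h" "(f, g, h) \<in> Tri K" for L M N f g h
    proof -
      obtain x where x: "L = triv x" "x \<in> Ob K" using mhomD(1)[OF h(1)] unfolding modules_unit_ring by blast
      obtain y where y: "M = triv y" "y \<in> Ob K" using mhomD(2)[OF h(1)] unfolding modules_unit_ring by blast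
      obtain z where z: "N = triv z" "z \<in> Ob K" using mhomD(2)[OF h(2)] unfolding modules_unit_ring by blast
      have e: "Dom K f = x" "Cod K f = y" "Cod K g = z"
        using mhomD(4,5)[OF h(1)] mhomD(5)[OF h(2)] unfolding x(1) y(1) z(1) by simp_all
      note D = thick_idealD(4-6)[OF t h(4), unfolded e]
      show ?thesis unfolding x(1) y(1) z(1) triv_mem using D by blast
    qed
  qed
qed

lemma mprime_triv:
  assumes P: "P \<subseteq> Ob K"
  shows "mprime O1 (triv ` P) \<longleftrightarrow> prime_ideal K P"
proof (cases "mthick O1 (triv ` P)")
  case False
  then show ?thesis using mthick_triv[OF P] by (simp add: mprime_def prime_ideal_def)
next
  case True
  have "self_mod O1 \<notin> triv ` P \<longleftrightarrow> P \<noteq> Ob K"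
  proof -
    have "triv ` P = triv ` Ob K" if "\<one> \<in> P"
      using mthick_self[OF tt_ring_unit_ring True] that unfolding self_mod_unit_ring modules_unit_ring by simp
    then have "P = Ob K" if "\<one> \<in> P" using that by (simp add: triv_image_eq)
    then show ?thesis unfolding self_mod_unit_ring triv_mem using Unit_Ob by blast
  qed
  moreover have "(\<forall>M\<in>modules K O1. \<forall>N\<in>modules K O1. rten O1 O1 (\<I> (robj O1)) M N \<in> triv ` P \<longrightarrow> M \<in> triv ` P \<or> N \<in> triv ` P) \<longleftrightarrow>
    (\<forall>x\<in>Ob K. \<forall>y\<in>Ob K. x \<otimes> y \<in> P \<longrightarrow> x \<in> P \<or> y \<in> P)"
  proof -
    have "rten O1 O1 (\<I> (robj O1)) (triv x) (triv y) \<in> triv ` P \<longleftrightarrow> x \<otimes> y \<in> P" if "x \<in> Ob K" "y \<in> Ob K" for x y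
      using miso_mthick[OF True rten_triv_triv[OF that]] by simp
    then show ?thesis unfolding modules_unit_ring by simp
  qed
  ultimately show ?thesis using True mthick_triv[OF P] by (simp add: mprime_def prime_ideal_def)
qed

lemma prime_ideal_subset: "prime_ideal K P \<Longrightarrow> P \<subseteq> Ob K"
  by (simp add: prime_ideal_def thick_ideal_def)

lemma mprime_unit_ring: "mprime O1 Q \<longleftrightarrow> (\<exists>P. prime_ideal K P \<and> Q = triv ` P)"
proof
  assume Q: "mprime O1 Q"
  have "Q \<subseteq> triv ` Ob K" using mprimeD(3)[OF Q] unfolding modules_unit_ring .
  then obtain P where "P \<subseteq> Ob K" "Q = triv ` P" unfolding subset_image_iff by blast
  then show "\<exists>P. prime_ideal K P \<and> Q = triv ` P" using mprime_triv[of P] Q by blast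
qed (use mprime_triv prime_ideal_subset in blast)

lemma pull_unit:
  assumes A: "tt_ring K A" and T: "mthick A T"
  shows "pull A O1 (unit A) T = triv ` phi K A T"
  unfolding pull_def phi_def Spc_map_def modules_unit_ring
  using miso_mthick[OF T rten_triv_self[OF A]] by auto

lemma res_unit:
  assumes A: "tt_ring K A" and L: "L \<in> modules K A"
  shows "res_mod (unit A) L = triv (fst L)"
  using L by (auto simp: modules_def res_mod_def triv_def)

lemma thick_ideal_retract:
  assumes J: "thick_ideal K J" and s: "s \<in> J" and i: "i \<in> Hom x s" and p: "p \<in> Hom s x" and e: "p \<cdot> i = \<I> x"
  shows "x \<in> J"
proof -
  have Ob: "s \<in> Ob K" using thick_idealD(1)[OF J] s by blast
  have x: "x \<in> Ob K" using i Dom_Ob[of i] by simp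
  have t: "mthick O1 (triv ` J)" using mthick_triv[OF thick_idealD(1)[OF J]] J by blast
  have "mret O1 (triv x) (triv s)"
    by (rule mretI[of _ _ _ i p]) (use x Ob i p e in \<open>simp_all add: mhom_triv\<close>)
  from mthickD(5)[OF t this] show ?thesis using s by simp
qed

section \<open>Nil-faithfulness\<close>

text \<open>For a thick ideal \<open>P\<close>, these are the arrows inverted in the Verdier
  quotient of \<open>K\<close> by \<open>P\<close>.\<close>

definition cone_in where
  "cone_in P f \<longleftrightarrow> (\<exists>g h. (f, g, h) \<in> Tri K \<and> Cod K g \<in> P)"

lemma cone_in_Ar: "cone_in P f \<Longrightarrow> f \<in> Ar K"
  using Tri_simps(1) by (auto simp: cone_in_def)

text \<open>Two cones of \<open>f\<close> map to each other by the morphism axiom, and the round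
  trip is invertible by \<open>Tri_endomorphism_iso\<close>; so the given cone is a retract of the
  one in \<open>P\<close>.\<close>

lemma cone_in_Tri:
  assumes P: "thick_ideal K P" and c: "cone_in P f" and t: "(f, g, h) \<in> Tri K"
  shows "Cod K g \<in> P"
proof -
  from c obtain g' h' where t': "(f, g', h') \<in> Tri K" and g': "Cod K g' \<in> P" unfolding cone_in_def by blast
  note [simp] = Tri_simps[OF t] Tri_simps[OF t']
  have comparison: "\<exists>c\<in>Hom (Cod K g1) (Cod K g2). c \<cdot> g1 = g2 \<and> h2 \<cdot> c = h1"
    if t1: "(f, g1, h1) \<in> Tri K" and t2: "(f, g2, h2) \<in> Tri K" for g1 h1 g2 h2
  proof -
    note s = Tri_simps[OF t1] Tri_simps[OF t2]
    have "\<exists>c\<in>Hom (Cod K g1) (Cod K g2). c \<cdot> g1 = g2 \<cdot> \<I> (Cod K f) \<and> \<S> (\<I> (Dom K f)) \<cdot> h1 = h2 \<cdot> c"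
      by (rule Tri_morphism[OF t1 t2]) (simp_all add: s)
    moreover have "g2 \<cdot> \<I> (Cod K f) = g2" "\<S> (\<I> (Dom K f)) \<cdot> h1 = h1" by (simp_all add: s)
    ultimately show ?thesis by metis
  qed
  from comparison[OF t t'] obtain c where c: "c \<in> Hom (Cod K g) (Cod K g')" "c \<cdot> g = g'" "h' \<cdot> c = h" by (elim bexE conjE)
  from comparison[OF t' t] obtain d where d: "d \<in> Hom (Cod K g') (Cod K g)" "d \<cdot> g' = g" "h \<cdot> d = h'" by (elim bexE conjE)
  note [simp] = c(1)[unfolded Hom_iff] d(1)[unfolded Hom_iff]
  have i: "iso K (d \<cdot> c)"
  proof (rule Tri_endomorphism_iso[OF t])
    show "(d \<cdot> c) \<cdot> g = g" using d(2) by (simp add: c(2))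
    have "h \<cdot> (d \<cdot> c) = (h \<cdot> d) \<cdot> c" by simp
    then show "h \<cdot> (d \<cdot> c) = h" unfolding d(3) c(3) .
  qed simp
  show ?thesis
    by (rule thick_ideal_retract[OF P g', of c _ "inv_arrow K (d \<cdot> c) \<cdot> d"])
      (use i inv_arrow_simps(4)[OF i] in simp_all)
qed

text \<open>An octahedron exhibits the cone of \<open>g \<cdot> f\<close> as the middle term of a
  triangle on the cones of \<open>f\<close> and \<open>g\<close>.\<close>

lemma cone_in_comp:
  assumes P: "thick_ideal K P" and f: "cone_in P f" and g: "cone_in P g" and fg: "Cod K f = Dom K g"
  shows "cone_in P (g \<cdot> f)"
proof -
  obtain Oct where Oct: "\<forall>X\<in>Oct. octahedron K X"
    "\<forall>f\<in>Ar K. \<forall>g\<in>Ar K. Cod K f = Dom K g \<longrightarrow>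
         (\<exists>f1 f2 g1 g2 k1 k2 u v. (f, g, f1, f2, g1, g2, k1, k2, u, v) \<in> Oct)"
    using distinguished_octahedra by (elim exE conjE) (rule that)
  from Oct(2)[THEN bspec, OF cone_in_Ar[OF f], THEN bspec, OF cone_in_Ar[OF g], THEN mp, OF fg]
  obtain f1 f2 g1 g2 k1 k2 u v where "(f, g, f1, f2, g1, g2, k1, k2, u, v) \<in> Oct" by (elim exE)
  from Oct(1)[THEN bspec, OF this] have o: "(f, f1, f2) \<in> Tri K" "(g, g1, g2) \<in> Tri K" "(g \<cdot> f, k1, k2) \<in> Tri K"
    "u \<in> Hom (Cod K f1) (Cod K k1)" "v \<in> Hom (Cod K k1) (Cod K g1)" "(u, v, \<S> f1 \<cdot> g2) \<in> Tri K"
    unfolding octahedron_def prod.case by simp_all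
  have "Cod K u \<in> P"
    using thick_idealD(6)[OF P o(6)] cone_in_Tri[OF P f o(1)] cone_in_Tri[OF P g o(2)] o(4,5) by simp
  then show ?thesis using o(3,4) unfolding cone_in_def by auto
qed

lemma cone_in_TenA:
  assumes P: "thick_ideal K P" and f: "cone_in P f" and x: "x \<in> Ob K"
  shows "cone_in P (\<I> x \<odot> f)" "cone_in P (f \<odot> \<I> x)"
proof -
  from f obtain g h where t: "(f, g, h) \<in> Tri K" and g: "Cod K g \<in> P" unfolding cone_in_def by blast
  note [simp] = Tri_simps[OF t] x
  note e = Ten_exact[OF x t]
  have xg: "x \<otimes> Cod K g \<in> P" by (rule thick_idealD(7)[OF P x g])
  then show "cone_in P (\<I> x \<odot> f)" using e unfolding cone_in_def by auto
  have "(f \<odot> \<I> x, (\<I> x \<odot> g) \<cdot> \<gamma> (Cod K f) x, \<S> (\<gamma> x (Dom K f)) \<cdot> \<theta> x (Dom K f) \<cdot> (\<I> x \<odot> h)) \<in> Tri K"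
    by (rule Tri_iso[OF e, of _ "Dom K f \<otimes> x" "Cod K f \<otimes> x" _ "x \<otimes> Cod K g" _ "\<gamma> x (Dom K f)" "\<gamma> x (Cod K f)" "\<I> (x \<otimes> Cod K g)"])
      (simp_all add: braid_nat)
  moreover have "Cod K ((\<I> x \<odot> g) \<cdot> \<gamma> (Cod K f) x) \<in> P" using xg by simp
  ultimately show "cone_in P (f \<odot> \<I> x)" unfolding cone_in_def by blast
qed

lemma tensor_power_Suc: "tensor_power K f (Suc (Suc n)) = tensor_power K f (Suc n) \<odot> f"
  by simp

lemma tensor_power_simps:
  assumes [simp]: "f \<in> Ar K"
  shows "tensor_power K f (Suc n) \<in> Ar K"
  by (induction n) simp_all

lemma cone_in_tensor_power:
  assumes P: "thick_ideal K P" and f: "cone_in P f"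
  shows "cone_in P (tensor_power K f (Suc n))"
proof (induction n)
  case 0
  then show ?case using f by simp
next
  case (Suc n)
  let ?T = "tensor_power K f (Suc n)"
  note [simp] = cone_in_Ar[OF f] tensor_power_simps[OF cone_in_Ar[OF f]]
  have "?T \<odot> f = (?T \<odot> \<I> (Cod K f)) \<cdot> (\<I> (Dom K ?T) \<odot> f)" by (simp add: merge del: tensor_power.simps)
  then show ?case
    using cone_in_comp[OF P cone_in_TenA(1)[OF P f] cone_in_TenA(2)[OF P Suc.IH]]
    unfolding tensor_power_Suc by (simp del: tensor_power.simps)
qed

lemma prime_tensor_power_Dom:
  assumes P: "prime_ideal K P" and [simp]: "f \<in> Ar K" and n: "Dom K (tensor_power K f (Suc n)) \<in> P"
  shows "Dom K f \<in> P"
  using n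
proof (induction n)
  case (Suc n)
  note [simp] = tensor_power_simps[OF assms(2)]
  have "Dom K (tensor_power K f (Suc n)) \<otimes> Dom K f \<in> P"
    using Suc.prems unfolding tensor_power_Suc by (simp del: tensor_power.simps)
  moreover have "Dom K (tensor_power K f (Suc n)) \<in> Ob K" "Dom K f \<in> Ob K" by (simp_all del: tensor_power.simps)
  ultimately have "Dom K (tensor_power K f (Suc n)) \<in> P \<or> Dom K f \<in> P" using P unfolding prime_ideal_def by blast
  then show ?case using Suc.IH by blast
qed simp

text \<open>For zero \<open>f\<close> the identity of \<open>\<Sigma> ?x\<close> lifts along the
  last arrow \<open>h\<close> of the triangle, so \<open>\<Sigma> ?x\<close> is a retract of the
  cone.\<close>

lemma cone_in_Zero:
  assumes P: "thick_ideal K P" and c: "cone_in P f" and z: "zero_arrow K f"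
  shows "Dom K f \<in> P"
proof -
  from c obtain g h where t: "(f, g, h) \<in> Tri K" and g: "Cod K g \<in> P" unfolding cone_in_def by blast
  note [simp] = Tri_simps[OF t]
  let ?x = "Dom K f"
  have "\<S> f = \<S> (Zero K ?x (Cod K f))" by (rule arg_cong[OF z[unfolded zero_arrow_def]])
  then have Sf: "\<S> f = Zero K (\<Sigma> ?x) (\<Sigma> (Cod K f))" by simp
  have "neg (\<S> f) = Zero K (\<Sigma> ?x) (\<Sigma> (Cod K f))"
    by (rule eq_neg[symmetric]) (simp_all add: Sf)
  then have "\<exists>r\<in>Hom (Dom K (\<I> (\<Sigma> ?x))) (Dom K h). \<I> (\<Sigma> ?x) = h \<cdot> r"
    by (intro Tri_lift[OF Tri_rotated[OF Tri_rotated[OF t]]]) simp_all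
  then obtain r where "r \<in> Hom (\<Sigma> ?x) (Cod K g)" "\<I> (\<Sigma> ?x) = h \<cdot> r" by auto
  then have "\<Sigma> ?x \<in> P" by (intro thick_ideal_retract[OF P g, of r _ h]) simp_all
  then show ?thesis using thick_idealD(3)[OF P, of ?x] by simp
qed

lemma nil_faithful_supp:
  assumes A: "tt_ring K A" and nf: "nil_faithful K A" and P: "prime_ideal K P"
  shows "robj A \<notin> P"
proof
  let ?a = "robj A"
  assume aP: "?a \<in> P"
  have tP: "thick_ideal K P" using P by (simp add: prime_ideal_def)
  note [simp] = tt_ringD[OF A]
  obtain g h where t: "(unit A, g, h) \<in> Tri K" using Tri_exists[of "unit A"] by auto
  note [simp] = Tri_simps[OF t, simplified]
  note e = Ten_exact[OF tt_ringD(1)[OF A] t, simplified]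
  define w where "w = \<theta> ?a \<one> \<cdot> (\<I> ?a \<odot> h)"
  have [simp]: "w \<in> Ar K" "Dom K w = ?a \<otimes> Cod K g" "Cod K w = \<Sigma> (?a \<otimes> \<one>)" by (simp_all add: w_def)
  have m: "mult A \<cdot> (\<I> ?a \<odot> unit A) = \<rho>\<rho> ?a" using A by (simp add: tt_ring_def is_ring_def)
  \<comment> \<open>The multiplication inverts \<open>\<I> ?a \<odot> unit A\<close> from the left,
    up to the right unitor. So \<open>w\<close>, which is killed by the suspension of that arrow, is
    zero, and with it \<open>\<I> ?a \<odot> h\<close>.\<close>
  have "neg (\<S> (\<I> ?a \<odot> unit A)) \<cdot> w = Zero K (?a \<otimes> Cod K g) (\<Sigma> (?a \<otimes> ?a))"
    using Tri_comp_Zero2[OF Tri_rotated[OF e]] by (simp add: w_def)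
  then have n: "neg (\<S> (\<I> ?a \<odot> unit A) \<cdot> w) = Zero K (?a \<otimes> Cod K g) (\<Sigma> (?a \<otimes> ?a))"
    by (simp add: neg_comp)
  have "\<S> (\<I> ?a \<odot> unit A) \<cdot> w \<oplus> neg (\<S> (\<I> ?a \<odot> unit A) \<cdot> w) = Zero K (?a \<otimes> Cod K g) (\<Sigma> (?a \<otimes> ?a))"
    by simp
  then have "\<S> (\<I> ?a \<odot> unit A) \<cdot> w = Zero K (?a \<otimes> Cod K g) (\<Sigma> (?a \<otimes> ?a))" unfolding n by simp
  then have "\<S> (mult A) \<cdot> \<S> (\<I> ?a \<odot> unit A) \<cdot> w = Zero K (?a \<otimes> Cod K g) (\<Sigma> ?a)" by simp
  then have "\<S> (\<rho>\<rho> ?a) \<cdot> w = Zero K (?a \<otimes> Cod K g) (\<Sigma> ?a)" by (simp add: merge_S m)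
  then have "inv_arrow K (\<S> (\<rho>\<rho> ?a)) \<cdot> \<S> (\<rho>\<rho> ?a) \<cdot> w = Zero K (?a \<otimes> Cod K g) (\<Sigma> (?a \<otimes> \<one>))" by simp
  then have w: "w = Zero K (?a \<otimes> Cod K g) (\<Sigma> (?a \<otimes> \<one>))" by simp
  have "\<I> ?a \<odot> h = inv_arrow K (\<theta> ?a \<one>) \<cdot> w" by (simp add: w_def)
  then have "zero_arrow K (\<I> ?a \<odot> h)" unfolding w by (simp add: zero_arrow_def)
  then obtain n where n: "n \<ge> 1" "zero_arrow K (tensor_power K h n)"
    using nf \<open>h \<in> Ar K\<close> unfolding nil_faithful_def by blast
  then obtain k where k: "zero_arrow K (tensor_power K h (Suc k))" by (cases n) auto
  \<comment> \<open>The cone of \<open>h\<close> is the suspension of \<open>A\<close>, so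
    \<open>h\<close> and its tensor powers have cones in \<open>P\<close>. A vanishing power then
    puts its source, by primality the source of \<open>h\<close>, and finally \<open>\<one>\<close>
    into \<open>P\<close>.\<close>
  have "Cod K (neg (\<S> (unit A))) \<in> P" using thick_idealD(3)[OF tP, of ?a] aP by simp
  then have "cone_in P h" using Tri_rotated[OF Tri_rotated[OF t]] unfolding cone_in_def by blast
  from cone_in_Zero[OF tP cone_in_tensor_power[OF tP this] k]
  have "Cod K g \<in> P" using prime_tensor_power_Dom[OF P, of h k] by simp
  then have u: "\<one> \<in> P" using thick_idealD(5)[OF tP t] aP by simp
  have "x \<in> P" if x: "x \<in> Ob K" for x
    by (rule thick_ideal_retract[OF tP thick_idealD(7)[OF tP x u], of "inv_arrow K (\<rho>\<rho> x)" x "\<rho>\<rho> x"]) (use x in simp_all)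
  then show False using P thick_idealD(1)[OF tP] unfolding prime_ideal_def by blast
qed

text \<open>Some \<open>f \<otimes> (\<dots> (f \<otimes> \<phi>))\<close> vanishes. Nesting to the
  right lets inductions peel off one \<open>f\<close> without associators; an object is tested
  through its identity.\<close>

definition nilpotent_on where
  "nilpotent_on f \<phi> \<longleftrightarrow> \<phi> \<in> Ar K \<and> (\<exists>n. zero_arrow K ((TenA K f ^^ n) \<phi>))"

lemma zero_arrow_comp:
  assumes "zero_arrow K f" and [simp]: "f \<in> Ar K" "g \<in> Ar K"
  shows "Cod K f = Dom K g \<Longrightarrow> zero_arrow K (g \<cdot> f)" "Cod K g = Dom K f \<Longrightarrow> zero_arrow K (f \<cdot> g)"
proof -
  have f: "f = Zero K (Dom K f) (Cod K f)" using assms(1) by (simp only: zero_arrow_def)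
  show "zero_arrow K (g \<cdot> f)" if e: "Cod K f = Dom K g"
  proof -
    have "g \<cdot> f = g \<cdot> Zero K (Dom K f) (Cod K f)" by (rule arg_cong[OF f])
    also have "\<dots> = Zero K (Dom K f) (Cod K g)" using e by simp
    finally show ?thesis using e by (simp add: zero_arrow_def)
  qed
  show "zero_arrow K (f \<cdot> g)" if e: "Cod K g = Dom K f"
  proof -
    have "f \<cdot> g = Zero K (Dom K f) (Cod K f) \<cdot> g" by (rule arg_cong[OF f, of "\<lambda>u. u \<cdot> g"])
    also have "\<dots> = Zero K (Dom K g) (Cod K f)" using e by simp
    finally show ?thesis using e by (simp add: zero_arrow_def)
  qed
qed

lemma zero_arrow_TenA:
  assumes "zero_arrow K f" "f \<in> Ar K" "x \<in> Ob K"
  shows "zero_arrow K (\<I> x \<odot> f)"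
proof -
  have "\<I> x \<odot> f = \<I> x \<odot> Zero K (Dom K f) (Cod K f)"
    by (rule arg_cong[OF assms(1)[unfolded zero_arrow_def]])
  then show ?thesis using assms(2,3) by (simp add: zero_arrow_def)
qed

lemma funpow_TenA_Ar: "f \<in> Ar K \<Longrightarrow> \<phi> \<in> Ar K \<Longrightarrow> (TenA K f ^^ n) \<phi> \<in> Ar K"
  by (induction n) simp_all

text \<open>Tensoring a composite with \<open>f\<close> can be split with \<open>f\<close> on either
  factor and the identity of its target or source on the other. Hence vanishing on one factor passes
  to the composite.\<close>

lemma funpow_TenA_comp:
  assumes [simp]: "f \<in> Ar K" "\<phi> \<in> Ar K" "\<psi> \<in> Ar K" and e: "Cod K \<phi> = Dom K \<psi>"
  shows "(TenA K f ^^ n) (\<psi> \<cdot> \<phi>) = (TenA K (\<I> (Cod K f)) ^^ n) \<psi> \<cdot> (TenA K f ^^ n) \<phi> \<and>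
      Cod K ((TenA K f ^^ n) \<phi>) = Dom K ((TenA K (\<I> (Cod K f)) ^^ n) \<psi>)"
    "(TenA K f ^^ n) (\<psi> \<cdot> \<phi>) = (TenA K f ^^ n) \<psi> \<cdot> (TenA K (\<I> (Dom K f)) ^^ n) \<phi> \<and>
      Cod K ((TenA K (\<I> (Dom K f)) ^^ n) \<phi>) = Dom K ((TenA K f ^^ n) \<psi>)"
proof -
  note [simp] = funpow_TenA_Ar
  show "(TenA K f ^^ n) (\<psi> \<cdot> \<phi>) = (TenA K (\<I> (Cod K f)) ^^ n) \<psi> \<cdot> (TenA K f ^^ n) \<phi> \<and>
      Cod K ((TenA K f ^^ n) \<phi>) = Dom K ((TenA K (\<I> (Cod K f)) ^^ n) \<psi>)"
    by (induction n) (simp_all add: e merge)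
  show "(TenA K f ^^ n) (\<psi> \<cdot> \<phi>) = (TenA K f ^^ n) \<psi> \<cdot> (TenA K (\<I> (Dom K f)) ^^ n) \<phi> \<and>
      Cod K ((TenA K (\<I> (Dom K f)) ^^ n) \<phi>) = Dom K ((TenA K f ^^ n) \<psi>)"
    by (induction n) (simp_all add: e merge)
qed

context
  fixes f
  assumes f: "f \<in> Ar K"
begin

lemma zero_funpow_comp:
  assumes z: "zero_arrow K ((TenA K f ^^ n) \<phi>)" and [simp]: "\<phi> \<in> Ar K" "\<psi> \<in> Ar K"
  shows "Cod K \<phi> = Dom K \<psi> \<Longrightarrow> zero_arrow K ((TenA K f ^^ n) (\<psi> \<cdot> \<phi>))"
    "Cod K \<psi> = Dom K \<phi> \<Longrightarrow> zero_arrow K ((TenA K f ^^ n) (\<phi> \<cdot> \<psi>))"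
  using funpow_TenA_comp(1)[OF f assms(2,3)] funpow_TenA_comp(2)[OF f assms(3,2)]
    zero_arrow_comp[OF z] funpow_TenA_Ar f by simp_all

lemma nilpotent_comp:
  assumes "nilpotent_on f \<phi>" "\<psi> \<in> Ar K"
  shows "Cod K \<phi> = Dom K \<psi> \<Longrightarrow> nilpotent_on f (\<psi> \<cdot> \<phi>)" "Cod K \<psi> = Dom K \<phi> \<Longrightarrow> nilpotent_on f (\<phi> \<cdot> \<psi>)"
  using zero_funpow_comp assms unfolding nilpotent_on_def by (simp, blast)+

lemma funpow_TenA_Suc: "(TenA K f ^^ n) (f \<odot> \<phi>) = (TenA K f ^^ Suc n) \<phi>"
  by (simp add: funpow_swap1)

lemma nilpotent_TenA_self: "\<phi> \<in> Ar K \<Longrightarrow> nilpotent_on f (f \<odot> \<phi>) \<longleftrightarrow> nilpotent_on f \<phi>"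
proof
  assume "\<phi> \<in> Ar K" "nilpotent_on f (f \<odot> \<phi>)"
  then show "nilpotent_on f \<phi>" unfolding nilpotent_on_def funpow_TenA_Suc by blast
next
  assume "\<phi> \<in> Ar K" "nilpotent_on f \<phi>"
  then obtain n where n: "\<phi> \<in> Ar K" "zero_arrow K ((TenA K f ^^ n) \<phi>)" unfolding nilpotent_on_def by blast
  let ?p = "(TenA K f ^^ n) \<phi>"
  note [simp] = f funpow_TenA_Ar[OF f n(1)] n(1)
  have "f \<odot> ?p = (f \<odot> \<I> (Cod K ?p)) \<cdot> (\<I> (Dom K f) \<odot> ?p)" by (simp add: merge)
  moreover have "zero_arrow K \<dots>" by (rule zero_arrow_comp(1)[OF zero_arrow_TenA[OF n(2)]]) simp_all
  ultimately have "zero_arrow K ((TenA K f ^^ Suc n) \<phi>)" by simp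
  then show "nilpotent_on f (f \<odot> \<phi>)" using f n(1) unfolding nilpotent_on_def funpow_TenA_Suc[symmetric] by auto
qed

lemma nilpotent_zero: "zero_arrow K \<phi> \<Longrightarrow> \<phi> \<in> Ar K \<Longrightarrow> nilpotent_on f \<phi>"
  unfolding nilpotent_on_def by (auto intro: exI[of _ 0])

text \<open>Each \<open>f\<close> is moved past \<open>x\<close> by the exchange \<open>sw\<close>,
  an isomorphism on both ends.\<close>

lemma nilpotent_TenA:
  assumes n: "nilpotent_on f \<phi>" and x: "x \<in> Ob K"
  shows "nilpotent_on f (\<I> x \<odot> \<phi>)"
proof -
  have "nilpotent_on f (\<I> x \<odot> \<phi>)" if "zero_arrow K ((TenA K f ^^ n) \<phi>)" "\<phi> \<in> Ar K" for n \<phi>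
    using that
  proof (induction n arbitrary: \<phi>)
    case 0
    then show ?case using x by (intro nilpotent_zero) (simp_all add: zero_arrow_TenA)
  next
    case (Suc n)
    note [simp] = f x Suc.prems(2)
    have "nilpotent_on f (\<I> x \<odot> (f \<odot> \<phi>))"
      by (rule Suc.IH) (use Suc.prems in \<open>simp_all add: funpow_TenA_Suc del: funpow.simps\<close>)
    then have "nilpotent_on f (sw x (Cod K f) (Cod K \<phi>) \<cdot> (\<I> x \<odot> (f \<odot> \<phi>)))"
      by (rule nilpotent_comp) simp_all
    then have "nilpotent_on f ((sw x (Cod K f) (Cod K \<phi>) \<cdot> (\<I> x \<odot> (f \<odot> \<phi>))) \<cdot> sw (Dom K f) x (Dom K \<phi>))"
      by (rule nilpotent_comp) simp_all
    moreover have "(sw x (Cod K f) (Cod K \<phi>) \<cdot> (\<I> x \<odot> (f \<odot> \<phi>))) \<cdot> sw (Dom K f) x (Dom K \<phi>) = f \<odot> (\<I> x \<odot> \<phi>)"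
      by (simp add: sw_nat)
    ultimately show ?case using nilpotent_TenA_self[of "\<I> x \<odot> \<phi>"] by simp
  qed
  then show ?thesis using n unfolding nilpotent_on_def by blast
qed

text \<open>Conjugation by \<open>\<theta>\<close> moves the suspension out of
  \<open>f \<otimes> -\<close>; both inductions peel off one \<open>f\<close> at a time.\<close>

lemma nilpotent_SuspA:
  assumes p: "\<phi> \<in> Ar K"
  shows "nilpotent_on f (\<S> \<phi>) \<longleftrightarrow> nilpotent_on f \<phi>"
proof -
  have conj: "f \<odot> \<S> \<phi> = inv_arrow K (\<theta> (Cod K f) (Cod K \<phi>)) \<cdot> \<S> (f \<odot> \<phi>) \<cdot> \<theta> (Dom K f) (Dom K \<phi>)"
    "\<S> (f \<odot> \<phi>) = \<theta> (Cod K f) (Cod K \<phi>) \<cdot> (f \<odot> \<S> \<phi>) \<cdot> inv_arrow K (\<theta> (Dom K f) (Dom K \<phi>))" if "\<phi> \<in> Ar K" for \<phi>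
  proof -
    note [simp] = f that
    note n = theta_nat[OF f that refl refl]
    show "f \<odot> \<S> \<phi> = inv_arrow K (\<theta> (Cod K f) (Cod K \<phi>)) \<cdot> \<S> (f \<odot> \<phi>) \<cdot> \<theta> (Dom K f) (Dom K \<phi>)"
      unfolding n[symmetric] by simp
    have "(\<theta> (Cod K f) (Cod K \<phi>) \<cdot> (f \<odot> \<S> \<phi>)) \<cdot> inv_arrow K (\<theta> (Dom K f) (Dom K \<phi>)) = \<S> (f \<odot> \<phi>)"
      unfolding n by simp
    then show "\<S> (f \<odot> \<phi>) = \<theta> (Cod K f) (Cod K \<phi>) \<cdot> (f \<odot> \<S> \<phi>) \<cdot> inv_arrow K (\<theta> (Dom K f) (Dom K \<phi>))" by simp
  qed
  have 1: "nilpotent_on f (\<S> \<phi>)" if "zero_arrow K ((TenA K f ^^ n) \<phi>)" "\<phi> \<in> Ar K" for n \<phi>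
    using that
  proof (induction n arbitrary: \<phi>)
    case 0
    have "\<S> \<phi> = \<S> (Zero K (Dom K \<phi>) (Cod K \<phi>))"
      by (rule arg_cong) (use 0 in \<open>simp only: zero_arrow_def funpow.simps id_apply\<close>)
    then show ?case using 0 by (intro nilpotent_zero) (simp_all add: zero_arrow_def)
  next
    case (Suc n)
    note [simp] = f Suc.prems(2)
    have "nilpotent_on f (\<S> (f \<odot> \<phi>))"
      by (rule Suc.IH) (use Suc.prems in \<open>simp_all add: funpow_TenA_Suc del: funpow.simps\<close>)
    then have "nilpotent_on f (\<S> (f \<odot> \<phi>) \<cdot> \<theta> (Dom K f) (Dom K \<phi>))" by (rule nilpotent_comp) simp_all
    then have "nilpotent_on f (f \<odot> \<S> \<phi>)" unfolding conj(1)[OF Suc.prems(2)] by (rule nilpotent_comp) simp_all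
    then show ?case using nilpotent_TenA_self[of "\<S> \<phi>"] by simp
  qed
  have 2: "nilpotent_on f \<phi>" if "zero_arrow K ((TenA K f ^^ n) (\<S> \<phi>))" "\<phi> \<in> Ar K" for n \<phi>
    using that
  proof (induction n arbitrary: \<phi>)
    case 0
    then have "\<S> \<phi> = \<S> (Zero K (Dom K \<phi>) (Cod K \<phi>))" by (simp add: zero_arrow_def)
    then have "\<phi> = Zero K (Dom K \<phi>) (Cod K \<phi>)" by (rule SuspA_cancel) (use 0 in simp_all)
    then show ?case using 0(2) by (intro nilpotent_zero) (simp_all only: zero_arrow_def)
  next
    case (Suc n)
    note [simp] = f Suc.prems(2)
    have z: "zero_arrow K ((TenA K f ^^ n) (f \<odot> \<S> \<phi>))" using Suc.prems(1) by (simp only: funpow_TenA_Suc)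
    have z2: "zero_arrow K ((TenA K f ^^ n) ((f \<odot> \<S> \<phi>) \<cdot> inv_arrow K (\<theta> (Dom K f) (Dom K \<phi>))))"
      by (rule zero_funpow_comp[OF z]) simp_all
    have "zero_arrow K ((TenA K f ^^ n) (\<S> (f \<odot> \<phi>)))"
      unfolding conj(2)[OF Suc.prems(2)] by (rule zero_funpow_comp[OF z2]) simp_all
    then have "nilpotent_on f (f \<odot> \<phi>)" by (rule Suc.IH) simp
    then show ?case using nilpotent_TenA_self[of \<phi>] by simp
  qed
  show ?thesis using 1 2 p unfolding nilpotent_on_def[of f \<phi>] nilpotent_on_def[of f "\<S> \<phi>"]
    by (metis Susp_simps(1) nilpotent_on_def)
qed

text \<open>For \<open>n = 0\<close> the arrow \<open>\<phi>\<close> factors through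
  \<open>u\<close>, hence through an object on which \<open>f\<close> is nilpotent. The step tensors
  the triangle with \<open>Cod K f\<close> and \<open>\<phi>\<close> with \<open>f\<close>, so the
  triangle has to vary in the induction.\<close>

lemma nilpotent_lift:
  assumes "(u, v, w) \<in> Tri K" "nilpotent_on f (\<I> (Dom K u))" "\<phi> \<in> Ar K" "Cod K \<phi> = Cod K u"
    "zero_arrow K ((TenA K f ^^ n) (v \<cdot> \<phi>))"
  shows "nilpotent_on f \<phi>"
  using assms
proof (induction n arbitrary: u v w \<phi>)
  case 0
  note t = 0(1) and p [simp] = 0(3,4)
  note [simp] = Tri_simps[OF t]
  have "\<exists>r\<in>Hom (Dom K \<phi>) (Dom K u). \<phi> = u \<cdot> r"
    by (rule Tri_lift[OF t]) (use 0(5) in \<open>simp_all add: zero_arrow_def\<close>)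
  then obtain r where r: "r \<in> Hom (Dom K \<phi>) (Dom K u)" "\<phi> = u \<cdot> r" by (rule bexE)
  have "nilpotent_on f (\<I> (Dom K u) \<cdot> r)" by (rule nilpotent_comp[OF 0(2)]) (use r(1) in simp_all)
  then have "nilpotent_on f r" using r(1) by simp
  then have "nilpotent_on f (u \<cdot> r)" by (rule nilpotent_comp) (use r(1) in simp_all)
  then show ?case unfolding r(2)[symmetric] .
next
  case (Suc n)
  note t = Suc.prems(1) and p [simp] = Suc.prems(3,4)
  note [simp] = Tri_simps[OF t] f
  let ?y = "Cod K f"
  note e = Ten_exact[of ?y, OF _ t]
  have "nilpotent_on f (f \<odot> \<phi>)"
  proof (rule Suc.IH[OF e])
    show "nilpotent_on f (\<I> (Dom K (\<I> ?y \<odot> u)))"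
      using nilpotent_TenA[OF Suc.prems(2), of ?y] by simp
    have "(\<I> ?y \<odot> v) \<cdot> (f \<odot> \<phi>) = f \<odot> (v \<cdot> \<phi>)" by (simp add: merge)
    then show "zero_arrow K ((TenA K f ^^ n) ((\<I> ?y \<odot> v) \<cdot> (f \<odot> \<phi>)))"
      using Suc.prems(5) by (simp only: funpow_TenA_Suc)
  qed simp_all
  then show ?case using nilpotent_TenA_self[of \<phi>] by simp
qed

lemma nilpotent_ident_retract:
  assumes "nilpotent_on f (\<I> s)" "i \<in> Hom x s" "p \<in> Hom s x" "p \<cdot> i = \<I> x"
  shows "nilpotent_on f (\<I> x)"
proof -
  have [simp]: "s \<in> Ob K" using assms(2) Cod_Ob[of i] by simp
  have "nilpotent_on f (\<I> s \<cdot> i)" by (rule nilpotent_comp[OF assms(1)]) (use assms(2) in simp_all)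
  then have "nilpotent_on f i" using assms(2) by simp
  then have "nilpotent_on f (p \<cdot> i)" by (rule nilpotent_comp) (use assms(2,3) in simp_all)
  then show ?thesis unfolding assms(4) .
qed

text \<open>Only the middle term of a triangle is treated directly, by \<open>nilpotent_lift\<close>
  applied to its identity; the other two cases follow by rotating and removing suspensions.\<close>

lemma nilpotent_thick: "thick_ideal K {z \<in> Ob K. nilpotent_on f (\<I> z)}"
proof -
  let ?J = "{z \<in> Ob K. nilpotent_on f (\<I> z)}"
  have mid: "nilpotent_on f (\<I> (Cod K u))"
    if t: "(u, v, w) \<in> Tri K" and a: "nilpotent_on f (\<I> (Dom K u))" and b: "nilpotent_on f (\<I> (Cod K v))" for u v w
  proof -
    note [simp] = Tri_simps[OF t]
    have "nilpotent_on f (\<I> (Cod K v) \<cdot> v)" by (rule nilpotent_comp[OF b]) simp_all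
    then obtain n where "zero_arrow K ((TenA K f ^^ n) v)" unfolding nilpotent_on_def by auto
    then show ?thesis by (intro nilpotent_lift[OF t a, of _ n]) simp_all
  qed
  have susp: "nilpotent_on f (\<I> (\<Sigma> x)) \<longleftrightarrow> nilpotent_on f (\<I> x)" if "x \<in> Ob K" for x
    using nilpotent_SuspA[of "\<I> x"] that by simp
  show ?thesis
    unfolding thick_ideal_def
  proof (intro conjI ballI allI impI)
    show "z \<in> ?J" if "zero_object K z" for z
      using zero_object_ident[OF that] nilpotent_zero[of "\<I> z"] by (simp add: zero_arrow_def)
    show "\<Sigma> x \<in> ?J \<longleftrightarrow> x \<in> ?J" if "x \<in> Ob K" for x
      using susp[OF that] that Susp_Ob by simp
    fix u v w assume t: "(u, v, w) \<in> Tri K"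
    note [simp] = Tri_simps[OF t]
    show "Cod K v \<in> ?J" if "Dom K u \<in> ?J \<and> Cod K u \<in> ?J"
      using mid[OF Tri_rotated[OF t]] susp[of "Dom K u"] that by simp
    show "Dom K u \<in> ?J" if "Cod K u \<in> ?J \<and> Cod K v \<in> ?J"
      using mid[OF Tri_rotated[OF Tri_rotated[OF t]]] susp[of "Dom K u"] susp[of "Cod K u"] that by simp
    show "Cod K u \<in> ?J" if "Dom K u \<in> ?J \<and> Cod K v \<in> ?J"
      using mid[OF t] that by simp
  next
    fix x y s i j p q assume x: "x \<in> Ob K" and y: "y \<in> Ob K" and s: "s \<in> ?J" and b: "biproduct K x y s i j p q"
    note d = biproductD[OF b x y]
    show "x \<in> ?J" using nilpotent_ident_retract[of s i x p] s x d by simp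
    show "y \<in> ?J" using nilpotent_ident_retract[of s j y q] s y d by simp
  next
    fix x y assume "x \<in> Ob K" "y \<in> ?J"
    then show "x \<otimes> y \<in> ?J" using nilpotent_TenA[of "\<I> y" x] by simp
  qed simp
qed

text \<open>\<open>tensor_power\<close> nests to the left and \<open>funpow\<close> to the right.
  Symmetries relate the two, and for vanishing it is enough that one is a composite through the
  other.\<close>

lemma tensor_power_factor:
  "\<exists>a\<in>Ar K. \<exists>b\<in>Ar K. Cod K b = Dom K ((TenA K f ^^ n) f) \<and> Cod K ((TenA K f ^^ n) f) = Dom K a \<and>
    tensor_power K f (Suc n) = a \<cdot> (TenA K f ^^ n) f \<cdot> b"
proof (induction n)
  case 0
  show ?case using f by (intro bexI[of _ "\<I> (Cod K f)"] bexI[of _ "\<I> (Dom K f)"]) simp_all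
next
  case (Suc n)
  let ?p = "(TenA K f ^^ n) f" let ?T = "tensor_power K f (Suc n)"
  from Suc obtain a b where ab: "a \<in> Ar K" "b \<in> Ar K" "Cod K b = Dom K ?p" "Cod K ?p = Dom K a" and T: "?T = a \<cdot> ?p \<cdot> b"
    by (elim bexE conjE)
  note [simp] = f funpow_TenA_Ar[OF f f] ab tensor_power_simps[OF f]
  have "?T \<odot> f = \<gamma> (Cod K f) (Cod K ?T) \<cdot> (f \<odot> ?T) \<cdot> \<gamma> (Dom K ?T) (Dom K f)"
    by (simp add: braid_nat[THEN reassoc] del: tensor_power.simps)
  also have "f \<odot> ?T = (\<I> (Cod K f) \<odot> a) \<cdot> (f \<odot> ?p) \<cdot> (\<I> (Dom K f) \<odot> b)"
    unfolding T by (simp add: merge)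
  finally have "tensor_power K f (Suc (Suc n)) = (\<gamma> (Cod K f) (Cod K a) \<cdot> (\<I> (Cod K f) \<odot> a)) \<cdot>
      (TenA K f ^^ Suc n) f \<cdot> ((\<I> (Dom K f) \<odot> b) \<cdot> \<gamma> (Dom K b) (Dom K f))"
    unfolding tensor_power_Suc using T by (simp del: tensor_power.simps)
  then show ?case
    by (intro bexI[of _ "\<gamma> (Cod K f) (Cod K a) \<cdot> (\<I> (Cod K f) \<odot> a)"]
        bexI[of _ "(\<I> (Dom K f) \<odot> b) \<cdot> \<gamma> (Dom K b) (Dom K f)"] conjI) (simp_all del: tensor_power.simps)
qed

end

lemma prime_ideal_exists:
  assumes J: "thick_ideal K J" and u: "\<one> \<notin> J"
  shows "\<exists>P. prime_ideal K P \<and> J \<subseteq> P"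
proof -
  note O = tt_ring_unit_ring
  have t: "mthick O1 (triv ` J)" using mthick_triv[OF thick_idealD(1)[OF J]] J by blast
  have S: "{self_mod O1} \<subseteq> modules K O1" "{self_mod O1} \<noteq> {}" "{self_mod O1} \<inter> triv ` J = {}"
    using self_mod_modules[OF O] u by (simp_all add: self_mod_unit_ring)
  have "\<exists>Q. mprime O1 Q \<and> triv ` J \<subseteq> Q \<and> Q \<inter> {self_mod O1} = {}"
  proof (rule mprime_exists[OF O t S])
    fix s t assume "s \<in> {self_mod O1}" "t \<in> {self_mod O1}"
    then show "\<exists>u\<in>{self_mod O1}. \<forall>J. mthick O1 J \<longrightarrow> rten O1 O1 (\<I> (robj O1)) s t \<in> J \<longrightarrow> u \<in> J"
      using mthickD(5)[OF _ mret_rten_right_unit(1)[OF O self_mod_modules[OF O]]] by blast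
  qed
  then obtain Q where Q: "mprime O1 Q" "triv ` J \<subseteq> Q" by blast
  from Q(1) obtain P where P: "prime_ideal K P" "Q = triv ` P" unfolding mprime_unit_ring by blast
  then show ?thesis using Q(2) triv_image_eq(2) by blast
qed

lemma supp_nil_faithful:
  assumes A: "tt_ring K A" and s: "\<And>P. prime_ideal K P \<Longrightarrow> robj A \<notin> P"
  shows "nil_faithful K A"
  unfolding nil_faithful_def
proof (intro ballI impI)
  fix f assume f: "f \<in> Ar K" and z: "zero_arrow K (\<I> (robj A) \<odot> f)"
  let ?a = "robj A"
  let ?J = "{z \<in> Ob K. nilpotent_on f (\<I> z)}"
  note [simp] = f tt_ringD(1)[OF A]
  note J = nilpotent_thick[OF f]
  \<comment> \<open>\<open>f \<odot> \<I> ?a\<close> vanishes along with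
    \<open>\<I> ?a \<odot> f\<close>, so \<open>A\<close> lies in \<open>?J\<close> with exponent
    one. As no prime contains \<open>A\<close>, the ideal \<open>?J\<close> contains
    \<open>\<one>\<close>, hence the domain of \<open>f\<close>.\<close>
  have "\<gamma> ?a (Cod K f) \<cdot> (\<I> ?a \<odot> f) \<cdot> \<gamma> (Dom K f) ?a = f \<odot> \<I> ?a"
    by (simp add: braid_nat[THEN reassoc])
  moreover have "zero_arrow K (\<gamma> ?a (Cod K f) \<cdot> (\<I> ?a \<odot> f) \<cdot> \<gamma> (Dom K f) ?a)"
    by (rule zero_arrow_comp(1)[OF zero_arrow_comp(2)[OF z]]) simp_all
  ultimately have "zero_arrow K ((TenA K f ^^ 1) (\<I> ?a))" by simp
  then have "?a \<in> ?J" unfolding nilpotent_on_def by (simp, blast)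
  then have "\<one> \<in> ?J" using prime_ideal_exists[OF J] s by blast
  then have 1: "nilpotent_on f (\<I> \<one>)" by simp
  have "nilpotent_on f (\<I> (Dom K f \<otimes> \<one>))" using nilpotent_TenA[OF f 1, of "Dom K f"] by simp
  then have "nilpotent_on f (\<I> (Dom K f))"
    by (rule nilpotent_ident_retract[OF f, of _ "inv_arrow K (\<rho>\<rho> (Dom K f))" _ "\<rho>\<rho> (Dom K f)"]) simp_all
  from nilpotent_comp(2)[OF f this, of f] have "nilpotent_on f f"
    using nilpotent_comp(1)[OF f \<open>nilpotent_on f (\<I> (Dom K f))\<close>, of f] by simp
  then obtain n where n: "zero_arrow K ((TenA K f ^^ n) f)" unfolding nilpotent_on_def by blast
  from tensor_power_factor[OF f, of n] obtain a b where ab: "a \<in> Ar K" "b \<in> Ar K" "Cod K b = Dom K ((TenA K f ^^ n) f)"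
    "Cod K ((TenA K f ^^ n) f) = Dom K a" "tensor_power K f (Suc n) = a \<cdot> (TenA K f ^^ n) f \<cdot> b" by (elim bexE conjE)
  note [simp] = ab(1-4) funpow_TenA_Ar[OF f f]
  have "zero_arrow K (tensor_power K f (Suc n))"
    unfolding ab(5) by (rule zero_arrow_comp(1)[OF zero_arrow_comp(2)[OF n]]) simp_all
  then show "\<exists>n\<ge>1. zero_arrow K (tensor_power K f n)" by (intro exI[of _ "Suc n"]) simp
qed

end

section \<open>Spectra as topological spaces\<close>

text \<open>The space of a generated topology is the union of its generators, and a prime lies in a
  generator only if it contains an object.\<close>

lemma topspace_Spc:
  assumes "\<And>P. prime_ideal X P \<Longrightarrow> P \<noteq> {}"
  shows "topspace (Spc X) = {P. prime_ideal X P}"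
proof (intro set_eqI iffI)
  fix P assume "P \<in> {P. prime_ideal X P}"
  then have P: "prime_ideal X P" by simp
  then have "P \<subseteq> Ob X" by (simp add: prime_ideal_def thick_ideal_def)
  with assms[OF P] obtain x where "x \<in> Ob X" "x \<in> P" by blast
  then show "P \<in> topspace (Spc X)" using P by (auto simp: Spc_def topology_generated_by_topspace)
qed (auto simp: Spc_def topology_generated_by_topspace)

lemma closure_Spc:
  assumes ne: "\<And>P. prime_ideal X P \<Longrightarrow> P \<noteq> {}" and P: "prime_ideal X P"
  shows "Spc X closure_of {P} = {P'. prime_ideal X P' \<and> P' \<subseteq> P}"
proof (intro set_eqI iffI)
  fix P' assume c: "P' \<in> Spc X closure_of {P}"
  then have P': "prime_ideal X P'" by (simp add: in_closure_of topspace_Spc[OF ne])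
  have "P' \<subseteq> P"
  proof
    fix x assume x: "x \<in> P'"
    then have "x \<in> Ob X" using P' by (auto simp: prime_ideal_def thick_ideal_def)
    then have o: "openin (Spc X) {P. prime_ideal X P \<and> x \<in> P}"
      unfolding Spc_def by (intro topology_generated_by_Basis CollectI exI[of _ x]) simp
    have "\<forall>T. P' \<in> T \<and> openin (Spc X) T \<longrightarrow> P \<in> T" using c by (simp add: in_closure_of)
    from this[THEN spec, THEN mp, OF conjI[OF _ o]] show "x \<in> P" using P' x by simp
  qed
  then show "P' \<in> {P'. prime_ideal X P' \<and> P' \<subseteq> P}" using P' by simp
next
  fix P' assume "P' \<in> {P'. prime_ideal X P' \<and> P' \<subseteq> P}"
  then have P': "prime_ideal X P'" "P' \<subseteq> P" by simp_all
  \<comment> \<open>Open sets are closed under passing to larger primes: the generators are, and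
    unions and finite intersections preserve this.\<close>
  have "P \<in> T" if "generate_topology_on {{P. prime_ideal X P \<and> x \<in> P} | x. x \<in> Ob X} T" "P' \<in> T" for T
    using that by induction (use P P' in auto)
  then have "P \<in> T" if "openin (Spc X) T" "P' \<in> T" for T
    using that unfolding Spc_def openin_topology_generated_by_iff by blast
  moreover have "P' \<in> topspace (Spc X)" using P'(1) by (simp add: topspace_Spc[OF ne])
  ultimately show "P' \<in> Spc X closure_of {P}" unfolding in_closure_of by blast
qed

lemma finite_discrete_topology:
  assumes F: "finite F" "topspace X = F" and c: "\<And>x. x \<in> F \<Longrightarrow> X closure_of {x} \<subseteq> {x}"
  shows "X = discrete_topology F"
proof -
  have "closedin X {x}" if "x \<in> F" for x
  proof -
    have "X closure_of {x} = {x}" using c[OF that] closure_of_subset[of "{x}" X] F(2) that by blast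
    then show ?thesis by (simp add: closure_of_eq)
  qed
  then have "closedin X (\<Union>x\<in>F - S. {x})" for S
    using F(1) by (intro closedin_Union) auto
  then have "closedin X (F - S)" for S by simp
  then have "openin X {x}" if "x \<in> F" for x
    using that F(2) by (simp add: openin_closedin_eq)
  then show ?thesis using F(2) discrete_topology_unique[of F X] by auto
qed

text \<open>Chains have the same possible lengths on both sides. \<open>mono\<close> pushes a chain
  forward, and \<open>inc\<close> with \<open>t0\<close> keeps it strict; \<open>up\<close> lifts a
  chain point by point from its first member, and strictness of the lift follows from
  \<open>mono\<close>.\<close>

lemma krull_dim_eq:
  assumes im: "\<phi> ` topspace X = topspace Y"
    and mono: "\<And>a b. a \<in> topspace X \<Longrightarrow> b \<in> X closure_of {a} \<Longrightarrow> \<phi> b \<in> Y closure_of {\<phi> a}"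
    and up: "\<And>a p. a \<in> topspace X \<Longrightarrow> p \<in> Y closure_of {\<phi> a} \<Longrightarrow> \<exists>b\<in>X closure_of {a}. \<phi> b = p"
    and inc: "\<And>a b. a \<in> topspace X \<Longrightarrow> b \<in> topspace X \<Longrightarrow> b \<in> X closure_of {a} \<Longrightarrow> \<phi> a = \<phi> b \<Longrightarrow> a = b"
    and t0: "\<And>p q. p \<in> topspace Y \<Longrightarrow> q \<in> topspace Y \<Longrightarrow> p \<in> Y closure_of {q} \<Longrightarrow> q \<in> Y closure_of {p} \<Longrightarrow> p = q"
  shows "krull_dim X = krull_dim Y"
proof -
  have self: "a \<in> X closure_of {a}" if "a \<in> topspace X" for a using that by (auto simp: in_closure_of)
  have "specialization_chain Y (\<phi> \<circ> c) n" if c: "specialization_chain X c n" for c n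
    unfolding specialization_chain_def
  proof (intro conjI allI impI)
    have top: "c i \<in> topspace X" if "i \<le> n" for i using c that by (simp add: specialization_chain_def)
    then show "(\<phi> \<circ> c) i \<in> topspace Y" if "i \<le> n" for i using that im by auto
    fix i assume i: "i < n"
    have s: "c (Suc i) \<in> X closure_of {c i}" "c i \<notin> X closure_of {c (Suc i)}"
      using c i by (simp_all add: specialization_chain_def)
    have t: "c i \<in> topspace X" "c (Suc i) \<in> topspace X" using top i by simp_all
    show m: "(\<phi> \<circ> c) (Suc i) \<in> Y closure_of {(\<phi> \<circ> c) i}" using mono[OF t(1) s(1)] by simp
    show "(\<phi> \<circ> c) i \<notin> Y closure_of {(\<phi> \<circ> c) (Suc i)}"
    proof
      assume "(\<phi> \<circ> c) i \<in> Y closure_of {(\<phi> \<circ> c) (Suc i)}"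
      then have "\<phi> (c i) = \<phi> (c (Suc i))" using m t im by (intro t0) auto
      then have "c i = c (Suc i)" by (rule inc[OF t s(1)])
      then show False using s(2) self[OF t(1)] by simp
    qed
  qed
  moreover have "\<exists>c'. specialization_chain X c' n \<and> (\<forall>i\<le>n. \<phi> (c' i) = c i)" if "specialization_chain Y c n" for c n
    using that
  proof (induction n)
    case 0
    then have "c 0 \<in> \<phi> ` topspace X" unfolding im by (simp add: specialization_chain_def)
    then obtain a where "a \<in> topspace X" "\<phi> a = c 0" by (metis imageE)
    then show ?case by (intro exI[of _ "\<lambda>_. a"]) (simp add: specialization_chain_def)
  next
    case (Suc n)
    then have "specialization_chain Y c n" by (simp add: specialization_chain_def)
    with Suc.IH obtain c' where c': "specialization_chain X c' n" "\<And>i. i \<le> n \<Longrightarrow> \<phi> (c' i) = c i" by blast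
    have s: "c (Suc n) \<in> Y closure_of {c n}" "c n \<notin> Y closure_of {c (Suc n)}"
      using Suc.prems by (simp_all add: specialization_chain_def)
    have t: "c' n \<in> topspace X" using c'(1) by (simp add: specialization_chain_def)
    from up[OF t] s(1) c'(2)[of n] obtain b where b: "b \<in> X closure_of {c' n}" "\<phi> b = c (Suc n)" by auto
    have bt: "b \<in> topspace X" using b(1) by (simp add: in_closure_of)
    have "c' n \<notin> X closure_of {b}" using mono[OF bt, of "c' n"] s(2) b(2) c'(2)[of n] by auto
    then have "specialization_chain X (c'(Suc n := b)) (Suc n)"
      using c'(1) b(1) bt by (auto simp: specialization_chain_def less_Suc_eq le_Suc_eq)
    moreover have "\<forall>i\<le>Suc n. \<phi> ((c'(Suc n := b)) i) = c i" using c'(2) b(2) by (simp add: le_Suc_eq)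
    ultimately show ?case by blast
  qed
  ultimately have "{n. \<exists>c. specialization_chain X c n} = {n. \<exists>c. specialization_chain Y c n}" by blast
  then show ?thesis unfolding krull_dim_def by simp
qed

section \<open>The map of spectra and its fibers\<close>

context tt_category
begin

lemma prime_ideal_nonempty: "prime_ideal K P \<Longrightarrow> P \<noteq> {}"
  using thick_idealD(2)[of P] zero_object_exists by (auto simp: prime_ideal_def)

text \<open>This makes \<open>topspace_Spc\<close> applicable to modules: the extension of a zero
  object is a zero module, which lies in every ideal.\<close>

lemma Mod_prime_nonempty:
  assumes A: "tt_ring K A" and Q: "prime_ideal (Mod K A) Q"
  shows "Q \<noteq> {}"
proof -
  from zero_object_exists obtain z where z: "zero_object K z" by blast
  then have zO: "z \<in> Ob K" and i: "\<I> z = Zero K z z" using zero_object_ident[OF z] by blast+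
  note [simp] = zO tt_ringD(1)[OF A]
  have M: "extension K A z \<in> modules K A"
    using rten_triv_self[OF A zO] mhomD(2) unfolding miso_def by blast
  have "\<I> (robj A \<otimes> z) = \<I> (robj A) \<odot> \<I> z" by simp
  also have "\<dots> = Zero K (robj A \<otimes> z) (robj A \<otimes> z)" unfolding i by simp
  finally have "zero_object K (fst (extension K A z))" by (simp add: zero_object_iff extension_def)
  then show ?thesis using mthickD(2)[OF _ M] Q mprimeD(1) unfolding prime_ideal_Mod[OF A] by blast
qed

lemma topspace_Spc_K: "topspace (Spc K) = {P. prime_ideal K P}"
  by (rule topspace_Spc) (rule prime_ideal_nonempty)

lemma closure_Spc_K: "prime_ideal K P \<Longrightarrow> Spc K closure_of {P} = {P'. prime_ideal K P' \<and> P' \<subseteq> P}"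
  by (rule closure_Spc) (rule prime_ideal_nonempty)

context
  fixes A
  assumes A: "tt_ring K A"
begin

lemma topspace_Spc_Mod: "topspace (Spc (Mod K A)) = {Q. mprime A Q}"
  using topspace_Spc[of "Mod K A"] Mod_prime_nonempty[OF A] by (simp add: prime_ideal_Mod[OF A])

lemma closure_Spc_Mod: "mprime A Q \<Longrightarrow> Spc (Mod K A) closure_of {Q} = {Q'. mprime A Q' \<and> Q' \<subseteq> Q}"
  using closure_Spc[of "Mod K A" Q] Mod_prime_nonempty[OF A] by (simp add: prime_ideal_Mod[OF A])

lemma phi_pull: "mprime A Q \<Longrightarrow> pull A O1 (unit A) Q = triv ` phi K A Q"
  by (rule pull_unit[OF A mprimeD(1)])

lemma phi_pull_eq: "mprime A Q \<Longrightarrow> mprime A Q' \<Longrightarrow> pull A O1 (unit A) Q = pull A O1 (unit A) Q' \<longleftrightarrow> phi K A Q = phi K A Q'"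
  by (simp add: phi_pull triv_image_eq)

lemma phi_prime:
  assumes Q: "mprime A Q"
  shows "prime_ideal K (phi K A Q)"
  using mprime_pull[OF tt_ring_unit_ring A ring_hom_unit[OF A] Q]
  unfolding phi_pull[OF Q] mprime_unit_ring triv_image_eq by simp

lemma phi_mono: "Q' \<subseteq> Q \<Longrightarrow> phi K A Q' \<subseteq> phi K A Q"
  unfolding phi_def Spc_map_def by blast

lemma res_unit_self: "res_mod (unit A) (self_mod A) = triv (robj A)"
  using res_unit[OF A self_mod_modules[OF A]] by simp

lemma phi_image: "phi K A ` {Q. mprime A Q} = supp K (robj A)"
proof (intro set_eqI iffI)
  fix P assume "P \<in> phi K A ` {Q. mprime A Q}"
  then obtain Q where Q: "mprime A Q" "P = phi K A Q" by blast
  have "robj A \<notin> P"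
  proof
    assume "robj A \<in> P"
    then have "res_mod (unit A) (self_mod A) \<in> pull A O1 (unit A) Q"
      unfolding phi_pull[OF Q(1)] res_unit_self Q(2)[symmetric] by simp
    then show False
      using res_mod_pull[OF tt_ring_unit_ring A ring_hom_unit[OF A] mprimeD(1)[OF Q(1)] self_mod_modules[OF A]] mprimeD(2)[OF Q(1)]
      by blast
  qed
  then show "P \<in> supp K (robj A)" using phi_prime[OF Q(1)] Q(2) by (simp add: supp_def)
next
  fix P assume "P \<in> supp K (robj A)"
  then have P: "prime_ideal K P" "robj A \<notin> P" by (simp_all add: supp_def)
  have p: "mprime O1 (triv ` P)" unfolding mprime_unit_ring using P(1) by blast
  have "\<exists>Q. mprime A Q \<and> pull A O1 (unit A) Q = triv ` P"
    by (rule lying_over[OF tt_ring_unit_ring A ring_hom_unit[OF A] p]) (simp add: res_unit_self P(2))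
  then obtain Q where Q: "mprime A Q" "pull A O1 (unit A) Q = triv ` P" by blast
  then have "P = phi K A Q" unfolding phi_pull[OF Q(1)] triv_image_eq by simp
  then show "P \<in> phi K A ` {Q. mprime A Q}" using Q(1) by blast
qed

lemma phi_going_up:
  assumes Q: "mprime A Q" and P: "prime_ideal K P" "P \<subseteq> phi K A Q"
  shows "\<exists>Q'. mprime A Q' \<and> Q' \<subseteq> Q \<and> phi K A Q' = P"
proof -
  have p: "mprime O1 (triv ` P)" unfolding mprime_unit_ring using P(1) by blast
  have "triv ` P \<subseteq> pull A O1 (unit A) Q" unfolding phi_pull[OF Q] triv_image_eq by (rule P(2))
  from going_up[OF tt_ring_unit_ring A ring_hom_unit[OF A] Q p this]
  obtain Q' where Q': "mprime A Q'" "Q' \<subseteq> Q" "pull A O1 (unit A) Q' = triv ` P" by blast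
  then have "phi K A Q' = P" unfolding phi_pull[OF Q'(1)] triv_image_eq by simp
  then show ?thesis using Q' by blast
qed

lemma supp_full_iff_nil_faithful: "supp K (robj A) = {P. prime_ideal K P} \<longleftrightarrow> nil_faithful K A"
  using nil_faithful_supp[OF A] supp_nil_faithful[OF A] unfolding supp_def by blast

lemma finite_degree_fibers:
  assumes d: "has_degree K A d"
  shows "mprime A Q \<Longrightarrow> mprime A Q' \<Longrightarrow> Q' \<subseteq> Q \<Longrightarrow> phi K A Q = phi K A Q' \<Longrightarrow> Q = Q'"
    "finite {Q. mprime A Q \<and> phi K A Q = P}" "card {Q. mprime A Q \<and> phi K A Q = P} \<le> d"
    "subtopology (Spc (Mod K A)) {Q. mprime A Q \<and> phi K A Q = P} = discrete_topology {Q. mprime A Q \<and> phi K A Q = P}"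
proof -
  note h = has_degree_fibers[OF A d]
  show inc: "mprime A Q \<Longrightarrow> mprime A Q' \<Longrightarrow> Q' \<subseteq> Q \<Longrightarrow> phi K A Q = phi K A Q' \<Longrightarrow> Q = Q'" for Q Q'
    using h[THEN conjunct1] unfolding incomparable_fibers_def by (simp add: phi_pull_eq)
  let ?F = "{Q. mprime A Q \<and> phi K A Q = P}"
  have e: "?F = {Q. mprime A Q \<and> pull A O1 (unit A) Q = triv ` P}"
    using phi_pull by (auto simp: triv_image_eq)
  show F: "finite ?F" "card ?F \<le> d"
    using h[THEN conjunct2] unfolding e fibers_card_le_def by blast+
  show "subtopology (Spc (Mod K A)) ?F = discrete_topology ?F"
  proof (rule finite_discrete_topology[OF F(1)])
    show "topspace (subtopology (Spc (Mod K A)) ?F) = ?F" by (auto simp: topspace_Spc_Mod)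
    fix Q assume Q: "Q \<in> ?F"
    then have "?F \<inter> {Q} = {Q}" by blast
    then show "subtopology (Spc (Mod K A)) ?F closure_of {Q} \<subseteq> {Q}"
      unfolding closure_of_subtopology using Q inc by (auto simp: closure_Spc_Mod)
  qed
qed

lemma krull_dim_Mod:
  assumes d: "has_degree K A d"
  shows "krull_dim (Spc (Mod K A)) = krull_dim (subtopology (Spc K) (supp K (robj A)))"
proof (rule krull_dim_eq[where \<phi> = "phi K A"])
  let ?Y = "subtopology (Spc K) (supp K (robj A))"
  have top: "topspace ?Y = supp K (robj A)" by (auto simp: topspace_Spc_K supp_def)
  have cl: "?Y closure_of {P} = {P'. P' \<in> supp K (robj A) \<and> P' \<subseteq> P}" if "P \<in> supp K (robj A)" for P
  proof -
    have "supp K (robj A) \<inter> {P} = {P}" "prime_ideal K P" using that by (auto simp: supp_def)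
    then show ?thesis unfolding closure_of_subtopology by (auto simp: closure_Spc_K supp_def)
  qed
  show "phi K A ` topspace (Spc (Mod K A)) = topspace ?Y" unfolding top topspace_Spc_Mod by (rule phi_image)
  have s: "phi K A Q \<in> supp K (robj A)" if "mprime A Q" for Q using phi_image that by blast
  show "phi K A b \<in> ?Y closure_of {phi K A a}" if "a \<in> topspace (Spc (Mod K A))" "b \<in> Spc (Mod K A) closure_of {a}" for a b
    using that s phi_mono by (simp add: topspace_Spc_Mod closure_Spc_Mod cl)
  show "\<exists>b\<in>Spc (Mod K A) closure_of {a}. phi K A b = p" if "a \<in> topspace (Spc (Mod K A))" "p \<in> ?Y closure_of {phi K A a}" for a p
  proof -
    have a: "mprime A a" using that(1) by (simp add: topspace_Spc_Mod)
    have "prime_ideal K p" "p \<subseteq> phi K A a" using that(2) unfolding cl[OF s[OF a]] by (simp_all add: supp_def)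
    from phi_going_up[OF a this] show ?thesis unfolding closure_Spc_Mod[OF a] by blast
  qed
  show "a = b" if "a \<in> topspace (Spc (Mod K A))" "b \<in> topspace (Spc (Mod K A))" "b \<in> Spc (Mod K A) closure_of {a}" "phi K A a = phi K A b" for a b
    using that finite_degree_fibers(1)[OF d] by (simp add: topspace_Spc_Mod closure_Spc_Mod)
  show "p = q" if "p \<in> topspace ?Y" "q \<in> topspace ?Y" "p \<in> ?Y closure_of {q}" "q \<in> ?Y closure_of {p}" for p q
    using that unfolding top by (simp add: cl)
qed

end

end

theorem theorem1p5:
  fixes K :: "('o, 'm) tt_data" and A :: "('o, 'm) ring_object"
  assumes "tt_category K" and "tt_ring K A"
  shows "phi K A ` topspace (Spc (Mod K A)) = supp K (robj A) \<and>
    (phi K A ` topspace (Spc (Mod K A)) = topspace (Spc K) \<longleftrightarrow> nil_faithful K A) \<and>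
    (\<forall>d. has_degree K A d \<longrightarrow>
      (\<forall>Q \<in> topspace (Spc (Mod K A)). \<forall>P' \<in> Spc K closure_of {phi K A Q}.
         \<exists>Q' \<in> Spc (Mod K A) closure_of {Q}. phi K A Q' = P') \<and>
      (\<forall>Q \<in> topspace (Spc (Mod K A)). \<forall>Q' \<in> topspace (Spc (Mod K A)).
         Q' \<in> Spc (Mod K A) closure_of {Q} \<and> phi K A Q = phi K A Q' \<longrightarrow> Q = Q') \<and>
      (\<forall>P \<in> topspace (Spc K).
         let fiber = {Q \<in> topspace (Spc (Mod K A)). phi K A Q = P} in
         finite fiber \<and> card fiber \<le> d \<and>
         subtopology (Spc (Mod K A)) fiber = discrete_topology fiber) \<and>
      krull_dim (Spc (Mod K A)) = krull_dim (subtopology (Spc K) (supp K (robj A))) \<and>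
      (nil_faithful K A \<longrightarrow> krull_dim (Spc (Mod K A)) = krull_dim (Spc K)))"
proof -
  note A = assms(2)
  interpret tt_category K by (rule assms(1))
  show ?thesis
  proof (intro conjI allI impI)
    show i: "phi K A ` topspace (Spc (Mod K A)) = supp K (robj A)"
      unfolding topspace_Spc_Mod[OF A] by (rule phi_image[OF A])
    show "phi K A ` topspace (Spc (Mod K A)) = topspace (Spc K) \<longleftrightarrow> nil_faithful K A"
      unfolding i topspace_Spc_K by (rule supp_full_iff_nil_faithful[OF A])
    fix d assume d: "has_degree K A d"
    show "\<forall>Q \<in> topspace (Spc (Mod K A)). \<forall>P' \<in> Spc K closure_of {phi K A Q}.
           \<exists>Q' \<in> Spc (Mod K A) closure_of {Q}. phi K A Q' = P'"
      using phi_going_up[OF A] by (auto simp: topspace_Spc_Mod[OF A] closure_Spc_Mod[OF A] closure_Spc_K phi_prime[OF A])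
    show "\<forall>Q \<in> topspace (Spc (Mod K A)). \<forall>Q' \<in> topspace (Spc (Mod K A)).
           Q' \<in> Spc (Mod K A) closure_of {Q} \<and> phi K A Q = phi K A Q' \<longrightarrow> Q = Q'"
      using finite_degree_fibers(1)[OF A d] by (simp add: topspace_Spc_Mod[OF A] closure_Spc_Mod[OF A])
    show "\<forall>P \<in> topspace (Spc K).
           let fiber = {Q \<in> topspace (Spc (Mod K A)). phi K A Q = P} in
           finite fiber \<and> card fiber \<le> d \<and>
           subtopology (Spc (Mod K A)) fiber = discrete_topology fiber"
      using finite_degree_fibers(2-4)[OF A d] by (simp add: topspace_Spc_Mod[OF A] Let_def)
    show k: "krull_dim (Spc (Mod K A)) = krull_dim (subtopology (Spc K) (supp K (robj A)))"
      by (rule krull_dim_Mod[OF A d])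
    assume "nil_faithful K A"
    then have "supp K (robj A) = topspace (Spc K)"
      using supp_full_iff_nil_faithful[OF A] topspace_Spc_K by simp
    then show "krull_dim (Spc (Mod K A)) = krull_dim (Spc K)" unfolding k by simp
  qed
qed

end
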